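(* (Real case.) For every $\varepsilon>0$ there exists $\delta>0$ (depending only on $\varepsilon$, not on the matrix size) such that for every $n\ge 1$ and all real orthogonal matrices $U,V\in M_n$ with $$\|UV-VU\|\le\delta,$$ there exist real orthogonal matrices $U',V'\in M_n$ such that $$\|U-U'\|\le\varepsilon,\quad \|V-V'\|\le\varepsilon,\quad\text{and}\quad U'V'=V'U'.$$ (Symplectic case.) For every $\varepsilon>0$ there exists $\delta>0$ (depending only on $\varepsilon$) such that for every $n\ge 1$ and all symplectic unitary matrices $U,V\in M_{2n}$ with $\|UV-VU\|\le\delta$, there exist symplectic unitary matrices $U',V'\in M_{2n}$ such that $\|U-U'\|\le\varepsilon$, $\|V-V'\|\le\varepsilon$ and $U'V'=V'U'$.
   Context: $M_n=M_n(\mathbb{C})$ and $\|\cdot\|$ is the operator norm. A real orthogonal matrix is a unitary matrix with real entries (equivalently, a unitary $U$ with $U^{\mathrm T}=U^*$). The dual operation $\sharp$ on $M_{2n}(\mathbb{C})$ is defined, in terms of $n\times n$ blocks, by $$\begin{pmatrix}A&B\\C&D\end{pmatrix}^{\sharp}=\begin{pmatrix}D^{\mathrm T}&-B^{\mathrm T}\\-C^{\mathrm T}&A^{\mathrm T}\end{pmatrix}.$$ A symplectic unitary matrix is a unitary $U\in M_{2n}(\mathbb{C})$ with $U^\sharp=U^*$. *)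

theory Defs
  imports
    "Jordan_Normal_Form.Schur_Decomposition"
    "HOL-Analysis.L2_Norm"
begin

definition l2_norm_vec :: "complex vec \<Rightarrow> real" where
  "l2_norm_vec v = L2_set (\<lambda>i. cmod (v $ i)) {..<dim_vec v}"

definition op_norm :: "complex mat \<Rightarrow> real" where
  "op_norm A = (SUP v \<in> {v \<in> carrier_vec (dim_col A). l2_norm_vec v \<le> 1}. l2_norm_vec (A *\<^sub>v v))"

definition unitary_mat :: "nat \<Rightarrow> complex mat \<Rightarrow> bool" where
  "unitary_mat n U \<longleftrightarrow> U \<in> carrier_mat n n \<and>
     mat_adjoint U * U = 1\<^sub>m n \<and> U * mat_adjoint U = 1\<^sub>m n"

definition real_orthogonal_mat :: "nat \<Rightarrow> complex mat \<Rightarrow> bool" where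
  "real_orthogonal_mat n U \<longleftrightarrow> unitary_mat n U \<and> elements_mat U \<subseteq> \<real>"

text \<open>The operation \<open>\<sharp>\<close> on matrices of size \<open>2 * n\<close>; the argument \<open>n\<close> is the size of the blocks.\<close>

definition dual_mat :: "nat \<Rightarrow> complex mat \<Rightarrow> complex mat" where
  "dual_mat n M = (case split_block M n n of (A, B, C, D) \<Rightarrow>
     four_block_mat (transpose_mat D) (- transpose_mat B)
                    (- transpose_mat C) (transpose_mat A))"

definition symplectic_unitary_mat :: "nat \<Rightarrow> complex mat \<Rightarrow> bool" where
  "symplectic_unitary_mat n U \<longleftrightarrow> unitary_mat (2 * n) U \<and> dual_mat n U = mat_adjoint U"

lemma dual_mat_four_block_mat:
  assumes "A \<in> carrier_mat n n" "B \<in> carrier_mat n n"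
    and "C \<in> carrier_mat n n" "D \<in> carrier_mat n n"
  shows "dual_mat n (four_block_mat A B C D) =
    four_block_mat (transpose_mat D) (- transpose_mat B)
                   (- transpose_mat C) (transpose_mat A)"
proof -
  have "split_block (four_block_mat A B C D) n n = (A, B, C, D)"
    using assms by (auto simp: split_block_def Let_def intro!: eq_matI)
  then show ?thesis by (simp add: dual_mat_def)
qed

text \<open>The supremum defining \<^const>\<open>op_norm\<close> is over a nonempty set that is bounded above,
  so it is the least upper bound.\<close>

lemma op_norm_set_nonempty: "{v \<in> carrier_vec (dim_col A). l2_norm_vec v \<le> 1} \<noteq> {}"
proof -
  have "l2_norm_vec (0\<^sub>v (dim_col A)) = 0"
    by (simp add: l2_norm_vec_def L2_set_def)
  then have "0\<^sub>v (dim_col A) \<in> {v \<in> carrier_vec (dim_col A). l2_norm_vec v \<le> 1}" by simp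
  then show ?thesis by blast
qed

lemma op_norm_bdd_above:
  "bdd_above ((\<lambda>v. l2_norm_vec (A *\<^sub>v v)) ` {v \<in> carrier_vec (dim_col A). l2_norm_vec v \<le> 1})"
proof (rule bdd_aboveI2)
  fix v assume v: "v \<in> {v \<in> carrier_vec (dim_col A). l2_norm_vec v \<le> 1}"
  then have dv: "dim_vec v = dim_col A" by auto
  have le1: "cmod (v $ j) \<le> 1" if "j < dim_col A" for j
  proof -
    have "cmod (v $ j) \<le> l2_norm_vec v"
      unfolding l2_norm_vec_def by (rule member_le_L2_set) (use that dv in auto)
    with v show ?thesis by auto
  qed
  have row_le: "cmod ((A *\<^sub>v v) $ i) \<le> (\<Sum>j<dim_col A. cmod (A $$ (i, j)))"
    if i: "i < dim_row A" for i
  proof -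
    have "(A *\<^sub>v v) $ i = (\<Sum>j<dim_col A. A $$ (i, j) * v $ j)"
      using i dv by (simp add: scalar_prod_def atLeast0LessThan)
    also have "cmod \<dots> \<le> (\<Sum>j<dim_col A. cmod (A $$ (i, j) * v $ j))"
      by (rule norm_sum)
    also have "\<dots> \<le> (\<Sum>j<dim_col A. cmod (A $$ (i, j)))"
      by (intro sum_mono) (auto simp: norm_mult intro!: mult_left_le le1)
    finally show ?thesis .
  qed
  have "l2_norm_vec (A *\<^sub>v v) \<le> (\<Sum>i<dim_row A. cmod ((A *\<^sub>v v) $ i))"
    unfolding l2_norm_vec_def dim_mult_mat_vec by (rule L2_set_le_sum) simp
  also have "\<dots> \<le> (\<Sum>i<dim_row A. \<Sum>j<dim_col A. cmod (A $$ (i, j)))"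
    by (intro sum_mono row_le) auto
  finally show "l2_norm_vec (A *\<^sub>v v) \<le> (\<Sum>i<dim_row A. \<Sum>j<dim_col A. cmod (A $$ (i, j)))" .
qed

end

theory Submission
  imports
    "HOL-Analysis.Weierstrass_Theorems"
    "HOL-Analysis.Complex_Transcendental"
    "Jordan_Normal_Form.Spectral_Radius"
    Defs
begin

text \<open>
  A sequence of counterexamples gives two commuting unitaries \<open>u\<close> and \<open>v\<close> in the algebra of bounded families of matrices
  modulo null families, both fixed by the antilinear automorphism \<open>sg\<close>. It suffices to perturb \<open>u\<close> to a symmetric
  unitary with finite spectrum whose spectral projections almost commute with \<open>v\<close>: such a unitary lifts exactly, \<open>v\<close> may be
  compressed to its spectral subspaces, and the polar part of the compression commutes with it.

  The spectral projections of \<open>u\<close> are differences of nested projections, each cutting the circle at two conjugate places.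
  To find one, compress \<open>v\<close> to an arc and repair it to a unitary \<open>w\<close> commuting with a bump \<open>s\<close> that is supported near one
  of the places; then \<open>x = s * w\<close> is normal and one needs a projection that almost commutes with \<open>x\<close> and is approximately
  the spectral projection of \<open>|x|\<close> for the values above \<open>1/2\<close>. After moving the spectrum of \<open>x\<close> away from finitely many
  points of the circle of radius \<open>1/2\<close>, this circle falls into small pieces, on each of which \<open>x\<close> may be treated
  as a scalar; there the function \<open>\<bar>x\<bar>\<close> lives on the spectrum of a unitary, whose Borel calculus supplies the jump.
\<close>

unbundle no vec_syntax
hide_const (open) Finite_Cartesian_Product.mat Finite_Cartesian_Product.vec Finite_Cartesian_Product.row
  Finite_Cartesian_Product.column
hide_type (open) Finite_Cartesian_Product.vec

section \<open>The operator norm\<close>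

text \<open>For complex unitaries without the symmetry the statement is false, as Voiculescu's shift
  and diagonal matrices show. The obstruction is an integer: compressing \<open>v\<close> to an arc
  can lose dimensions at one end and gain them at the other. Here \<open>sg\<close> exchanges the
  two conjugate ends, so the dimensions lost in total are \<open>2 * a\<close> and those missing in
  the range \<open>2 * b\<close>, where \<open>a\<close> and \<open>b\<close> count the top end
  alone. The totals agree, hence \<open>a = b\<close>, and the repair can be done end by end. The
  element at one place is only normal, with no symmetry left. It is handled in the spirit of Friis
  and Rordam's proof of Lin's theorem: an arbitrarily small shift makes a matrix invertible, so
  polar decompositions in the quotient have unitary factors, and holes can be punched into spectra.
  Spectral projections are discontinuous functions, and a Borel calculus belongs to one chosen lift;
  only continuous functions can be compared between elements. Therefore the projection in
  \<open>cut\<close> is a continuous function plus corrections from the Borel calculi of auxiliary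
  unitaries.\<close>

definition adj :: "complex mat \<Rightarrow> complex mat" where
  "adj A = mat (dim_col A) (dim_row A) (\<lambda>(i,j). cnj (A $$ (j,i)))"

lemma mat_adjoint_eq_adj: "mat_adjoint A = adj A"
  by (rule eq_matI) (auto simp: mat_adjoint_def adj_def mat_of_rows_def conjugate_vec_def)

lemma adj_carrier[simp]: "A \<in> carrier_mat n m \<Longrightarrow> adj A \<in> carrier_mat m n"
  by (auto simp: adj_def)

lemma adj_dim[simp]: "dim_row (adj A) = dim_col A" "dim_col (adj A) = dim_row A"
  by (auto simp: adj_def)

lemma adj_adj[simp]: "adj (adj A) = A"
  by (rule eq_matI) (auto simp: adj_def)

lemma adj_mult: "A \<in> carrier_mat n m \<Longrightarrow> B \<in> carrier_mat m k \<Longrightarrow> adj (A * B) = adj B * adj A"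
  by (rule eq_matI) (auto simp: adj_def scalar_prod_def mult.commute intro!: sum.cong)

lemma adj_add: "A \<in> carrier_mat n m \<Longrightarrow> B \<in> carrier_mat n m \<Longrightarrow> adj (A + B) = adj A + adj B"
  by (rule eq_matI) (auto simp: adj_def)

lemma adj_smult: "adj (c \<cdot>\<^sub>m A) = cnj c \<cdot>\<^sub>m adj A"
  by (rule eq_matI) (auto simp: adj_def)

lemma adj_one[simp]: "adj (1\<^sub>m n) = 1\<^sub>m n"
  by (rule eq_matI) (auto simp: adj_def)

lemma adj_diag: "adj (mat n n (\<lambda>(i,j). if i = j then f i else 0)) = mat n n (\<lambda>(i,j). if i = j then cnj (f i) else 0)"
  by (rule eq_matI) (auto simp: adj_def)

definition cjm :: "complex mat \<Rightarrow> complex mat" where "cjm A = map_mat cnj A"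

lemma cjm_carrier[simp]: "A \<in> carrier_mat n m \<Longrightarrow> cjm A \<in> carrier_mat n m"
  by (auto simp: cjm_def)

lemma cjm_mult: "A \<in> carrier_mat n m \<Longrightarrow> B \<in> carrier_mat m k \<Longrightarrow> cjm (A * B) = cjm A * cjm B"
  by (rule eq_matI) (auto simp: cjm_def scalar_prod_def)

lemma cjm_add: "A \<in> carrier_mat n m \<Longrightarrow> B \<in> carrier_mat n m \<Longrightarrow> cjm (A + B) = cjm A + cjm B"
  by (rule eq_matI) (auto simp: cjm_def)

lemma cjm_smult: "cjm (c \<cdot>\<^sub>m A) = cnj c \<cdot>\<^sub>m cjm A"
  by (rule eq_matI) (auto simp: cjm_def)

lemma cjm_one[simp]: "cjm (1\<^sub>m n) = 1\<^sub>m n"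
  by (rule eq_matI) (auto simp: cjm_def)

lemma cjm_cjm[simp]: "cjm (cjm A) = A"
  by (rule eq_matI) (auto simp: cjm_def)

lemma cjm_adj: "cjm (adj A) = adj (cjm A)"
  by (rule eq_matI) (auto simp: cjm_def adj_def)

section \<open>Inner product and Euclidean norm\<close>

definition ip :: "complex vec \<Rightarrow> complex vec \<Rightarrow> complex" where
  "ip v w = (\<Sum>i<dim_vec v. cnj (v $ i) * w $ i)"

lemma l2_nonneg[simp]: "0 \<le> l2_norm_vec v"
  by (simp add: l2_norm_vec_def L2_set_nonneg)

lemma l2_sq: "complex_of_real ((l2_norm_vec v)\<^sup>2) = ip v v"
  by (simp add: l2_norm_vec_def L2_set_def ip_def real_sqrt_pow2 sum_nonneg complex_norm_square mult.commute
      flip: of_real_power)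

lemma ip_bound: "dim_vec v = dim_vec w \<Longrightarrow> cmod (ip v w) \<le> l2_norm_vec v * l2_norm_vec w"
proof -
  assume d: "dim_vec v = dim_vec w"
  have "cmod (ip v w) \<le> (\<Sum>i<dim_vec v. \<bar>cmod (v $ i)\<bar> * \<bar>cmod (w $ i)\<bar>)"
    unfolding ip_def by (rule order_trans[OF norm_sum]) (auto simp: norm_mult)
  also have "\<dots> \<le> L2_set (\<lambda>i. cmod (v $ i)) {..<dim_vec v} * L2_set (\<lambda>i. cmod (w $ i)) {..<dim_vec v}"
    by (rule L2_set_mult_ineq)
  finally show ?thesis using d by (simp add: l2_norm_vec_def)
qed

lemma ip_adj:
  assumes A: "A \<in> carrier_mat n m" and v: "v \<in> carrier_vec n" and w: "w \<in> carrier_vec m"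
  shows "ip v (A *\<^sub>v w) = ip (adj A *\<^sub>v v) w"
proof -
  have "ip v (A *\<^sub>v w) = (\<Sum>i<n. \<Sum>j<m. cnj (v $ i) * (A $$ (i,j) * w $ j))"
    using assms by (auto simp: ip_def scalar_prod_def sum_distrib_left atLeast0LessThan intro!: sum.cong)
  also have "\<dots> = (\<Sum>j<m. \<Sum>i<n. cnj (v $ i) * (A $$ (i,j) * w $ j))"
    by (rule sum.swap)
  also have "\<dots> = ip (adj A *\<^sub>v v) w"
    using assms by (auto simp: ip_def scalar_prod_def sum_distrib_left sum_distrib_right adj_def
        atLeast0LessThan mult_ac intro!: sum.cong)
  finally show ?thesis .
qed

lemma l2_smult: "l2_norm_vec (c \<cdot>\<^sub>v v) = cmod c * l2_norm_vec v"
proof -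
  have "l2_norm_vec (c \<cdot>\<^sub>v v) = L2_set (\<lambda>i. cmod c * cmod (v $ i)) {..<dim_vec v}"
    unfolding l2_norm_vec_def by (rule L2_set_cong) (auto simp: norm_mult)
  then show ?thesis by (simp add: l2_norm_vec_def L2_set_right_distrib)
qed

lemma l2_zero_iff: "l2_norm_vec v = 0 \<longleftrightarrow> v = 0\<^sub>v (dim_vec v)"
proof
  assume "l2_norm_vec v = 0"
  then show "v = 0\<^sub>v (dim_vec v)" by (intro eq_vecI) (auto simp: l2_norm_vec_def L2_set_eq_0_iff)
next
  assume "v = 0\<^sub>v (dim_vec v)"
  then have "v $ i = 0" if "i < dim_vec v" for i using that by (metis index_zero_vec(1))
  then show "l2_norm_vec v = 0" by (auto simp: l2_norm_vec_def L2_set_eq_0_iff)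
qed

lemma l2_add: "dim_vec v = dim_vec w \<Longrightarrow> l2_norm_vec (v + w) \<le> l2_norm_vec v + l2_norm_vec w"
proof -
  assume d: "dim_vec v = dim_vec w"
  have "l2_norm_vec (v + w) \<le> L2_set (\<lambda>i. cmod (v $ i) + cmod (w $ i)) {..<dim_vec w}"
    unfolding l2_norm_vec_def using d by (auto intro!: L2_set_mono norm_triangle_ineq)
  also have "\<dots> \<le> l2_norm_vec v + l2_norm_vec w"
    unfolding l2_norm_vec_def using d by (metis L2_set_triangle_ineq)
  finally show ?thesis .
qed

section \<open>The operator norm as a C*-norm\<close>

lemma op_norm_le:
  assumes "\<And>v. v \<in> carrier_vec (dim_col A) \<Longrightarrow> l2_norm_vec (A *\<^sub>v v) \<le> c * l2_norm_vec v" "0 \<le> c"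
  shows "op_norm A \<le> c"
  unfolding op_norm_def
proof (rule cSUP_least[OF op_norm_set_nonempty])
  fix v assume v: "v \<in> {v \<in> carrier_vec (dim_col A). l2_norm_vec v \<le> 1}"
  then have "l2_norm_vec (A *\<^sub>v v) \<le> c * l2_norm_vec v" using assms(1) by auto
  also have "\<dots> \<le> c" using v assms(2) by (auto simp: mult_left_le)
  finally show "l2_norm_vec (A *\<^sub>v v) \<le> c" .
qed

lemma op_norm_ge:
  assumes "v \<in> carrier_vec (dim_col A)"
  shows "l2_norm_vec (A *\<^sub>v v) \<le> op_norm A * l2_norm_vec v"
proof (cases "l2_norm_vec v = 0")
  case True
  then have "v = 0\<^sub>v (dim_col A)" using l2_zero_iff assms by auto
  then show ?thesis by (auto simp: l2_norm_vec_def L2_set_def scalar_prod_def)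
next
  case False
  define c where "c = l2_norm_vec v"
  have c: "c > 0" using False l2_nonneg[of v] unfolding c_def by linarith
  let ?w = "complex_of_real (1 / c) \<cdot>\<^sub>v v"
  have "l2_norm_vec ?w = 1" unfolding l2_smult using c by (simp add: c_def[symmetric] norm_divide)
  then have "l2_norm_vec (A *\<^sub>v ?w) \<le> op_norm A"
    unfolding op_norm_def using assms by (intro cSUP_upper op_norm_bdd_above) auto
  also have "A *\<^sub>v ?w = complex_of_real (1 / c) \<cdot>\<^sub>v (A *\<^sub>v v)"
    using assms by (intro mult_mat_vec[of A "dim_row A" "dim_col A"]) auto
  finally show ?thesis using c by (simp add: l2_smult c_def[symmetric] norm_divide field_simps)
qed

lemma op_norm_nonneg[simp]: "0 \<le> op_norm A"
proof -
  have "l2_norm_vec (A *\<^sub>v 0\<^sub>v (dim_col A)) \<le> op_norm A"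
    unfolding op_norm_def
    by (intro cSUP_upper op_norm_bdd_above) (auto simp: l2_norm_vec_def L2_set_def)
  then show ?thesis using l2_nonneg order_trans by blast
qed

lemma op_norm_add:
  assumes A: "A \<in> carrier_mat n m" and B: "B \<in> carrier_mat n m"
  shows "op_norm (A + B) \<le> op_norm A + op_norm B"
proof (rule op_norm_le)
  fix v :: "complex vec" assume v: "v \<in> carrier_vec (dim_col (A + B))"
  then have v: "v \<in> carrier_vec m" using A B by auto
  have "(A + B) *\<^sub>v v = A *\<^sub>v v + B *\<^sub>v v" using A B v by (rule add_mult_distrib_mat_vec)
  then have "l2_norm_vec ((A + B) *\<^sub>v v) \<le> l2_norm_vec (A *\<^sub>v v) + l2_norm_vec (B *\<^sub>v v)"
    using l2_add[of "A *\<^sub>v v" "B *\<^sub>v v"] A B by auto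
  also have "\<dots> \<le> op_norm A * l2_norm_vec v + op_norm B * l2_norm_vec v"
    using A B v by (intro add_mono op_norm_ge) auto
  finally show "l2_norm_vec ((A + B) *\<^sub>v v) \<le> (op_norm A + op_norm B) * l2_norm_vec v"
    by (simp add: algebra_simps)
qed simp

lemma op_norm_mult:
  assumes A: "A \<in> carrier_mat n m" and B: "B \<in> carrier_mat m k"
  shows "op_norm (A * B) \<le> op_norm A * op_norm B"
proof (rule op_norm_le)
  fix v :: "complex vec" assume v: "v \<in> carrier_vec (dim_col (A * B))"
  then have v: "v \<in> carrier_vec k" using A B by auto
  have "(A * B) *\<^sub>v v = A *\<^sub>v (B *\<^sub>v v)" using A B v by (rule assoc_mult_mat_vec)
  then have "l2_norm_vec ((A * B) *\<^sub>v v) \<le> op_norm A * l2_norm_vec (B *\<^sub>v v)"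
    using op_norm_ge[of "B *\<^sub>v v" A] A B v mult_mat_vec_carrier[OF B v] by auto
  also have "\<dots> \<le> op_norm A * (op_norm B * l2_norm_vec v)"
    using A B v by (intro mult_left_mono op_norm_ge) auto
  finally show "l2_norm_vec ((A * B) *\<^sub>v v) \<le> op_norm A * op_norm B * l2_norm_vec v"
    by (simp add: algebra_simps)
qed simp

lemma op_norm_smult: "op_norm (c \<cdot>\<^sub>m A) = cmod c * op_norm A"
proof -
  have le: "op_norm (c \<cdot>\<^sub>m A) \<le> cmod c * op_norm A" for c A
  proof (rule op_norm_le)
    fix v :: "complex vec" assume v: "v \<in> carrier_vec (dim_col (c \<cdot>\<^sub>m A))"
    then have "(c \<cdot>\<^sub>m A) *\<^sub>v v = c \<cdot>\<^sub>v (A *\<^sub>v v)"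
      by (intro eq_vecI) (auto simp: scalar_prod_def sum_distrib_left mult.assoc)
    then show "l2_norm_vec ((c \<cdot>\<^sub>m A) *\<^sub>v v) \<le> cmod c * op_norm A * l2_norm_vec v"
      using op_norm_ge[of v A] v by (auto simp: l2_smult mult.assoc intro!: mult_left_mono)
  qed simp
  show ?thesis
  proof (cases "c = 0")
    case True then show ?thesis using le[of 0 A] op_norm_nonneg[of "0 \<cdot>\<^sub>m A"] by auto
  next
    case False
    have "inverse c \<cdot>\<^sub>m (c \<cdot>\<^sub>m A) = A" using False by (intro eq_matI) auto
    then have "op_norm A \<le> cmod (inverse c) * op_norm (c \<cdot>\<^sub>m A)" using le[of "inverse c" "c \<cdot>\<^sub>m A"] by simp
    then have "cmod c * op_norm A \<le> op_norm (c \<cdot>\<^sub>m A)" using False by (simp add: norm_inverse norm_divide field_simps)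
    then show ?thesis using le[of c A] by simp
  qed
qed

text \<open>\<open>ip (A v) (A v)\<close> equals \<open>ip (adj A * A v) v\<close>, and
  Cauchy-Schwarz applies. This half of the C*-identity comes first because the isometry of
  \<open>adj\<close>, and with it the other half, is deduced from it.\<close>

lemma op_norm_cstar_le:
  assumes A: "A \<in> carrier_mat n m"
  shows "(op_norm A)\<^sup>2 \<le> op_norm (adj A * A)"
proof -
  have "op_norm A \<le> sqrt (op_norm (adj A * A))"
  proof (rule op_norm_le)
    fix v :: "complex vec" assume "v \<in> carrier_vec (dim_col A)"
    then have v: "v \<in> carrier_vec m" using A by auto
    have "complex_of_real ((l2_norm_vec (A *\<^sub>v v))\<^sup>2) = ip (A *\<^sub>v v) (A *\<^sub>v v)" by (rule l2_sq)
    also have "\<dots> = ip (adj A *\<^sub>v (A *\<^sub>v v)) v" using A v by (intro ip_adj) auto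
    also have "adj A *\<^sub>v (A *\<^sub>v v) = (adj A * A) *\<^sub>v v" using A v by (simp add: assoc_mult_mat_vec[of _ m n _ m])
    finally have "(l2_norm_vec (A *\<^sub>v v))\<^sup>2 = cmod (ip ((adj A * A) *\<^sub>v v) v)"
      by (metis abs_of_nonneg norm_of_real zero_le_power2)
    also have "\<dots> \<le> l2_norm_vec ((adj A * A) *\<^sub>v v) * l2_norm_vec v"
      using A v by (intro ip_bound) auto
    also have "\<dots> \<le> op_norm (adj A * A) * l2_norm_vec v * l2_norm_vec v"
      using A v by (intro mult_right_mono op_norm_ge) auto
    finally have "(l2_norm_vec (A *\<^sub>v v))\<^sup>2 \<le> (sqrt (op_norm (adj A * A)) * l2_norm_vec v)\<^sup>2"
      unfolding power_mult_distrib by (simp add: power2_eq_square mult.assoc)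
    then show "l2_norm_vec (A *\<^sub>v v) \<le> sqrt (op_norm (adj A * A)) * l2_norm_vec v"
      by (rule power2_le_imp_le) simp
  qed simp
  from power_mono[OF this op_norm_nonneg, of 2] show ?thesis by simp
qed

lemma op_norm_adj[simp]: "op_norm (adj A) = op_norm A"
proof -
  have le: "op_norm A \<le> op_norm (adj A)" for A
  proof (cases "op_norm A = 0")
    case True then show ?thesis by simp
  next
    case False
    have c: "A \<in> carrier_mat (dim_row A) (dim_col A)" by (rule carrier_matI[OF refl refl])
    have "(op_norm A)\<^sup>2 \<le> op_norm (adj A) * op_norm A"
      by (rule order_trans[OF op_norm_cstar_le[OF c] op_norm_mult[OF adj_carrier[OF c] c]])
    moreover have "op_norm A > 0" using False op_norm_nonneg[of A] by linarith
    ultimately show ?thesis by (simp add: power2_eq_square)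
  qed
  show ?thesis using le[of A] le[of "adj A"] by simp
qed

lemma op_norm_cstar:
  assumes A: "A \<in> carrier_mat n m"
  shows "op_norm (adj A * A) = (op_norm A)\<^sup>2"
  using op_norm_cstar_le[OF A] op_norm_mult[of "adj A" m n A m] A by (simp add: power2_eq_square)

lemma op_norm_eq_0:
  assumes A: "A \<in> carrier_mat n m" and z: "op_norm A = 0"
  shows "A = 0\<^sub>m n m"
proof (rule eq_matI)
  fix i j assume "i < dim_row (0\<^sub>m n m :: complex mat)" "j < dim_col (0\<^sub>m n m :: complex mat)"
  then have ij: "i < n" "j < m" by auto
  have "col (A * 1\<^sub>m m) j = A *\<^sub>v col (1\<^sub>m m) j"
    using A ij by (intro col_mult2) auto
  then have e: "A *\<^sub>v unit_vec m j = col A j"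
    unfolding right_mult_one_mat[OF A] col_one[OF ij(2)] by (rule sym)
  have "l2_norm_vec (col A j) \<le> 0"
    using op_norm_ge[of "unit_vec m j" A] A z e by auto
  then have "l2_norm_vec (col A j) = 0" using l2_nonneg[of "col A j"] by linarith
  then have "col A j = 0\<^sub>v n" using l2_zero_iff[of "col A j"] A by simp
  then have "col A j $ i = 0" using ij by simp
  then show "A $$ (i, j) = 0\<^sub>m n m $$ (i, j)" using ij A by simp
qed (use A in auto)

lemma op_norm_diag:
  assumes "\<And>i. i < n \<Longrightarrow> cmod (f i) \<le> c" "0 \<le> c"
  shows "op_norm (mat n n (\<lambda>(i,j). if i = j then f i else 0)) \<le> c" (is "op_norm ?D \<le> c")
proof (rule op_norm_le)
  fix v :: "complex vec" assume "v \<in> carrier_vec (dim_col ?D)"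
  then have v: "dim_vec v = n" by auto
  have e: "(?D *\<^sub>v v) $ i = f i * v $ i" if i: "i < n" for i
  proof -
    have "(?D *\<^sub>v v) $ i = (\<Sum>j\<in>{0..<n}. (if i = j then f i else 0) * v $ j)"
      using i v by (simp add: scalar_prod_def)
    also have "\<dots> = (\<Sum>j\<in>{0..<n}. if i = j then f i * v $ j else 0)"
      by (rule sum.cong) auto
    finally show ?thesis using i by simp
  qed
  have "l2_norm_vec (?D *\<^sub>v v) = L2_set (\<lambda>i. cmod (f i * v $ i)) {..<n}"
    unfolding l2_norm_vec_def by (rule L2_set_cong) (use e in auto)
  also have "\<dots> \<le> L2_set (\<lambda>i. c * cmod (v $ i)) {..<n}"
    by (rule L2_set_mono) (auto simp: norm_mult intro!: mult_right_mono assms)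
  also have "\<dots> = c * l2_norm_vec v" using v assms(2) by (simp add: L2_set_right_distrib l2_norm_vec_def)
  finally show "l2_norm_vec (?D *\<^sub>v v) \<le> c * l2_norm_vec v" .
qed fact

lemma op_norm_one_le: "op_norm (1\<^sub>m n) \<le> 1"
  by (rule op_norm_le) auto

lemma op_norm_one: "n > 0 \<Longrightarrow> op_norm (1\<^sub>m n) = 1"
proof -
  assume n: "n > 0"
  have "op_norm (1\<^sub>m n) \<noteq> 0"
  proof
    assume "op_norm (1\<^sub>m n) = 0"
    then have "1\<^sub>m n = (0\<^sub>m n n :: complex mat)" by (intro op_norm_eq_0) auto
    then have "1\<^sub>m n $$ (0,0) = (0\<^sub>m n n :: complex mat) $$ (0,0)" by simp
    then show False using n by simp
  qed
  moreover have "(op_norm (1\<^sub>m n))\<^sup>2 = op_norm (1\<^sub>m n)"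
    using op_norm_cstar[of "1\<^sub>m n" n n] by simp
  ultimately show ?thesis by (simp add: power2_eq_square)
qed

lemma op_norm_cjm_le: "op_norm (cjm A) \<le> op_norm A"
proof (rule op_norm_le)
  fix v :: "complex vec" assume v: "v \<in> carrier_vec (dim_col (cjm A))"
  let ?c = "\<lambda>v. map_vec cnj v"
  have l: "l2_norm_vec (?c v) = l2_norm_vec v" for v :: "complex vec"
    unfolding l2_norm_vec_def by (rule L2_set_cong) auto
  have "cjm A *\<^sub>v v = ?c (A *\<^sub>v ?c v)"
    using v by (intro eq_vecI) (auto simp: cjm_def scalar_prod_def)
  then show "l2_norm_vec (cjm A *\<^sub>v v) \<le> op_norm A * l2_norm_vec v"
    using op_norm_ge[of "?c v" A] v by (auto simp: l cjm_def)
qed simp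

section \<open>The spectral theorem\<close>

definition dgm :: "nat \<Rightarrow> (nat \<Rightarrow> complex) \<Rightarrow> complex mat" where
  "dgm n d = mat n n (\<lambda>(i,j). if i = j then d i else 0)"

lemma dgm_carrier[simp]: "dgm n d \<in> carrier_mat n n" by (simp add: dgm_def)

lemma dgm_dim[simp]: "dim_row (dgm n d) = n" "dim_col (dgm n d) = n" by (simp_all add: dgm_def)

lemma dgm_mult: "dgm n d * dgm n e = dgm n (\<lambda>i. d i * e i)"
proof (rule eq_matI)
  fix i j assume "i < dim_row (dgm n (\<lambda>i. d i * e i))" "j < dim_col (dgm n (\<lambda>i. d i * e i))"
  then have ij: "i < n" "j < n" by auto
  have "(dgm n d * dgm n e) $$ (i,j) = (\<Sum>k\<in>{0..<n}. (if i = k then d i else 0) * (if k = j then e k else 0))"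
    using ij by (simp add: dgm_def scalar_prod_def)
  also have "\<dots> = (\<Sum>k\<in>{0..<n}. if i = k then d i * (if k = j then e k else 0) else 0)"
    by (rule sum.cong) auto
  finally show "(dgm n d * dgm n e) $$ (i,j) = dgm n (\<lambda>i. d i * e i) $$ (i,j)" using ij by (simp add: dgm_def)
qed auto

lemma dgm_add: "dgm n d + dgm n e = dgm n (\<lambda>i. d i + e i)"
  by (rule eq_matI) (auto simp: dgm_def)

lemma dgm_one: "dgm n (\<lambda>i. 1) = 1\<^sub>m n"
  by (rule eq_matI) (auto simp: dgm_def)

lemma adj_dgm: "adj (dgm n d) = dgm n (\<lambda>i. cnj (d i))"
  unfolding dgm_def by (rule adj_diag)

lemma op_norm_dgm: "(\<And>i. i < n \<Longrightarrow> cmod (d i) \<le> c) \<Longrightarrow> 0 \<le> c \<Longrightarrow> op_norm (dgm n d) \<le> c"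
  unfolding dgm_def by (rule op_norm_diag)

text \<open>The direct sum of a scalar and a matrix: the shape reached after splitting off one
  eigenvector in the spectral theorem.\<close>

definition ext :: "nat \<Rightarrow> complex \<Rightarrow> complex mat \<Rightarrow> complex mat" where
  "ext n c P = mat (Suc n) (Suc n) (\<lambda>(i,j). if i = 0 \<and> j = 0 then c else if i = 0 \<or> j = 0 then 0 else P $$ (i - 1, j - 1))"

lemma ext_carrier[simp]: "ext n c P \<in> carrier_mat (Suc n) (Suc n)" by (simp add: ext_def)

lemma ext_mult:
  assumes "P \<in> carrier_mat n n" "Q \<in> carrier_mat n n"
  shows "ext n c P * ext n e Q = ext n (c * e) (P * Q)"
proof (rule eq_matI)
  fix i j assume "i < dim_row (ext n (c * e) (P * Q))" "j < dim_col (ext n (c * e) (P * Q))"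
  then have ij: "i < Suc n" "j < Suc n" by (auto simp: ext_def)
  have "(ext n c P * ext n e Q) $$ (i,j) = (\<Sum>k<Suc n. ext n c P $$ (i,k) * ext n e Q $$ (k,j))"
    using ij by (simp add: scalar_prod_def ext_def atLeast0LessThan)
  also have "\<dots> = ext n c P $$ (i,0) * ext n e Q $$ (0,j) + (\<Sum>k<n. ext n c P $$ (i,Suc k) * ext n e Q $$ (Suc k,j))"
    by (rule sum.lessThan_Suc_shift)
  also have "\<dots> = ext n (c * e) (P * Q) $$ (i,j)"
    using ij assms by (cases i; cases j) (auto simp: ext_def scalar_prod_def atLeast0LessThan)
  finally show "(ext n c P * ext n e Q) $$ (i,j) = ext n (c * e) (P * Q) $$ (i,j)" .
qed (auto simp: ext_def)

lemma adj_ext: "P \<in> carrier_mat n n \<Longrightarrow> adj (ext n c P) = ext n (cnj c) (adj P)"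
  by (rule eq_matI) (auto simp: ext_def adj_def)

lemma ext_one: "ext n 1 (1\<^sub>m n) = 1\<^sub>m (Suc n)"
  by (rule eq_matI) (auto simp: ext_def)

lemma ext_dgm: "ext n c (dgm n d) = dgm (Suc n) (case_nat c d)"
  by (rule eq_matI) (auto simp: ext_def dgm_def split: nat.splits)

lemma ext_inj:
  assumes "P \<in> carrier_mat n n" "Q \<in> carrier_mat n n" "ext n c P = ext n e Q"
  shows "P = Q"
proof (rule eq_matI)
  fix i j assume "i < dim_row Q" "j < dim_col Q"
  then have ij: "i < n" "j < n" using assms by auto
  have "ext n c P $$ (Suc i, Suc j) = ext n e Q $$ (Suc i, Suc j)" using assms by simp
  then show "P $$ (i,j) = Q $$ (i,j)" using ij by (simp add: ext_def)
qed (use assms in auto)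

text \<open>A Householder reflection; taking \<open>v $ 0\<close> to be real and nonpositive keeps \<open>v - e\<^sub>0\<close> away from \<open>0\<close>.\<close>

lemma householder:
  assumes v: "v \<in> carrier_vec (Suc n)" and nv: "(\<Sum>i<Suc n. (cmod (v $ i))\<^sup>2) = 1"
    and r: "v $ 0 = complex_of_real r" "r \<le> 0"
  shows "\<exists>H. H \<in> carrier_mat (Suc n) (Suc n) \<and> adj H = H \<and> H * H = 1\<^sub>m (Suc n) \<and> col H 0 = v"
proof -
  let ?N = "Suc n"
  define u where "u i = (if i = 0 then v $ 0 - 1 else v $ i)" for i
  define s where "s = (\<Sum>i<?N. cnj (u i) * u i)"
  have s1: "s = complex_of_real (2 - 2 * r)"
  proof -
    have a: "(\<Sum>i<n. (cmod (v $ Suc i))\<^sup>2) = 1 - r\<^sup>2"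
      using nv unfolding sum.lessThan_Suc_shift r by simp
    have "s = cnj (u 0) * u 0 + (\<Sum>i<n. cnj (u (Suc i)) * u (Suc i))"
      unfolding s_def by (rule sum.lessThan_Suc_shift)
    also have "(\<Sum>i<n. cnj (u (Suc i)) * u (Suc i)) = complex_of_real (\<Sum>i<n. (cmod (v $ Suc i))\<^sup>2)"
      by (simp add: u_def complex_norm_square mult.commute flip: of_real_power)
    finally show ?thesis unfolding a by (simp add: u_def r algebra_simps power2_eq_square)
  qed
  then have s0: "s \<noteq> 0" using r by (simp add: complex_eq_iff)
  define H where "H = mat ?N ?N (\<lambda>(i,j). (if i = j then 1 else 0) - 2 / s * u i * cnj (u j))"
  have Hc: "H \<in> carrier_mat ?N ?N" by (simp add: H_def)
  have cs: "cnj s = s" unfolding s1 by simp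
  have "adj H = H" by (rule eq_matI) (auto simp: H_def adj_def cs)
  moreover have "H * H = 1\<^sub>m ?N"
  proof (rule eq_matI)
    fix i j assume "i < dim_row (1\<^sub>m ?N :: complex mat)" "j < dim_col (1\<^sub>m ?N :: complex mat)"
    then have ij: "i < ?N" "j < ?N" by auto
    let ?t = "2 / s"
    let ?d = "\<lambda>i j. if i = j then (1::complex) else 0"
    have "(H * H) $$ (i,j) = (\<Sum>k<?N. (?d i k - ?t * u i * cnj (u k)) * (?d k j - ?t * u k * cnj (u j)))"
      using ij by (simp add: H_def scalar_prod_def atLeast0LessThan)
    also have "\<dots> = (\<Sum>k<?N. (if i = k then ?d i j else 0) - (if i = k then ?t * u i * cnj (u j) else 0)
        - (if k = j then ?t * u i * cnj (u j) else 0) + ?t * ?t * u i * cnj (u j) * (cnj (u k) * u k))"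
      by (rule sum.cong) (auto simp: algebra_simps)
    also have "\<dots> = ?d i j - ?t * u i * cnj (u j) - ?t * u i * cnj (u j) + ?t * ?t * u i * cnj (u j) * s"
      using ij unfolding sum.distrib sum_subtractf s_def sum_distrib_left by simp
    also have "\<dots> = ?d i j" using s0 by (simp add: field_simps)
    finally show "(H * H) $$ (i,j) = 1\<^sub>m ?N $$ (i,j)" using ij by simp
  qed (use Hc in auto)
  moreover have "col H 0 = v"
  proof (rule eq_vecI)
    fix i assume "i < dim_vec v"
    then have i: "i < ?N" using v by auto
    have "2 / s * cnj (u 0) = -1" unfolding s1 u_def r using r by (simp add: complex_eq_iff field_simps)
    then have "2 / s * u i * cnj (u 0) = - u i"
      by (metis (no_types, lifting) mult.commute mult.left_commute mult_minus1)
    then show "col H 0 $ i = v $ i" using i by (auto simp: H_def u_def r)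
  qed (use v Hc in auto)
  ultimately show ?thesis using Hc by blast
qed

lemma exists_unit_eigenvector:
  assumes A: "A \<in> carrier_mat (Suc n) (Suc n)"
  shows "\<exists>v r e. v \<in> carrier_vec (Suc n) \<and> (\<Sum>i<Suc n. (cmod (v $ i))\<^sup>2) = 1 \<and>
    v $ 0 = complex_of_real r \<and> r \<le> 0 \<and> A *\<^sub>v v = e \<cdot>\<^sub>v v"
proof -
  obtain e where "e \<in> spectrum A" using spectrum_non_empty[OF A] by auto
  then obtain w where w: "w \<in> carrier_vec (Suc n)" "w \<noteq> 0\<^sub>v (Suc n)" "A *\<^sub>v w = e \<cdot>\<^sub>v w"
    using A unfolding spectrum_def eigenvalue_def eigenvector_def by auto
  define N where "N = l2_norm_vec w"
  have N: "N > 0" using w l2_zero_iff[of w] l2_nonneg[of w] unfolding N_def by (metis carrier_vecD less_eq_real_def)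
  have N2: "N\<^sup>2 = (\<Sum>i<Suc n. (cmod (w $ i))\<^sup>2)"
    using w by (simp add: N_def l2_norm_vec_def L2_set_def real_sqrt_pow2 sum_nonneg)
  \<comment> \<open>The phase that turns the first coordinate into minus its modulus, as
    \<open>householder\<close> demands.\<close>
  define p where "p = (if w $ 0 = 0 then 1 else - cnj (w $ 0) / cmod (w $ 0))"
  have p: "cmod p = 1" by (auto simp: p_def norm_divide)
  have pw: "p * w $ 0 = complex_of_real (- cmod (w $ 0))"
    by (auto simp: p_def field_simps complex_norm_square[symmetric] power2_eq_square mult.commute[of "cnj _"])
  let ?v = "(p / N) \<cdot>\<^sub>v w"
  have "(\<Sum>i<Suc n. (cmod (?v $ i))\<^sup>2) = (\<Sum>i<Suc n. (cmod (w $ i))\<^sup>2 / N\<^sup>2)"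
    using w N p by (intro sum.cong) (auto simp: norm_mult norm_divide power_mult_distrib power_divide)
  then have 1: "(\<Sum>i<Suc n. (cmod (?v $ i))\<^sup>2) = 1" using N unfolding sum_divide_distrib[symmetric] N2[symmetric] by simp
  have 2: "?v $ 0 = complex_of_real (- cmod (w $ 0) / N)" using w pw by (simp add: field_simps)
  have 3: "A *\<^sub>v ?v = e \<cdot>\<^sub>v ?v"
    using mult_mat_vec[OF A w(1), of "p / N"] w by (simp add: smult_smult_assoc mult.commute)
  show ?thesis using 1 2 3 w N by (intro exI[of _ ?v] exI[of _ "- cmod (w $ 0) / N"] exI[of _ e]) auto
qed

text \<open>Deflation: a Householder reflection moves a unit eigenvector to the first basis vector,
  and normality clears the first row together with the first column, which leaves a normal block of
  smaller size.\<close>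

lemma spectral_theorem:
  assumes "A \<in> carrier_mat n n" "A * adj A = adj A * A"
  shows "\<exists>P d. P \<in> carrier_mat n n \<and> adj P * P = 1\<^sub>m n \<and> P * adj P = 1\<^sub>m n \<and> A = P * dgm n d * adj P"
  using assms
proof (induction n arbitrary: A)
  case 0
  then show ?case by (intro exI[of _ "1\<^sub>m 0"]) (auto intro!: eq_matI)
next
  case (Suc n)
  let ?N = "Suc n"
  note A = Suc.prems(1)
  obtain v r e where v: "v \<in> carrier_vec ?N" "(\<Sum>i<?N. (cmod (v $ i))\<^sup>2) = 1"
    "v $ 0 = complex_of_real r" "r \<le> 0" "A *\<^sub>v v = e \<cdot>\<^sub>v v"
    using exists_unit_eigenvector[OF A] by blast
  obtain H where H: "H \<in> carrier_mat ?N ?N" "adj H = H" "H * H = 1\<^sub>m ?N" "col H 0 = v"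
    using householder[OF v(1-4)] by blast
  note as = assoc_mult_mat[of _ ?N ?N _ ?N _ ?N]
  have HH: "H * (H * X) = X" if "X \<in> carrier_mat ?N ?N" for X
    using as[of H H X] H that by simp
  define A' where "A' = H * A * H"
  have A'c: "A' \<in> carrier_mat ?N ?N" using A H by (auto simp: A'_def)
  have aA': "adj A' = H * adj A * H"
    using A H by (simp add: A'_def adj_mult[of _ ?N ?N _ ?N] as)
  have "A' * adj A' = H * ((A * adj A) * H)"
    using A H unfolding aA' unfolding A'_def by (simp add: as HH mult_carrier_mat[of _ ?N ?N _ ?N])
  moreover have "adj A' * A' = H * ((adj A * A) * H)"
    using A H unfolding aA' unfolding A'_def by (simp add: as HH mult_carrier_mat[of _ ?N ?N _ ?N])
  ultimately have nA': "A' * adj A' = adj A' * A'" using Suc.prems(2) by simp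
  have colA': "col A' 0 = e \<cdot>\<^sub>v col (1\<^sub>m ?N) 0"
  proof -
    have "col A' 0 = (H * A) *\<^sub>v col H 0" unfolding A'_def using A H by (intro col_mult2) auto
    also have "\<dots> = H *\<^sub>v (A *\<^sub>v v)" using A H v by (simp add: assoc_mult_mat_vec[of _ ?N ?N _ ?N])
    also have "\<dots> = e \<cdot>\<^sub>v (H *\<^sub>v col H 0)" using H v by (simp add: mult_mat_vec[of _ ?N ?N])
    also have "H *\<^sub>v col H 0 = col (H * H) 0" using H by (intro col_mult2[symmetric]) auto
    finally show ?thesis using H by simp
  qed
  have c0: "A' $$ (i,0) = (if i = 0 then e else 0)" if "i < ?N" for i
  proof -
    have "A' $$ (i,0) = col A' 0 $ i" using that A'c by auto
    then show ?thesis using that unfolding colA' by auto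
  qed
  \<comment> \<open>Comparing the corner entries of \<open>A' * adj A'\<close> and
    \<open>adj A' * A'\<close> shows that the first row and the first column have the same length;
    the column has only its corner entry.\<close>
  have r0: "A' $$ (0,j) = 0" if j: "j < ?N" "j \<noteq> 0" for j
  proof -
    have "(A' * adj A') $$ (0,0) = (\<Sum>k<?N. complex_of_real ((cmod (A' $$ (0,k)))\<^sup>2))"
      using A'c by (auto simp: scalar_prod_def adj_def atLeast0LessThan complex_norm_square simp del: of_real_power intro!: sum.cong)
    moreover have "(adj A' * A') $$ (0,0) = (\<Sum>k<?N. complex_of_real ((cmod (A' $$ (k,0)))\<^sup>2))"
      using A'c by (auto simp: scalar_prod_def adj_def atLeast0LessThan complex_norm_square mult.commute simp del: of_real_power intro!: sum.cong)
    ultimately have "complex_of_real (\<Sum>k<?N. (cmod (A' $$ (0,k)))\<^sup>2) = complex_of_real (\<Sum>k<?N. (cmod (A' $$ (k,0)))\<^sup>2)"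
      unfolding of_real_sum nA' by metis
    then have "(\<Sum>k<?N. (cmod (A' $$ (0,k)))\<^sup>2) = (\<Sum>k<?N. (cmod (A' $$ (k,0)))\<^sup>2)" by (simp only: of_real_eq_iff)
    also have "\<dots> = (\<Sum>k<?N. if k = 0 then (cmod e)\<^sup>2 else 0)" by (rule sum.cong) (auto simp: c0)
    finally have "(\<Sum>k<n. (cmod (A' $$ (0,Suc k)))\<^sup>2) = 0"
      using c0[of 0] unfolding sum.lessThan_Suc_shift by simp
    then have "\<forall>k<n. (cmod (A' $$ (0,Suc k)))\<^sup>2 = 0" by (subst (asm) sum_nonneg_eq_0_iff) auto
    then show ?thesis using j by (cases j) auto
  qed
  define B where "B = mat n n (\<lambda>(i,j). A' $$ (Suc i, Suc j))"
  have Bc: "B \<in> carrier_mat n n" by (simp add: B_def)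
  have A'B: "A' = ext n e B"
    using A'c c0 r0 by (intro eq_matI) (auto simp: ext_def B_def)
  have "B * adj B = adj B * B"
    using ext_inj[OF mult_carrier_mat[OF Bc adj_carrier[OF Bc]] mult_carrier_mat[OF adj_carrier[OF Bc] Bc]
        nA'[unfolded A'B adj_ext[OF Bc] ext_mult[OF Bc adj_carrier[OF Bc]] ext_mult[OF adj_carrier[OF Bc] Bc]]] .
  from Suc.IH[OF Bc this] obtain P d where P: "P \<in> carrier_mat n n" "adj P * P = 1\<^sub>m n" "P * adj P = 1\<^sub>m n"
    "B = P * dgm n d * adj P" by blast
  define R where "R = H * ext n 1 P"
  have Rc: "R \<in> carrier_mat ?N ?N" using H by (simp add: R_def)
  have aR: "adj R = ext n 1 (adj P) * H" using H P by (simp add: R_def adj_mult[of _ ?N ?N _ ?N] adj_ext)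
  note mc = mult_carrier_mat[of _ ?N ?N _ ?N]
  have "adj R * R = ext n 1 (adj P) * ext n 1 P"
    unfolding aR unfolding R_def using H(1-3) by (simp add: as HH mc)
  then have 1: "adj R * R = 1\<^sub>m ?N" using P by (simp add: ext_mult ext_one)
  have "R * adj R = H * ((ext n 1 P * ext n 1 (adj P)) * H)"
    unfolding aR unfolding R_def using H(1-3) by (simp add: as mc)
  then have 2: "R * adj R = 1\<^sub>m ?N" using P(1-3) H(1-3) by (simp add: ext_mult ext_one)
  have "A' = ext n 1 P * ext n e (dgm n d) * ext n 1 (adj P)"
    unfolding A'B P(4) using P(1-3) by (simp add: ext_mult mult_carrier_mat[of _ n n _ n])
  then have "H * A' * H = R * dgm ?N (case_nat e d) * adj R"
    unfolding aR unfolding R_def using H(1-3) by (simp add: as ext_dgm mc)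
  moreover have "H * A' * H = A" unfolding A'_def using H(1-3) A by (simp add: as HH mc)
  ultimately show ?case using 1 2 Rc by blast
qed

section \<open>Traces, projections of equal rank, invertible shifts\<close>

definition trm :: "complex mat \<Rightarrow> complex" where "trm A = (\<Sum>i<dim_row A. A $$ (i,i))"

lemma trm_add: "A \<in> carrier_mat n n \<Longrightarrow> B \<in> carrier_mat n n \<Longrightarrow> trm (A + B) = trm A + trm B"
  by (auto simp: trm_def sum.distrib)

lemma trm_comm:
  assumes "A \<in> carrier_mat n n" "B \<in> carrier_mat n n" shows "trm (A * B) = trm (B * A)"
proof -
  have "trm (A * B) = (\<Sum>i<n. \<Sum>k<n. A $$ (i,k) * B $$ (k,i))"
    using assms by (auto simp: trm_def scalar_prod_def atLeast0LessThan intro!: sum.cong)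
  also have "\<dots> = (\<Sum>k<n. \<Sum>i<n. A $$ (i,k) * B $$ (k,i))" by (rule sum.swap)
  also have "\<dots> = trm (B * A)"
    using assms by (auto simp: trm_def scalar_prod_def atLeast0LessThan mult.commute intro!: sum.cong)
  finally show ?thesis .
qed

lemma trm_cjm: "A \<in> carrier_mat n n \<Longrightarrow> trm (cjm A) = cnj (trm A)"
  by (auto simp: trm_def cjm_def)

text \<open>The eigenvalues are 0 or 1, so the trace counts the ones. That it is a natural number
  later turns an equality of doubled traces into an equality of ranks.\<close>

lemma projection_diag:
  assumes P: "P \<in> carrier_mat n n" "adj P = P" "P * P = P"
  shows "\<exists>R S. R \<in> carrier_mat n n \<and> adj R * R = 1\<^sub>m n \<and> R * adj R = 1\<^sub>m n \<and> S \<subseteq> {..<n} \<and>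
     P = R * dgm n (\<lambda>i. if i \<in> S then 1 else 0) * adj R \<and> trm P = of_nat (card S)"
proof -
  obtain R d where R: "R \<in> carrier_mat n n" "adj R * R = 1\<^sub>m n" "R * adj R = 1\<^sub>m n" "P = R * dgm n d * adj R"
    using spectral_theorem[of P n] P by auto
  note as = assoc_mult_mat[of _ n n _ n _ n]
  have RR: "adj R * (R * X) = X" if "X \<in> carrier_mat n n" for X using as[of "adj R" R X] R that by simp
  note mc = mult_carrier_mat[of _ n n _ n]
  have D: "adj R * (R * X * adj R) * R = X" if "X \<in> carrier_mat n n" for X
    using R(1-3) that by (simp add: as RR mc)
  have "P * P = R * (dgm n d * dgm n d) * adj R" unfolding R(4) using R(1-3) by (simp add: as RR mc)
  then have "R * (dgm n d * dgm n d) * adj R = R * dgm n d * adj R" using P(3) R(4) by metis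
  then have "dgm n d * dgm n d = dgm n d" using D[of "dgm n d * dgm n d"] D[of "dgm n d"] by (simp add: mc)
  then have "dgm n (\<lambda>i. d i * d i) $$ (i,i) = dgm n d $$ (i,i)" for i unfolding dgm_mult by simp
  then have dd: "d i = 0 \<or> d i = 1" if i: "i < n" for i
  proof -
    have "d i * d i = d i" using \<open>\<And>i. dgm n (\<lambda>i. d i * d i) $$ (i,i) = dgm n d $$ (i,i)\<close>[of i] i by (simp add: dgm_def)
    then show ?thesis by simp
  qed
  define S where "S = {i\<in>{..<n}. d i = 1}"
  have dS: "dgm n d = dgm n (\<lambda>i. if i \<in> S then 1 else 0)"
    using dd by (intro eq_matI) (auto simp: dgm_def S_def)
  have "trm P = trm (adj R * (R * dgm n d))" unfolding R(4)
    using R by (intro trm_comm) auto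
  also have "\<dots> = trm (dgm n d)" using R by (simp add: RR)
  also have "\<dots> = (\<Sum>i<n. if i \<in> S then 1 else 0)" unfolding dS by (simp add: trm_def dgm_def)
  also have "\<dots> = of_nat (card S)"
    by (simp add: sum.If_cases S_def Int_def)
  finally show ?thesis using R dS S_def by (intro exI[of _ R] exI[of _ S]) auto
qed

text \<open>A bijection between the two sets of eigenvalues 1 gives a partial permutation matrix
  \<open>M\<close>, which the eigenbases carry to the required partial isometry.\<close>

lemma projections_equiv:
  assumes P: "P \<in> carrier_mat n n" "adj P = P" "P * P = P"
    and Q: "Q \<in> carrier_mat n n" "adj Q = Q" "Q * Q = Q" and t: "trm P = trm Q"
  shows "\<exists>Z. Z \<in> carrier_mat n n \<and> adj Z * Z = P \<and> Z * adj Z = Q"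
proof -
  obtain R S where R: "R \<in> carrier_mat n n" "adj R * R = 1\<^sub>m n" "R * adj R = 1\<^sub>m n" "S \<subseteq> {..<n}"
    "P = R * dgm n (\<lambda>i. if i \<in> S then 1 else 0) * adj R" "trm P = of_nat (card S)"
    using projection_diag[OF P] by blast
  obtain R' S' where R': "R' \<in> carrier_mat n n" "adj R' * R' = 1\<^sub>m n" "R' * adj R' = 1\<^sub>m n" "S' \<subseteq> {..<n}"
    "Q = R' * dgm n (\<lambda>i. if i \<in> S' then 1 else 0) * adj R'" "trm Q = of_nat (card S')"
    using projection_diag[OF Q] by blast
  have fin: "finite S" "finite S'" using R(4) R'(4) finite_subset by auto
  have "card S = card S'" using t R(6) R'(6) by simp
  then obtain f where f: "bij_betw f S S'" using fin by (metis finite_same_card_bij)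
  define g where "g = the_inv_into S f"
  have g1: "g i \<in> S \<and> f (g i) = i" if "i \<in> S'" for i
    using f that unfolding g_def by (metis bij_betw_def f_the_inv_into_f the_inv_into_into subset_refl)
  have g2: "f k \<in> S' \<and> g (f k) = k" if "k \<in> S" for k
    using f that unfolding g_def by (metis bij_betw_def imageI the_inv_into_f_f)
  define M where "M = mat n n (\<lambda>(i,j). if j \<in> S \<and> i = f j then (1::complex) else 0)"
  have Mc: "M \<in> carrier_mat n n" by (simp add: M_def)
  have fS: "f j < n" if "j \<in> S" for j using f R'(4) that by (auto simp: bij_betw_def)
  have M1: "adj M * M = dgm n (\<lambda>i. if i \<in> S then 1 else 0)"
  proof (rule eq_matI)
    fix i j assume "i < dim_row (dgm n (\<lambda>i. if i \<in> S then 1 else 0))" "j < dim_col (dgm n (\<lambda>i. if i \<in> S then 1 else 0))"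
    then have ij: "i < n" "j < n" by auto
    have "(adj M * M) $$ (i,j) = (\<Sum>k<n. (if i \<in> S \<and> k = f i then 1 else 0) * (if j \<in> S \<and> k = f j then 1 else 0))"
      using ij by (auto simp: M_def adj_def scalar_prod_def atLeast0LessThan intro!: sum.cong)
    also have "\<dots> = (\<Sum>k<n. if k = f i then (if i \<in> S \<and> j \<in> S \<and> i = j then 1 else 0) else 0)"
      using f by (intro sum.cong) (auto simp: bij_betw_def inj_on_def)
    also have "\<dots> = (if i \<in> S \<and> i = j then 1 else 0)" using fS[of i] by auto
    finally show "(adj M * M) $$ (i,j) = dgm n (\<lambda>i. if i \<in> S then 1 else 0) $$ (i,j)" using ij by (auto simp: dgm_def)
  qed (auto simp: M_def)
  have M2: "M * adj M = dgm n (\<lambda>i. if i \<in> S' then 1 else 0)"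
  proof (rule eq_matI)
    fix i j assume "i < dim_row (dgm n (\<lambda>i. if i \<in> S' then 1 else 0))" "j < dim_col (dgm n (\<lambda>i. if i \<in> S' then 1 else 0))"
    then have ij: "i < n" "j < n" by auto
    have "(M * adj M) $$ (i,j) = (\<Sum>k<n. (if k \<in> S \<and> i = f k then 1 else 0) * (if k \<in> S \<and> j = f k then 1 else 0))"
      using ij by (auto simp: M_def adj_def scalar_prod_def atLeast0LessThan intro!: sum.cong)
    also have "\<dots> = (\<Sum>k<n. if k = g i then (if i \<in> S' \<and> i = j then 1 else 0) else 0)"
    proof (rule sum.cong[OF refl])
      fix k
      show "(if k \<in> S \<and> i = f k then 1 else 0) * (if k \<in> S \<and> j = f k then 1 else 0) =
        (if k = g i then (if i \<in> S' \<and> i = j then 1 else 0) else (0::complex))"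
      proof (cases "k \<in> S \<and> i = f k")
        case True
        then have "i \<in> S'" "g i = k" using g2 by metis+
        then show ?thesis using True by simp
      next
        case False
        then have "\<not> (k = g i \<and> i \<in> S')" using g1 by metis
        then have "(if k = g i then (if i \<in> S' \<and> i = j then 1 else 0) else (0::complex)) = 0"
          by (cases "k = g i") simp_all
        then show ?thesis using False by (simp only: if_False mult_zero_left)
      qed
    qed
    also have "\<dots> = (if i \<in> S' \<and> i = j then 1 else 0)"
    proof -
      have "g i < n" if "i \<in> S'" using g1[OF that] R(4) by auto
      then show ?thesis by auto
    qed
    finally show "(M * adj M) $$ (i,j) = dgm n (\<lambda>i. if i \<in> S' then 1 else 0) $$ (i,j)" using ij by (auto simp: dgm_def)
  qed (auto simp: M_def)
  define Z where "Z = R' * M * adj R"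
  have Zc: "Z \<in> carrier_mat n n" using R R' Mc by (auto simp: Z_def)
  note as = assoc_mult_mat[of _ n n _ n _ n]
  have RR: "adj R * (R * X) = X" if "X \<in> carrier_mat n n" for X using as[of "adj R" R X] R that by simp
  have RR': "adj R' * (R' * X) = X" if "X \<in> carrier_mat n n" for X using as[of "adj R'" R' X] R' that by simp
  have aZ: "adj Z = R * (adj M * adj R')" using R(1-3) R'(1-3) Mc by (simp add: Z_def adj_mult[of _ n n _ n] as mult_carrier_mat[of _ n n _ n])
  have "adj Z * Z = R * ((adj M * M) * adj R)" unfolding aZ unfolding Z_def using R(1-3) R'(1-3) Mc by (simp add: as RR' mult_carrier_mat[of _ n n _ n])
  moreover have "Z * adj Z = R' * ((M * adj M) * adj R')" unfolding aZ unfolding Z_def using R(1-3) R'(1-3) Mc by (simp add: as RR mult_carrier_mat[of _ n n _ n])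
  ultimately show ?thesis unfolding M1 M2 R(5) R'(5) using Zc R(1-3) R'(1-3)
    by (intro exI[of _ Z]) (simp add: as mult_carrier_mat[of _ n n _ n])
qed

text \<open>Only finitely many shifts hit the spectrum. The shift is real so that it is compatible
  with the symmetry \<open>sg\<close>.\<close>

lemma exists_invertible_shift:
  assumes A: "A \<in> carrier_mat n n" and e: "e > 0"
  shows "\<exists>t>0. t < e \<and> (\<forall>v\<in>carrier_vec n. (A + complex_of_real t \<cdot>\<^sub>m 1\<^sub>m n) *\<^sub>v v = 0\<^sub>v n \<longrightarrow> v = 0\<^sub>v n)"
proof -
  have "finite (spectrum A)" using card_finite_spectrum[OF A] by auto
  then have "finite ((\<lambda>z. - Re z) ` spectrum A)" by simp
  moreover have "infinite {0<..<e}" using e by simp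
  ultimately obtain t where t: "t \<in> {0<..<e}" "t \<notin> (\<lambda>z. - Re z) ` spectrum A"
    by (metis finite_subset subsetI)
  have "v = 0\<^sub>v n" if v: "v \<in> carrier_vec n" "(A + complex_of_real t \<cdot>\<^sub>m 1\<^sub>m n) *\<^sub>v v = 0\<^sub>v n" for v
  proof (rule ccontr)
    assume "v \<noteq> 0\<^sub>v n"
    have "(A + complex_of_real t \<cdot>\<^sub>m 1\<^sub>m n) *\<^sub>v v = A *\<^sub>v v + complex_of_real t \<cdot>\<^sub>v v"
    proof -
      have "(complex_of_real t \<cdot>\<^sub>m 1\<^sub>m n) *\<^sub>v v = complex_of_real t \<cdot>\<^sub>v v"
      proof (rule eq_vecI)
        fix i assume "i < dim_vec (complex_of_real t \<cdot>\<^sub>v v)"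
        then have i: "i < n" using v by auto
        have "((complex_of_real t \<cdot>\<^sub>m 1\<^sub>m n) *\<^sub>v v) $ i = (\<Sum>k\<in>{0..<n}. if i = k then complex_of_real t * v $ k else 0)"
        proof -
          have "((complex_of_real t \<cdot>\<^sub>m 1\<^sub>m n) *\<^sub>v v) $ i = (\<Sum>k\<in>{0..<n}. complex_of_real t * (if k = i then 1 else 0) * v $ k)"
            using i v(1) by (simp add: scalar_prod_def)
          also have "\<dots> = (\<Sum>k\<in>{0..<n}. if i = k then complex_of_real t * v $ k else 0)"
            by (rule sum.cong) auto
          finally show ?thesis .
        qed
        then show "((complex_of_real t \<cdot>\<^sub>m 1\<^sub>m n) *\<^sub>v v) $ i = (complex_of_real t \<cdot>\<^sub>v v) $ i" using i v(1) by simp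
      qed (use v in auto)
      then show ?thesis using A v(1) by (subst add_mult_distrib_mat_vec[of _ n n]) auto
    qed
    then have s: "A *\<^sub>v v + complex_of_real t \<cdot>\<^sub>v v = 0\<^sub>v n" using v by simp
    have "A *\<^sub>v v = complex_of_real (- t) \<cdot>\<^sub>v v"
    proof (rule eq_vecI)
      fix i assume "i < dim_vec (complex_of_real (- t) \<cdot>\<^sub>v v)"
      then have i: "i < n" using v by auto
      then have "(A *\<^sub>v v + complex_of_real t \<cdot>\<^sub>v v) $ i = 0" using s by simp
      then show "(A *\<^sub>v v) $ i = (complex_of_real (- t) \<cdot>\<^sub>v v) $ i" using i v A
        by (simp add: add_eq_0_iff2)
    qed (use v A in auto)
    then have "complex_of_real (- t) \<in> spectrum A" using v \<open>v \<noteq> 0\<^sub>v n\<close> A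
      unfolding spectrum_def eigenvalue_def eigenvector_def by (auto intro!: exI[of _ v])
    then have "t \<in> (\<lambda>z. - Re z) ` spectrum A" by (intro image_eqI[of _ _ "complex_of_real (- t)"]) auto
    then show False using t by blast
  qed
  then show ?thesis using t by auto
qed

section \<open>Families of matrices modulo null families\<close>

text \<open>\<open>sg\<close> is the antilinear automorphism whose fixed points are the real (or quaternionic) elements, \<open>sc\<close> embeds
  the scalars.\<close>

class star_ring = ring_1 +
  fixes star :: "'a \<Rightarrow> 'a" and sg :: "'a \<Rightarrow> 'a" and sc :: "complex \<Rightarrow> 'a"
  assumes star_add: "star (x + y) = star x + star y"
    and star_mult: "star (x * y) = star y * star x"
    and star_star[simp]: "star (star x) = x"
    and sg_add: "sg (x + y) = sg x + sg y"
    and sg_mult: "sg (x * y) = sg x * sg y"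
    and sg_sg[simp]: "sg (sg x) = x"
    and sg_star: "sg (star x) = star (sg x)"
    and sc_add: "sc (a + b) = sc a + sc b"
    and sc_mult: "sc (a * b) = sc a * sc b"
    and sc_one[simp]: "sc 1 = 1"
    and sc_comm: "x * sc a = sc a * x"
    and star_sc: "star (sc a) = sc (cnj a)"
    and sg_sc: "sg (sc a) = sc (cnj a)"
begin

lemma star_zero[simp]: "star 0 = 0"
  using star_add[of 0 0] by simp
lemma sg_zero[simp]: "sg 0 = 0"
  using sg_add[of 0 0] by simp
lemma sc_zero[simp]: "sc 0 = 0"
  using sc_add[of 0 0] by simp
lemma star_one[simp]: "star 1 = 1"
  using star_sc[of 1] by simp
lemma sg_one[simp]: "sg 1 = 1"
  using sg_sc[of 1] by simp
lemma star_uminus: "star (- x) = - star x"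
  using star_add[of x "- x"] by (simp add: minus_unique)
lemma sg_uminus: "sg (- x) = - sg x"
  using sg_add[of x "- x"] by (simp add: minus_unique)
lemma sc_uminus: "sc (- a) = - sc a"
  using sc_add[of a "- a"] by (simp add: minus_unique)
lemma star_diff: "star (x - y) = star x - star y"
  using star_add[of x "- y"] by (simp add: star_uminus)
lemma sg_diff: "sg (x - y) = sg x - sg y"
  using sg_add[of x "- y"] by (simp add: sg_uminus)
lemma star_sum: "star (sum f A) = (\<Sum>i\<in>A. star (f i))"
  by (induction A rule: infinite_finite_induct) (simp_all add: star_add)
lemma sg_sum: "sg (sum f A) = (\<Sum>i\<in>A. sg (f i))"
  by (induction A rule: infinite_finite_induct) (simp_all add: sg_add)
end

text \<open>\<open>Idx b m k\<close> indexes the \<open>k\<close>-th copy of the matrices of size \<open>m + 1\<close> (real case) or \<open>2 * (m + 1)\<close>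
  (\<open>b = True\<close>, symplectic case); a sequence of counterexamples of varying sizes is then one element of a single algebra.\<close>

datatype idx = Idx (sympl: bool) nat nat

definition dm :: "idx \<Rightarrow> nat" where
  "dm i = (case i of Idx b n k \<Rightarrow> if b then 2 * (n + 1) else n + 1)"

lemma dm_pos: "dm i > 0" by (auto simp: dm_def split: idx.splits)

text \<open>Chosen so that both kinds of matrices are the unitaries fixed by
  \<open>X \<mapsto> Jm * cjm X * adj Jm\<close>: plain conjugation in the real case, and in the
  symplectic case the quaternionic structure given by the skew matrix with blocks
  \<open>0, 1, -1, 0\<close>.\<close>

definition Jm :: "idx \<Rightarrow> complex mat" where
  "Jm i = (case i of Idx b n k \<Rightarrow> if b then mat (2 * (n + 1)) (2 * (n + 1))
     (\<lambda>(r, s). if s = r + (n + 1) then 1 else if r = s + (n + 1) then - 1 else 0) else 1\<^sub>m (n + 1))"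

text \<open>The sign of \<open>Jm * Jm\<close>. It enters twice when \<open>sg\<close> is applied
  twice, so \<open>sg\<close> is an involution in both cases.\<close>

definition Js :: "idx \<Rightarrow> complex" where "Js i = (if sympl i then - 1 else 1)"

lemma Jm_carrier[simp]: "Jm i \<in> carrier_mat (dm i) (dm i)"
  by (auto simp: Jm_def dm_def split: idx.splits)

lemma cjm_Jm: "cjm (Jm i) = Jm i"
  by (rule eq_matI) (auto simp: Jm_def cjm_def split: idx.splits)

lemma adj_Jm: "adj (Jm i) = Js i \<cdot>\<^sub>m Jm i"
  by (rule eq_matI) (auto simp: Jm_def adj_def Js_def split: idx.splits)

lemma Jm_sq: "Jm i * Jm i = Js i \<cdot>\<^sub>m 1\<^sub>m (dm i)"
proof (cases i)
  case (Idx b n k)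
  show ?thesis
  proof (cases b)
    case False then show ?thesis by (auto simp: Idx Jm_def dm_def Js_def intro!: eq_matI)
  next
    case True
    let ?m = "n + 1"
    let ?f = "\<lambda>r s. if s = r + ?m then 1 else if r = s + ?m then - 1 else (0::complex)"
    show ?thesis
    proof (rule eq_matI)
      fix r s assume "r < dim_row (Js i \<cdot>\<^sub>m 1\<^sub>m (dm i))" "s < dim_col (Js i \<cdot>\<^sub>m 1\<^sub>m (dm i))"
      then have rs: "r < 2 * ?m" "s < 2 * ?m" using True Idx by (auto simp: dm_def)
      have "(Jm i * Jm i) $$ (r, s) = (\<Sum>t\<in>{0..<2 * ?m}. ?f r t * ?f t s)"
        using rs True Idx by (simp add: Jm_def scalar_prod_def)
      also have "\<dots> = (\<Sum>t\<in>{0..<2 * ?m}. if t = (if r < ?m then r + ?m else r - ?m) then (if r = s then - 1 else 0) else 0)"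
        using rs by (intro sum.cong) auto
      also have "\<dots> = (if r = s then - 1 else 0)" using rs by (subst sum.delta) auto
      finally show "(Jm i * Jm i) $$ (r, s) = (Js i \<cdot>\<^sub>m 1\<^sub>m (dm i)) $$ (r, s)"
        using rs True Idx by (simp add: Js_def dm_def)
    qed (use Idx True in \<open>auto simp: dm_def Jm_def\<close>)
  qed
qed

lemma Js_sq[simp]: "Js i * Js i = 1" "cnj (Js i) = Js i" by (auto simp: Js_def)

lemma smult_smult_mat: "a \<cdot>\<^sub>m (b \<cdot>\<^sub>m A) = (a * b) \<cdot>\<^sub>m (A :: complex mat)"
  by (rule eq_matI) auto

lemma smult_one_mult: "A \<in> carrier_mat n n \<Longrightarrow> (a \<cdot>\<^sub>m 1\<^sub>m n) * A = a \<cdot>\<^sub>m (A :: complex mat)"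
  by (subst mult_smult_assoc_mat[of _ n n _ n]) auto

lemma mult_smult_one: "A \<in> carrier_mat n n \<Longrightarrow> A * (a \<cdot>\<^sub>m 1\<^sub>m n) = a \<cdot>\<^sub>m (A :: complex mat)"
  by (subst mult_smult_distrib[of _ n n _ n]) auto

lemma one_smult_mat: "1 \<cdot>\<^sub>m A = (A :: complex mat)"
  by (rule eq_matI) auto

lemma Jm_unitary: "adj (Jm i) * Jm i = 1\<^sub>m (dm i)" "Jm i * adj (Jm i) = 1\<^sub>m (dm i)"
  unfolding adj_Jm mult_smult_assoc_mat[OF Jm_carrier Jm_carrier] mult_smult_distrib[OF Jm_carrier Jm_carrier] Jm_sq
  by (auto simp: Js_def intro!: eq_matI)

typedef fam = "{f :: idx \<Rightarrow> complex mat. \<forall>i. f i \<in> carrier_mat (dm i) (dm i)}" morphisms fib Fam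
  by (rule exI[of _ "\<lambda>i. 0\<^sub>m (dm i) (dm i)"]) auto

setup_lifting type_definition_fam

lemma fib_carrier[simp]: "fib x i \<in> carrier_mat (dm i) (dm i)"
  using fib[of x] by auto

lemma fib_dim[simp]: "dim_row (fib x i) = dm i" "dim_col (fib x i) = dm i"
  by (rule carrier_matD[OF fib_carrier])+

lemma fam_eqI: "(\<And>i. fib x i = fib y i) \<Longrightarrow> x = y"
  using fib_inject by blast

lift_definition Jf :: fam is Jm by simp
lift_definition cjf :: "fam \<Rightarrow> fam" is "\<lambda>f i. cjm (f i)" by simp
lift_definition dgf :: "(idx \<Rightarrow> nat \<Rightarrow> complex) \<Rightarrow> fam" is "\<lambda>d i. dgm (dm i) (d i)" by simp

instantiation fam :: star_ring
begin
lift_definition zero_fam :: fam is "\<lambda>i. 0\<^sub>m (dm i) (dm i)" by simp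
lift_definition one_fam :: fam is "\<lambda>i. 1\<^sub>m (dm i)" by simp
lift_definition plus_fam :: "fam \<Rightarrow> fam \<Rightarrow> fam" is "\<lambda>f g i. f i + g i" by simp
lift_definition minus_fam :: "fam \<Rightarrow> fam \<Rightarrow> fam" is "\<lambda>f g i. f i - g i" by (simp add: minus_carrier_mat)
lift_definition uminus_fam :: "fam \<Rightarrow> fam" is "\<lambda>f i. - f i" by simp
lift_definition times_fam :: "fam \<Rightarrow> fam \<Rightarrow> fam" is "\<lambda>f g i. f i * g i" by (metis mult_carrier_mat)
lift_definition star_fam :: "fam \<Rightarrow> fam" is "\<lambda>f i. adj (f i)" by simp
lift_definition sc_fam :: "complex \<Rightarrow> fam" is "\<lambda>c i. c \<cdot>\<^sub>m 1\<^sub>m (dm i)" by simp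
lift_definition sg_fam :: "fam \<Rightarrow> fam" is "\<lambda>f i. Jm i * cjm (f i) * adj (Jm i)"
  by (meson Jm_carrier adj_carrier cjm_carrier mult_carrier_mat)

instance
proof
  fix x y z :: fam and a b :: complex
  note fibs = zero_fam.rep_eq one_fam.rep_eq plus_fam.rep_eq minus_fam.rep_eq uminus_fam.rep_eq times_fam.rep_eq
    star_fam.rep_eq sc_fam.rep_eq sg_fam.rep_eq
  have JJ: "adj (Jm i) * (Jm i * X) = X" if "X \<in> carrier_mat (dm i) (dm i)" for X i
    using assoc_mult_mat[of "adj (Jm i)" "dm i" "dm i" "Jm i" "dm i" X "dm i"] that by (simp add: Jm_unitary)
  show "x * y * z = x * (y * z)" apply (rule fam_eqI) subgoal for i by (simp add: fibs assoc_mult_mat[of _ "dm i" "dm i" _ "dm i" _ "dm i"] mult_carrier_mat[of _ "dm i" "dm i" _ "dm i"]) done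
  show "(x + y) * z = x * z + y * z"
    apply (rule fam_eqI) subgoal for i by (simp add: fibs add_mult_distrib_mat[of _ "dm i" "dm i" _ _ "dm i"]) done
  show "x * (y + z) = x * y + x * z"
    apply (rule fam_eqI) subgoal for i by (simp add: fibs mult_add_distrib_mat[of _ "dm i" "dm i" _ "dm i"]) done
  show "1 * x = x" "x * 1 = x" by (rule fam_eqI, simp add: fibs)+
  show "x + y + z = x + (y + z)" apply (rule fam_eqI) subgoal for i by (simp add: fibs assoc_add_mat[of _ "dm i" "dm i"]) done
  show "x + y = y + x" apply (rule fam_eqI) subgoal for i by (simp add: fibs comm_add_mat[of _ "dm i" "dm i"]) done
  show "0 + x = x" by (rule fam_eqI) (simp add: fibs)
  show "- x + x = 0" by (rule fam_eqI) (simp add: fibs uminus_l_inv_mat)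
  show "x - y = x + - y" apply (rule fam_eqI) subgoal for i by (simp add: fibs minus_add_uminus_mat[of _ "dm i" "dm i"]) done
  show "(0::fam) \<noteq> 1"
  proof
    assume "(0::fam) = 1"
    then have "fib 0 (Idx False 0 0) $$ (0,0) = fib 1 (Idx False 0 0) $$ (0,0)" by simp
    then show False by (simp add: fibs dm_def)
  qed
  show "star (x + y) = star x + star y" apply (rule fam_eqI) subgoal for i by (simp add: fibs adj_add[of _ "dm i" "dm i"]) done
  show "star (x * y) = star y * star x"
    apply (rule fam_eqI) subgoal for i by (simp add: fibs adj_mult[of _ "dm i" "dm i" _ "dm i"]) done
  show "star (star x) = x" by (rule fam_eqI) (simp add: fibs)
  show "sg (x + y) = sg x + sg y"
    apply (rule fam_eqI) subgoal for i by (simp add: fibs cjm_add[of _ "dm i" "dm i"] mult_carrier_mat[of _ "dm i" "dm i" _ "dm i"]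
        add_mult_distrib_mat[of _ "dm i" "dm i" _ _ "dm i"] mult_add_distrib_mat[of _ "dm i" "dm i" _ "dm i"]) done
  show "sg (x * y) = sg x * sg y"
    apply (rule fam_eqI) subgoal for i by (simp add: fibs cjm_mult[of _ "dm i" "dm i" _ "dm i"] assoc_mult_mat[of _ "dm i" "dm i" _ "dm i" _ "dm i"] mult_carrier_mat[of _ "dm i" "dm i" _ "dm i"] JJ) done
  show "sg (sg x) = x"
  proof (rule fam_eqI)
    fix i
    let ?J = "Jm i" let ?x = "fib x i"
    have "fib (sg (sg x)) i = ?J * (?J * ?x * adj ?J) * adj ?J"
      by (simp add: fibs cjm_mult[of _ "dm i" "dm i" _ "dm i"] mult_carrier_mat[of _ "dm i" "dm i" _ "dm i"] cjm_Jm cjm_adj)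
    also have "\<dots> = (?J * ?J) * ?x * (adj ?J * adj ?J)" by (simp add: assoc_mult_mat[of _ "dm i" "dm i" _ "dm i" _ "dm i"] mult_carrier_mat[of _ "dm i" "dm i" _ "dm i"])
    also have "adj ?J * adj ?J = adj (?J * ?J)" by (simp add: adj_mult[of _ "dm i" "dm i" _ "dm i"])
    also have "?J * ?J * ?x * adj (?J * ?J) = ?x"
      unfolding Jm_sq by (simp add: adj_smult smult_one_mult[of _ "dm i"] mult_smult_one[of _ "dm i"] smult_smult_mat one_smult_mat)
    finally show "fib (sg (sg x)) i = fib x i" .
  qed
  show "sg (star x) = star (sg x)"
    apply (rule fam_eqI) subgoal for i by (simp add: fibs adj_mult[of _ "dm i" "dm i" _ "dm i"] mult_carrier_mat[of _ "dm i" "dm i" _ "dm i"] assoc_mult_mat[of _ "dm i" "dm i" _ "dm i" _ "dm i"] cjm_adj) done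
  show "sc (a + b) = (sc a + sc b :: fam)"
    apply (rule fam_eqI) subgoal for i by (simp add: fibs add_smult_distrib_right_mat[of _ "dm i" "dm i"]) done
  show "sc (a * b) = (sc a * sc b :: fam)"
    apply (rule fam_eqI) subgoal for i by (simp add: fibs smult_one_mult[of _ "dm i"] mult_smult_one[of _ "dm i"] smult_smult_mat one_smult_mat mult.commute) done
  show "sc 1 = (1::fam)" by (rule fam_eqI) (auto simp: fibs one_smult_mat)
  show "x * sc a = sc a * x"
    apply (rule fam_eqI) subgoal for i by (simp add: fibs smult_one_mult[of _ "dm i"] mult_smult_one[of _ "dm i"] smult_smult_mat one_smult_mat) done
  show "star (sc a) = (sc (cnj a) :: fam)" by (rule fam_eqI) (simp add: fibs adj_smult)
  show "sg (sc a) = (sc (cnj a) :: fam)"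
    apply (rule fam_eqI) subgoal for i
      by (simp add: fibs cjm_smult mult_smult_assoc_mat[OF Jm_carrier adj_carrier[OF Jm_carrier]] smult_one_mult[of _ "dm i"] mult_smult_one[of _ "dm i"] smult_smult_mat one_smult_mat Jm_unitary) done
qed
end

lemmas fibs = zero_fam.rep_eq one_fam.rep_eq plus_fam.rep_eq minus_fam.rep_eq uminus_fam.rep_eq times_fam.rep_eq
    star_fam.rep_eq sc_fam.rep_eq sg_fam.rep_eq Jf.rep_eq cjf.rep_eq dgf.rep_eq

section \<open>Fibrewise norms, bounded and null families\<close>

definition fn :: "fam \<Rightarrow> idx \<Rightarrow> real" where "fn x i = op_norm (fib x i)"

lemma fn_nonneg[simp]: "0 \<le> fn x i" by (simp add: fn_def)
lemma fn_add: "fn (x + y) i \<le> fn x i + fn y i" by (simp add: fn_def fibs op_norm_add[of _ "dm i" "dm i"])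
lemma fn_mult: "fn (x * y) i \<le> fn x i * fn y i" by (simp add: fn_def fibs op_norm_mult[of _ "dm i" "dm i" _ "dm i"])
lemma fn_star[simp]: "fn (star x) i = fn x i" by (simp add: fn_def fibs)
lemma fn_cstar: "fn (star x * x) i = (fn x i)\<^sup>2" by (simp add: fn_def fibs op_norm_cstar[of _ "dm i" "dm i"])
lemma fn_one[simp]: "fn 1 i = 1" by (simp add: fn_def fibs op_norm_one dm_pos)
lemma fn_sc[simp]: "fn (sc a) i = cmod a" by (simp add: fn_def fibs op_norm_smult op_norm_one dm_pos)
lemma fn_zero[simp]: "fn 0 i = 0"
  using fn_sc[of 0 i] by simp
lemma fn_uminus[simp]: "fn (- x) i = fn x i"
proof -
  have le: "fn (- x) i \<le> fn x i" for x
  proof -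
    have "fn (- x) i = fn (sc (-1) * x) i" by (simp add: sc_uminus)
    also have "\<dots> \<le> fn (sc (-1)) i * fn x i" by (rule fn_mult)
    finally show ?thesis by simp
  qed
  show ?thesis using le[of x] le[of "- x"] by simp
qed
lemma fn_diff_comm: "fn (x - y) i = fn (y - x) i" using fn_uminus[of "x - y" i] by simp
lemma fn_Jf: "fn Jf i \<le> 1"
  using op_norm_cstar[of "Jm i" "dm i" "dm i"] op_norm_one_le[of "dm i"]
  by (simp add: fn_def fibs Jm_unitary abs_square_le_1)
lemma sg_fam_eq: "sg x = Jf * cjf x * star Jf" for x :: fam by (rule fam_eqI) (simp add: fibs)
lemma fn_cjf: "fn (cjf x) i \<le> fn x i" by (simp add: fn_def fibs op_norm_cjm_le)
lemma fn_sg[simp]: "fn (sg x) i = fn x i"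
proof -
  have le: "fn (sg x) i \<le> fn x i" for x
  proof -
    have "fn (sg x) i \<le> fn Jf i * fn (cjf x) i * fn Jf i" unfolding sg_fam_eq
    proof -
      have "fn (Jf * cjf x * star Jf) i \<le> fn (Jf * cjf x) i * fn Jf i"
        using fn_mult[of "Jf * cjf x" "star Jf" i] by simp
      also have "\<dots> \<le> fn Jf i * fn (cjf x) i * fn Jf i" by (intro mult_right_mono fn_mult) simp
      finally show "fn (Jf * cjf x * star Jf) i \<le> fn Jf i * fn (cjf x) i * fn Jf i" .
    qed
    also have "\<dots> \<le> 1 * fn x i * 1" by (intro mult_mono fn_Jf fn_cjf) auto
    finally show ?thesis by simp
  qed
  show ?thesis using le[of x] le[of "sg x"] by simp
qed
lemma fn_dgf: "(\<And>k. k < dm i \<Longrightarrow> cmod (d i k) \<le> c) \<Longrightarrow> 0 \<le> c \<Longrightarrow> fn (dgf d) i \<le> c"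
  by (simp add: fn_def fibs op_norm_dgm)

definition bd :: "fam \<Rightarrow> bool" where "bd x \<longleftrightarrow> (\<exists>B. \<forall>i. fn x i \<le> B)"
text \<open>Convergence to 0 along the cofinite filter, so the quotient still sees every infinite
  set of indices, in particular the one carrying a sequence of counterexamples.\<close>

definition nl :: "fam \<Rightarrow> bool" where "nl x \<longleftrightarrow> (\<forall>e>0. \<forall>\<^sub>F i in cofinite. fn x i \<le> e)"

lemma bd_pos: "bd x \<Longrightarrow> \<exists>B>0. \<forall>i. fn x i \<le> B"
  unfolding bd_def by (meson gt_ex less_le_trans less_imp_le linorder_le_cases order_trans)
lemma bd_add[intro]: "bd x \<Longrightarrow> bd y \<Longrightarrow> bd (x + y)"
proof -
  assume "bd x" "bd y"
  then obtain A B where "\<forall>i. fn x i \<le> A" "\<forall>i. fn y i \<le> B" unfolding bd_def by auto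
  then have "fn (x + y) i \<le> A + B" for i
    using fn_add[of x y i] by (meson add_mono order_trans)
  then show ?thesis unfolding bd_def by auto
qed
lemma bd_mult[intro]: "bd x \<Longrightarrow> bd y \<Longrightarrow> bd (x * y)"
proof -
  assume "bd x" "bd y"
  then obtain A B where "\<forall>i. fn x i \<le> A" "\<forall>i. fn y i \<le> B" unfolding bd_def by auto
  then have "fn (x * y) i \<le> A * B" for i
    using fn_mult[of x y i] by (meson fn_nonneg mult_mono order_trans)
  then show ?thesis unfolding bd_def by auto
qed
lemma bd_uminus[intro]: "bd x \<Longrightarrow> bd (- x)" unfolding bd_def by simp
lemma bd_diff[intro]: "bd x \<Longrightarrow> bd y \<Longrightarrow> bd (x - y)" using bd_add[of x "- y"] by auto
lemma bd_star[intro]: "bd x \<Longrightarrow> bd (star x)" unfolding bd_def by simp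
lemma bd_sg[intro]: "bd x \<Longrightarrow> bd (sg x)" unfolding bd_def by simp
lemma bd_sc[intro, simp]: "bd (sc a)" unfolding bd_def by auto
lemma bd_one[intro, simp]: "bd 1" unfolding bd_def by auto
lemma bd_zero[intro, simp]: "bd 0" unfolding bd_def by auto

lemma nl_zero[simp]: "nl 0" by (simp add: nl_def)
lemma nl_add: assumes "nl x" "nl y" shows "nl (x + y)"
  unfolding nl_def
proof (intro allI impI)
  fix e :: real assume e: "e > 0"
  have "\<forall>\<^sub>F i in cofinite. fn x i \<le> e / 2" "\<forall>\<^sub>F i in cofinite. fn y i \<le> e / 2"
    using assms e unfolding nl_def by (meson half_gt_zero)+
  then show "\<forall>\<^sub>F i in cofinite. fn (x + y) i \<le> e"
    by eventually_elim (use fn_add[of x y] in \<open>smt (verit) field_sum_of_halves\<close>)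
qed
lemma nl_uminus: "nl x \<Longrightarrow> nl (- x)" by (simp add: nl_def)
lemma nl_multL: assumes "bd x" "nl y" shows "nl (x * y)"
  unfolding nl_def
proof (intro allI impI)
  fix e :: real assume e: "e > 0"
  obtain B where B: "B > 0" "\<forall>i. fn x i \<le> B" using bd_pos assms(1) by blast
  have "\<forall>\<^sub>F i in cofinite. fn y i \<le> e / B" using assms e B unfolding nl_def by simp
  then show "\<forall>\<^sub>F i in cofinite. fn (x * y) i \<le> e"
  proof eventually_elim
    fix i assume "fn y i \<le> e / B"
    then have "fn x i * fn y i \<le> B * (e / B)" using B by (intro mult_mono) auto
    then show "fn (x * y) i \<le> e" using fn_mult[of x y i] B by simp
  qed
qed
lemma nl_multR: assumes "nl x" "bd y" shows "nl (x * y)"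
proof -
  have "nl (star y * star x)" using assms by (intro nl_multL) (auto simp: nl_def)
  then have "nl (star (star y * star x))" unfolding nl_def by simp
  then show ?thesis by (simp add: star_mult)
qed

section \<open>The quotient algebra and its norm\<close>

definition qrel :: "fam \<Rightarrow> fam \<Rightarrow> bool" where "qrel x y \<longleftrightarrow> bd x \<and> bd y \<and> nl (x - y)"

lemma qrelI: "bd x \<Longrightarrow> x = y \<Longrightarrow> qrel x y"
  by (simp add: qrel_def)

\<comment> \<open>Boundedness is part of the relation: unbounded families are related to nothing,
  which makes the quotient a partial one.\<close>
quotient_type q = fam / partial: qrel
proof (rule part_equivpI)
  show "\<exists>x. qrel x x" by (rule exI[of _ 0]) (simp add: qrel_def)
  show "symp qrel" by (rule sympI) (auto simp: qrel_def dest: nl_uminus)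
  show "transp qrel"
  proof (rule transpI)
    fix x y z assume "qrel x y" "qrel y z"
    then show "qrel x z" using nl_add[of "x - y" "y - z"] by (auto simp: qrel_def)
  qed
qed

text \<open>The limit superior of the fibre norms along the cofinite filter, which is the norm of
  the class in the quotient.\<close>

definition fnl :: "fam \<Rightarrow> real" where "fnl x = Inf {c. \<forall>\<^sub>F i in cofinite. fn x i \<le> c}"

lemma cofinite_idx: "cofinite \<noteq> (bot :: idx filter)"
proof -
  have "inj (Idx False 0)" by (auto simp: inj_def)
  then have "infinite (UNIV :: idx set)"
    using finite_imageD[of "Idx False 0" UNIV] finite_subset[of "range (Idx False 0)" UNIV] by auto
  then show ?thesis by simp
qed

lemma fnl_aux: "(\<forall>\<^sub>F i in cofinite. fn x i \<le> c) \<Longrightarrow> 0 \<le> c"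
proof -
  assume a: "\<forall>\<^sub>F i in cofinite. fn x i \<le> c"
  obtain i where "fn x i \<le> c" using eventually_happens'[OF cofinite_idx a] by blast
  then show "0 \<le> c" using fn_nonneg order_trans by blast
qed

lemma fnl_bdd: "bdd_below {c. \<forall>\<^sub>F i in cofinite. fn x i \<le> c}"
  by (rule bdd_belowI[of _ 0]) (use fnl_aux in auto)

lemma fnl_le: "(\<And>e. e > 0 \<Longrightarrow> \<forall>\<^sub>F i in cofinite. fn x i \<le> c + e) \<Longrightarrow> fnl x \<le> c"
  unfolding fnl_def by (rule field_le_epsilon) (auto intro!: cInf_lower fnl_bdd)

lemma fnl_ne: "bd x \<Longrightarrow> \<exists>c. \<forall>\<^sub>F i in cofinite. fn x i \<le> c"
  unfolding bd_def using always_eventually by blast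

lemma fnl_less: "bd x \<Longrightarrow> fnl x < c \<Longrightarrow> \<forall>\<^sub>F i in cofinite. fn x i \<le> c"
proof -
  assume b: "bd x" and l: "fnl x < c"
  have "{c. \<forall>\<^sub>F i in cofinite. fn x i \<le> c} \<noteq> {}" using fnl_ne[OF b] by auto
  from cInf_lessD[OF this] l obtain d where "\<forall>\<^sub>F i in cofinite. fn x i \<le> d" "d < c" unfolding fnl_def by auto
  then show ?thesis by (auto elim: eventually_mono)
qed

lemma fnl_nonneg: "bd x \<Longrightarrow> 0 \<le> fnl x"
  unfolding fnl_def by (rule cInf_greatest) (use fnl_aux fnl_ne in auto)

lemma fnl_add: assumes "bd x" "bd y" shows "fnl (x + y) \<le> fnl x + fnl y"
proof (rule fnl_le)
  fix e :: real assume e: "e > 0"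
  have "\<forall>\<^sub>F i in cofinite. fn x i \<le> fnl x + e / 2" "\<forall>\<^sub>F i in cofinite. fn y i \<le> fnl y + e / 2"
    using e assms by (auto intro!: fnl_less)
  then show "\<forall>\<^sub>F i in cofinite. fn (x + y) i \<le> fnl x + fnl y + e"
    by eventually_elim (use fn_add[of x y] in \<open>smt (verit) field_sum_of_halves\<close>)
qed

lemma fnl_nl: "bd x \<Longrightarrow> nl x \<longleftrightarrow> fnl x = 0"
proof
  assume b: "bd x" and "nl x"
  then have "fnl x \<le> 0" by (intro fnl_le) (auto simp: nl_def)
  then show "fnl x = 0" using fnl_nonneg[OF b] by simp
next
  assume "bd x" "fnl x = 0"
  then show "nl x" unfolding nl_def using fnl_less[of x] by auto
qed

lemma fnl_mult: assumes "bd x" "bd y" shows "fnl (x * y) \<le> fnl x * fnl y"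
proof (rule field_le_epsilon)
  fix e :: real assume e: "e > 0"
  define M where "M = fnl x + fnl y + 1"
  have M: "M > 0" using fnl_nonneg[OF assms(1)] fnl_nonneg[OF assms(2)] unfolding M_def by simp
  define t where "t = min 1 (e / M)"
  have t: "t > 0" "t \<le> 1" "t * M \<le> e" using e M by (auto simp: t_def min_def field_simps)
  have "\<forall>\<^sub>F i in cofinite. fn x i \<le> fnl x + t" "\<forall>\<^sub>F i in cofinite. fn y i \<le> fnl y + t"
    using t assms by (auto intro!: fnl_less)
  then have "\<forall>\<^sub>F i in cofinite. fn (x * y) i \<le> (fnl x + t) * (fnl y + t)"
  proof eventually_elim
    fix i assume "fn x i \<le> fnl x + t" "fn y i \<le> fnl y + t"
    then have "fn x i * fn y i \<le> (fnl x + t) * (fnl y + t)" using fnl_nonneg[OF assms(1)] t by (intro mult_mono) auto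
    then show "fn (x * y) i \<le> (fnl x + t) * (fnl y + t)" using fn_mult[of x y i] by simp
  qed
  then have "fnl (x * y) \<le> (fnl x + t) * (fnl y + t)" unfolding fnl_def by (intro cInf_lower fnl_bdd) auto
  also have "\<dots> = fnl x * fnl y + t * (fnl x + fnl y + t)" by (simp add: algebra_simps)
  also have "t * (fnl x + fnl y + t) \<le> t * M" unfolding M_def using t by (intro mult_left_mono) auto
  finally show "fnl (x * y) \<le> fnl x * fnl y + e" using t by simp
qed

lemma fnl_star[simp]: "fnl (star x) = fnl x" by (simp add: fnl_def)
lemma fnl_sg[simp]: "fnl (sg x) = fnl x" by (simp add: fnl_def)
lemma fnl_uminus[simp]: "fnl (- x) = fnl x" by (simp add: fnl_def)

lemma fnl_sc: "fnl (sc a) = cmod a"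
proof (rule antisym)
  show "fnl (sc a) \<le> cmod a" by (rule fnl_le) simp
  show "cmod a \<le> fnl (sc a)"
    unfolding fnl_def
    by (rule cInf_greatest) (use cofinite_idx in \<open>auto simp: eventually_const intro: always_eventually\<close>)
qed

lemma fnl_cstar: assumes "bd x" shows "fnl (star x * x) = (fnl x)\<^sup>2"
proof (rule antisym)
  show "fnl (star x * x) \<le> (fnl x)\<^sup>2" using fnl_mult[of "star x" x] assms by (auto simp: power2_eq_square)
  have "fnl x \<le> sqrt (fnl (star x * x))"
  proof (rule fnl_le)
    fix e :: real assume e: "e > 0"
    let ?c = "fnl (star x * x)"
    have c: "?c \<ge> 0" using assms by (intro fnl_nonneg) auto
    have "?c < (sqrt ?c + e)\<^sup>2" using e c by (simp add: power2_sum add_pos_nonneg)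
    then have "\<forall>\<^sub>F i in cofinite. fn (star x * x) i \<le> (sqrt ?c + e)\<^sup>2" using assms by (intro fnl_less) auto
    then show "\<forall>\<^sub>F i in cofinite. fn x i \<le> sqrt ?c + e"
      by eventually_elim (use e c in \<open>auto simp: fn_cstar intro: power2_le_imp_le\<close>)
  qed
  then have "(fnl x)\<^sup>2 \<le> (sqrt (fnl (star x * x)))\<^sup>2" using fnl_nonneg[OF assms] by (rule power_mono)
  then show "(fnl x)\<^sup>2 \<le> fnl (star x * x)" using assms by (subst (asm) real_sqrt_pow2) (auto intro!: fnl_nonneg)
qed

abbreviation qc :: "fam \<Rightarrow> q" where "qc \<equiv> abs_q"

instantiation q :: star_ring
begin
lift_definition zero_q :: q is 0 by (simp add: qrel_def)
lift_definition one_q :: q is 1 by (simp add: qrel_def)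
lift_definition plus_q :: "q \<Rightarrow> q \<Rightarrow> q" is "(+)"
proof -
  fix a b c d assume "qrel a b" "qrel c d"
  moreover have "a + c - (b + d) = (a - b) + (c - d)" by simp
  ultimately show "qrel (a + c) (b + d)" unfolding qrel_def by (metis nl_add bd_add)
qed
lift_definition uminus_q :: "q \<Rightarrow> q" is "uminus"
proof -
  fix a b assume "qrel a b"
  moreover have "- a - - b = - (a - b)" by simp
  ultimately show "qrel (- a) (- b)" unfolding qrel_def by (metis nl_uminus bd_uminus)
qed
lift_definition minus_q :: "q \<Rightarrow> q \<Rightarrow> q" is "(-)"
proof -
  fix a b c d assume "qrel a b" "qrel c d"
  moreover have "a - c - (b - d) = (a - b) + - (c - d)" by simp
  ultimately show "qrel (a - c) (b - d)" unfolding qrel_def by (metis nl_add nl_uminus bd_diff)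
qed
lift_definition times_q :: "q \<Rightarrow> q \<Rightarrow> q" is "(*)"
proof -
  fix a b c d assume "qrel a b" "qrel c d"
  moreover have "a * c - b * d = (a - b) * c + b * (c - d)" by (simp add: algebra_simps)
  ultimately show "qrel (a * c) (b * d)" unfolding qrel_def by (metis nl_add nl_multL nl_multR bd_mult)
qed
lift_definition star_q :: "q \<Rightarrow> q" is star
proof -
  fix a b assume "qrel a b"
  moreover have "nl (star (a - b)) = nl (a - b)" unfolding nl_def by simp
  ultimately show "qrel (star a) (star b)" unfolding qrel_def by (auto simp: star_diff)
qed
lift_definition sg_q :: "q \<Rightarrow> q" is sg
proof -
  fix a b assume "qrel a b"
  moreover have "nl (sg (a - b)) = nl (a - b)" unfolding nl_def by simp
  ultimately show "qrel (sg a) (sg b)" unfolding qrel_def by (auto simp: sg_diff)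
qed
lift_definition sc_q :: "complex \<Rightarrow> q" is sc by (simp add: qrel_def)

instance
proof
  fix x y z :: q and a b :: complex
  note bds = bd_add bd_mult bd_uminus bd_diff bd_star bd_sg
  show "x * y * z = x * (y * z)" by (transfer, rule qrelI) (simp_all add: qrel_def bds mult.assoc)
  show "(x + y) * z = x * z + y * z" by (transfer, rule qrelI) (simp_all add: qrel_def bds distrib_right)
  show "x * (y + z) = x * y + x * z" by (transfer, rule qrelI) (simp_all add: qrel_def bds distrib_left)
  show "1 * x = x" by (transfer, rule qrelI) (simp_all add: qrel_def bds )
  show "x * 1 = x" by (transfer, rule qrelI) (simp_all add: qrel_def bds )
  show "x + y + z = x + (y + z)" by (transfer, rule qrelI) (simp_all add: qrel_def bds add.assoc)
  show "x + y = y + x" by (transfer, rule qrelI) (simp_all add: qrel_def bds add.commute)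
  show "0 + x = x" by (transfer, rule qrelI) (simp_all add: qrel_def bds )
  show "- x + x = 0" by (transfer, rule qrelI) (simp_all add: qrel_def bds )
  show "x - y = x + - y" by (transfer, rule qrelI) (simp_all add: qrel_def bds )
  show "star (x + y) = star x + star y" by (transfer, rule qrelI) (simp_all add: qrel_def bds star_add)
  show "star (x * y) = star y * star x" by (transfer, rule qrelI) (simp_all add: qrel_def bds star_mult)
  show "star (star x) = x" by (transfer, rule qrelI) (simp_all add: qrel_def bds )
  show "sg (x + y) = sg x + sg y" by (transfer, rule qrelI) (simp_all add: qrel_def bds sg_add)
  show "sg (x * y) = sg x * sg y" by (transfer, rule qrelI) (simp_all add: qrel_def bds sg_mult)
  show "sg (sg x) = x" by (transfer, rule qrelI) (simp_all add: qrel_def bds )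
  show "sg (star x) = star (sg x)" by (transfer, rule qrelI) (simp_all add: qrel_def bds sg_star)
  show "sc (a + b) = (sc a + sc b :: q)" by (transfer, rule qrelI) (simp_all add: qrel_def bds sc_add)
  show "sc (a * b) = (sc a * sc b :: q)" by (transfer, rule qrelI) (simp_all add: qrel_def bds sc_mult)
  show "sc 1 = (1 :: q)" by (transfer, rule qrelI) (simp_all add: qrel_def bds )
  show "star (sc a) = (sc (cnj a) :: q)" by (transfer, rule qrelI) (simp_all add: qrel_def bds star_sc)
  show "sg (sc a) = (sc (cnj a) :: q)" by (transfer, rule qrelI) (simp_all add: qrel_def bds sg_sc)
  show "x * sc a = sc a * x" by (transfer, rule qrelI) (simp_all add: qrel_def bds, rule sc_comm)
  show "(0::q) \<noteq> 1"
  proof (transfer)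
    have "\<not> nl (0 - 1)" using fnl_nl[of "0 - 1"] fnl_sc[of 1] by auto
    then show "\<not> qrel 0 1" by (simp add: qrel_def)
  qed
qed
end

instantiation q :: real_normed_algebra_1
begin
lift_definition norm_q :: "q \<Rightarrow> real" is fnl
proof -
  fix a b assume ab: "qrel a b"
  have "fnl a \<le> fnl b" if "bd a" "bd b" "nl (a - b)" for a b
    using fnl_add[of "a - b" b] that fnl_nl[of "a - b"] by auto
  from this[of a b] this[of b a] show "fnl a = fnl b" using ab nl_uminus[of "a - b"] by (auto simp: qrel_def)
qed
definition "scaleR_q r (x::q) = sc (complex_of_real r) * x"
definition "sgn_q (x::q) = scaleR (inverse (norm x)) x"
definition "dist_q (x::q) y = norm (x - y)"
definition "uniformity_q = (INF e\<in>{0<..}. principal {(x, y::q). dist x y < e})"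
definition "open_q (U :: q set) = (\<forall>x\<in>U. eventually (\<lambda>(x', y). x' = x \<longrightarrow> y \<in> U) uniformity)"

instance
proof
  fix x y z :: q and a b :: real
  show "a *\<^sub>R (x + y) = a *\<^sub>R x + a *\<^sub>R y" by (simp add: scaleR_q_def algebra_simps)
  show "(a + b) *\<^sub>R x = a *\<^sub>R x + b *\<^sub>R x" by (simp add: scaleR_q_def algebra_simps sc_add)
  show "a *\<^sub>R b *\<^sub>R x = (a * b) *\<^sub>R x" by (simp add: scaleR_q_def sc_mult mult.assoc)
  show "1 *\<^sub>R x = x" by (simp add: scaleR_q_def)
  show "a *\<^sub>R x * y = a *\<^sub>R (x * y)" by (simp add: scaleR_q_def mult.assoc)
  show "x * a *\<^sub>R y = a *\<^sub>R (x * y)" by (simp add: scaleR_q_def mult.assoc[symmetric] sc_comm)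
  show "norm x = 0 \<longleftrightarrow> x = 0" by transfer (auto simp: qrel_def fnl_nl)
  show "norm (x + y) \<le> norm x + norm y" by transfer (auto simp: qrel_def fnl_add)
  have nm: "norm (x * y) \<le> norm x * norm y" for x y :: q by transfer (auto simp: qrel_def fnl_mult)
  show "norm (x * y) \<le> norm x * norm y" by (rule nm)
  have ns: "norm (sc c :: q) = cmod c" for c by transfer (simp add: fnl_sc)
  show "norm (a *\<^sub>R x) = \<bar>a\<bar> * norm x"
  proof (cases "a = 0")
    case True then show ?thesis using ns[of 0] by (simp add: scaleR_q_def)
  next
    case False
    have le: "norm (a *\<^sub>R x) \<le> \<bar>a\<bar> * norm x" for a :: real and x :: q using nm[of "sc (complex_of_real a)" x] by (simp add: ns scaleR_q_def)
    have "inverse a *\<^sub>R (a *\<^sub>R x) = x" using False by (simp add: scaleR_q_def mult.assoc[symmetric] flip: sc_mult of_real_mult)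
    then have "norm x \<le> \<bar>inverse a\<bar> * norm (a *\<^sub>R x)" using le[of "inverse a" "a *\<^sub>R x"] by simp
    then have "\<bar>a\<bar> * norm x \<le> norm (a *\<^sub>R x)" using False by (simp add: field_simps)
    then show ?thesis using le[of a x] by simp
  qed
  show "norm (1::q) = 1" using ns[of 1] by simp
qed (simp_all add: sgn_q_def dist_q_def uniformity_q_def open_q_def)
end

lemma norm_star[simp]: "norm (star x) = norm x" for x :: q by transfer simp
lemma norm_sg[simp]: "norm (sg x) = norm x" for x :: q by transfer simp
lemma norm_sc[simp]: "norm (sc a :: q) = cmod a" by transfer (simp add: fnl_sc)
lemma norm_cstar: "norm (star x * x) = (norm x)\<^sup>2" for x :: q by transfer (auto simp: qrel_def fnl_cstar)

lemma qrel_refl[simp]: "qrel x x \<longleftrightarrow> bd x" by (simp add: qrel_def)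
lemma qc_eq_iff: "bd x \<Longrightarrow> bd y \<Longrightarrow> qc x = qc y \<longleftrightarrow> nl (x - y)"
  using Quotient3_rel[OF Quotient3_q, of x y] by (simp add: qrel_def)
lemma q_cases: fixes x :: q obtains X where "bd X" "x = qc X"
  by (metis Quotient3_q Quotient3_abs_rep Quotient3_rep_reflp qrel_refl)
lemma qc_add: "bd x \<Longrightarrow> bd y \<Longrightarrow> qc x + qc y = qc (x + y)" by (simp add: plus_q.abs_eq eq_onp_def)
lemma qc_diff: "bd x \<Longrightarrow> bd y \<Longrightarrow> qc x - qc y = qc (x - y)" by (simp add: minus_q.abs_eq eq_onp_def)
lemma qc_mult: "bd x \<Longrightarrow> bd y \<Longrightarrow> qc x * qc y = qc (x * y)" by (simp add: times_q.abs_eq eq_onp_def)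
lemma qc_star: "bd x \<Longrightarrow> star (qc x) = qc (star x)" by (simp add: star_q.abs_eq eq_onp_def)
lemma qc_sg: "bd x \<Longrightarrow> sg (qc x) = qc (sg x)" by (simp add: sg_q.abs_eq eq_onp_def)
lemma qc_sc: "qc (sc a) = sc a" by (simp add: sc_q.abs_eq)
lemma qc_one: "qc 1 = 1" by (simp add: one_q.abs_eq)
lemma qc_zero: "qc 0 = 0" by (simp add: zero_q.abs_eq)
lemma norm_qc: "bd x \<Longrightarrow> norm (qc x) = fnl x" by (simp add: norm_q.abs_eq eq_onp_def)

section \<open>Functional calculus\<close>

definition nrm :: "fam \<Rightarrow> bool" where "nrm N \<longleftrightarrow> star N * N = N * star N"

lemma fam_spectral:
  assumes "nrm N"
  shows "\<exists>P d. star P * P = 1 \<and> P * star P = 1 \<and> N = P * dgf d * star P"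
proof -
  have "fib (star N * N) i = fib (N * star N) i" for i using assms by (simp add: nrm_def)
  then have "\<forall>i. \<exists>P d. P \<in> carrier_mat (dm i) (dm i) \<and> adj P * P = 1\<^sub>m (dm i) \<and> P * adj P = 1\<^sub>m (dm i) \<and>
      fib N i = P * dgm (dm i) d * adj P"
    by (intro allI spectral_theorem) (simp_all add: fibs)
  then obtain P where "\<forall>i. \<exists>d. P i \<in> carrier_mat (dm i) (dm i) \<and> adj (P i) * P i = 1\<^sub>m (dm i) \<and> P i * adj (P i) = 1\<^sub>m (dm i) \<and>
      fib N i = P i * dgm (dm i) d * adj (P i)" by metis
  then obtain d where P: "\<And>i. P i \<in> carrier_mat (dm i) (dm i)" "\<And>i. adj (P i) * P i = 1\<^sub>m (dm i)" "\<And>i. P i * adj (P i) = 1\<^sub>m (dm i)"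
      "\<And>i. fib N i = P i * dgm (dm i) (d i) * adj (P i)" by metis
  have fP: "fib (Fam P) i = P i" for i using P(1) by (subst Fam_inverse) auto
  show ?thesis
    by (intro exI[of _ "Fam P"] exI[of _ d] conjI; rule fam_eqI) (simp_all add: fibs fP P(2,3), rule P(4))
qed

lemma dgf_mult: "dgf d * dgf e = dgf (\<lambda>i k. d i k * e i k)" by (rule fam_eqI) (simp add: fibs dgm_mult)
lemma dgf_add: "dgf d + dgf e = dgf (\<lambda>i k. d i k + e i k)" by (rule fam_eqI) (simp add: fibs dgm_add)
lemma star_dgf: "star (dgf d) = dgf (\<lambda>i k. cnj (d i k))" by (rule fam_eqI) (simp add: fibs adj_dgm)
lemma cjf_dgf: "cjf (dgf d) = dgf (\<lambda>i k. cnj (d i k))"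
  by (rule fam_eqI) (auto simp: fibs cjm_def dgm_def intro!: eq_matI)
lemma dgf_const: "dgf (\<lambda>i k. c) = sc c"
  by (rule fam_eqI) (auto simp: fibs dgm_def intro!: eq_matI)
lemma dgf_eqD: "dgf d = dgf e \<Longrightarrow> k < dm i \<Longrightarrow> d i k = e i k"
proof -
  assume a: "dgf d = dgf e" "k < dm i"
  have "fib (dgf d) i $$ (k,k) = fib (dgf e) i $$ (k,k)" using a by simp
  then show ?thesis using a(2) by (simp add: fibs dgm_def)
qed
lemma dgf_cong: "(\<And>i k. k < dm i \<Longrightarrow> d i k = e i k) \<Longrightarrow> dgf d = dgf e"
  by (rule fam_eqI) (auto simp: fibs dgm_def intro!: eq_matI)

lemma mult_dgm_index:
  assumes A: "A \<in> carrier_mat n n" and jk: "j < n" "k < n"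
  shows "(A * dgm n d) $$ (j,k) = A $$ (j,k) * d k" "(dgm n d * A) $$ (j,k) = d j * A $$ (j,k)"
proof -
  have "(A * dgm n d) $$ (j,k) = (\<Sum>l\<in>{0..<n}. A $$ (j,l) * (if l = k then d l else 0))"
    using A jk by (auto simp: dgm_def scalar_prod_def intro!: sum.cong)
  also have "\<dots> = (\<Sum>l\<in>{0..<n}. if l = k then A $$ (j,k) * d k else 0)" by (rule sum.cong) auto
  finally show "(A * dgm n d) $$ (j,k) = A $$ (j,k) * d k" using jk by simp
  have "(dgm n d * A) $$ (j,k) = (\<Sum>l\<in>{0..<n}. (if j = l then d j else 0) * A $$ (l,k))"
    using A jk by (auto simp: dgm_def scalar_prod_def intro!: sum.cong)
  also have "\<dots> = (\<Sum>l\<in>{0..<n}. if j = l then d j * A $$ (j,k) else 0)" by (rule sum.cong) auto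
  finally show "(dgm n d * A) $$ (j,k) = d j * A $$ (j,k)" using jk by simp
qed

text \<open>Entrywise, the assumption says that the entry \<open>(j, k)\<close> of \<open>Y\<close>
  vanishes unless the eigenvalues \<open>d i k\<close> and \<open>e i j\<close> agree. Hence
  \<open>f\<close> may be any function, without continuity.\<close>

lemma dgf_intertwine:
  assumes "Y * dgf d = dgf e * Y"
  shows "Y * dgf (\<lambda>i k. f (d i k)) = dgf (\<lambda>i k. f (e i k)) * Y"
proof (rule fam_eqI)
  fix i
  let ?n = "dm i"
  have c: "fib Y i \<in> carrier_mat ?n ?n" by simp
  have "fib (Y * dgf d) i = fib (dgf e * Y) i" using assms by simp
  then have eq: "fib Y i * dgm ?n (d i) = dgm ?n (e i) * fib Y i" by (simp add: fibs)
  have "fib Y i * dgm ?n (\<lambda>k. f (d i k)) = dgm ?n (\<lambda>k. f (e i k)) * fib Y i"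
  proof (rule eq_matI)
    fix j k assume "j < dim_row (dgm ?n (\<lambda>k. f (e i k)) * fib Y i)" "k < dim_col (dgm ?n (\<lambda>k. f (e i k)) * fib Y i)"
    then have jk: "j < ?n" "k < ?n" by simp_all
    have "fib Y i $$ (j,k) * d i k = e i j * fib Y i $$ (j,k)"
      using arg_cong[OF eq, of "\<lambda>M. M $$ (j,k)"] unfolding mult_dgm_index[OF c jk] .
    then have "fib Y i $$ (j,k) = 0 \<or> d i k = e i j" by (simp add: mult.commute)
    then show "(fib Y i * dgm ?n (\<lambda>k. f (d i k))) $$ (j,k) = (dgm ?n (\<lambda>k. f (e i k)) * fib Y i) $$ (j,k)"
      unfolding mult_dgm_index[OF c jk] by auto
  qed simp_all
  then show "fib (Y * dgf (\<lambda>i k. f (d i k))) i = fib (dgf (\<lambda>i k. f (e i k)) * Y) i" by (simp add: fibs)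
qed

section \<open>The Borel calculus of a normal family and its spectrum\<close>

definition is_dec :: "fam \<Rightarrow> fam \<Rightarrow> (idx \<Rightarrow> nat \<Rightarrow> complex) \<Rightarrow> bool" where
  "is_dec N P d \<longleftrightarrow> star P * P = 1 \<and> P * star P = 1 \<and> N = P * dgf d * star P"

text \<open>A diagonalisation is fixed by choice; \<open>fc_dec\<close> shows that the resulting
  calculus does not depend on it.\<close>

definition fcP :: "fam \<Rightarrow> fam" where "fcP N = (SOME P. \<exists>d. is_dec N P d)"
definition fcd :: "fam \<Rightarrow> idx \<Rightarrow> nat \<Rightarrow> complex" where "fcd N = (SOME d. is_dec N (fcP N) d)"
definition fc :: "fam \<Rightarrow> (complex \<Rightarrow> complex) \<Rightarrow> fam" where
  "fc N f = fcP N * dgf (\<lambda>i k. f (fcd N i k)) * star (fcP N)"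
definition sp :: "fam \<Rightarrow> complex set" where "sp N = {fcd N i k |i k. k < dm i}"

lemma is_dec_fc: "nrm N \<Longrightarrow> is_dec N (fcP N) (fcd N)"
proof -
  assume "nrm N"
  then have "\<exists>P d. is_dec N P d" using fam_spectral unfolding is_dec_def by blast
  then have "\<exists>d. is_dec N (fcP N) d" unfolding fcP_def by (rule someI_ex)
  then show ?thesis unfolding fcd_def by (rule someI_ex)
qed

lemma is_dec_nrm: "is_dec N P d \<Longrightarrow> nrm N"
proof -
  assume a: "is_dec N P d"
  then have u: "star P * P = 1" and N: "N = P * dgf d * star P" by (auto simp: is_dec_def)
  have u': "star P * (P * x) = x" for x using u by (metis mult.assoc mult_1)
  show "nrm N" unfolding nrm_def N by (simp add: star_mult mult.assoc u' star_dgf) (simp add: mult.assoc[symmetric] dgf_mult mult.commute)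
qed

lemma dec_intertwine:
  assumes a: "is_dec N P d" "is_dec N' P' d'" and X: "X * N = N' * X"
  shows "X * (P * dgf (\<lambda>i k. f (d i k)) * star P) = (P' * dgf (\<lambda>i k. f (d' i k)) * star P') * X"
proof -
  have u: "star P * P = 1" "P * star P = 1" "N = P * dgf d * star P"
    "star P' * P' = 1" "P' * star P' = 1" "N' = P' * dgf d' * star P'" using a by (auto simp: is_dec_def)
  have u': "star P * (P * x) = x" "P * (star P * x) = x" "star P' * (P' * x) = x" "P' * (star P' * x) = x" for x
    using u by (metis mult.assoc mult_1)+
  define Y where "Y = star P' * X * P"
  have "Y * dgf d = star P' * (X * N) * P" unfolding Y_def u(3) by (simp add: mult.assoc u(1))
  also have "\<dots> = dgf d' * Y" unfolding X Y_def u(6) by (simp add: mult.assoc u')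
  finally have "Y * dgf (\<lambda>i k. f (d i k)) = dgf (\<lambda>i k. f (d' i k)) * Y" by (rule dgf_intertwine)
  then have "P' * (Y * dgf (\<lambda>i k. f (d i k))) * star P = P' * (dgf (\<lambda>i k. f (d' i k)) * Y) * star P" by simp
  then show ?thesis unfolding Y_def by (simp add: mult.assoc u' u)
qed

lemma fc_dec: "is_dec N P d \<Longrightarrow> fc N f = P * dgf (\<lambda>i k. f (d i k)) * star P"
  using dec_intertwine[OF is_dec_fc, of N N P d 1 f] is_dec_nrm[of N P d] by (simp add: fc_def)

lemma fc_intertwine: "nrm N \<Longrightarrow> nrm N' \<Longrightarrow> X * N = N' * X \<Longrightarrow> X * fc N f = fc N' f * X"
  unfolding fc_def by (rule dec_intertwine[OF is_dec_fc is_dec_fc])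

lemma fcP_simps:
  assumes "nrm N"
  shows "star (fcP N) * fcP N = 1" "fcP N * star (fcP N) = 1" "fcP N * dgf (fcd N) * star (fcP N) = N"
    "star (fcP N) * (fcP N * x) = x"
proof -
  show *: "star (fcP N) * fcP N = 1" "fcP N * star (fcP N) = 1" "fcP N * dgf (fcd N) * star (fcP N) = N"
    using is_dec_fc[OF assms] by (auto simp: is_dec_def)
  then show "star (fcP N) * (fcP N * x) = x" by (metis mult.assoc mult_1)
qed

lemma fc_id: "nrm N \<Longrightarrow> fc N (\<lambda>z. z) = N" by (simp add: fc_def fcP_simps)
lemma fc_const: "nrm N \<Longrightarrow> fc N (\<lambda>z. c) = sc c"
  by (simp add: fc_def dgf_const sc_comm mult.assoc fcP_simps)
lemma fc_add: "nrm N \<Longrightarrow> fc N (\<lambda>z. f z + g z) = fc N f + fc N g"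
  by (simp add: fc_def dgf_add[symmetric] algebra_simps)
lemma fc_mult: "nrm N \<Longrightarrow> fc N (\<lambda>z. f z * g z) = fc N f * fc N g"
  by (simp add: fc_def dgf_mult[symmetric] mult.assoc fcP_simps)
lemma star_fc: "star (fc N f) = fc N (\<lambda>z. cnj (f z))"
  by (simp add: fc_def star_mult star_dgf mult.assoc)
lemma fc_cong: "(\<And>z. z \<in> sp N \<Longrightarrow> f z = g z) \<Longrightarrow> fc N f = fc N g"
  unfolding fc_def by (subst dgf_cong[of "\<lambda>i k. f (fcd N i k)" "\<lambda>i k. g (fcd N i k)"]) (auto simp: sp_def)

lemma fn_unitary: "star P * P = 1 \<Longrightarrow> fn P i = 1"
proof -
  assume "star P * P = 1"
  then have "(fn P i)\<^sup>2 = 1" using fn_cstar[of P i] by simp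
  then show ?thesis using fn_nonneg[of P i] by (simp add: power2_eq_1_iff)
qed

lemma fn_mult_unitary:
  assumes "star P * P = 1" "P * star P = 1"
  shows "fn (P * X * star P) i \<le> fn X i" "fn (star P * X * P) i \<le> fn X i"
proof -
  have "fn P i = 1" using fn_unitary assms by auto
  then show "fn (P * X * star P) i \<le> fn X i" "fn (star P * X * P) i \<le> fn X i"
    using fn_mult[of "P * X" "star P" i] fn_mult[of P X i] fn_mult[of "star P * X" P i] fn_mult[of "star P" X i] by auto
qed

lemma fn_fc: "nrm N \<Longrightarrow> (\<And>z. z \<in> sp N \<Longrightarrow> cmod (f z) \<le> c) \<Longrightarrow> 0 \<le> c \<Longrightarrow> fn (fc N f) i \<le> c"
  unfolding fc_def
  by (rule order_trans[OF fn_mult_unitary(1)[OF fcP_simps(1,2)] fn_dgf]) (auto simp: sp_def)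

lemma fn_dgf_ge: "k < dm i \<Longrightarrow> cmod (d i k) \<le> fn (dgf d) i"
proof -
  assume k: "k < dm i"
  let ?n = "dm i" let ?D = "dgm ?n (d i)"
  have e: "col (?D * 1\<^sub>m ?n) k = ?D *\<^sub>v col (1\<^sub>m ?n) k" using k by (intro col_mult2[of _ ?n ?n]) auto
  have "cmod (?D $$ (k,k)) \<le> l2_norm_vec (col ?D k)"
    unfolding l2_norm_vec_def using member_le_L2_set[of "{..<?n}" k "\<lambda>i. cmod (col ?D k $ i)"] k by auto
  also have "col ?D k = ?D *\<^sub>v unit_vec ?n k" using e k by (simp add: col_one)
  also have "l2_norm_vec \<dots> \<le> op_norm ?D * l2_norm_vec (unit_vec ?n k)" by (rule op_norm_ge) simp
  also have "l2_norm_vec (unit_vec ?n k :: complex vec) = sqrt (\<Sum>j<?n. if j = k then 1 else 0)"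
    unfolding l2_norm_vec_def L2_set_def using k by (intro arg_cong[of _ _ sqrt] sum.cong) auto
  finally show ?thesis using k by (simp add: fn_def fibs dgm_def)
qed

lemma sp_bound: "nrm N \<Longrightarrow> bd N \<Longrightarrow> \<exists>K>0. \<forall>z\<in>sp N. cmod z \<le> K"
proof -
  assume n: "nrm N" and "bd N"
  then obtain K where K: "K > 0" "\<forall>i. fn N i \<le> K" using bd_pos by blast
  have "dgf (fcd N) = star (fcP N) * (fcP N * dgf (fcd N) * star (fcP N)) * fcP N"
    using n by (simp add: mult.assoc fcP_simps)
  also have "\<dots> = star (fcP N) * N * fcP N" using n by (simp add: fcP_simps)
  finally have "fn (dgf (fcd N)) i \<le> fn N i" for i using fn_mult_unitary(2)[OF fcP_simps(1,2)[OF n]] by metis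
  then have "cmod (fcd N i k) \<le> K" if "k < dm i" for i k
    using fn_dgf_ge[OF that, of "fcd N"] K by (meson order_trans)
  then show ?thesis using K(1) unfolding sp_def by auto
qed

text \<open>\<open>sg\<close> turns a diagonalisation of \<open>N\<close> into one of
  \<open>sg N\<close> with conjugated eigenvalues. One conjugation undoes this in the argument of
  \<open>f\<close>, the other is the antilinearity of \<open>sg\<close>.\<close>

lemma sg_fc: "nrm N \<Longrightarrow> sg (fc N f) = fc (sg N) (\<lambda>z. cnj (f (cnj z)))"
proof -
  assume n: "nrm N"
  have JJ: "star Jf * Jf = 1" "Jf * star Jf = 1" by (rule fam_eqI, simp add: fibs Jm_unitary)+
  have cm: "cjf (x * y) = cjf x * cjf y" for x y
    apply (rule fam_eqI) subgoal for i by (simp add: fibs cjm_mult[of _ "dm i" "dm i" _ "dm i"]) done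
  have cs: "cjf (star x) = star (cjf x)" for x by (rule fam_eqI) (simp add: fibs cjm_adj)
  have c1: "cjf 1 = 1" by (rule fam_eqI) (simp add: fibs)
  let ?P = "fcP N" let ?R = "Jf * cjf ?P"
  have JJ': "star Jf * (Jf * x) = x" for x using JJ by (metis mult.assoc mult_1)
  have PP: "star (cjf ?P) * cjf ?P = 1" "cjf ?P * star (cjf ?P) = 1"
    using fcP_simps(1,2)[OF n] by (metis cm cs c1)+
  have PP': "cjf ?P * (star (cjf ?P) * x) = x" for x using PP by (metis mult.assoc mult_1)
  have s: "sg (?P * dgf d * star ?P) = ?R * dgf (\<lambda>i k. cnj (d i k)) * star ?R" for d
    by (simp add: sg_fam_eq cm cs cjf_dgf star_mult mult.assoc)
  have "sg N = ?R * dgf (\<lambda>i k. cnj (fcd N i k)) * star ?R"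
    using s[of "fcd N"] fcP_simps(3)[OF n] by simp
  then have "is_dec (sg N) ?R (\<lambda>i k. cnj (fcd N i k))"
    by (simp add: is_dec_def star_mult mult.assoc JJ JJ' PP PP')
  from fc_dec[OF this, of "\<lambda>z. cnj (f (cnj z))"] show ?thesis unfolding fc_def[of N] s by simp
qed

lemma fc_fc:
  assumes "nrm N"
  shows "nrm (fc N g)" "fc (fc N g) h = fc N (\<lambda>z. h (g z))"
proof -
  have d: "is_dec (fc N g) (fcP N) (\<lambda>i k. g (fcd N i k))"
    using fcP_simps[OF assms] by (simp add: is_dec_def fc_def)
  show "nrm (fc N g)" using is_dec_nrm[OF d] .
  show "fc (fc N g) h = fc N (\<lambda>z. h (g z))" unfolding fc_dec[OF d] by (simp add: fc_def)
qed

lemma fc_eq_iff: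
  assumes "nrm N"
  shows "fc N f = fc N g \<longleftrightarrow> (\<forall>z\<in>sp N. f z = g z)"
proof
  assume "fc N f = fc N g"
  then have "star (fcP N) * fc N f * fcP N = star (fcP N) * fc N g * fcP N" by simp
  then have "dgf (\<lambda>i k. f (fcd N i k)) = dgf (\<lambda>i k. g (fcd N i k))"
    using fcP_simps[OF assms] by (simp add: fc_def mult.assoc)
  then show "\<forall>z\<in>sp N. f z = g z" using dgf_eqD by (fastforce simp: sp_def)
qed (use fc_cong in blast)

lemma sp_fc: "nrm N \<Longrightarrow> sp (fc N g) \<subseteq> g ` sp N"
proof
  fix z assume n: "nrm N" and z: "z \<in> sp (fc N g)"
  \<comment> \<open>Tested with the indicator of the complement of the image.\<close>
  let ?h = "\<lambda>w. if w \<in> g ` sp N then 0 else (1::complex)"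
  have "fc (fc N g) ?h = fc N (\<lambda>z. 0)" unfolding fc_fc[OF n] by (rule fc_cong) auto
  also have "\<dots> = fc (fc N g) (\<lambda>z. 0)" by (simp add: fc_const n fc_fc(1))
  finally have "?h z = 0" using z fc_eq_iff[OF fc_fc(1)[OF n], of g ?h "\<lambda>z. 0"] by simp
  then show "z \<in> g ` sp N" by (auto split: if_splits)
qed

lemma sp_selfadj: "star N = N \<Longrightarrow> sp N \<subseteq> \<real>"
proof
  fix z assume s: "star N = N" and z: "z \<in> sp N"
  then have n: "nrm N" by (simp add: nrm_def)
  have "fc N cnj = fc N (\<lambda>z. z)" using star_fc[of N "\<lambda>z. z"] s n by (simp add: fc_id)
  then have "cnj z = z" using z fc_eq_iff[OF n, of cnj "\<lambda>z. z"] by simp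
  then show "z \<in> \<real>" using Reals_cnj_iff by blast
qed

lemma sp_unitary: "star N * N = 1 \<Longrightarrow> nrm N \<Longrightarrow> sp N \<subseteq> sphere 0 1"
proof
  fix z assume s: "star N * N = 1" and n: "nrm N" and z: "z \<in> sp N"
  have "fc N (\<lambda>z. cnj z * z) = fc N (\<lambda>z. 1)"
    using star_fc[of N "\<lambda>z. z"] s n by (simp add: fc_id fc_mult fc_const)
  then have "cnj z * z = 1" using z fc_eq_iff[OF n, of "\<lambda>z. cnj z * z" "\<lambda>z. 1"] by simp
  then have "complex_of_real ((cmod z)\<^sup>2) = 1" by (simp add: complex_norm_square mult.commute del: of_real_power)
  then have "(cmod z)\<^sup>2 = 1" by (simp only: of_real_eq_1_iff)
  then show "z \<in> sphere 0 1" using norm_ge_zero[of z] by (auto simp: dist_norm power2_eq_1_iff simp del: norm_ge_zero)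
qed

text \<open>An eigenvalue of \<open>star Z * Z\<close> is the squared length of the image of its
  eigenvector under \<open>Z\<close>. Beyond positivity, this form shows when an eigenvalue is 0,
  which \<open>sp_injective_psd\<close> exploits.\<close>

lemma sp_psd_aux:
  assumes "k < dm i"
  shows "fcd (star Z * Z) i k = complex_of_real (\<Sum>j<dm i. (cmod (fib (Z * fcP (star Z * Z)) i $$ (j,k)))\<^sup>2)"
proof -
  let ?N = "star Z * Z"
  have n: "nrm ?N" by (simp add: nrm_def star_mult)
  let ?Y = "Z * fcP ?N"
  have "dgf (fcd ?N) = star (fcP ?N) * (fcP ?N * dgf (fcd ?N) * star (fcP ?N)) * fcP ?N"
    using n by (simp add: mult.assoc fcP_simps)
  also have "\<dots> = star ?Y * ?Y" unfolding fcP_simps(3)[OF n] by (simp add: star_mult mult.assoc)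
  finally have "fib (dgf (fcd ?N)) i $$ (k,k) = fib (star ?Y * ?Y) i $$ (k,k)" by simp
  then have "fcd ?N i k = (adj (fib ?Y i) * fib ?Y i) $$ (k,k)" using assms by (simp add: fibs dgm_def)
  also have "\<dots> = (\<Sum>j<dm i. complex_of_real ((cmod (fib ?Y i $$ (j,k)))\<^sup>2))"
    using assms by (auto simp: scalar_prod_def adj_def atLeast0LessThan complex_norm_square mult.commute
        simp del: of_real_power times_fam.rep_eq intro!: sum.cong)
  finally show ?thesis by simp
qed

section \<open>The Borel calculus in the quotient\<close>

definition NN :: "complex set" where "NN = {z. Im z = 0 \<and> 0 \<le> Re z}"

lemma sp_psd: "sp (star Z * Z) \<subseteq> NN"
  unfolding sp_def NN_def using sp_psd_aux by (auto intro!: sum_nonneg)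

text \<open>The growth condition under which \<open>fc N f\<close> is bounded for bounded
  \<open>N\<close>. It admits indicators, which continuity would exclude.\<close>

definition lb :: "complex set \<Rightarrow> (complex \<Rightarrow> complex) \<Rightarrow> bool" where
  "lb S f \<longleftrightarrow> (\<forall>K. \<exists>B. \<forall>z\<in>S. cmod z \<le> K \<longrightarrow> cmod (f z) \<le> B)"

lemma lb_bounded: "(\<And>z. z \<in> S \<Longrightarrow> cmod (f z) \<le> B) \<Longrightarrow> lb S f" unfolding lb_def by blast
lemma lb_const[intro, simp]: "lb S (\<lambda>z. c)" unfolding lb_def by blast
lemma lb_id[intro, simp]: "lb S (\<lambda>z. z)" unfolding lb_def by blast
lemma lb_cnj[intro]: "lb S f \<Longrightarrow> lb S (\<lambda>z. cnj (f z))" unfolding lb_def by simp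
lemma lb_add[intro]: "lb S f \<Longrightarrow> lb S g \<Longrightarrow> lb S (\<lambda>z. f z + g z)"
  unfolding lb_def
proof
  fix K assume "\<forall>K. \<exists>B. \<forall>z\<in>S. cmod z \<le> K \<longrightarrow> cmod (f z) \<le> B" "\<forall>K. \<exists>B. \<forall>z\<in>S. cmod z \<le> K \<longrightarrow> cmod (g z) \<le> B"
  then obtain A B where "\<forall>z\<in>S. cmod z \<le> K \<longrightarrow> cmod (f z) \<le> A" "\<forall>z\<in>S. cmod z \<le> K \<longrightarrow> cmod (g z) \<le> B" by meson
  then have "\<forall>z\<in>S. cmod z \<le> K \<longrightarrow> cmod (f z + g z) \<le> A + B"
    by (meson add_mono norm_triangle_ineq order_trans)
  then show "\<exists>B. \<forall>z\<in>S. cmod z \<le> K \<longrightarrow> cmod (f z + g z) \<le> B" by blast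
qed
lemma lb_mult[intro]: "lb S f \<Longrightarrow> lb S g \<Longrightarrow> lb S (\<lambda>z. f z * g z)"
  unfolding lb_def
proof
  fix K assume "\<forall>K. \<exists>B. \<forall>z\<in>S. cmod z \<le> K \<longrightarrow> cmod (f z) \<le> B" "\<forall>K. \<exists>B. \<forall>z\<in>S. cmod z \<le> K \<longrightarrow> cmod (g z) \<le> B"
  then obtain A B where AB: "\<forall>z\<in>S. cmod z \<le> K \<longrightarrow> cmod (f z) \<le> A" "\<forall>z\<in>S. cmod z \<le> K \<longrightarrow> cmod (g z) \<le> B" by meson
  have "cmod (f z * g z) \<le> A * B" if "z \<in> S" "cmod z \<le> K" for z
    unfolding norm_mult using AB that by (intro mult_mono) (auto intro: order_trans[OF norm_ge_zero])
  then show "\<exists>B. \<forall>z\<in>S. cmod z \<le> K \<longrightarrow> cmod (f z * g z) \<le> B" by blast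
qed
lemma lb_uminus[intro]: "lb S f \<Longrightarrow> lb S (\<lambda>z. - f z)" unfolding lb_def by simp
lemma lb_diff[intro]: "lb S f \<Longrightarrow> lb S g \<Longrightarrow> lb S (\<lambda>z. f z - g z)"
  using lb_add[of S f "\<lambda>z. - g z"] lb_uminus[of S g] by simp
lemma lb_continuous: "closed S \<Longrightarrow> continuous_on S f \<Longrightarrow> lb S f"
  unfolding lb_def
proof
  fix K assume S: "closed S" and f: "continuous_on S f"
  have "compact (S \<inter> cball 0 K)" using S by (simp add: closed_Int_compact)
  then have "compact (f ` (S \<inter> cball 0 K))"
    by (rule compact_continuous_image[OF continuous_on_subset[OF f Int_lower1]])
  then have "bounded (f ` (S \<inter> cball 0 K))" by (rule compact_imp_bounded)
  then obtain B where "\<forall>w\<in>f ` (S \<inter> cball 0 K). cmod w \<le> B" unfolding bounded_iff by blast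
  then show "\<exists>B. \<forall>z\<in>S. cmod z \<le> K \<longrightarrow> cmod (f z) \<le> B" by (intro exI[of _ B]) auto
qed

text \<open>A Borel functional calculus for \<open>a :: q\<close> comes from a lift of \<open>a\<close> to a family of normal matrices; only its
  restriction to continuous functions is independent of the lift.\<close>

definition calc :: "complex set \<Rightarrow> q \<Rightarrow> ((complex \<Rightarrow> complex) \<Rightarrow> q) \<Rightarrow> bool" where
  "calc S a \<phi> \<longleftrightarrow> (\<exists>N. bd N \<and> nrm N \<and> sp N \<subseteq> S \<and> a = qc N \<and> \<phi> = (\<lambda>f. qc (fc N f)))"

lemma bd_fc: "bd N \<Longrightarrow> nrm N \<Longrightarrow> sp N \<subseteq> S \<Longrightarrow> lb S f \<Longrightarrow> bd (fc N f)"
proof -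
  assume a: "bd N" "nrm N" "sp N \<subseteq> S" "lb S f"
  obtain K where K: "\<forall>z\<in>sp N. cmod z \<le> K" using sp_bound a by blast
  obtain B where "\<forall>z\<in>S. cmod z \<le> K \<longrightarrow> cmod (f z) \<le> B" using a(4) unfolding lb_def by blast
  then have "cmod (f z) \<le> max B 0" if "z \<in> sp N" for z using K a(3) that by fastforce
  then have "fn (fc N f) i \<le> max B 0" for i by (intro fn_fc a) auto
  then show ?thesis unfolding bd_def by blast
qed

context
  fixes S a \<phi> assumes c: "calc S a \<phi>"
begin

lemma calc_id: "\<phi> (\<lambda>z. z) = a" using c by (auto simp: calc_def fc_id)
lemma calc_const: "\<phi> (\<lambda>z. w) = sc w" using c by (auto simp: calc_def fc_const qc_sc)
lemma calc_one: "\<phi> (\<lambda>z. 1) = 1" using calc_const[of 1] by simp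
lemma calc_zero: "\<phi> (\<lambda>z. 0) = 0" using calc_const[of 0] by simp
lemma calc_add: "lb S f \<Longrightarrow> lb S g \<Longrightarrow> \<phi> (\<lambda>z. f z + g z) = \<phi> f + \<phi> g"
  using c by (auto simp: calc_def fc_add qc_add bd_fc)
lemma calc_mult: "lb S f \<Longrightarrow> lb S g \<Longrightarrow> \<phi> (\<lambda>z. f z * g z) = \<phi> f * \<phi> g"
  using c by (auto simp: calc_def fc_mult qc_mult bd_fc)
lemma calc_star: "lb S f \<Longrightarrow> star (\<phi> f) = \<phi> (\<lambda>z. cnj (f z))"
  using c by (auto simp: calc_def star_fc qc_star bd_fc)
lemma calc_cong: "(\<And>z. z \<in> S \<Longrightarrow> f z = g z) \<Longrightarrow> \<phi> f = \<phi> g"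
  using c fc_cong unfolding calc_def by (metis subsetD)
lemma calc_zero': "(\<And>z. z \<in> S \<Longrightarrow> f z = 0) \<Longrightarrow> \<phi> f = 0"
  using calc_cong[of f "\<lambda>z. 0"] calc_zero by simp
lemma calc_uminus: "lb S f \<Longrightarrow> \<phi> (\<lambda>z. - f z) = - \<phi> f"
  using calc_mult[of "\<lambda>z. -1" f] calc_const[of "-1"] by (simp add: sc_uminus)
lemma calc_diff: "lb S f \<Longrightarrow> lb S g \<Longrightarrow> \<phi> (\<lambda>z. f z - g z) = \<phi> f - \<phi> g"
  using calc_add[of f "\<lambda>z. - g z"] calc_uminus[of g] by (simp add: lb_uminus)
lemma calc_scale: "lb S f \<Longrightarrow> \<phi> (\<lambda>z. w * f z) = sc w * \<phi> f"
  using calc_mult[of "\<lambda>z. w" f] calc_const[of w] by simp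

lemma calc_norm: "(\<And>z. z \<in> S \<Longrightarrow> cmod (f z) \<le> B) \<Longrightarrow> 0 \<le> B \<Longrightarrow> norm (\<phi> f) \<le> B"
proof -
  assume B: "\<And>z. z \<in> S \<Longrightarrow> cmod (f z) \<le> B" "0 \<le> B"
  obtain N where N: "bd N" "nrm N" "sp N \<subseteq> S" "\<phi> f = qc (fc N f)" using c by (auto simp: calc_def)
  have "fn (fc N f) i \<le> B" for i by (rule fn_fc) (use N B in auto)
  then have "fnl (fc N f) \<le> B"
    by (intro fnl_le always_eventually allI) (meson add_increasing2 less_imp_le order_trans)
  moreover have "lb S f" by (rule lb_bounded) (rule B)
  ultimately show ?thesis using N B bd_fc[of N S f] by (simp add: norm_qc)
qed

text \<open>A lift is bounded, so only the values of \<open>f\<close> on a bounded part of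
  \<open>S\<close> count. This supplies the compactness that Stone-Weierstrass needs.\<close>

lemma calc_radius: "\<exists>K. \<forall>f B. (\<forall>z\<in>S. cmod z \<le> K \<longrightarrow> cmod (f z) \<le> B) \<longrightarrow> 0 \<le> B \<longrightarrow> norm (\<phi> f) \<le> B"
proof -
  obtain N where N: "bd N" "nrm N" "sp N \<subseteq> S" "a = qc N" "\<phi> = (\<lambda>f. qc (fc N f))" using c by (auto simp: calc_def)
  obtain K where K: "\<forall>z\<in>sp N. cmod z \<le> K" using sp_bound N by blast
  have "norm (\<phi> f) \<le> B" if B: "\<forall>z\<in>S. cmod z \<le> K \<longrightarrow> cmod (f z) \<le> B" "0 \<le> B" for f B
  proof -
    have fb: "fn (fc N f) i \<le> B" for i by (rule fn_fc) (use N B K in auto)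
    then have "fnl (fc N f) \<le> B"
      by (intro fnl_le always_eventually allI) (meson add_increasing2 less_imp_le order_trans)
    moreover have "bd (fc N f)" using fb unfolding bd_def by blast
    ultimately show ?thesis using N(5) by (simp add: norm_qc)
  qed
  then show ?thesis by blast
qed

lemma calc_comp:
  assumes "lb S g" "g ` S \<subseteq> S'"
  shows "calc S' (\<phi> g) (\<lambda>h. \<phi> (\<lambda>z. h (g z)))"
proof -
  obtain N where N: "bd N" "nrm N" "sp N \<subseteq> S" "\<phi> = (\<lambda>f. qc (fc N f))" using c by (auto simp: calc_def)
  have "sp (fc N g) \<subseteq> S'" using sp_fc[OF N(2), of g] N(3) assms(2) by blast
  then show ?thesis unfolding calc_def
    by (intro exI[of _ "fc N g"]) (use N assms bd_fc[OF N(1,2,3)] fc_fc[OF N(2)] in auto)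
qed

end

text \<open>Turns the linear generators of real polynomial functions into combinations of
  \<open>z\<close> and \<open>cnj z\<close>, on which a calculus is known.\<close>

lemma real_linear_complex:
  assumes "bounded_linear (g :: complex \<Rightarrow> real)"
  shows "\<exists>\<alpha> \<beta>. \<forall>z. complex_of_real (g z) = \<alpha> * z + \<beta> * cnj z"
proof -
  interpret bounded_linear g by fact
  define \<alpha> \<beta> where "\<alpha> = (g 1 - \<i> * g \<i>) / 2" and "\<beta> = (g 1 + \<i> * g \<i>) / 2"
  have "complex_of_real (g z) = \<alpha> * z + \<beta> * cnj z" for z
  proof -
    have "z = Re z *\<^sub>R 1 + Im z *\<^sub>R \<i>" by (simp add: complex_eq_iff)
    then have "g z = Re z * g 1 + Im z * g \<i>" by (metis add scaleR real_scaleR_def)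
    then show ?thesis unfolding \<alpha>_def \<beta>_def by (simp add: complex_eq_iff field_simps)
  qed
  then show ?thesis by blast
qed

lemma real_poly_lb: "real_polynomial_function g \<Longrightarrow> lb S (\<lambda>z. complex_of_real (g z))"
proof -
  assume "real_polynomial_function g"
  then have "continuous_on UNIV (\<lambda>z. complex_of_real (g z))"
    by (intro continuous_intros continuous_real_polymonial_function continuous_at_imp_continuous_on ballI)
  then have "lb UNIV (\<lambda>z. complex_of_real (g z))" by (rule lb_continuous[OF closed_UNIV])
  then show ?thesis unfolding lb_def by blast
qed

text \<open>The relation holds for \<open>z\<close> and \<open>cnj z\<close> by assumption, hence
  for polynomials in both, and passes to continuous functions by uniform approximation on a bounded
  part of \<open>S\<close>. This is the main bridge between calculi of different lifts or different
  elements.\<close>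

lemma calc_intertwine:
  assumes c: "calc S a \<phi>" and c': "calc S a' \<phi>'" and S: "closed S" and f: "continuous_on S f"
    and y: "y * a = a' * y" "y * star a = star a' * y"
  shows "y * \<phi> f = \<phi>' f * y"
proof -
  have poly: "y * \<phi> (\<lambda>z. complex_of_real (g z)) = \<phi>' (\<lambda>z. complex_of_real (g z)) * y" if "real_polynomial_function g" for g
    using that
  proof (induction rule: real_polynomial_function.induct)
    case (linear g)
    obtain \<alpha> \<beta> where g: "\<forall>z. complex_of_real (g z) = \<alpha> * z + \<beta> * cnj z" using real_linear_complex[OF linear] by blast
    have e: "\<phi> (\<lambda>z. complex_of_real (g z)) = sc \<alpha> * a + sc \<beta> * star a" if "calc S a \<phi>" for \<phi> a
      using that calc_star[OF that, of "\<lambda>z. z"]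
      by (simp add: g calc_add[OF that] calc_scale[OF that] calc_id[OF that] lb_mult lb_cnj)
    show ?case unfolding e[OF c] e[OF c'] using y
      by (simp add: distrib_left distrib_right mult.assoc) (metis mult.assoc sc_comm)
  next
    case (const r)
    show ?case by (simp add: calc_const[OF c] calc_const[OF c'] sc_comm)
  next
    case (add g h)
    then show ?case by (simp add: calc_add[OF c] calc_add[OF c'] real_poly_lb algebra_simps)
  next
    case (mult g h)
    then show ?case by (simp add: calc_mult[OF c] calc_mult[OF c'] real_poly_lb) (metis mult.assoc)
  qed
  obtain K1 where K1: "\<forall>f B. (\<forall>z\<in>S. cmod z \<le> K1 \<longrightarrow> cmod (f z) \<le> B) \<longrightarrow> 0 \<le> B \<longrightarrow> norm (\<phi> f) \<le> B"
    using calc_radius[OF c] by blast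
  obtain K2 where K2: "\<forall>f B. (\<forall>z\<in>S. cmod z \<le> K2 \<longrightarrow> cmod (f z) \<le> B) \<longrightarrow> 0 \<le> B \<longrightarrow> norm (\<phi>' f) \<le> B"
    using calc_radius[OF c'] by blast
  define K where "K = max K1 K2"
  have fl: "lb S f" by (rule lb_continuous[OF S f])
  have small: "norm (y * \<phi> f - \<phi>' f * y) \<le> 4 * norm y * e" if e: "e > 0" for e
  proof -
    have cS: "compact (S \<inter> cball 0 K)" using S by (simp add: closed_Int_compact)
    have cf: "continuous_on (S \<inter> cball 0 K) f" using f continuous_on_subset by blast
    obtain g where g: "real_polynomial_function g" "\<And>z. z \<in> S \<inter> cball 0 K \<Longrightarrow> \<bar>Re (f z) - g z\<bar> < e"
      by (rule Stone_Weierstrass_real_polynomial_function[OF cS continuous_on_Re[OF cf] e]) (rule that)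
    obtain h where h: "real_polynomial_function h" "\<And>z. z \<in> S \<inter> cball 0 K \<Longrightarrow> \<bar>Im (f z) - h z\<bar> < e"
      by (rule Stone_Weierstrass_real_polynomial_function[OF cS continuous_on_Im[OF cf] e]) (rule that)
    define p where "p z = complex_of_real (g z) + \<i> * complex_of_real (h z)" for z
    have pl: "lb S p" unfolding p_def by (intro lb_add lb_mult real_poly_lb g h) auto
    have yp: "y * \<phi> p = \<phi>' p * y"
      unfolding p_def using poly[OF g(1)] poly[OF h(1)]
      by (simp add: calc_add[OF c] calc_add[OF c'] calc_scale[OF c] calc_scale[OF c'] real_poly_lb g h lb_mult algebra_simps)
         (metis mult.assoc sc_comm)
    have near: "cmod (f z - p z) \<le> 2 * e" if "z \<in> S" "cmod z \<le> K" for z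
    proof -
      have "cmod (f z - p z) \<le> \<bar>Re (f z) - g z\<bar> + \<bar>Im (f z) - h z\<bar>"
        using cmod_le[of "f z - p z"] by (simp add: p_def)
      then show ?thesis using g(2)[of z] h(2)[of z] that by (simp add: dist_norm)
    qed
    have n1: "norm (\<phi> (\<lambda>z. f z - p z)) \<le> 2 * e" using K1 near e unfolding K_def by auto
    have n2: "norm (\<phi>' (\<lambda>z. f z - p z)) \<le> 2 * e" using K2 near e unfolding K_def by auto
    have "y * \<phi> f - \<phi>' f * y = y * \<phi> (\<lambda>z. f z - p z) - \<phi>' (\<lambda>z. f z - p z) * y"
      using yp by (simp add: calc_diff[OF c fl pl] calc_diff[OF c' fl pl] algebra_simps)
    also have "norm \<dots> \<le> norm y * (2 * e) + (2 * e) * norm y"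
      by (rule order_trans[OF norm_triangle_ineq4 add_mono[OF order_trans[OF norm_mult_ineq mult_left_mono[OF n1 norm_ge_zero]]
            order_trans[OF norm_mult_ineq mult_right_mono[OF n2 norm_ge_zero]]]])
    finally show ?thesis by (simp add: algebra_simps)
  qed
  have "norm (y * \<phi> f - \<phi>' f * y) \<le> 0"
  proof (rule field_le_epsilon)
    fix e :: real assume e: "e > 0"
    have "4 * norm y * (e / (4 * norm y + 1)) \<le> e" using e by (simp add: field_simps add_pos_nonneg)
    then show "norm (y * \<phi> f - \<phi>' f * y) \<le> 0 + e"
      using small[of "e / (4 * norm y + 1)"] e by (simp add: add_nonneg_pos)
  qed
  then show ?thesis by simp
qed

lemma calc_commute:
  assumes "calc S a \<phi>" "closed S" "continuous_on S f" "y * a = a * y" "y * star a = star a * y"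
  shows "y * \<phi> f = \<phi> f * y"
  using calc_intertwine[OF assms(1,1-5)] .

lemma calc_unique:
  assumes "calc S a \<phi>" "calc S a \<phi>'" "closed S" "continuous_on S f"
  shows "\<phi> f = \<phi>' f"
  using calc_intertwine[OF assms, of 1] by simp

section \<open>Lifting to exact relations\<close>

lemma sc_half: "sc (1/2) * (x + x) = (x :: 'a :: star_ring)"
proof -
  have "sc (1/2) * (x + x) = (sc (1/2) + sc (1/2)) * x" by (simp only: distrib_left distrib_right)
  also have "sc (1/2) + sc (1/2) = (1 :: 'a)" by (simp flip: sc_add)
  finally show ?thesis by simp
qed

lemma selfadj_lift:
  assumes "star a = (a :: q)"
  shows "\<exists>N. bd N \<and> star N = N \<and> a = qc N"
proof -
  obtain X where X: "bd X" "a = qc X" by (rule q_cases)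
  let ?N = "sc (1/2) * (X + star X)"
  have b: "bd ?N" using X by auto
  have "star ?N = ?N" by (simp add: star_mult star_sc star_add sc_comm add.commute)
  moreover have "qc ?N = sc (1/2) * (a + star a)"
    using X b by (simp add: qc_mult[symmetric] qc_add[symmetric] qc_star[symmetric] bd_add bd_star qc_sc)
  moreover have "sc (1/2) * (a + star a) = a"
    using assms sc_half by simp
  ultimately show ?thesis using b by metis
qed

lemma calc_psd: "\<exists>\<phi>. calc NN (star z * z) \<phi>"
proof -
  obtain Z where Z: "bd Z" "z = qc Z" by (rule q_cases)
  have "star z * z = qc (star Z * Z)" using Z by (simp add: qc_star qc_mult bd_star)
  then show ?thesis unfolding calc_def using Z sp_psd[of Z]
    by (intro exI[of _ "\<lambda>f. qc (fc (star Z * Z) f)"] exI[of _ "star Z * Z"]) (auto simp: nrm_def star_mult)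
qed

section \<open>Polar decomposition with a unitary factor\<close>

lift_definition tsc :: "(idx \<Rightarrow> real) \<Rightarrow> fam" is "\<lambda>t i. complex_of_real (t i) \<cdot>\<^sub>m 1\<^sub>m (dm i)" by simp

lemma sg_tsc: "sg (tsc t) = tsc t"
  apply (rule fam_eqI) subgoal for i
    by (simp add: fibs tsc.rep_eq cjm_smult mult_smult_assoc_mat[OF Jm_carrier adj_carrier[OF Jm_carrier]]
        smult_one_mult[of _ "dm i"] mult_smult_one[of _ "dm i"] Jm_unitary) done

lemma fn_tsc: "fn (tsc t) i = \<bar>t i\<bar>"
  by (simp add: fn_def tsc.rep_eq op_norm_smult op_norm_one dm_pos)

instance idx :: countable by countable_datatype

text \<open>The shift at the index numbered \<open>k\<close> is less than
  \<open>1 / (k + 1)\<close>: every fibre becomes injective, while the whole perturbation vanishes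
  in the quotient.\<close>

lemma exists_injective_perturbation:
  "\<exists>t. nl (tsc t) \<and> bd (tsc t) \<and> (\<forall>i. \<forall>v\<in>carrier_vec (dm i). fib (X + tsc t) i *\<^sub>v v = 0\<^sub>v (dm i) \<longrightarrow> v = 0\<^sub>v (dm i))"
proof -
  have "\<forall>i. \<exists>t>0. t < 1 / (real (to_nat i) + 1) \<and> (\<forall>v\<in>carrier_vec (dm i).
      (fib X i + complex_of_real t \<cdot>\<^sub>m 1\<^sub>m (dm i)) *\<^sub>v v = 0\<^sub>v (dm i) \<longrightarrow> v = 0\<^sub>v (dm i))"
    by (intro allI exists_invertible_shift) auto
  then obtain t where t: "\<And>i. t i > 0" "\<And>i. t i < 1 / (real (to_nat (i :: idx)) + 1)"
    "\<And>i. \<forall>v\<in>carrier_vec (dm i). (fib X i + complex_of_real (t i) \<cdot>\<^sub>m 1\<^sub>m (dm i)) *\<^sub>v v = 0\<^sub>v (dm i) \<longrightarrow> v = 0\<^sub>v (dm i)"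
    by metis
  have "nl (tsc t)" unfolding nl_def
  proof (intro allI impI)
    fix e :: real assume e: "e > 0"
    obtain m :: nat where m: "1 / e < real m" using reals_Archimedean2 by blast
    have "{i. \<not> fn (tsc t) i \<le> e} \<subseteq> to_nat -` {..<m}"
    proof
      fix i assume "i \<in> {i. \<not> fn (tsc t) i \<le> e}"
      then have "e < t i" using t(1)[of i] by (simp add: fn_tsc)
      then have "e < 1 / (real (to_nat i) + 1)" using t(2)[of i] by simp
      then have "real (to_nat i) + 1 < 1 / e" using e by (simp add: field_simps)
      then have "real (to_nat i) < real m" using m by simp
      then show "i \<in> to_nat -` {..<m}" by simp
    qed
    moreover have "finite (to_nat -` {..<m} :: idx set)" by (rule finite_vimageI) auto
    ultimately show "\<forall>\<^sub>F i in cofinite. fn (tsc t) i \<le> e" unfolding eventually_cofinite by (rule finite_subset)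
  qed
  moreover have "fn (tsc t) i \<le> 1" for i
  proof -
    have "t i < 1" by (rule less_le_trans[OF t(2)]) simp
    then show ?thesis using t(1)[of i] by (simp add: fn_tsc)
  qed
  then have "bd (tsc t)" unfolding bd_def by blast
  ultimately show ?thesis using t(3) by (intro exI[of _ t]) (simp add: fibs tsc.rep_eq)
qed

text \<open>An eigenvalue 0 would make \<open>Y\<close> annihilate a column of the unitary
  \<open>fcP\<close>.\<close>

lemma sp_injective_psd:
  assumes inj: "\<And>i v. v \<in> carrier_vec (dm i) \<Longrightarrow> fib Y i *\<^sub>v v = 0\<^sub>v (dm i) \<Longrightarrow> v = 0\<^sub>v (dm i)"
  shows "sp (star Y * Y) \<subseteq> NN - {0}"
proof
  fix z assume z: "z \<in> sp (star Y * Y)"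
  then obtain i k where ik: "k < dm i" "z = fcd (star Y * Y) i k" by (auto simp: sp_def)
  let ?n = "dm i"
  let ?P = "fcP (star Y * Y)"
  have n: "nrm (star Y * Y)" by (simp add: nrm_def star_mult)
  have "z \<noteq> 0"
  proof
    assume "z = 0"
    then have "complex_of_real (\<Sum>j<?n. (cmod (fib (Y * ?P) i $$ (j,k)))\<^sup>2) = 0"
      using sp_psd_aux[OF ik(1), of Y] ik(2) by metis
    then have "(\<Sum>j<?n. (cmod (fib (Y * ?P) i $$ (j,k)))\<^sup>2) = 0" by (simp only: of_real_eq_0_iff)
    then have z0: "fib (Y * ?P) i $$ (j,k) = 0" if "j < ?n" for j using that by (subst (asm) sum_nonneg_eq_0_iff) auto
    have "col (fib (Y * ?P) i) k = 0\<^sub>v ?n"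
      using z0 ik by (intro eq_vecI) auto
    then have colk: "col (fib Y i * fib ?P i) k = 0\<^sub>v ?n" unfolding times_fam.rep_eq .
    have "col (fib Y i * fib ?P i) k = fib Y i *\<^sub>v col (fib ?P i) k"
      using ik by (intro col_mult2[of _ ?n ?n _ ?n]) auto
    then have "col (fib ?P i) k = 0\<^sub>v ?n" using inj[of "col (fib ?P i) k" i] colk ik by simp
    then have p0: "fib ?P i $$ (j,k) = 0" if "j < ?n" for j
      using that ik by (metis fib_dim(1,2) index_col index_zero_vec(1))
    have "fib (star ?P * ?P) i $$ (k,k) = (\<Sum>j\<in>{0..<?n}. cnj (fib ?P i $$ (j,k)) * fib ?P i $$ (j,k))"
      using ik by (auto simp: fibs scalar_prod_def adj_def intro!: sum.cong)
    also have "\<dots> = 0" using p0 by simp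
    finally show False using fcP_simps(1)[OF n] ik by (simp add: fibs)
  qed
  then show "z \<in> NN - {0}" using z sp_psd[of Y] by auto
qed

definition rt :: "complex \<Rightarrow> complex" where "rt z = complex_of_real (sqrt (Re z))"

lemma fam_square_inverse: "x * y = (1::fam) \<Longrightarrow> y * x = 1"
proof -
  assume a: "x * y = 1"
  show "y * x = 1"
  proof (rule fam_eqI)
    fix i
    have "fib x i * fib y i = 1\<^sub>m (dm i)" using arg_cong[OF a, of "\<lambda>z. fib z i"] by (simp add: fibs)
    then have "fib y i * fib x i = 1\<^sub>m (dm i)" by (rule mat_mult_left_right_inverse[OF fib_carrier fib_carrier])
    then show "fib (y * x) i = fib 1 i" by (simp add: fibs)
  qed
qed

text \<open>The factor is \<open>Y\<close> times the inverse square root of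
  \<open>star Y * Y\<close>. The fibres are square matrices, so the isometry \<open>W\<close> is
  unitary, and as the function used commutes with conjugation, \<open>W\<close> inherits the
  symmetry of \<open>Y\<close>.\<close>

lemma polar_fam:
  assumes inj: "\<And>i v. v \<in> carrier_vec (dm i) \<Longrightarrow> fib Y i *\<^sub>v v = 0\<^sub>v (dm i) \<Longrightarrow> v = 0\<^sub>v (dm i)"
  shows "\<exists>W. star W * W = 1 \<and> W * star W = 1 \<and> Y = W * fc (star Y * Y) rt \<and> (sg Y = Y \<longrightarrow> sg W = W)"
proof -
  let ?G = "star Y * Y"
  define f where "f z = complex_of_real (1 / sqrt (Re z))" for z
  have cf: "cnj (f z) = f z" "cnj (f (cnj z)) = f z" "f (cnj z) = f z" for z by (simp_all add: f_def)
  have n: "nrm ?G" by (simp add: nrm_def star_mult)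
  have s: "Re z > 0" "complex_of_real (Re z) = z" if "z \<in> sp ?G" for z
  proof -
    have "sp ?G \<subseteq> NN - {0}" by (rule sp_injective_psd) (rule inj)
    then show "Re z > 0" "complex_of_real (Re z) = z" using that by (auto simp: NN_def complex_eq_iff less_le)
  qed
  define W where "W = Y * fc ?G f"
  have sf: "star (fc ?G f) = fc ?G f" unfolding star_fc cf ..
  have "star W * W = fc ?G f * ?G * fc ?G f" by (simp add: W_def star_mult sf mult.assoc)
  also have "\<dots> = fc ?G (\<lambda>z. f z * z * f z)" by (simp add: fc_mult n fc_id)
  also have "\<dots> = fc ?G (\<lambda>z. 1)"
  proof (rule fc_cong)
    fix z assume z: "z \<in> sp ?G"
    have "f z * z * f z = complex_of_real (1 / sqrt (Re z) * Re z * (1 / sqrt (Re z)))"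
      using s(2)[OF z] unfolding f_def by (metis of_real_mult)
    also have "1 / sqrt (Re z) * Re z * (1 / sqrt (Re z)) = 1" using s(1)[OF z] by (simp add: field_simps)
    finally show "f z * z * f z = 1" by simp
  qed
  finally have W1: "star W * W = 1" by (simp add: fc_const n)
  have "W * fc ?G rt = Y * fc ?G (\<lambda>z. f z * rt z)" by (simp add: W_def mult.assoc fc_mult n)
  also have "fc ?G (\<lambda>z. f z * rt z) = fc ?G (\<lambda>z. 1)"
  proof (rule fc_cong)
    fix z assume "z \<in> sp ?G"
    then have "Re z > 0" by (rule s(1))
    then show "f z * rt z = 1" by (simp add: f_def rt_def flip: of_real_mult)
  qed
  finally have Y: "Y = W * fc ?G rt" by (simp add: fc_const n)
  have "sg W = W" if "sg Y = Y"
  proof -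
    have "sg ?G = ?G" using that by (simp add: sg_mult sg_star)
    then show ?thesis using that sg_fc[OF n, of f] by (simp add: W_def sg_mult cf)
  qed
  then show ?thesis using W1 fam_square_inverse[OF W1] Y by blast
qed

lemma sg_lift:
  assumes "sg x = (x :: q)"
  shows "\<exists>X. bd X \<and> sg X = X \<and> x = qc X"
proof -
  obtain X where X: "bd X" "x = qc X" by (rule q_cases)
  let ?N = "sc (1/2) * (X + sg X)"
  have b: "bd ?N" using X by auto
  have "sg ?N = ?N" by (simp add: sg_mult sg_sc sg_add add.commute)
  moreover have "qc ?N = sc (1/2) * (x + sg x)"
    using X b by (simp add: qc_mult[symmetric] qc_add[symmetric] qc_sg[symmetric] bd_add bd_sg qc_sc)
  moreover have "sc (1/2) * (x + sg x) = x"
    using assms sc_half by simp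
  ultimately show ?thesis using b by metis
qed

lemma bd_unitary: "star W * W = 1 \<Longrightarrow> bd W"
  unfolding bd_def using fn_unitary[of W] by (metis order_refl)

text \<open>A null shift makes a lift injective, and then \<open>polar_fam\<close> applies. In a
  general C*-algebra the polar factor is a mere partial isometry that may lie outside the algebra;
  the unitary factor is the special property of the quotient on which the moving of spectra
  rests.\<close>

lemma polar_lift:
  fixes x :: q
  shows "\<exists>W \<phi>. star W * W = 1 \<and> W * star W = 1 \<and> (sg x = x \<longrightarrow> sg W = W) \<and>
     calc NN (star x * x) \<phi> \<and> x = qc W * \<phi> rt"
proof -
  obtain X where X: "bd X" "x = qc X" "sg x = x \<longrightarrow> sg X = X"
  proof (cases "sg x = x")
    case True then show ?thesis using sg_lift[OF True] that by blast
  next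
    case False
    obtain X where "bd X" "x = qc X" by (rule q_cases)
    then show ?thesis using False that by blast
  qed
  obtain t where t: "nl (tsc t)" "bd (tsc t)"
    "\<And>i v. v \<in> carrier_vec (dm i) \<Longrightarrow> fib (X + tsc t) i *\<^sub>v v = 0\<^sub>v (dm i) \<Longrightarrow> v = 0\<^sub>v (dm i)"
    using exists_injective_perturbation[of X] by blast
  let ?Y = "X + tsc t"
  have bY: "bd ?Y" using X t by auto
  then have "qc X = qc ?Y \<longleftrightarrow> nl (X - ?Y)" using X by (intro qc_eq_iff)
  then have xY: "x = qc ?Y" "bd ?Y" using X bY nl_uminus[OF t(1)] by auto
  obtain W where W: "star W * W = 1" "W * star W = 1" "?Y = W * fc (star ?Y * ?Y) rt" "sg ?Y = ?Y \<longrightarrow> sg W = W"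
    using polar_fam[OF t(3)] by blast
  have n: "nrm (star ?Y * ?Y)" by (simp add: nrm_def star_mult)
  have b: "bd (star ?Y * ?Y)" using xY by auto
  have "calc NN (star x * x) (\<lambda>f. qc (fc (star ?Y * ?Y) f))"
    unfolding calc_def using n b xY sp_psd[of ?Y]
    by (intro exI[of _ "star ?Y * ?Y"]) (simp add: qc_star qc_mult bd_star)
  moreover have "lb NN rt"
    unfolding lb_def rt_def
  proof
    fix K show "\<exists>B. \<forall>z\<in>NN. cmod z \<le> K \<longrightarrow> cmod (complex_of_real (sqrt (Re z))) \<le> B"
      by (rule exI[of _ "sqrt K"]) (auto simp: NN_def intro: order_trans[OF complex_Re_le_cmod])
  qed
  then have "bd (fc (star ?Y * ?Y) rt)" using bd_fc[OF b n sp_psd] by blast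
  then have "x = qc W * qc (fc (star ?Y * ?Y) rt)"
    using W(3) xY bd_unitary[OF W(1)] by (metis qc_mult)
  moreover have "sg x = x \<longrightarrow> sg W = W" using X W(4) by (simp add: sg_add sg_tsc)
  ultimately show ?thesis using W(1,2) by (intro exI[of _ W] exI[of _ "\<lambda>f. qc (fc (star ?Y * ?Y) f)"]) blast
qed

lemma rt_continuous: "continuous_on S rt"
  unfolding rt_def by (intro continuous_intros)

lemma closed_NN: "closed NN"
  unfolding NN_def by (intro closed_Collect_conj closed_Collect_eq closed_Collect_le continuous_intros)

lemma calc_of_one: "calc S 1 \<phi> \<Longrightarrow> closed S \<Longrightarrow> continuous_on S f \<Longrightarrow> 1 \<in> S \<Longrightarrow> \<phi> f = sc (f 1)"
proof -
  assume c: "calc S 1 \<phi>" and S: "closed S" and f: "continuous_on S f" and 1: "1 \<in> S"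
  have d: "is_dec 1 1 (\<lambda>i k. 1)" by (simp add: is_dec_def dgf_const)
  have fc1: "fc 1 f = sc (f 1)" for f using fc_dec[OF d, of f] by (simp add: dgf_const)
  have n: "nrm 1" by (simp add: nrm_def)
  have "fc 1 (\<lambda>z. if z = 1 then 0 else 1) = fc 1 (\<lambda>z. 0)" by (simp add: fc1)
  then have "sp 1 \<subseteq> {1}" using fc_eq_iff[OF n, of "\<lambda>z. if z = 1 then 0 else 1" "\<lambda>z. 0"]
    by (auto split: if_splits)
  then have "calc S 1 (\<lambda>f. qc (fc 1 f))" unfolding calc_def using n 1 by (intro exI[of _ 1]) (auto simp: qc_one)
  from calc_unique[OF c this S f] show ?thesis by (simp add: fc1 qc_sc)
qed

text \<open>The modulus of a unitary is 1 in the quotient, so the exact polar factor of a lift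
  already represents \<open>w\<close>.\<close>

lemma unitary_lift:
  fixes w :: q
  assumes "star w * w = 1"
  shows "\<exists>W. star W * W = 1 \<and> W * star W = 1 \<and> w = qc W \<and> (sg w = w \<longrightarrow> sg W = W)"
proof -
  obtain W \<phi> where W: "star W * W = 1" "W * star W = 1" "sg w = w \<longrightarrow> sg W = W"
    "calc NN (star w * w) \<phi>" "w = qc W * \<phi> rt" using polar_lift[of w] by blast
  have "\<phi> rt = sc (rt 1)"
    by (rule calc_of_one[OF _ closed_NN rt_continuous]) (use W(4) assms in \<open>auto simp: NN_def\<close>)
  then show ?thesis using W by (intro exI[of _ W]) (simp add: rt_def)
qed

lemma calc_unitary:
  fixes w :: q
  assumes "star w * w = 1"
  shows "w * star w = 1" and
    "\<exists>\<phi>. calc (sphere 0 1) w \<phi> \<and> (sg w = w \<longrightarrow> (\<forall>f. lb (sphere 0 1) f \<longrightarrow> sg (\<phi> f) = \<phi> (\<lambda>z. cnj (f (cnj z)))))"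
proof -
  obtain W where W: "star W * W = 1" "W * star W = 1" "w = qc W" "sg w = w \<longrightarrow> sg W = W"
    using unitary_lift[OF assms] by blast
  have b: "bd W" using W(1) by (rule bd_unitary)
  show "w * star w = 1" using W b by (simp add: qc_star qc_mult bd_star qc_one)
  have n: "nrm W" using W by (simp add: nrm_def)
  have s: "sp W \<subseteq> sphere 0 1" using sp_unitary[OF W(1) n] .
  have "calc (sphere 0 1) w (\<lambda>f. qc (fc W f))" unfolding calc_def using b n s W(3) by blast
  moreover have "sg (qc (fc W f)) = qc (fc W (\<lambda>z. cnj (f (cnj z))))" if "sg w = w" "lb (sphere 0 1) f" for f
    using that W(4) by (simp add: qc_sg bd_fc[OF b n s] sg_fc[OF n])
  ultimately show "\<exists>\<phi>. calc (sphere 0 1) w \<phi> \<and> (sg w = w \<longrightarrow> (\<forall>f. lb (sphere 0 1) f \<longrightarrow> sg (\<phi> f) = \<phi> (\<lambda>z. cnj (f (cnj z)))))"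
    by (intro exI[of _ "\<lambda>f. qc (fc W f)"]) auto
qed

text \<open>Lifting \<open>p - sg p\<close> to an odd self-adjoint family makes the two lifted projections exactly orthogonal.\<close>

lemma projection_pair_lift:
  fixes p :: q
  assumes "star p = p" "p * p = p" "p * sg p = 0"
  shows "\<exists>P. bd P \<and> star P = P \<and> P * P = P \<and> P * sg P = 0 \<and> p = qc P"
proof -
  have sp0: "sg p * p = 0" using assms(1,3) by (metis sg_star star_mult star_zero)
  obtain N where N: "bd N" "star N = N" "p = qc N" using selfadj_lift[OF assms(1)] by blast
  let ?D = "N - sg N"
  have D: "bd ?D" "star ?D = ?D" "sg ?D = - ?D" using N by (auto simp: star_diff sg_diff sg_star[symmetric])
  have n: "nrm ?D" using D by (simp add: nrm_def)
  have sR: "sp ?D \<subseteq> \<real>" using sp_selfadj[OF D(2)] .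
  let ?d = "p - sg p"
  have dd: "?d = qc ?D" using N by (simp add: qc_diff bd_sg qc_sg)
  \<comment> \<open>The eigenvalue 1 is picked out of the spectrum \<open>{-1, 0, 1}\<close> of
    \<open>p - sg p\<close>. Since \<open>sg\<close> changes the sign of \<open>?D\<close>, the
    projection \<open>sg P\<close> belongs to real parts below \<open>-1/2\<close>, whence the exact
    orthogonality.\<close>
  define e where "e z = (if Re z > 1/2 then 1 else 0 :: complex)" for z :: complex
  define P where "P = fc ?D e"
  have c: "calc \<real> ?d (\<lambda>f. qc (fc ?D f))" unfolding calc_def using n D sR dd by blast
  have le: "lb \<real> e" by (rule lb_bounded[of _ _ 1]) (simp add: e_def)
  have bP: "bd P" unfolding P_def by (rule bd_fc[OF D(1) n sR le])
  have "star P = P" unfolding P_def star_fc by (rule arg_cong[of _ _ "fc ?D"]) (auto simp: e_def)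
  moreover have "P * P = P" unfolding P_def fc_mult[OF n, symmetric] by (rule arg_cong[of _ _ "fc ?D"]) (auto simp: e_def)
  moreover have "P * sg P = 0"
  proof -
    have mD: "- ?D = fc ?D uminus" using fc_mult[OF n, of "\<lambda>z. -1" "\<lambda>z. z"] by (simp add: fc_const fc_id n sc_uminus)
    have "sg P = fc (- ?D) (\<lambda>z. cnj (e (cnj z)))" unfolding P_def sg_fc[OF n] D(3) ..
    also have "\<dots> = fc ?D (\<lambda>z. cnj (e (cnj (- z))))" unfolding mD fc_fc[OF n] ..
    finally have "P * sg P = fc ?D (\<lambda>z. e z * cnj (e (cnj (- z))))" unfolding P_def by (simp add: fc_mult n)
    also have "(\<lambda>z. e z * cnj (e (cnj (- z)))) = (\<lambda>z. 0)" by (auto simp: e_def)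
    finally show ?thesis by (simp add: fc_const n)
  qed
  moreover have "p = qc P"
  proof -
    let ?\<phi> = "\<lambda>f. qc (fc ?D f)"
    \<comment> \<open>On \<open>{-1, 0, 1}\<close> the jump function \<open>e\<close> agrees with
      \<open>(z^2 + z) / 2\<close>. The difference is \<open>z^3 - z\<close> times the bounded
      function \<open>h\<close>, and \<open>z^3 - z\<close> vanishes at \<open>p - sg p\<close>, so
      \<open>P\<close> represents \<open>p\<close> although \<open>e\<close> is
      discontinuous.\<close>
    define h where "h z = (e z - (z * z + z) / 2) / (z * z * z - z)" for z
    have d2: "?d * ?d = p + sg p" using assms sp0 by (simp add: algebra_simps flip: sg_mult)
    have d3: "?d * ?d * ?d = ?d" unfolding d2 using assms sp0 by (simp add: algebra_simps flip: sg_mult)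
    have eq: "e z - (z * z + z) / 2 = (z * z * z - z) * h z" if "z \<in> \<real>" for z
    proof (cases "z * z * z - z = 0")
      case True
      then have "z * (z - 1) * (z + 1) = 0" by (simp add: algebra_simps)
      then have "z = 0 \<or> z = 1 \<or> z = -1" by (auto simp: add_eq_0_iff2)
      then show ?thesis using True by (auto simp: e_def)
    qed (simp add: h_def)
    have hb: "cmod (h z) \<le> 8" if z: "z \<in> \<real>" for z
    proof -
      obtain r where r: "z = complex_of_real r" using z Reals_cases by blast
      have "h z = complex_of_real (((if r > 1/2 then 1 else 0) - (r * r + r) / 2) / (r * r * r - r))"
        by (simp add: h_def e_def r)
      moreover have "\<bar>((if r > 1/2 then 1 else 0) - (r * r + r) / 2) / (r * r * r - r)\<bar> \<le> 8"
      proof (cases "r * r * r - r = 0")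
        case False
        have den: "r * r * r - r = r * (r + 1) * (r - 1)" by (simp add: algebra_simps)
        have "\<bar>(if r > 1/2 then 1 else 0) - (r * r + r) / 2\<bar> \<le> 8 * \<bar>r * r * r - r\<bar>"
        proof (cases "r > 1/2")
          case True
          have num: "(if r > 1/2 then 1 else 0) - (r * r + r) / 2 = - ((r + 2) / 2 * (r - 1))"
            using True by (simp add: field_simps)
          have "1 * (r + 1) \<le> (2 * r) * (r + 1)" using True by (intro mult_right_mono) auto
          then have "r + 1 \<le> 2 * (r * (r + 1))" by simp
          moreover have "(r + 2) / 2 \<le> 8 * t" if "r + 1 \<le> 2 * t" for t using that True by (simp add: field_simps)
          ultimately have "(r + 2) / 2 \<le> 8 * (r * (r + 1))" by blast
          then have "(r + 2) / 2 * \<bar>r - 1\<bar> \<le> 8 * (r * (r + 1)) * \<bar>r - 1\<bar>" by (intro mult_right_mono) auto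
          then show ?thesis using True unfolding num den by (simp add: abs_mult mult.assoc)
        next
          case F: False
          have num: "(if r > 1/2 then 1 else 0) - (r * r + r) / 2 = - (r * (r + 1) / 2)"
            using F by (simp add: field_simps)
          have "\<bar>r * (r + 1)\<bar> * (1/2) \<le> \<bar>r * (r + 1)\<bar> * (8 * \<bar>r - 1\<bar>)" using F by (intro mult_left_mono) auto
          moreover have "\<bar>- (r * (r + 1) / 2)\<bar> = \<bar>r * (r + 1)\<bar> * (1/2)" by (simp add: abs_mult)
          moreover have "8 * \<bar>r * (r + 1) * (r - 1)\<bar> = \<bar>r * (r + 1)\<bar> * (8 * \<bar>r - 1\<bar>)" by (simp only: abs_mult mult_ac)
          ultimately show ?thesis unfolding num den by (simp only:)
        qed
        then show ?thesis using False by (simp add: abs_divide divide_le_eq)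
      next
        case True
        show ?thesis unfolding True by simp
      qed
      ultimately show ?thesis by (simp only: norm_of_real)
    qed
    have lh: "lb \<real> h" using hb by (rule lb_bounded)
    have l: "lb \<real> (\<lambda>z. z * z * z - z)" "lb \<real> (\<lambda>z. z * z)" "lb \<real> (\<lambda>z. z * z * z)" "lb \<real> (\<lambda>z. (1/2) * (z * z + z))"
      by (intro lb_diff lb_mult lb_add lb_id lb_const)+
    have "?\<phi> (\<lambda>z. e z - (1/2) * (z * z + z)) = ?\<phi> (\<lambda>z. (z * z * z - z) * h z)"
      by (rule calc_cong[OF c]) (use eq in simp)
    also have "\<dots> = (?d * ?d * ?d - ?d) * ?\<phi> h"
      using l lh by (simp add: calc_mult[OF c] calc_diff[OF c] calc_id[OF c] lb_mult)
    also have "\<dots> = 0" using d3 by simp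
    finally have "?\<phi> e = ?\<phi> (\<lambda>z. (1/2) * (z * z + z))" using l le by (simp add: calc_diff[OF c])
    also have "\<dots> = sc (1/2) * ?\<phi> (\<lambda>z. z * z + z)"
      by (rule calc_scale[OF c]) (intro lb_add lb_mult lb_id)
    also have "?\<phi> (\<lambda>z. z * z + z) = ?\<phi> (\<lambda>z. z * z) + ?\<phi> (\<lambda>z. z)" by (rule calc_add[OF c]) (intro lb_mult lb_id)+
    also have "?\<phi> (\<lambda>z. z * z) = ?d * ?d" using calc_mult[OF c lb_id lb_id] calc_id[OF c] by simp
    also have "?\<phi> (\<lambda>z. z) = ?d" by (rule calc_id[OF c])
    also have "?d * ?d + ?d = p + p" unfolding d2 by simp
    also have "sc (1/2) * (p + p) = p" by (rule sc_half)
    finally show ?thesis by (simp add: P_def)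
  qed
  ultimately show ?thesis using bP by blast
qed

section \<open>Ranks of equivalent projections\<close>

lemma trm_sg: "trm (fib (sg x) i) = cnj (trm (fib x i))"
proof -
  let ?n = "dm i"
  have "trm (fib (sg x) i) = trm (adj (Jm i) * (Jm i * cjm (fib x i)))"
    unfolding sg_fam.rep_eq by (rule trm_comm[of _ ?n]) (auto simp: mult_carrier_mat[of _ ?n ?n _ ?n])
  also have "adj (Jm i) * (Jm i * cjm (fib x i)) = cjm (fib x i)"
    using assoc_mult_mat[of "adj (Jm i)" ?n ?n "Jm i" ?n "cjm (fib x i)" ?n] left_mult_one_mat[of "cjm (fib x i)" ?n ?n]
    by (simp add: Jm_unitary)
  finally show ?thesis by (simp add: trm_cjm[of _ ?n])
qed

text \<open>Equivalence in the quotient holds only up to null families, but ranks are integers: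
  where a map between exact projections is nearly isometric in both directions, the ranks
  coincide.\<close>

lemma equivalent_projections_trace:
  assumes M: "bd M" "star M = M" "M * M = M" and M': "bd M'" "star M' = M'" "M' * M' = M'"
    and x: "star x * x = qc M" "x * star x = qc M'"
  shows "\<forall>\<^sub>F i in cofinite. trm (fib M i) = trm (fib M' i)"
proof -
  obtain X where X: "bd X" "x = qc X" by (rule q_cases)
  \<comment> \<open>Cutting down by the exact projections makes \<open>Z * M = Z\<close> and
    \<open>M' * Z = Z\<close> exact rather than approximate.\<close>
  define Z where "Z = M' * X * M"
  have bZ: "bd Z" using X M M' by (auto simp: Z_def)
  have xM: "x * qc M = x"
  proof -
    let ?y = "x - x * qc M"
    have "star ?y * ?y = qc M - qc M * qc M - qc M * qc M + qc M * qc M * qc M"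
      using x(1) M by (simp add: star_diff star_mult qc_star algebra_simps) (simp add: mult.assoc[symmetric])
    also have "\<dots> = 0" using M by (simp add: qc_mult)
    finally show ?thesis using norm_cstar[of ?y] by simp
  qed
  have M'x: "qc M' * x = x"
  proof -
    let ?y = "star x - star x * qc M'"
    have "star ?y * ?y = qc M' - qc M' * qc M' - qc M' * qc M' + qc M' * qc M' * qc M'"
      using x(2) M' by (simp add: star_diff star_mult qc_star algebra_simps) (simp add: mult.assoc[symmetric])
    also have "\<dots> = 0" using M' by (simp add: qc_mult)
    finally have "star x = star x * qc M'" using norm_cstar[of ?y] by simp
    then have "star (star x) = star (star x * qc M')" by simp
    then show ?thesis using M' by (simp add: star_mult qc_star)
  qed
  have xZ: "x = qc Z" using X M M' xM M'x by (simp add: Z_def qc_mult[symmetric] bd_mult)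
  have n1: "nl (star Z * Z - M)" using x(1) bZ M by (simp add: xZ qc_star qc_mult bd_star bd_mult qc_eq_iff)
  have n2: "nl (Z * star Z - M')" using x(2) bZ M' by (simp add: xZ qc_star qc_mult bd_star bd_mult qc_eq_iff)
  have ZM: "Z * M = Z" "M' * Z = Z" using M M' by (simp_all add: Z_def mult.assoc) (simp add: mult.assoc[symmetric])
  \<comment> \<open>Adding \<open>1 - M\<close> gives \<open>G - 1 = star Z * Z - M\<close>, so
    \<open>G\<close> is invertible in every fibre where \<open>Z\<close> is nearly isometric on the
    range of \<open>M\<close>.\<close>
  define G where "G = star Z * Z + (1 - M)"
  have ev: "\<forall>\<^sub>F i in cofinite. fn (star Z * Z - M) i \<le> 1/2" "\<forall>\<^sub>F i in cofinite. fn (Z * star Z - M') i \<le> 1/2"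
    using n1 n2 unfolding nl_def by (auto elim!: allE[of _ "1/2::real"])
  show ?thesis using ev
  proof eventually_elim
    fix i
    assume a1: "fn (star Z * Z - M) i \<le> 1/2" and a2: "fn (Z * star Z - M') i \<le> 1/2"
    \<comment> \<open>\<open>fib Z i\<close> maps the range of \<open>fib M i\<close> onto that of \<open>fib M' i\<close>, so its polar part is a partial isometry between them\<close>
    let ?n = "dm i"
    define g where "g z = (if cmod z < 1/2 then 1 else complex_of_real (1 / sqrt (Re z)))" for z :: complex
    have nG: "nrm G" and sG: "star G = G" using M by (simp_all add: nrm_def G_def star_add star_mult star_diff)
    have MG: "M * G = star Z * Z" "G * M = star Z * Z"
    proof -
      have "M * star Z = star Z" using arg_cong[OF ZM(1), of star] M by (simp add: star_mult)
      then show "M * G = star Z * Z" "G * M = star Z * Z"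
        using M ZM by (simp_all add: G_def distrib_left distrib_right algebra_simps) (simp_all add: mult.assoc[symmetric] mult.assoc ZM)
    qed
    have spG: "1/2 \<le> Re (fcd G i k) \<and> Im (fcd G i k) = 0" if k: "k < ?n" for k
    proof -
      have "fcd G i k \<in> \<real>" using sp_selfadj[OF sG] k unfolding sp_def by blast
      then have im: "Im (fcd G i k) = 0" by (simp add: complex_is_Real_iff)
      have "G - 1 = star Z * Z - M" by (simp add: G_def)
      have "dgf (\<lambda>i k. fcd G i k - 1) = star (fcP G) * fc G (\<lambda>z. z - 1) * fcP G"
        using fcP_simps[OF nG] by (simp add: fc_def mult.assoc)
      also have "fc G (\<lambda>z. z - 1) = G - 1" using fc_add[OF nG, of "\<lambda>z. z" "\<lambda>z. -1"] by (simp add: fc_id fc_const nG sc_uminus)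
      finally have "fn (dgf (\<lambda>i k. fcd G i k - 1)) i \<le> fn (G - 1) i"
        using fn_mult_unitary(2)[OF fcP_simps(1,2)[OF nG], of "G - 1" i] by simp
      then have "cmod (fcd G i k - 1) \<le> 1/2"
        using fn_dgf_ge[OF k, of "\<lambda>i k. fcd G i k - 1"] a1 \<open>G - 1 = star Z * Z - M\<close> by simp
      then show ?thesis using im abs_Re_le_cmod[of "fcd G i k - 1"] by simp
    qed
    define h where "h = fc G g"
    have sh: "star h = h" unfolding h_def star_fc by (rule arg_cong[of _ _ "fc G"]) (auto simp: g_def)
    have hM: "h * M = M * h" unfolding h_def using fc_intertwine[OF nG nG, of M g] MG by simp
    have hGh: "fib (h * G * h) i = 1\<^sub>m ?n"
    proof -
      have "h * G * h = fc G (\<lambda>z. g z * z * g z)" by (simp add: h_def fc_mult fc_id nG)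
      then have "fib (h * G * h) i = fib (fcP G) i * dgm ?n (\<lambda>k. g (fcd G i k) * fcd G i k * g (fcd G i k)) * adj (fib (fcP G) i)"
        by (simp add: fc_def fibs)
      also have "dgm ?n (\<lambda>k. g (fcd G i k) * fcd G i k * g (fcd G i k)) = dgm ?n (\<lambda>k. 1)"
      proof -
        have "g z * z * g z = 1" if z: "1/2 \<le> Re z" "Im z = 0" for z
        proof -
          have "\<not> cmod z < 1/2" using z complex_Re_le_cmod[of z] by linarith
          then have "g z = complex_of_real (1 / sqrt (Re z))" by (simp add: g_def)
          moreover have "z = complex_of_real (Re z)" using z by (simp add: complex_eq_iff)
          ultimately have "g z * z * g z = complex_of_real (1 / sqrt (Re z) * Re z * (1 / sqrt (Re z)))" by (metis of_real_mult)
          also have "1 / sqrt (Re z) * Re z * (1 / sqrt (Re z)) = 1" using z by (simp add: field_simps)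
          finally show ?thesis by simp
        qed
        then show ?thesis using spG by (intro eq_matI) (auto simp: dgm_def)
      qed
      finally show ?thesis using arg_cong[OF fcP_simps(2)[OF nG], of "\<lambda>x. fib x i"] by (simp add: dgm_one fibs)
    qed
    define R where "R = Z * h"
    have "star R * R = M * (h * G * h)"
      unfolding R_def by (simp add: star_mult sh) (metis MG(1) hM mult.assoc)
    then have RM: "fib (star R * R) i = fib M i" using hGh by (simp add: times_fam.rep_eq)
    \<comment> \<open>In this fibre \<open>N\<close> is a projection below \<open>M'\<close> that
      kills \<open>Z\<close>. Compressing \<open>M' - Z * star Z\<close> by \<open>N\<close> returns
      \<open>N\<close>, so the bound 1/2 forces \<open>N = 0\<close>, that is, \<open>R\<close>
      reaches all of \<open>M'\<close>.\<close>
    define N where "N = M' - R * star R"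
    have fN0: "fib (N * Z) i = fib 0 i"
    proof -
      have "R * star R * Z = Z * h * (h * G) * M" unfolding R_def by (simp add: star_mult sh) (metis MG(2) mult.assoc)
      also have "h * (h * G) = h * G * h" unfolding h_def
        by (metis fc_id fc_mult mult.commute mult.assoc nG fc_intertwine)
      then have "Z * h * (h * G) * M = Z * (h * G * h) * M" by (metis mult.assoc)
      finally have "fib (R * star R * Z) i = fib Z i" using hGh ZM(1) by (simp add: times_fam.rep_eq) (metis times_fam.rep_eq)
      then show ?thesis using ZM(2) by (simp add: N_def algebra_simps minus_fam.rep_eq zero_fam.rep_eq)
    qed
    have sN: "star N = N" by (simp add: N_def star_diff star_mult M')
    have "fib (R * star R * (R * star R)) i = fib R i * fib (star R * R) i * fib (star R) i"
      by (simp add: times_fam.rep_eq assoc_mult_mat[of _ ?n ?n _ ?n _ ?n] mult_carrier_mat[of _ ?n ?n _ ?n])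
    also have "\<dots> = fib (R * M * star R) i" unfolding RM by (simp add: times_fam.rep_eq)
    also have "R * M * star R = R * star R" unfolding R_def using hM ZM(1) by (metis mult.assoc)
    finally have RR: "fib (R * star R * (R * star R)) i = fib (R * star R) i" .
    have M'R: "M' * R = R" "star R * M' = star R"
    proof -
      show *: "M' * R = R" unfolding R_def using ZM(2) by (metis mult.assoc)
      show "star R * M' = star R" using arg_cong[OF *, of star] M' by (simp add: star_mult)
    qed
    have "N * N = M' - R * star R - R * star R + R * star R * (R * star R)"
      unfolding N_def using M' M'R by (simp add: algebra_simps) (metis mult.assoc)
    then have NN: "fib (N * N) i = fib N i"
      unfolding N_def by (simp add: plus_fam.rep_eq minus_fam.rep_eq RR)
        (rule eq_matI, auto simp: times_fam.rep_eq)
    have NM': "N * M' = N" unfolding N_def using M' M'R by (simp add: left_diff_distrib mult.assoc)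
    have "N * (M' - Z * star Z) * N = N * N - (N * Z) * (star Z * N)" using NM' by (simp add: algebra_simps)
    then have "fib (N * (M' - Z * star Z) * N) i = fib N i"
      using fN0 NN by (simp add: minus_fam.rep_eq times_fam.rep_eq[of "N * Z"] zero_fam.rep_eq)
        (rule eq_matI, auto)
    then have "fn N i \<le> fn N i * fn (M' - Z * star Z) i * fn N i"
      using fn_mult[of "N * (M' - Z * star Z)" N i] fn_mult[of N "M' - Z * star Z" i]
      by (simp add: fn_def) (meson mult_right_mono op_norm_nonneg order_trans)
    also have "\<dots> \<le> fn N i * (1/2) * fn N i"
      using a2 fn_diff_comm[of M' "Z * star Z" i] by (intro mult_right_mono mult_left_mono) auto
    finally have "fn N i \<le> (1/2) * (fn N i * fn N i)" by simp
    moreover have "fn N i * fn N i = fn N i"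
      using fn_cstar[of N i] sN NN by (simp add: fn_def power2_eq_square)
    ultimately have "fn N i = 0" using fn_nonneg[of N i] by linarith
    then have "fib N i = 0\<^sub>m ?n ?n" unfolding fn_def by (intro op_norm_eq_0) auto
    then have E: "fib M' i - fib R i * fib (star R) i = 0\<^sub>m ?n ?n" by (simp add: N_def minus_fam.rep_eq times_fam.rep_eq)
    have "fib M' i = fib R i * fib (star R) i"
    proof (rule eq_matI)
      fix r s assume "r < dim_row (fib R i * fib (star R) i)" "s < dim_col (fib R i * fib (star R) i)"
      then have rs: "r < ?n" "s < ?n" by auto
      have "(fib M' i - fib R i * fib (star R) i) $$ (r,s) = 0" unfolding E using rs by simp
      then show "fib M' i $$ (r,s) = (fib R i * fib (star R) i) $$ (r,s)" using rs by simp
    qed auto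
    moreover have "fib M i = fib (star R) i * fib R i" using RM by (simp add: times_fam.rep_eq)
    ultimately show "trm (fib M i) = trm (fib M' i)" using trm_comm[of "fib (star R) i" ?n "fib R i"] by simp
  qed
qed

text \<open>The index argument. Traces of projections are natural numbers and \<open>sg\<close>
  conjugates traces, so the equivalence of the doubled projections says
  \<open>2 * a = 2 * b\<close>. The partial isometry \<open>z\<close> is then built from equal ranks
  and need not be related to \<open>x\<close>.\<close>

lemma halve_equivalence:
  fixes p :: q
  assumes p: "star p = p" "p * p = p" "p * sg p = 0" and r: "star r = r" "r * r = r" "r * sg r = 0"
    and x: "star x * x = p + sg p" "x * star x = r + sg r"
  shows "\<exists>z. star z * z = p \<and> z * star z = r"
proof -
  obtain P where P: "bd P" "star P = P" "P * P = P" "P * sg P = 0" "p = qc P" using projection_pair_lift[OF p] by blast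
  obtain R where R: "bd R" "star R = R" "R * R = R" "R * sg R = 0" "r = qc R" using projection_pair_lift[OF r] by blast
  have aux: "bd (P + sg P) \<and> star (P + sg P) = P + sg P \<and> (P + sg P) * (P + sg P) = P + sg P"
    if "bd P" "star P = P" "P * P = P" "P * sg P = 0" for P :: fam
  proof -
    have "sg P * P = 0" using arg_cong[OF that(4), of star] that(2) by (simp add: star_mult sg_star[symmetric])
    then show ?thesis using that by (auto simp: star_add sg_star[symmetric] algebra_simps simp flip: sg_mult)
  qed
  have ev0: "\<forall>\<^sub>F i in cofinite. trm (fib (P + sg P) i) = trm (fib (R + sg R) i)"
    by (rule equivalent_projections_trace[of "P + sg P" "R + sg R" x])
       (use aux[OF P(1-4)] aux[OF R(1-4)] x P R in \<open>auto simp: qc_add bd_sg qc_sg\<close>)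
  have tr: "trm (fib (P + sg P) i) = trm (fib P i) + cnj (trm (fib P i))" for P i
    by (simp add: plus_fam.rep_eq trm_add[of _ "dm i"] trm_sg)
  have ev: "\<forall>\<^sub>F i in cofinite. trm (fib P i) = trm (fib R i)"
    using ev0
  proof eventually_elim
    fix i assume a: "trm (fib (P + sg P) i) = trm (fib (R + sg R) i)"
    have "fib P i * fib P i = fib P i" "adj (fib P i) = fib P i" "fib R i * fib R i = fib R i" "adj (fib R i) = fib R i"
      using P R by (metis times_fam.rep_eq star_fam.rep_eq)+
    then obtain a b :: nat where "trm (fib P i) = of_nat a" "trm (fib R i) = of_nat b"
      using projection_diag[of "fib P i" "dm i"] projection_diag[of "fib R i" "dm i"] by auto
    then show "trm (fib P i) = trm (fib R i)" using a unfolding tr by simp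
  qed
  \<comment> \<open>The identity is a filler at the finitely many indices of unequal rank; it does
    not influence the class.\<close>
  have "\<exists>Z. Z \<in> carrier_mat (dm i) (dm i) \<and> (trm (fib P i) = trm (fib R i) \<longrightarrow> adj Z * Z = fib P i \<and> Z * adj Z = fib R i) \<and>
      (trm (fib P i) \<noteq> trm (fib R i) \<longrightarrow> Z = 1\<^sub>m (dm i))" for i
  proof (cases "trm (fib P i) = trm (fib R i)")
    case True
    have "fib P i * fib P i = fib P i" "adj (fib P i) = fib P i" "fib R i * fib R i = fib R i" "adj (fib R i) = fib R i"
      using P R by (metis times_fam.rep_eq star_fam.rep_eq)+
    then show ?thesis using projections_equiv[of "fib P i" "dm i" "fib R i"] True by auto
  qed (use one_carrier_mat in blast)
  then obtain Z where Z: "\<And>i. Z i \<in> carrier_mat (dm i) (dm i)"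
    "\<And>i. trm (fib P i) = trm (fib R i) \<Longrightarrow> adj (Z i) * Z i = fib P i \<and> Z i * adj (Z i) = fib R i"
    "\<And>i. trm (fib P i) \<noteq> trm (fib R i) \<Longrightarrow> Z i = 1\<^sub>m (dm i)" by metis
  have fZ: "fib (Fam Z) i = Z i" for i using Z(1) by (subst Fam_inverse) auto
  obtain B where B: "B > 0" "\<forall>i. fn P i \<le> B" using bd_pos[OF P(1)] by blast
  have "fn (Fam Z) i \<le> max 1 B" for i
  proof (cases "trm (fib P i) = trm (fib R i)")
    case True
    then have "fn (star (Fam Z) * Fam Z) i = fn P i" using Z(2) by (simp add: fn_def fibs fZ)
    then have "(fn (Fam Z) i)\<^sup>2 = fn P i" by (simp add: fn_cstar)
    moreover have "fn P i * fn P i = fn P i" using fn_cstar[of P i] P by (simp add: power2_eq_square)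
    ultimately have "(fn (Fam Z) i)\<^sup>2 \<le> 1\<^sup>2" by auto
    then have "fn (Fam Z) i \<le> 1" by (rule power2_le_imp_le) simp
    then show ?thesis by simp
  next
    case False
    then show ?thesis using Z(3) by (simp add: fn_def fZ op_norm_one dm_pos)
  qed
  then have bZ: "bd (Fam Z)" unfolding bd_def by blast
  have "nl (star (Fam Z) * Fam Z - P)" unfolding nl_def
  proof (intro allI impI)
    fix e :: real assume "e > 0"
    show "\<forall>\<^sub>F i in cofinite. fn (star (Fam Z) * Fam Z - P) i \<le> e" using ev
    proof eventually_elim
      fix i assume "trm (fib P i) = trm (fib R i)"
      then have "fib (star (Fam Z) * Fam Z - P) i = fib (P - P) i" using Z(2) by (simp add: fibs fZ)
      then have "fn (star (Fam Z) * Fam Z - P) i = 0" unfolding fn_def using fn_zero[of i] by (simp add: fn_def)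
      then show "fn (star (Fam Z) * Fam Z - P) i \<le> e" using \<open>e > 0\<close> by simp
    qed
  qed
  moreover have "nl (Fam Z * star (Fam Z) - R)" unfolding nl_def
  proof (intro allI impI)
    fix e :: real assume "e > 0"
    show "\<forall>\<^sub>F i in cofinite. fn (Fam Z * star (Fam Z) - R) i \<le> e" using ev
    proof eventually_elim
      fix i assume "trm (fib P i) = trm (fib R i)"
      then have "fib (Fam Z * star (Fam Z) - R) i = fib (R - R) i" using Z(2) by (simp add: fibs fZ)
      then have "fn (Fam Z * star (Fam Z) - R) i = 0" unfolding fn_def using fn_zero[of i] by (simp add: fn_def)
      then show "fn (Fam Z * star (Fam Z) - R) i \<le> e" using \<open>e > 0\<close> by simp
    qed
  qed
  ultimately show ?thesis using bZ P R
    by (intro exI[of _ "qc (Fam Z)"]) (simp add: qc_star qc_mult bd_star bd_mult qc_eq_iff)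
qed

section \<open>Moving the spectrum of a normal element\<close>

definition isproj :: "q \<Rightarrow> bool" where "isproj p \<longleftrightarrow> star p = p \<and> p * p = p"
definition isunit :: "q \<Rightarrow> bool" where "isunit w \<longleftrightarrow> star w * w = 1 \<and> w * star w = 1"
definition qnormal :: "q \<Rightarrow> bool" where "qnormal x \<longleftrightarrow> star x * x = x * star x"

lemma norm_same_cstar: "star a * a = star b * b \<Longrightarrow> norm a = norm (b :: q)"
proof -
  assume "star a * a = star b * b"
  then have "(norm a)\<^sup>2 = (norm b)\<^sup>2" unfolding norm_cstar[symmetric] by (rule arg_cong)
  then show ?thesis by simp
qed

lemma isunitD:
  assumes "isunit w"
  shows "star w * w = 1" "w * star w = 1" "star w * (w * y) = y" "w * (star w * y) = y"
  using assms by (simp_all add: isunit_def mult.assoc[symmetric])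

lemma norm_unit_mult: "isunit w \<Longrightarrow> norm (w * y) = norm y"
  by (rule norm_same_cstar) (simp add: isunitD star_mult mult.assoc)

lemma norm_mult_le: "norm (a::q) \<le> A \<Longrightarrow> norm b \<le> B \<Longrightarrow> norm (a * b) \<le> A * B"
  by (rule order_trans[OF norm_mult_ineq mult_mono]) (auto intro: order_trans[OF norm_ge_zero])

lemma isunit_norm: "isunit w \<Longrightarrow> norm w = 1"
  using norm_unit_mult[of w 1] by simp

lemma isproj_norm: "isproj p \<Longrightarrow> norm p \<le> 1"
proof -
  assume "isproj p"
  then have "(norm p)\<^sup>2 = norm p" using norm_cstar[of p] by (simp add: isproj_def)
  then show ?thesis by (auto simp: power2_eq_square)
qed

lemma qnormal_shift: "qnormal (x - sc l) \<longleftrightarrow> qnormal x"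
proof -
  have "star (x - sc l) * (x - sc l) - (x - sc l) * star (x - sc l) = star x * x - x * star x"
    using sc_comm[of x "cnj l"] sc_comm[of "star x" l] by (simp add: star_diff star_sc left_diff_distrib right_diff_distrib flip: sc_mult) (simp add: mult.commute)
  then show ?thesis unfolding qnormal_def by (metis eq_iff_diff_eq_0)
qed

lemma commute_star: "star z = z \<Longrightarrow> z * x = x * z \<Longrightarrow> z * star x = star x * (z :: 'a :: star_ring)"
  by (metis star_mult)

lemma lb_cont: "continuous_on UNIV f \<Longrightarrow> lb S f"
  using lb_continuous[OF closed_UNIV, of f] unfolding lb_def by blast

section \<open>Polar form of a normal element and holes in its spectrum\<close>

definition rf :: "(real \<Rightarrow> real) \<Rightarrow> complex \<Rightarrow> complex" where "rf g z = complex_of_real (g (Re z))"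

lemma continuous_Re_comp: "continuous_on UNIV g \<Longrightarrow> continuous_on S (\<lambda>z. g (Re z))"
  using continuous_on_compose2[of UNIV g S Re] by (simp add: continuous_on_Re)

lemma rf_cont: "continuous_on UNIV g \<Longrightarrow> continuous_on S (rf g)"
  unfolding rf_def by (intro continuous_on_of_real continuous_Re_comp)

lemma rf_lb: "continuous_on UNIV g \<Longrightarrow> lb S (rf g)"
  by (rule lb_cont[OF rf_cont])

lemma rf_mult: "(\<lambda>z. rf f z * rf g z) = rf (\<lambda>t. f t * g t)" by (simp add: rf_def fun_eq_iff)
lemma rf_cnj: "(\<lambda>z. cnj (rf f z)) = rf f" by (simp add: rf_def fun_eq_iff)

definition clip :: "real \<Rightarrow> real \<Rightarrow> real \<Rightarrow> real" where "clip a b t = max a (min b t)"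

lemma clip_cont[continuous_intros]: "continuous_on S f \<Longrightarrow> continuous_on S (\<lambda>x. clip a b (f x))"
  unfolding clip_def by (intro continuous_intros)

text \<open>Conjugation by the polar factor turns \<open>star x * x\<close> into
  \<open>x * star x\<close>. For normal \<open>x\<close> the two are equal, so the factor commutes
  with \<open>star x * x\<close> and with continuous functions of it.\<close>

lemma normal_polar:
  assumes n: "qnormal x"
  shows "\<exists>w \<phi>. isunit w \<and> calc NN (star x * x) \<phi> \<and> x = w * \<phi> rt \<and>
     (\<forall>f. continuous_on NN f \<longrightarrow> w * \<phi> f = \<phi> f * w)"
proof -
  obtain W \<phi> where W: "star W * W = 1" "W * star W = 1" "calc NN (star x * x) \<phi>" "x = qc W * \<phi> rt"
    using polar_lift[of x] by blast
  note c = W(3)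
  have bW: "bd W" using W(1) by (rule bd_unitary)
  let ?w = "qc W"
  have u: "isunit ?w" using W bW by (simp add: isunit_def qc_star qc_mult bd_star qc_one)
  have lr: "lb NN rt" by (rule lb_cont[OF rt_continuous])
  have "(\<lambda>z. cnj (rt z)) = rt" by (simp add: rt_def fun_eq_iff)
  then have sr: "star (\<phi> rt) = \<phi> rt" using calc_star[OF c lr] by simp
  have rr: "\<phi> rt * \<phi> rt = star x * x"
  proof -
    have "\<phi> rt * \<phi> rt = \<phi> (\<lambda>z. rt z * rt z)" using calc_mult[OF c lr lr] by simp
    also have "\<dots> = \<phi> (\<lambda>z. z)"
      by (rule calc_cong[OF c]) (auto simp: NN_def rt_def complex_eq_iff simp flip: of_real_mult)
    finally show ?thesis by (simp add: calc_id[OF c])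
  qed
  have "star x * x = x * star x" using n by (simp add: qnormal_def)
  also have "\<dots> = ?w * (\<phi> rt * \<phi> rt) * star ?w" by (subst (1 2) W(4)) (simp add: star_mult sr mult.assoc)
  also have "\<dots> = ?w * (star x * x) * star ?w" unfolding rr ..
  finally have "star x * x * ?w = ?w * (star x * x) * (star ?w * ?w)" by (metis mult.assoc)
  then have "?w * (star x * x) = (star x * x) * ?w" using u by (simp add: isunit_def)
  then have "?w * \<phi> f = \<phi> f * ?w" if "continuous_on NN f" for f
    by (intro calc_commute[OF c closed_NN that]) (simp_all add: star_mult)
  then show ?thesis using u W by blast
qed

text \<open>In the polar form of \<open>x - l\<close> the modulus is replaced by its maximum with
  \<open>t\<close>. The last clause is locality: a \<open>z\<close> commuting with \<open>x\<close>,
  on whose range \<open>x - l\<close> is bounded below by more than \<open>t\<close>, does not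
  notice the change.\<close>

lemma punch_step:
  assumes n: "qnormal x" and t: "t > 0"
  shows "\<exists>x'. qnormal x' \<and> norm (x' - x) \<le> t \<and> (\<forall>y. t * norm y \<le> norm ((x' - sc l) * y)) \<and>
    (\<forall>z. star z = z \<longrightarrow> z * x = x * z \<longrightarrow> (\<exists>t'>t. \<forall>y. t' * norm (z * y) \<le> norm ((x - sc l) * (z * y))) \<longrightarrow>
       (x' - x) * z = 0 \<and> z * (x' - x) = 0)"
proof -
  let ?c = "x - sc l"
  obtain w \<phi> where w: "isunit w" "calc NN (star ?c * ?c) \<phi>" "?c = w * \<phi> rt"
     "\<And>f. continuous_on NN f \<Longrightarrow> w * \<phi> f = \<phi> f * w"
    using normal_polar[of ?c] n qnormal_shift by blast
  note c = w(2)
  \<comment> \<open>\<open>d\<close> is the increment of the modulus, \<open>m\<close> the new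
    modulus, \<open>i\<close> its inverse, and \<open>e\<close> the modulus truncated at
    \<open>t\<close>, which equals the modulus wherever \<open>d\<close> is nonzero.\<close>
  define d where "d = rf (\<lambda>s. max 0 (t - sqrt s))"
  define m where "m = rf (\<lambda>s. max (sqrt s) t)"
  define i where "i = rf (\<lambda>s. 1 / max (sqrt s) t)"
  define e where "e = rf (\<lambda>s. min (sqrt s) t)"
  have rt: "rt = rf sqrt" by (simp add: rt_def rf_def fun_eq_iff)
  have cont: "continuous_on S d" "continuous_on S m" "continuous_on S i" "continuous_on S e" "continuous_on S rt" for S
    unfolding d_def m_def i_def e_def rt using t by (auto intro!: rf_cont continuous_intros)
  have lbs: "lb NN d" "lb NN m" "lb NN i" "lb NN e" "lb NN rt" using cont lb_cont by blast+
  have sm: "star (\<phi> m) = \<phi> m" using calc_star[OF c lbs(2)] unfolding m_def rf_cnj .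
  define x' where "x' = x + w * \<phi> d"
  have rd: "\<phi> rt + \<phi> d = \<phi> m"
    using calc_add[OF c lbs(5) lbs(1)] calc_cong[OF c, of "\<lambda>z. rt z + d z" m]
    by (auto simp: rt rf_def d_def m_def simp flip: of_real_add)
  have x'l: "x' - sc l = w * \<phi> m"
  proof -
    have "x' - sc l = ?c + w * \<phi> d" by (simp add: x'_def)
    also have "\<dots> = w * \<phi> m" by (subst w(3)) (simp add: rd[symmetric] distrib_left)
    finally show ?thesis .
  qed
  have "qnormal (w * \<phi> m)"
  proof -
    have 1: "star (w * \<phi> m) * (w * \<phi> m) = \<phi> m * \<phi> m"
      using w(1) sm by (simp add: isunit_def star_mult mult.assoc) (metis mult.assoc mult_1)
    have "(w * \<phi> m) * star (w * \<phi> m) = \<phi> m * (w * star w) * \<phi> m"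
      using w(4)[OF cont(2)] sm by (simp add: star_mult) (metis mult.assoc star_mult)
    then show ?thesis using 1 w(1) by (simp add: qnormal_def isunit_def)
  qed
  then have nx': "qnormal x'" using x'l qnormal_shift[of x' l] by simp
  have nd: "norm (\<phi> d) \<le> t" using t by (intro calc_norm[OF c]) (auto simp: d_def rf_def NN_def)
  then have near: "norm (x' - x) \<le> t" using norm_unit_mult[OF w(1)] by (simp add: x'_def)
  have low: "t * norm y \<le> norm ((x' - sc l) * y)" for y
  proof -
    have "norm (\<phi> i) \<le> 1 / t" using t by (intro calc_norm[OF c]) (auto simp: i_def rf_def norm_divide divide_simps)
    moreover have "y = \<phi> i * (\<phi> m * y)"
    proof -
      have "\<phi> i * \<phi> m = \<phi> (\<lambda>z. i z * m z)" using calc_mult[OF c lbs(3,2)] by simp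
      also have "\<dots> = \<phi> (\<lambda>z. 1)" using t by (intro calc_cong[OF c]) (auto simp: i_def m_def rf_def max_def)
      finally show ?thesis by (simp add: calc_one[OF c] mult.assoc[symmetric])
    qed
    ultimately have "norm y \<le> 1 / t * norm (\<phi> m * y)" using norm_mult_le[of "\<phi> i" "1/t" "\<phi> m * y"] by simp
    then show ?thesis using t unfolding x'l by (simp add: mult.assoc norm_unit_mult[OF w(1)] field_simps)
  qed
  have loc: "(x' - x) * z = 0 \<and> z * (x' - x) = 0"
    if z: "star z = z" "z * x = x * z" and t': "t' > t" "\<And>y. t' * norm (z * y) \<le> norm (?c * (z * y))" for z t'
  proof -
    have zc: "z * ?c = ?c * z" using z(2) sc_comm[of z l] by (simp add: left_diff_distrib right_diff_distrib)
    have zsc: "z * star ?c = star ?c * z" by (rule commute_star[OF z(1) zc])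
    have "z * (star ?c * ?c) = star ?c * ?c * z" using zc zsc by (metis mult.assoc)
    then have zd: "z * \<phi> d = \<phi> d * z"
      by (intro calc_commute[OF c closed_NN cont(1)]) (simp_all add: star_mult)
    let ?u = "z * \<phi> d"
    \<comment> \<open>On the support of \<open>d\<close> the modulus is at most \<open>t\<close>, on
      the range of \<open>z\<close> it is at least \<open>t' > t\<close>; so the product of the two
      vanishes.\<close>
    have "norm (?c * ?u) = norm (\<phi> rt * ?u)" by (subst w(3)) (simp add: mult.assoc norm_unit_mult[OF w(1)])
    also have "\<phi> rt * ?u = \<phi> e * ?u"
    proof -
      have "\<phi> rt * \<phi> d = \<phi> (\<lambda>z. rt z * d z)" using calc_mult[OF c lbs(5,1)] by simp
      also have "\<dots> = \<phi> (\<lambda>z. e z * d z)" by (rule calc_cong[OF c]) (auto simp: rt e_def d_def rf_def)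
      also have "\<dots> = \<phi> e * \<phi> d" using calc_mult[OF c lbs(4,1)] by simp
      finally show ?thesis unfolding zd by (simp add: mult.assoc[symmetric])
    qed
    also have "norm (\<phi> e * ?u) \<le> t * norm ?u"
      by (intro norm_mult_le calc_norm[OF c]) (use t in \<open>auto simp: e_def rf_def NN_def\<close>)
    finally have "t' * norm ?u \<le> t * norm ?u" using t'(2)[of "\<phi> d"] by linarith
    then have u0: "?u = 0" using t'(1) by (auto simp: mult_le_cancel_right)
    have "(x' - x) * z = w * (\<phi> d * z)" by (simp add: x'_def mult.assoc)
    moreover have "z * (x' - x) = z * \<phi> d * w" using w(4)[OF cont(1)] by (simp add: x'_def mult.assoc)
    ultimately show ?thesis using u0 zd by simp
  qed
  show ?thesis using nx' near low loc by (intro exI[of _ x']) blast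
qed

lemma punch:
  assumes "finite L" "qnormal x" "e > 0" "d > 0"
  shows "\<exists>x' r. qnormal x' \<and> r > 0 \<and> norm (x' - x) \<le> e \<and> (\<forall>l\<in>L. \<forall>y. r * norm y \<le> norm ((x' - sc l) * y)) \<and>
    (\<forall>z. star z = z \<longrightarrow> z * x = x * z \<longrightarrow> (\<forall>l\<in>L. \<forall>y. d * norm (z * y) \<le> norm ((x - sc l) * (z * y))) \<longrightarrow>
       (x' - x) * z = 0 \<and> z * (x' - x) = 0)"
  using assms
proof (induction L arbitrary: e rule: finite_induct)
  case empty
  then show ?case by (intro exI[of _ x] exI[of _ 1]) auto
next
  case (insert l L)
  have "e / 2 > 0" using insert.prems by simp
  from insert.IH[OF insert.prems(1) this insert.prems(3)] obtain x1 r where x1: "qnormal x1" "r > 0" "norm (x1 - x) \<le> e / 2"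
    "\<And>l y. l \<in> L \<Longrightarrow> r * norm y \<le> norm ((x1 - sc l) * y)"
    "\<And>z. star z = z \<Longrightarrow> z * x = x * z \<Longrightarrow> (\<forall>l\<in>L. \<forall>y. d * norm (z * y) \<le> norm ((x - sc l) * (z * y))) \<Longrightarrow>
       (x1 - x) * z = 0 \<and> z * (x1 - x) = 0" by blast
  \<comment> \<open>The bound \<open>r / 2\<close> preserves half of the holes already made around
    \<open>L\<close>; the bound \<open>d / 2\<close> keeps \<open>t\<close> below the distance
    \<open>d\<close> of the locality clause.\<close>
  define t where "t = min (e / 2) (min (r / 2) (d / 2))"
  have t: "t > 0" "t \<le> e / 2" "t \<le> r / 2" "t < d" using insert.prems x1(2) by (auto simp: t_def)
  obtain x' where x': "qnormal x'" "norm (x' - x1) \<le> t" "\<And>y. t * norm y \<le> norm ((x' - sc l) * y)"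
    "\<And>z. star z = z \<Longrightarrow> z * x1 = x1 * z \<Longrightarrow> (\<exists>t'>t. \<forall>y. t' * norm (z * y) \<le> norm ((x1 - sc l) * (z * y))) \<Longrightarrow>
       (x' - x1) * z = 0 \<and> z * (x' - x1) = 0"
    using punch_step[OF x1(1) t(1), of l] by blast
  have "norm (x' - x) \<le> e" using norm_triangle_ineq[of "x' - x1" "x1 - x"] x'(2) x1(3) t by simp
  moreover have "t * norm y \<le> norm ((x' - sc k) * y)" if "k \<in> insert l L" for k y
  proof (cases "k = l")
    case False
    then have k: "k \<in> L" using that by simp
    have "norm ((x1 - sc k) * y) \<le> norm ((x' - sc k) * y) + norm ((x' - x1) * y)"
      using norm_triangle_ineq4[of "(x' - sc k) * y" "(x' - x1) * y"] by (simp add: algebra_simps)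
    moreover have "norm ((x' - x1) * y) \<le> (r / 2) * norm y" using x'(2) t by (intro norm_mult_le) auto
    ultimately have "(r / 2) * norm y \<le> norm ((x' - sc k) * y)" using x1(4)[OF k, of y] by (simp add: algebra_simps)
    moreover have "t * norm y \<le> (r / 2) * norm y" using t by (intro mult_right_mono) auto
    ultimately show ?thesis by linarith
  qed (use x'(3) in simp)
  moreover have "(x' - x) * z = 0 \<and> z * (x' - x) = 0"
    if z: "star z = z" "z * x = x * z" "\<forall>l\<in>insert l L. \<forall>y. d * norm (z * y) \<le> norm ((x - sc l) * (z * y))" for z
  proof -
    have 1: "(x1 - x) * z = 0" "z * (x1 - x) = 0" using x1(5)[OF z(1,2)] z(3) by auto
    then have e: "x1 * z = x * z" "z * x1 = z * x" by (simp_all add: algebra_simps)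
    have "(x1 - sc l) * (z * y) = (x - sc l) * (z * y)" for y
      using e(1) by (simp add: left_diff_distrib mult.assoc[symmetric])
    then have "(x' - x1) * z = 0 \<and> z * (x' - x1) = 0" using z t(4) e by (intro x'(4)) auto
    then show ?thesis using 1 by (simp add: algebra_simps)
  qed
  ultimately show ?case using x'(1) t(1) by (intro exI[of _ x'] exI[of _ t]) blast
qed

section \<open>Almost commuting projections for a normal element\<close>

text \<open>\<open>om\<close> wraps the interval \<open>[-1, 1]\<close> around the circle with both ends at \<open>1\<close>; \<open>arho\<close> is its inverse.\<close>

definition arho :: "complex \<Rightarrow> real" where "arho \<zeta> = Arg (- \<zeta>) / pi"
definition om :: "real \<Rightarrow> complex" where "om r = - cis (pi * r)"

lemma arho_om: "- 1 < r \<Longrightarrow> r \<le> 1 \<Longrightarrow> arho (om r) = r"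
proof -
  assume r: "- 1 < r" "r \<le> 1"
  have "pi * (- 1) < pi * r" "pi * r \<le> pi * 1" using r by (intro mult_strict_left_mono mult_left_mono; simp)+
  then have "Arg (cis (pi * r)) = pi * r" by (intro cis_Arg_unique) (simp_all add: sgn_eq)
  then show ?thesis by (simp add: arho_def om_def)
qed

lemma om_circle: "om r \<in> sphere 0 1" by (simp add: om_def dist_norm)

lemma arho_ge_half: "0 < Re \<zeta> \<Longrightarrow> 1/2 \<le> \<bar>arho \<zeta>\<bar>"
proof (rule ccontr)
  assume r: "0 < Re \<zeta>" and "\<not> 1/2 \<le> \<bar>arho \<zeta>\<bar>"
  then have "\<bar>Arg (- \<zeta>)\<bar> < pi / 2" by (simp add: arho_def abs_divide field_simps)
  then have "0 < cos (Arg (- \<zeta>))" by (intro cos_gt_zero_pi) auto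
  moreover have "- \<zeta> \<noteq> 0" using r by auto
  then have "Re (- \<zeta>) = cmod \<zeta> * cos (Arg (- \<zeta>))" by (subst Arg_eq) (auto simp: Re_exp)
  ultimately have "0 \<le> Re (- \<zeta>)" by simp
  then show False using r by simp
qed

lemma continuous_on_arho: "continuous_on (sphere 0 1 - {1}) arho"
proof -
  have "continuous_on (sphere 0 1 - {1}) (\<lambda>x. Arg (- x))"
  proof (intro continuous_at_imp_continuous_on ballI)
  fix \<zeta> :: complex assume z: "\<zeta> \<in> sphere 0 1 - {1}"
  have "- \<zeta> \<notin> \<real>\<^sub>\<le>\<^sub>0"
  proof
    assume "- \<zeta> \<in> \<real>\<^sub>\<le>\<^sub>0"
    then obtain r where r: "- \<zeta> = complex_of_real r" "r \<le> 0" unfolding nonpos_Reals_def by blast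
    then have "\<zeta> = complex_of_real (- r)" by (metis minus_equation_iff of_real_minus)
    then show False using z r by (auto simp: dist_norm)
  qed
  then show "isCont (\<lambda>x. Arg (- x)) \<zeta>"
    using continuous_at_Arg[of "- \<zeta>"] by (intro isCont_o2[where f = uminus and g = Arg]) auto
  qed
  then show ?thesis unfolding arho_def by (intro continuous_on_divide) auto
qed

lemma continuous_on_circle_extend:
  fixes k :: "complex \<Rightarrow> complex"
  assumes "continuous_on (sphere 0 1 - {1}) k" "\<And>\<zeta>. 0 < Re \<zeta> \<Longrightarrow> k \<zeta> = 0"
  shows "continuous_on (sphere 0 1) k"
proof -
  let ?A = "sphere 0 1 \<inter> {\<zeta>. Re \<zeta> \<le> 1/2}" and ?B = "sphere 0 1 \<inter> {\<zeta>. 1/2 \<le> Re \<zeta>}"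
  have "continuous_on ?A k" by (rule continuous_on_subset[OF assms(1)]) auto
  moreover have "continuous_on ?B k"
    by (subst continuous_on_cong[OF refl, of ?B k "\<lambda>z. 0"]) (use assms(2) in auto)
  ultimately have "continuous_on (?A \<union> ?B) k"
    by (rule continuous_on_closed_Un[rotated 2]) (intro closed_Int closed_sphere closed_halfspace_Re_le closed_halfspace_Re_ge)+
  moreover have "?A \<union> ?B = sphere 0 1" by auto
  ultimately show ?thesis by metis
qed

text \<open>\<open>F\<close> vanishes for large \<open>r\<close>, hence
  \<open>F (arho \<zeta>)\<close> vanishes on the open right half of the circle by
  \<open>arho_ge_half\<close>. This covers both the jump of \<open>arho\<close> and the zero of
  \<open>1 - \<zeta>\<close>.\<close>

lemma loop_function_continuous:
  assumes F: "continuous_on UNIV F" "\<And>r. 1/2 \<le> \<bar>r\<bar> \<Longrightarrow> F r = (0::real)"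
  shows "continuous_on (sphere 0 1) (\<lambda>\<zeta>. complex_of_real (F (arho \<zeta>)))"
    "continuous_on (sphere 0 1) (\<lambda>\<zeta>. complex_of_real (F (arho \<zeta>)) / (1 - \<zeta>))"
proof -
  have c: "continuous_on (sphere 0 1 - {1}) (\<lambda>\<zeta>. complex_of_real (F (arho \<zeta>)))"
    by (intro continuous_intros continuous_on_compose2[OF F(1) continuous_on_arho]) auto
  then show "continuous_on (sphere 0 1) (\<lambda>\<zeta>. complex_of_real (F (arho \<zeta>)))"
    by (rule continuous_on_circle_extend) (use F(2) arho_ge_half in auto)
  have "continuous_on (sphere 0 1 - {1}) (\<lambda>\<zeta>. complex_of_real (F (arho \<zeta>)) / (1 - \<zeta>))"
    by (intro continuous_intros c) auto
  then show "continuous_on (sphere 0 1) (\<lambda>\<zeta>. complex_of_real (F (arho \<zeta>)) / (1 - \<zeta>))"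
    by (rule continuous_on_circle_extend) (use F(2) arho_ge_half in auto)
qed

text \<open>A trapezoid around \<open>c\<close>: equal to 1 up to distance
  \<open>h / 2 - 2 * d\<close> and to 0 from distance \<open>h / 2 - d\<close> on, so that
  neighbours on a grid of mesh \<open>h\<close> have disjoint supports.\<close>

definition tri :: "real \<Rightarrow> real \<Rightarrow> real \<Rightarrow> real \<Rightarrow> real" where
  "tri h d c t = clip 0 1 ((h / 2 - d - \<bar>t - c\<bar>) / d)"

lemma tri_range: "0 \<le> tri h d c t" "tri h d c t \<le> 1" by (auto simp: tri_def clip_def)
lemma tri_one: "d > 0 \<Longrightarrow> \<bar>t - c\<bar> \<le> h / 2 - 2 * d \<Longrightarrow> tri h d c t = 1"
  by (simp add: tri_def clip_def max_def min_def field_simps)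
lemma tri_nonzero: "d > 0 \<Longrightarrow> tri h d c t \<noteq> 0 \<Longrightarrow> \<bar>t - c\<bar> < h / 2 - d"
proof (rule ccontr)
  assume d: "d > 0" and n: "tri h d c t \<noteq> 0" and "\<not> \<bar>t - c\<bar> < h / 2 - d"
  then have "(h / 2 - d - \<bar>t - c\<bar>) / d \<le> 0" by (intro divide_nonpos_pos) auto
  then show False using n by (simp add: tri_def clip_def)
qed
lemma tri_cont: "d > 0 \<Longrightarrow> continuous_on S f \<Longrightarrow> continuous_on S (\<lambda>x. tri h d c (f x))"
  unfolding tri_def by (intro continuous_intros) auto

lemma grid_sep: "h > 0 \<Longrightarrow> k \<noteq> l \<Longrightarrow> h \<le> \<bar>real_of_int k * h - real_of_int l * h\<bar>"
proof -
  assume h: "h > 0" and "k \<noteq> l"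
  then have "1 \<le> \<bar>real_of_int k - real_of_int l\<bar>" by linarith
  then have "1 * h \<le> \<bar>real_of_int k - real_of_int l\<bar> * h" using h by (intro mult_right_mono) auto
  then show ?thesis using h by (simp add: abs_mult left_diff_distrib[symmetric])
qed

lemma tri_disjoint:
  assumes "h > 0" "d > 0" "k \<noteq> l"
  shows "tri h d (real_of_int k * h) t * tri h d (real_of_int l * h) t = 0"
proof (rule ccontr)
  assume "tri h d (real_of_int k * h) t * tri h d (real_of_int l * h) t \<noteq> 0"
  then have "\<bar>t - real_of_int k * h\<bar> < h / 2 - d" "\<bar>t - real_of_int l * h\<bar> < h / 2 - d"
    using tri_nonzero assms by auto
  then show False using grid_sep[OF assms(1,3)] assms(2) by linarith
qed

lemma sqrt_diff_le: "0 \<le> a \<Longrightarrow> 0 \<le> b \<Longrightarrow> \<bar>sqrt a - sqrt b\<bar> \<le> sqrt \<bar>a - b\<bar>"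
proof -
  have le: "sqrt a \<le> sqrt b + sqrt \<bar>a - b\<bar>" if "0 \<le> b" for a b
    using sqrt_add_le_add_sqrt[of b "\<bar>a - b\<bar>"] that real_sqrt_le_mono[of a "b + \<bar>a - b\<bar>"] by linarith
  assume "0 \<le> a" "0 \<le> b"
  then show ?thesis using le[of b a] le[of a b] by (simp add: abs_minus_commute)
qed

text \<open>Where the unit circle meets the boundary lines of the square cells of side
  \<open>1 / N\<close> centred at the multiples of \<open>1 / N\<close>.\<close>

definition gridY :: "nat \<Rightarrow> complex set" where
  "gridY N = {y. cmod y = 1 \<and> (\<exists>k\<in>{- int N..<int N}. Re y = (real_of_int k + 1/2) / real N \<or> Im y = (real_of_int k + 1/2) / real N)}"

lemma finite_gridY: "finite (gridY N)"
proof -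
  let ?a = "\<lambda>k. (real_of_int k + 1/2) / real N"
  let ?s = "\<lambda>k. sqrt (1 - (?a k)\<^sup>2)"
  have "gridY N \<subseteq> (\<Union>k\<in>{- int N..<int N}. {Complex (?a k) (?s k), Complex (?a k) (- ?s k), Complex (?s k) (?a k), Complex (- ?s k) (?a k)})"
  proof
    fix y assume "y \<in> gridY N"
    then obtain k where k: "k \<in> {- int N..<int N}" "cmod y = 1" "Re y = ?a k \<or> Im y = ?a k" by (auto simp: gridY_def)
    have s: "(Re y)\<^sup>2 + (Im y)\<^sup>2 = 1" using k(2) by (simp add: cmod_def)
    have q: "v = sqrt (1 - u\<^sup>2) \<or> v = - sqrt (1 - u\<^sup>2)" if "u\<^sup>2 + v\<^sup>2 = 1" for u v :: real
    proof -
      have "1 - u\<^sup>2 = v\<^sup>2" using that by simp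
      then have "sqrt (1 - u\<^sup>2) = \<bar>v\<bar>" by simp
      then show ?thesis by auto
    qed
    from k(3) have "y \<in> {Complex (?a k) (?s k), Complex (?a k) (- ?s k), Complex (?s k) (?a k), Complex (- ?s k) (?a k)}"
    proof
      assume "Re y = ?a k"
      then show ?thesis using q[OF s] by (auto simp: complex_eq_iff)
    next
      assume "Im y = ?a k"
      then show ?thesis using q[of "Im y" "Re y"] s by (auto simp: complex_eq_iff add.commute)
    qed
    then show "y \<in> (\<Union>k\<in>{- int N..<int N}. {Complex (?a k) (?s k), Complex (?a k) (- ?s k), Complex (?s k) (?a k), Complex (- ?s k) (?a k)})"
      using k(1) by blast
  qed
  then show ?thesis by (rule finite_subset) simp
qed

text \<open>The square root is the price of near tangency: where the circle runs almost parallel to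
  the grid line, a small change of the real part can change the imaginary part by its square
  root.\<close>

lemma grid_near_Re:
  assumes N: "N > 0" and d: "0 < d" "4 * d < 1 / real N" and z: "cmod z = 1"
    and k: "\<bar>Re z - (real_of_int k + 1/2) / real N\<bar> \<le> 2 * d"
  shows "\<exists>y. cmod y = 1 \<and> k \<in> {- int N..<int N} \<and> Re y = (real_of_int k + 1/2) / real N \<and> cmod (z - y) \<le> 2 * d + 2 * sqrt d"
proof -
  define a where "a = (real_of_int k + 1/2) / real N"
  have rz: "\<bar>Re z\<bar> \<le> 1" using abs_Re_le_cmod[of z] z by simp
  have "\<bar>a\<bar> < 1 + 1 / (2 * real N)" using k rz d unfolding a_def[symmetric] by (simp add: field_simps)
  then have "\<bar>a\<bar> * real N < real N + 1/2" using N by (simp add: field_simps)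
  moreover have "\<bar>a\<bar> * real N = \<bar>real_of_int k + 1/2\<bar>" using N by (simp add: a_def abs_divide)
  ultimately have kk: "\<bar>real_of_int k + 1/2\<bar> < real N + 1/2" by simp
  then have kI: "k \<in> {- int N..<int N}" by (simp add: abs_less_iff)
  then have "\<bar>real_of_int k + 1/2\<bar> \<le> real N" by (simp add: abs_le_iff)
  then have a1: "\<bar>a\<bar> \<le> 1" using N by (simp add: a_def abs_divide)
  then have a2: "a\<^sup>2 \<le> 1" by (simp add: abs_square_le_1)
  have s: "(Re z)\<^sup>2 + (Im z)\<^sup>2 = 1" using z by (simp add: cmod_def)
  define y where "y = Complex a (if 0 \<le> Im z then sqrt (1 - a\<^sup>2) else - sqrt (1 - a\<^sup>2))"
  have y1: "cmod y = 1" using a2 by (simp add: y_def cmod_def)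
  have iz: "\<bar>Im z\<bar> = sqrt (1 - (Re z)\<^sup>2)"
  proof -
    have "1 - (Re z)\<^sup>2 = (Im z)\<^sup>2" using s by simp
    then show ?thesis by simp
  qed
  have "\<bar>Im z - Im y\<bar> = \<bar>sqrt (1 - (Re z)\<^sup>2) - sqrt (1 - a\<^sup>2)\<bar>"
    using iz by (auto simp: y_def)
  also have "\<dots> \<le> sqrt \<bar>(1 - (Re z)\<^sup>2) - (1 - a\<^sup>2)\<bar>"
    using a2 rz by (intro sqrt_diff_le) (auto simp: abs_square_le_1)
  also have "\<bar>(1 - (Re z)\<^sup>2) - (1 - a\<^sup>2)\<bar> = \<bar>a + Re z\<bar> * \<bar>Re z - a\<bar>"
    by (simp add: abs_mult[symmetric] power2_eq_square algebra_simps abs_minus_commute)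
  also have "sqrt \<dots> \<le> sqrt (2 * (2 * d))"
    using a1 rz k unfolding a_def[symmetric] by (intro real_sqrt_le_mono mult_mono) auto
  also have "sqrt (2 * (2 * d)) = 2 * sqrt d" using d by (simp add: real_sqrt_mult)
  finally have "\<bar>Im (z - y)\<bar> \<le> 2 * sqrt d" by simp
  moreover have "\<bar>Re (z - y)\<bar> \<le> 2 * d" using k by (simp add: y_def a_def)
  ultimately have "cmod (z - y) \<le> 2 * d + 2 * sqrt d" using cmod_le[of "z - y"] by linarith
  then show ?thesis using y1 kI by (intro exI[of _ y]) (simp add: y_def a_def)
qed

lemma grid_cell_Re:
  assumes N: "N > 0" and d: "0 < d" "4 * d < 1 / real N" and z: "cmod z = 1"
    and far: "\<And>y k. cmod y = 1 \<Longrightarrow> k \<in> {- int N..<int N} \<Longrightarrow> Re y = (real_of_int k + 1/2) / real N \<Longrightarrow> 2 * d + 2 * sqrt d < cmod (z - y)"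
  shows "\<exists>k\<in>{- int N..int N}. \<forall>l. tri (1 / real N) d (real_of_int l * (1 / real N)) (Re z) = (if l = k then 1 else 0)"
proof -
  let ?h = "1 / real N"
  have h: "?h > 0" using N by simp
  define k where "k = round (Re z * real N)"
  have "\<bar>real_of_int k - Re z * real N\<bar> \<le> 1/2" unfolding k_def by (rule of_int_round_abs_le)
  then have "\<bar>real_of_int k - Re z * real N\<bar> * ?h \<le> 1/2 * ?h" using h by (intro mult_right_mono) auto
  moreover have "\<bar>real_of_int k - Re z * real N\<bar> * ?h = \<bar>real_of_int k * ?h - Re z\<bar>"
  proof -
    have "real_of_int k * ?h - Re z = (real_of_int k - Re z * real N) * ?h" using N by (simp add: field_simps)
    then show ?thesis using N by (simp add: abs_mult)
  qed
  ultimately have k1: "\<bar>Re z - real_of_int k * ?h\<bar> \<le> ?h / 2" by (simp add: abs_minus_commute)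
  have nb: "2 * d < \<bar>Re z - (real_of_int l + 1/2) / real N\<bar>" for l
    using grid_near_Re[OF N d z, of l] far by (meson not_less)
  have e1: "(real_of_int k + 1/2) / real N = real_of_int k * ?h + ?h / 2"
    and e2: "(real_of_int (k - 1) + 1/2) / real N = real_of_int k * ?h - ?h / 2"
    using N by (simp_all add: field_simps)
  have k2: "\<bar>Re z - real_of_int k * ?h\<bar> < ?h / 2 - 2 * d"
    using nb[of k] nb[of "k - 1"] k1 unfolding e1 e2 by linarith
  have "\<bar>Re z\<bar> \<le> 1" using abs_Re_le_cmod[of z] z by simp
  moreover have "\<bar>y\<bar> < 1 + h / 2" if "\<bar>x\<bar> \<le> 1" "\<bar>x - y\<bar> < h / 2 - 2 * d" for x y h :: real
    using that d(1) by linarith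
  ultimately have "\<bar>real_of_int k * ?h\<bar> < 1 + ?h / 2" using k2 by blast
  then have "\<bar>real_of_int k\<bar> < real N + 1/2" using N by (simp add: abs_mult field_simps)
  then have "real_of_int k < real_of_int (int N + 1)" "real_of_int (- int N - 1) < real_of_int k" by (simp_all add: abs_less_iff)
  then have kI: "k \<in> {- int N..int N}" by simp
  have "tri ?h d (real_of_int l * ?h) (Re z) = (if l = k then 1 else 0)" for l
  proof (cases "l = k")
    case True then show ?thesis using k2 d by (simp add: tri_one)
  next
    case False
    then have "?h \<le> \<bar>real_of_int l * ?h - real_of_int k * ?h\<bar>" using h by (intro grid_sep) auto
    moreover have "\<not> \<bar>x - v\<bar> < h / 2 - d" if "h \<le> \<bar>v - y\<bar>" "\<bar>x - y\<bar> < h / 2 - 2 * d" for x y v h :: real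
      using that d(1) by linarith
    ultimately have "\<not> \<bar>Re z - real_of_int l * ?h\<bar> < ?h / 2 - d" using k2 by blast
    then show ?thesis using tri_nonzero[OF d(1), of ?h "real_of_int l * ?h" "Re z"] False by auto
  qed
  then show ?thesis using kI by blast
qed

lemma sum_one_nonzero_bound:
  fixes f :: "'a \<Rightarrow> complex"
  assumes "finite J" "\<And>i j. i \<in> J \<Longrightarrow> j \<in> J \<Longrightarrow> i \<noteq> j \<Longrightarrow> f i = 0 \<or> f j = 0" "\<And>i. i \<in> J \<Longrightarrow> cmod (f i) \<le> B" "0 \<le> B"
  shows "cmod (sum f J) \<le> B"
proof (cases "\<forall>i\<in>J. f i = 0")
  case False
  then obtain i where i: "i \<in> J" "f i \<noteq> 0" by blast
  then have "sum f J = sum f {i}" using assms by (intro sum.mono_neutral_right) auto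
  then show ?thesis using assms i by simp
qed (use assms in simp)

text \<open>The exceptional set \<open>Y\<close> does not depend on the resolution \<open>r\<close>, which is only known after the spectrum has
  been moved away from \<open>Y\<close>.\<close>

lemma circle_partition:
  assumes e: "(e::real) > 0"
  shows "\<exists>Y. finite Y \<and> (\<forall>r>0. \<exists>(J :: (int \<times> int) set) c \<mu> \<kappa>. finite J \<and>
     (\<forall>j\<in>J. continuous_on UNIV (c j)) \<and> continuous_on UNIV \<kappa> \<and>
     (\<forall>j\<in>J. \<forall>z. 0 \<le> c j z \<and> c j z \<le> (1::real)) \<and>
     (\<forall>i\<in>J. \<forall>j\<in>J. i \<noteq> j \<longrightarrow> (\<forall>z. c i z * c j z = 0)) \<and>
     (\<forall>z\<in>sphere 0 1. (\<forall>y\<in>Y. r < cmod (z - y)) \<longrightarrow> (\<Sum>j\<in>J. c j z) = 1 \<and> (\<forall>j\<in>J. c j z = 0 \<or> c j z = 1)) \<and>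
     (\<forall>z\<in>sphere 0 1. cmod (\<kappa> z - z) \<le> e) \<and> (\<forall>j\<in>J. \<forall>z. c j z \<noteq> 0 \<longrightarrow> \<kappa> z = \<mu> j)) \<and> (\<forall>y\<in>Y. cmod y = 1)"
proof -
  obtain N :: nat where N: "1 / e < real N" using reals_Archimedean2 by blast
  moreover have "0 < 1 / e" using e by simp
  ultimately have N0: "N > 0" by (intro of_nat_0_less_iff[where 'a = real, THEN iffD1]) linarith
  define h where "h = 1 / real N"
  have h: "h > 0" "h \<le> e" using N N0 e by (auto simp: h_def field_simps)
  have main: "\<exists>(J :: (int \<times> int) set) c \<mu> \<kappa>. finite J \<and>
     (\<forall>j\<in>J. continuous_on UNIV (c j)) \<and> continuous_on UNIV \<kappa> \<and>
     (\<forall>j\<in>J. \<forall>z. 0 \<le> c j z \<and> c j z \<le> (1::real)) \<and>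
     (\<forall>i\<in>J. \<forall>j\<in>J. i \<noteq> j \<longrightarrow> (\<forall>z. c i z * c j z = 0)) \<and>
     (\<forall>z\<in>sphere 0 1. (\<forall>y\<in>gridY N. r < cmod (z - y)) \<longrightarrow> (\<Sum>j\<in>J. c j z) = 1 \<and> (\<forall>j\<in>J. c j z = 0 \<or> c j z = 1)) \<and>
     (\<forall>z\<in>sphere 0 1. cmod (\<kappa> z - z) \<le> e) \<and> (\<forall>j\<in>J. \<forall>z. c j z \<noteq> 0 \<longrightarrow> \<kappa> z = \<mu> j)"
    if r: "r > 0" for r
  proof -
    \<comment> \<open>Makes the transition zones so thin that by \<open>grid_near_Re\<close> they
      lie within \<open>r\<close> of \<open>gridY N\<close>.\<close>
    define d where "d = min (h / 8) (min (r / 8) ((r / 8)\<^sup>2))"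
    have d: "d > 0" "4 * d < h" "2 * d + 2 * sqrt d < r"
    proof -
      show d0: "d > 0" using h r by (simp add: d_def)
      show "4 * d < h" using h by (simp add: d_def min_def)
      have "sqrt d \<le> sqrt ((r / 8)\<^sup>2)" by (rule real_sqrt_le_mono) (simp add: d_def)
      also have "\<dots> = r / 8" using r by simp
      finally have "sqrt d \<le> r / 8" .
      moreover have "d \<le> r / 8" by (simp add: d_def)
      ultimately show "2 * d + 2 * sqrt d < r" using r by linarith
    qed
    let ?I = "{- int N..int N}"
    define c where "c dd j z = tri h dd (real_of_int (fst j) * h) (Re z) * tri h dd (real_of_int (snd j) * h) (Im z)"
      for dd and j :: "int \<times> int" and z :: complex
    define \<mu> where "\<mu> j = Complex (real_of_int (fst j) * h) (real_of_int (snd j) * h)" for j :: "int \<times> int"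
    \<comment> \<open>The wider bumps with parameter \<open>d / 2\<close> are 1 on the supports of
      the bumps with parameter \<open>d\<close>, so there \<open>\<kappa>\<close> collapses to the
      centre \<open>\<mu> j\<close>; elsewhere it interpolates continuously.\<close>
    define \<kappa> where "\<kappa> z = z - (\<Sum>j\<in>?I \<times> ?I. (z - \<mu> j) * complex_of_real (c (d / 2) j z))" for z
    have ccont: "continuous_on UNIV (c dd j)" if "dd > 0" for dd j
      unfolding c_def using that by (intro continuous_intros tri_cont)
    have disj: "c dd i z * c dd j z = 0" if "i \<noteq> j" "dd > 0" for dd i j z
    proof -
      have "fst i \<noteq> fst j \<or> snd i \<noteq> snd j" using that(1) by (auto simp: prod_eq_iff)
      then show ?thesis
        using tri_disjoint[OF h(1) that(2), of "fst i" "fst j" "Re z"] tri_disjoint[OF h(1) that(2), of "snd i" "snd j" "Im z"]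
        by (auto simp: c_def)
    qed
    have cr: "0 \<le> c dd j z \<and> c dd j z \<le> 1" for dd j z
      unfolding c_def using tri_range[of h dd] by (auto intro!: mult_le_one)
    have near: "cmod ((z - \<mu> j) * complex_of_real (c (d / 2) j z)) \<le> h" for z j
    proof (cases "c (d / 2) j z = 0")
      case False
      then have "\<bar>Re z - real_of_int (fst j) * h\<bar> < h / 2 - d / 2" "\<bar>Im z - real_of_int (snd j) * h\<bar> < h / 2 - d / 2"
        using d(1) tri_nonzero[of "d / 2"] by (auto simp: c_def)
      then have "cmod (z - \<mu> j) \<le> h" using cmod_le[of "z - \<mu> j"] d(1) by (simp add: \<mu>_def)
      then have "cmod (z - \<mu> j) * c (d / 2) j z \<le> h * 1" using cr h by (intro mult_mono) auto
      then show ?thesis using cr by (simp add: norm_mult)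
    qed (use h in simp)
    have kap: "cmod (\<kappa> z - z) \<le> e" for z
    proof -
      have "cmod (\<Sum>j\<in>?I \<times> ?I. (z - \<mu> j) * complex_of_real (c (d / 2) j z)) \<le> h"
      proof (rule sum_one_nonzero_bound)
        fix i j :: "int \<times> int" assume "i \<noteq> j"
        then have "c (d/2) i z * c (d/2) j z = 0" using d(1) by (intro disj) auto
        then show "(z - \<mu> i) * complex_of_real (c (d / 2) i z) = 0 \<or> (z - \<mu> j) * complex_of_real (c (d / 2) j z) = 0" by auto
      qed (use near h in auto)
      then show ?thesis using h by (simp add: \<kappa>_def)
    qed
    have kmu: "\<kappa> z = \<mu> j" if j: "j \<in> ?I \<times> ?I" "c d j z \<noteq> 0" for j z
    proof -
      have "\<bar>Re z - real_of_int (fst j) * h\<bar> < h / 2 - d" "\<bar>Im z - real_of_int (snd j) * h\<bar> < h / 2 - d"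
        using j d(1) tri_nonzero[of d] by (auto simp: c_def)
      then have 1: "c (d / 2) j z = 1" using d(1) by (simp add: c_def tri_one)
      have 0: "c (d / 2) i z = 0" if "i \<noteq> j" for i using disj[OF that, of "d/2" z] 1 d(1) by simp
      have "(\<Sum>i\<in>?I \<times> ?I. (z - \<mu> i) * complex_of_real (c (d / 2) i z)) = (\<Sum>i\<in>{j}. (z - \<mu> i) * complex_of_real (c (d / 2) i z))"
        using j 0 by (intro sum.mono_neutral_right) auto
      then show ?thesis using 1 by (simp add: \<kappa>_def)
    qed
    have cell: "(\<Sum>j\<in>?I \<times> ?I. c d j z) = 1 \<and> (\<forall>j\<in>?I \<times> ?I. c d j z = 0 \<or> c d j z = 1)"
      if z: "z \<in> sphere 0 1" and far: "\<forall>y\<in>gridY N. r < cmod (z - y)" for z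
    proof -
      have z1: "cmod z = 1" using z by (simp add: dist_norm)
      have "2 * d + 2 * sqrt d < cmod (z - y)"
        if y: "cmod y = 1" "l \<in> {- int N..<int N}" "Re y = (real_of_int l + 1/2) / real N" for y l
      proof -
        have "y \<in> gridY N" using y unfolding gridY_def by auto
        then show ?thesis using d(3) far by fastforce
      qed
      then obtain k where k: "k \<in> ?I" "\<And>l. tri h d (real_of_int l * h) (Re z) = (if l = k then 1 else 0)"
        using grid_cell_Re[OF N0 d(1) d(2)[unfolded h_def] z1] unfolding h_def by blast
      \<comment> \<open>Reflection in the diagonal, under which \<open>gridY N\<close> is invariant,
        reduces imaginary parts to the case of real parts.\<close>
      define w where "w = Complex (Im z) (Re z)"
      have w1: "cmod w = 1" using z1 by (simp add: w_def cmod_def add.commute)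
      have "2 * d + 2 * sqrt d < cmod (w - y)"
        if y: "cmod y = 1" "l \<in> {- int N..<int N}" "Re y = (real_of_int l + 1/2) / real N" for y l
      proof -
        have "Complex (Im y) (Re y) \<in> gridY N" using y unfolding gridY_def by (auto simp: cmod_def add.commute)
        then have "r < cmod (z - Complex (Im y) (Re y))" using far by blast
        also have "\<dots> = cmod (w - y)" by (simp add: w_def cmod_def add.commute)
        finally show ?thesis using d(3) by simp
      qed
      then obtain l where l: "l \<in> ?I" "\<And>m. tri h d (real_of_int m * h) (Re w) = (if m = l then 1 else 0)"
        using grid_cell_Re[OF N0 d(1) d(2)[unfolded h_def] w1] unfolding h_def by blast
      have cv: "c d j z = (if j = (k, l) then 1 else 0)" for j
        using k(2) l(2) by (cases j) (simp add: c_def w_def)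
      show ?thesis using k(1) l(1) by (auto simp: cv)
    qed
    show ?thesis
      by (intro exI[of _ "?I \<times> ?I"] exI[of _ "c d"] exI[of _ \<mu>] exI[of _ \<kappa>] conjI)
        (use d(1) ccont cr disj cell kap kmu in \<open>auto simp: \<kappa>_def \<mu>_def intro!: continuous_intros\<close>)
  qed
  show ?thesis by (intro exI[of _ "gridY N"]) (use main finite_gridY in \<open>auto simp: gridY_def\<close>)
qed

text \<open>\<open>fr\<close> stretches the window of radius \<open>\<rho>\<close> around 1/2 to
  \<open>[-1, 1]\<close>. On that scale \<open>eta\<close> is a continuous substitute for the
  indicator of the positive reals, and \<open>cap\<close> is 1 wherever the two differ and 0 beyond
  1/2.\<close>

definition fr :: "real \<Rightarrow> real \<Rightarrow> real" where "fr \<rho> t = clip (-1) 1 ((t - 1/2) / \<rho>)"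
definition eta :: "real \<Rightarrow> real" where "eta r = clip 0 1 (2 * r + 1/2)"
definition cap :: "real \<Rightarrow> real" where "cap r = clip 0 1 (2 - 4 * \<bar>r\<bar>)"

lemma fr_cont: "\<rho> > 0 \<Longrightarrow> continuous_on S (fr \<rho>)" unfolding fr_def by (intro continuous_intros) auto
lemma eta_cont: "continuous_on S eta" unfolding eta_def by (intro continuous_intros)
lemma cap_cont: "continuous_on S cap" unfolding cap_def by (intro continuous_intros)

lemma fr_range: "- 1 \<le> fr \<rho> t" "fr \<rho> t \<le> 1" by (auto simp: fr_def clip_def)

lemma fr_high: "\<rho> > 0 \<Longrightarrow> 1/2 + \<rho> \<le> t \<Longrightarrow> fr \<rho> t = 1"
  by (simp add: fr_def clip_def min_def max_def field_simps)

lemma fr_low: "\<rho> > 0 \<Longrightarrow> t \<le> 1/2 - \<rho> \<Longrightarrow> fr \<rho> t = -1"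
  by (simp add: fr_def clip_def min_def max_def field_simps)

lemma fr_inside: "\<rho> > 0 \<Longrightarrow> fr \<rho> t \<noteq> 1 \<Longrightarrow> fr \<rho> t \<noteq> -1 \<Longrightarrow> \<bar>t - 1/2\<bar> \<le> \<rho>"
  using fr_high[of \<rho> t] fr_low[of \<rho> t] by linarith

lemma cap_zero: "1/2 \<le> \<bar>r\<bar> \<Longrightarrow> cap r = 0" by (simp add: cap_def clip_def)
lemma cap_one: "\<bar>r\<bar> \<le> 1/4 \<Longrightarrow> cap r = 1" by (simp add: cap_def clip_def)
lemma eta_high: "1/4 \<le> r \<Longrightarrow> eta r = 1" by (simp add: eta_def clip_def)
lemma eta_low: "r \<le> -1/4 \<Longrightarrow> eta r = 0" by (simp add: eta_def clip_def)

lemma om_values: "om 1 = 1" "om (- 1) = 1" "cnj (om r) * om r = 1" "om r * cnj (om r) = 1"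
  by (simp_all add: om_def cis_cnj cis_mult complex_eq_iff)

lemma om_cont: "continuous_on S f \<Longrightarrow> continuous_on S (\<lambda>x. om (f x))"
  unfolding om_def by (intro continuous_intros)

text \<open>At the ends of the interval the denominator is 0, but there \<open>F\<close> vanishes as
  well.\<close>

lemma loop_quotient:
  assumes F: "\<And>r. 1/2 \<le> \<bar>r\<bar> \<Longrightarrow> F r = (0::real)" and r: "- 1 \<le> r" "r \<le> 1"
  shows "complex_of_real (F (arho (om r))) / (1 - om r) * (1 - om r) = complex_of_real (F r)"
proof (cases "om r = 1")
  case True
  then have "F r = 0"
    using F[of r] arho_om[of r] arho_om[of 1] r by (cases "r = -1") (auto simp: om_values)
  then show ?thesis using True by simp
next
  case False
  then have "r \<noteq> - 1" using om_values by metis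
  then show ?thesis using False arho_om[of r] r by simp
qed

section \<open>Cutting the modulus at 1/2 when the spectrum has holes on the circle of radius
  1/2\<close>

lemma calc_lb_cont: "continuous_on UNIV f \<Longrightarrow> continuous_on S f"
  by (rule continuous_on_subset) auto

text \<open>Phase \<open>w\<close> and modulus \<open>s\<close> of a normal element that keeps
  distance \<open>r\<close> from the points \<open>y / 2\<close>; the modulus is to be cut within
  the window of radius \<open>\<rho>\<close> around 1/2.\<close>

locale punched =
  fixes w s :: q and \<psi> \<phi> :: "(complex \<Rightarrow> complex) \<Rightarrow> q" and Y :: "complex set" and r \<rho> :: real
  assumes c: "calc NN s \<phi>" and p: "calc (sphere 0 1) w \<psi>" and w: "isunit w" and ws: "w * s = s * w" and Y: "finite Y"
    and low: "\<And>y z. y \<in> Y \<Longrightarrow> r * norm z \<le> norm ((w * s - sc (y / 2)) * z)"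
    and rho: "\<rho> > 0" "2 * \<rho> < r"
begin

text \<open>The function \<open>a(w) f(s)\<close> of the commuting pair. If \<open>a\<close> and
  \<open>f\<close> have small supports, it lives on a box in polar coordinates.\<close>

definition bx :: "(complex \<Rightarrow> complex) \<Rightarrow> (complex \<Rightarrow> complex) \<Rightarrow> q" where "bx a f = \<psi> a * \<phi> f"

lemma s_selfadj: "star s = s"
  using calc_star[OF c, of "\<lambda>z. z"] calc_cong[OF c, of cnj "\<lambda>z. z"] calc_id[OF c] by (auto simp: NN_def complex_eq_iff)

lemma comm:
  assumes "continuous_on UNIV a" "continuous_on UNIV f"
  shows "\<phi> f * \<psi> a = \<psi> a * \<phi> f"
proof -
  have "star w * (w * s) * star w = star w * (s * w) * star w" using ws by simp
  then have ws': "s * star w = star w * s" using isunitD[OF w] by (simp add: mult.assoc)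
  have "w * \<phi> f = \<phi> f * w"
    by (rule calc_commute[OF c closed_NN calc_lb_cont[OF assms(2)]]) (simp_all add: ws s_selfadj)
  moreover have "star w * \<phi> f = \<phi> f * star w"
    by (rule calc_commute[OF c closed_NN calc_lb_cont[OF assms(2)]]) (simp_all add: ws' s_selfadj)
  ultimately show ?thesis
    by (intro calc_commute[OF p closed_sphere calc_lb_cont[OF assms(1)]]) simp_all
qed

lemma bx_mult:
  assumes "continuous_on UNIV a" "continuous_on UNIV f" "continuous_on UNIV a'" "continuous_on UNIV f'"
  shows "bx a f * bx a' f' = bx (\<lambda>z. a z * a' z) (\<lambda>z. f z * f' z)"
proof -
  have "bx a f * bx a' f' = \<psi> a * (\<phi> f * \<psi> a') * \<phi> f'" by (simp add: bx_def mult.assoc)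
  also have "\<dots> = (\<psi> a * \<psi> a') * (\<phi> f * \<phi> f')" using comm[OF assms(3,2)] by (simp add: mult.assoc)
  also have "\<dots> = bx (\<lambda>z. a z * a' z) (\<lambda>z. f z * f' z)"
    using calc_mult[OF p, of a a'] calc_mult[OF c, of f f'] assms by (simp add: bx_def lb_cont)
  finally show ?thesis .
qed

lemma bx_star:
  assumes "continuous_on UNIV a" "continuous_on UNIV f"
  shows "star (bx a f) = bx (\<lambda>z. cnj (a z)) (\<lambda>z. cnj (f z))"
proof -
  have "star (bx a f) = \<phi> (\<lambda>z. cnj (f z)) * \<psi> (\<lambda>z. cnj (a z))"
    using calc_star[OF p, of a] calc_star[OF c, of f] assms by (simp add: bx_def star_mult lb_cont)
  then show ?thesis using comm[of "\<lambda>z. cnj (a z)" "\<lambda>z. cnj (f z)"] assms by (simp add: bx_def continuous_on_cnj)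
qed

lemma bx_diff_left: "lb (sphere 0 1) a \<Longrightarrow> lb (sphere 0 1) a' \<Longrightarrow> bx (\<lambda>z. a z - a' z) f = bx a f - bx a' f"
  using calc_diff[OF p, of a a'] by (simp add: bx_def left_diff_distrib)

lemma bx_diff_right: "lb NN f \<Longrightarrow> lb NN f' \<Longrightarrow> bx a (\<lambda>z. f z - f' z) = bx a f - bx a f'"
  using calc_diff[OF c, of f f'] by (simp add: bx_def right_diff_distrib)

lemma bx_add_right: "lb NN f \<Longrightarrow> lb NN f' \<Longrightarrow> bx a (\<lambda>z. f z + f' z) = bx a f + bx a f'"
  using calc_add[OF c, of f f'] by (simp add: bx_def distrib_left)

lemma bx_zero: "(\<And>z. z \<in> NN \<Longrightarrow> f z = 0) \<Longrightarrow> bx a f = 0"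
  using calc_zero'[OF c, of f] by (simp add: bx_def)

lemma bx_zero_left: "(\<And>z. z \<in> sphere 0 1 \<Longrightarrow> a z = 0) \<Longrightarrow> bx a f = 0"
  using calc_zero'[OF p, of a] by (simp add: bx_def)

text \<open>Since \<open>w * s - y / 2 = w * (s - 1/2) + (w - y) / 2\<close>, this element has size
  at most \<open>3/2 * \<rho>\<close> on the box, which contradicts the lower bound \<open>r\<close>
  unless nothing lives there.\<close>

lemma box_zero:
  assumes y: "y \<in> Y" and a: "continuous_on UNIV a" "\<And>z. a z \<noteq> 0 \<Longrightarrow> cmod (z - y) \<le> \<rho>"
    and f: "continuous_on UNIV f" "\<And>z. f z \<noteq> 0 \<Longrightarrow> \<bar>Re z - 1/2\<bar> \<le> \<rho>"
  shows "bx a f = 0"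
proof -
  let ?z = "bx a f"
  define i where "i z = (if cmod (z - y) \<le> \<rho> then z - y else 0)" for z
  define k where "k z = (if \<bar>Re z - 1/2\<bar> \<le> \<rho> then complex_of_real (Re z - 1/2) else 0)" for z
  have lbs: "lb (sphere 0 1) i" "lb NN k"
    by (rule lb_bounded[of _ _ \<rho>], simp add: i_def less_imp_le[OF rho(1)] split: if_splits)
      (rule lb_bounded[of _ _ \<rho>], simp add: k_def less_imp_le[OF rho(1)] split: if_splits del: of_real_diff)
  note la = lb_cont[OF a(1), of "sphere 0 1"] and lf = lb_cont[OF f(1), of NN]
  have 1: "(w - sc y) * ?z = \<psi> i * ?z"
  proof -
    have "w - sc y = \<psi> (\<lambda>z. z - y)" using calc_diff[OF p, of "\<lambda>z. z" "\<lambda>z. y"] by (simp add: calc_id[OF p] calc_const[OF p])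
    then have "(w - sc y) * ?z = \<psi> (\<lambda>z. (z - y) * a z) * \<phi> f"
      using calc_mult[OF p, of "\<lambda>z. z - y" a] la by (simp add: bx_def mult.assoc lb_diff)
    also have "(\<lambda>z. (z - y) * a z) = (\<lambda>z. i z * a z)" using a(2) by (auto simp: i_def fun_eq_iff)
    finally show ?thesis using calc_mult[OF p lbs(1) la] by (simp add: bx_def mult.assoc)
  qed
  have 2: "(s - sc (1/2)) * ?z = \<phi> k * ?z"
  proof -
    have z: "?z = \<phi> f * \<psi> a" using comm[OF a(1) f(1)] by (simp add: bx_def)
    have "s - sc (1/2) = \<phi> (\<lambda>z. z - 1/2)" using calc_diff[OF c, of "\<lambda>z. z" "\<lambda>z. 1/2"] by (simp add: calc_id[OF c] calc_const[OF c])
    then have "(s - sc (1/2)) * ?z = \<phi> (\<lambda>z. (z - 1/2) * f z) * \<psi> a"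
      using calc_mult[OF c, of "\<lambda>z. z - 1/2" f] lf by (simp add: z mult.assoc lb_diff)
    also have "\<phi> (\<lambda>z. (z - 1/2) * f z) = \<phi> (\<lambda>z. k z * f z)"
      using f(2) by (intro calc_cong[OF c]) (auto simp: k_def NN_def complex_eq_iff)
    finally show ?thesis using calc_mult[OF c lbs(2) lf] by (simp add: z mult.assoc)
  qed
  have "(w * s - sc (y / 2)) * ?z = w * ((s - sc (1/2)) * ?z) + sc (1/2) * ((w - sc y) * ?z)"
  proof -
    have "sc (y / 2) = sc (1/2) * (sc y :: q)" by (simp flip: sc_mult)
    moreover have "w * (sc (1/2) * ?z) = sc (1/2) * (w * ?z)" using sc_comm[of w "1/2"] by (metis mult.assoc)
    ultimately show ?thesis by (simp add: left_diff_distrib right_diff_distrib mult.assoc)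
  qed
  then have "norm ((w * s - sc (y / 2)) * ?z) \<le> norm (w * (\<phi> k * ?z)) + norm (sc (1/2) * (\<psi> i * ?z))"
    unfolding 1 2 by (simp add: norm_triangle_ineq)
  also have "norm (w * (\<phi> k * ?z)) \<le> \<rho> * norm ?z"
    unfolding norm_unit_mult[OF w] using rho(1) by (intro norm_mult_le calc_norm[OF c]) (auto simp: k_def simp del: of_real_diff)
  also have "norm (sc (1/2) * (\<psi> i * ?z)) \<le> (1/2) * (\<rho> * norm ?z)"
    using rho(1) by (intro norm_mult_le calc_norm[OF p]) (auto simp: i_def)
  finally have "r * norm ?z \<le> (3/2 * \<rho>) * norm ?z" using low[OF y, of ?z] by simp
  moreover have "3/2 * \<rho> < r" using rho by simp
  ultimately have "norm ?z \<le> 0" by (metis mult_le_cancel_right not_less norm_ge_zero order.strict_iff_order)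
  then show ?thesis by simp
qed

text \<open>By \<open>box_zero\<close> each factor \<open>1 - e y\<close> acts as 1 beside
  \<open>f\<close>. The product of these factors vanishes within \<open>\<rho> / 2\<close> of
  \<open>Y\<close>, where \<open>a\<close> might have survived.\<close>

lemma near_zero:
  assumes a: "continuous_on UNIV a" "\<And>z. z \<in> sphere 0 1 \<Longrightarrow> (\<And>y. y \<in> Y \<Longrightarrow> \<rho> / 2 < cmod (z - y)) \<Longrightarrow> a z = 0"
    and f: "continuous_on UNIV f" "\<And>z. f z \<noteq> 0 \<Longrightarrow> \<bar>Re z - 1/2\<bar> \<le> \<rho>"
  shows "bx a f = 0"
proof -
  define e where "e y z = complex_of_real (clip 0 1 (2 - 2 * cmod (z - y) / \<rho>))" for y z
  have ec: "continuous_on UNIV (e y)" for y unfolding e_def using rho(1) by (intro continuous_intros) auto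
  have pc: "continuous_on UNIV (\<lambda>z. \<Prod>y\<in>Y'. 1 - e y z)" for Y' by (intro continuous_intros ec)
  have "bx (\<lambda>z. \<Prod>y\<in>Y'. 1 - e y z) f = \<phi> f" if "Y' \<subseteq> Y" for Y'
    using finite_subset[OF that Y] that
  proof (induction Y' rule: finite_induct)
    case empty
    then show ?case by (simp add: bx_def calc_one[OF p])
  next
    case (insert y Y')
    let ?P = "\<lambda>z. \<Prod>y\<in>Y'. 1 - e y z"
    have "bx (e y) f = 0"
    proof (rule box_zero[OF _ ec _ f])
      fix z assume "e y z \<noteq> 0"
      then have "clip 0 1 (2 - 2 * cmod (z - y) / \<rho>) \<noteq> 0" by (auto simp: e_def)
      then have "0 < 2 - 2 * cmod (z - y) / \<rho>" by (simp add: clip_def max_def min_def split: if_splits)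
      then show "cmod (z - y) \<le> \<rho>" using rho(1) by (simp add: field_simps)
    qed (use insert in auto)
    moreover have "\<psi> (\<lambda>z. (1 - e y z) * ?P z) = \<psi> (\<lambda>z. 1 - e y z) * \<psi> ?P"
      by (rule calc_mult[OF p]) (intro lb_cont pc continuous_intros ec)+
    moreover have "\<psi> (\<lambda>z. 1 - e y z) = 1 - \<psi> (e y)"
      using calc_diff[OF p, of "\<lambda>z. 1" "e y"] by (simp add: calc_one[OF p] lb_cont[OF ec])
    ultimately show ?case
      using insert by (simp add: bx_def mult.assoc left_diff_distrib)
  qed
  from this[of Y] have "bx a f = \<psi> a * bx (\<lambda>z. \<Prod>y\<in>Y. 1 - e y z) f" by (simp add: bx_def)
  also have "\<dots> = bx (\<lambda>z. a z * (\<Prod>y\<in>Y. 1 - e y z)) f"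
    using calc_mult[OF p lb_cont[OF a(1)] lb_cont[OF pc, of "sphere 0 1" Y]] by (simp add: bx_def mult.assoc)
  also have "\<dots> = 0"
  proof (rule bx_zero_left)
    fix z :: complex assume z: "z \<in> sphere 0 1"
    show "a z * (\<Prod>y\<in>Y. 1 - e y z) = 0"
    proof (cases "\<forall>y\<in>Y. \<rho> / 2 < cmod (z - y)")
      case False
      then obtain y where y: "y \<in> Y" "cmod (z - y) \<le> \<rho> / 2" by (auto simp: not_less)
      then have "1 \<le> 2 - 2 * cmod (z - y) / \<rho>" using rho(1) by (simp add: field_simps)
      then have "1 - e y z = 0" by (simp add: e_def clip_def)
      then show ?thesis using Y y(1) by auto
    qed (use a(2) z in auto)
  qed
  finally show ?thesis .
qed

text \<open>The unitary \<open>1 - bx a (1 - om \<circ> fr \<rho>)\<close> has its spectrum in a loop on which \<open>fr \<rho>\<close> is again visible.\<close>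

lemma loop:
  assumes a: "continuous_on UNIV a" "\<And>z. cnj (a z) = a z"
    and idem: "\<And>z. z \<in> sphere 0 1 \<Longrightarrow> (\<And>y. y \<in> Y \<Longrightarrow> \<rho> / 2 < cmod (z - y)) \<Longrightarrow> a z * a z = a z"
  shows "\<exists>u \<chi>. calc (sphere 0 1) u \<chi> \<and> (\<forall>F. continuous_on UNIV F \<longrightarrow> (\<forall>t. 1/2 \<le> \<bar>t\<bar> \<longrightarrow> F t = 0) \<longrightarrow>
     \<chi> (\<lambda>\<zeta>. complex_of_real (F (arho \<zeta>))) = bx a (rf (\<lambda>t. F (fr \<rho> t))))"
proof -
  define o1 where "o1 z = om (fr \<rho> (Re z))" for z
  define E where "E z = 1 - o1 z" for z
  define E' where "E' z = cnj (E z)" for z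
  have oc: "continuous_on UNIV o1" unfolding o1_def by (intro om_cont continuous_Re_comp fr_cont rho(1))
  have Ec: "continuous_on UNIV E" "continuous_on UNIV E'" unfolding E'_def E_def by (intro continuous_intros oc)+
  have Es: "\<bar>Re z - 1/2\<bar> \<le> \<rho>" if "E z \<noteq> 0" for z
    using that fr_inside[OF rho(1), of "Re z"] om_values unfolding E_def o1_def by force
  \<comment> \<open>\<open>a\<close> is idempotent up to a function living near \<open>Y\<close>,
    and \<open>near_zero\<close> removes it.\<close>
  have sq: "bx (\<lambda>z. a z * a z) f = bx a f" if f: "continuous_on UNIV f" "\<And>z. f z \<noteq> 0 \<Longrightarrow> \<bar>Re z - 1/2\<bar> \<le> \<rho>" for f
  proof -
    have "bx (\<lambda>z. a z * a z - a z) f = 0" by (rule near_zero[OF _ _ f]) (use a idem in \<open>auto intro!: continuous_intros\<close>)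
    then show ?thesis using bx_diff_left[of "\<lambda>z. a z * a z" a f] a(1) by (simp add: lb_cont continuous_on_mult)
  qed
  let ?y = "bx a E"
  have sy: "star ?y = bx a E'" using bx_star[OF a(1) Ec(1)] a(2) by (simp add: E'_def[abs_def])
  have yy: "?y * ?y = bx a (\<lambda>z. E z * E z)" "star ?y * ?y = bx a (\<lambda>z. E' z * E z)" "?y * star ?y = bx a (\<lambda>z. E z * E' z)"
    unfolding sy bx_mult[OF a(1) Ec(1) a(1) Ec(1)] bx_mult[OF a(1) Ec(2) a(1) Ec(1)] bx_mult[OF a(1) Ec(1) a(1) Ec(2)]
    by (rule sq; use Es in \<open>auto intro!: continuous_intros Ec\<close>)+
  let ?u = "1 - ?y"
  note lE = lb_cont[OF Ec(1), of NN] lb_cont[OF Ec(2), of NN]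
  have "star ?u * ?u = 1 - (?y + star ?y - star ?y * ?y)" by (simp add: star_diff left_diff_distrib right_diff_distrib)
  also have "?y + star ?y - star ?y * ?y = bx a (\<lambda>z. (E z + E' z) - E' z * E z)"
    unfolding yy using bx_diff_right[of "\<lambda>z. E z + E' z" "\<lambda>z. E' z * E z" a] bx_add_right[of E E' a] lE
    by (simp add: sy lb_add lb_mult)
  also have "\<dots> = 0"
    by (rule bx_zero) (simp add: E_def E'_def o1_def algebra_simps om_values)
  finally have "star ?u * ?u = 1" by simp
  then obtain \<chi> where u: "calc (sphere 0 1) ?u \<chi>" using calc_unitary(2) by blast
  define om' where "om' = \<phi> o1"
  have ocalc: "calc (sphere 0 1) om' (\<lambda>h. \<phi> (\<lambda>z. h (o1 z)))"
    unfolding om'_def using om_circle by (intro calc_comp[OF c] lb_cont oc) (auto simp: o1_def)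
  have oy: "om' * ?y = bx a (\<lambda>z. o1 z * E z)" "star om' * ?y = bx a (\<lambda>z. cnj (o1 z) * E z)"
    using bx_mult[of "\<lambda>z. 1" o1 a E] bx_mult[of "\<lambda>z. 1" "\<lambda>z. cnj (o1 z)" a E] calc_star[OF c lb_cont[OF oc]] oc Ec a
    by (simp_all add: bx_def calc_one[OF p] om'_def continuous_on_cnj)
  \<comment> \<open>\<open>?y\<close> intertwines the new unitary \<open>?u\<close> with
    \<open>om (fr \<rho> s)\<close>. This transfers continuous functions, but only beside a factor
    \<open>?y\<close>; dividing by \<open>1 - \<zeta>\<close> below is what splits such a factor
    off.\<close>
  have int: "?y * ?u = om' * ?y" "?y * star ?u = star om' * ?y"
  proof -
    have "?y * ?u = bx a (\<lambda>z. E z - E z * E z)"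
      using bx_diff_right[of E "\<lambda>z. E z * E z" a] lE by (simp add: right_diff_distrib yy lb_mult)
    then show "?y * ?u = om' * ?y" by (simp add: oy E_def algebra_simps)
    have "?y * star ?u = bx a (\<lambda>z. E z - E z * E' z)"
      using bx_diff_right[of E "\<lambda>z. E z * E' z" a] lE by (simp add: right_diff_distrib yy star_diff lb_mult)
    then show "?y * star ?u = star om' * ?y" by (simp add: oy E_def E'_def algebra_simps)
  qed
  have "\<chi> (\<lambda>\<zeta>. complex_of_real (F (arho \<zeta>))) = bx a (rf (\<lambda>t. F (fr \<rho> t)))"
    if F: "continuous_on UNIV F" "\<And>t. 1/2 \<le> \<bar>t\<bar> \<Longrightarrow> F t = 0" for F
  proof -
    define G where "G \<zeta> = complex_of_real (F (arho \<zeta>)) / (1 - \<zeta>)" for \<zeta>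
    have G: "continuous_on (sphere 0 1) G" using loop_function_continuous(2)[OF F] by (simp add: G_def[abs_def])
    have lG: "lb (sphere 0 1) G" by (rule lb_continuous[OF closed_sphere G])
    have lGo: "lb NN (\<lambda>z. G (o1 z))"
    proof (rule lb_cont, rule continuous_on_compose2[OF G oc])
      show "range o1 \<subseteq> sphere 0 1" using om_circle unfolding o1_def by blast
    qed
    have F1: "F (arho 1) = 0" using arho_om[of 1] F(2) by (simp add: om_values)
    have "\<chi> (\<lambda>\<zeta>. complex_of_real (F (arho \<zeta>))) = \<chi> (\<lambda>\<zeta>. (1 - \<zeta>) * G \<zeta>)"
      by (rule calc_cong[OF u]) (auto simp: G_def F1)
    also have "\<dots> = (1 - ?u) * \<chi> G"
      using calc_mult[OF u, of "\<lambda>\<zeta>. 1 - \<zeta>" G] calc_diff[OF u, of "\<lambda>\<zeta>. 1" "\<lambda>\<zeta>. \<zeta>"] lG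
      by (simp add: calc_one[OF u] calc_id[OF u] lb_diff)
    also have "\<dots> = ?y * \<chi> G" by simp
    also have "\<dots> = \<phi> (\<lambda>z. G (o1 z)) * ?y" by (rule calc_intertwine[OF u ocalc closed_sphere G int])
    also have "\<dots> = \<phi> (\<lambda>z. G (o1 z)) * \<phi> E * \<psi> a" using comm[OF a(1) Ec(1)] by (simp add: bx_def mult.assoc)
    also have "\<phi> (\<lambda>z. G (o1 z)) * \<phi> E = \<phi> (\<lambda>z. G (o1 z) * E z)" using calc_mult[OF c lGo lE(1)] by simp
    also have "(\<lambda>z. G (o1 z) * E z) = rf (\<lambda>t. F (fr \<rho> t))"
      unfolding G_def E_def o1_def rf_def using loop_quotient[of F, OF F(2) fr_range] by (intro ext) blast
    finally show ?thesis
      using comm[OF a(1), of "rf (\<lambda>t. F (fr \<rho> t))"] continuous_on_compose2[OF F(1) fr_cont[OF rho(1), of UNIV]]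
      by (simp add: bx_def rf_cont)
  qed
  then show ?thesis using u by blast
qed

text \<open>\<open>P = H + B\<close>. The continuous function \<open>H = eta (fr \<rho> s)\<close>
  fails to be a projection only inside the window. There \<open>b j\<close> adds, cell by cell, the
  missing difference between the indicator of the positive reals and \<open>eta\<close>, taken in
  the Borel calculus of the loop unitary of the cell. On a cell the phase counts as the scalar
  \<open>\<mu> j\<close> and in the window the modulus as 1/2, hence the exact commutation with the
  rounded functions.\<close>

lemma cut:
  fixes J :: "'j set" and cj :: "'j \<Rightarrow> complex \<Rightarrow> real"
  assumes J: "finite J" and cc: "\<And>j. j \<in> J \<Longrightarrow> continuous_on UNIV (cj j)" and kc: "continuous_on UNIV \<kappa>"
    and disj: "\<And>i j z. i \<in> J \<Longrightarrow> j \<in> J \<Longrightarrow> i \<noteq> j \<Longrightarrow> cj i z * cj j z = 0"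
    and part: "\<And>z. z \<in> sphere 0 1 \<Longrightarrow> (\<And>y. y \<in> Y \<Longrightarrow> \<rho> / 2 < cmod (z - y)) \<Longrightarrow> (\<Sum>j\<in>J. cj j z) = 1 \<and> (\<forall>j\<in>J. cj j z = 0 \<or> cj j z = 1)"
    and const: "\<And>j z. j \<in> J \<Longrightarrow> cj j z \<noteq> 0 \<Longrightarrow> \<kappa> z = \<mu> j"
  shows "\<exists>P. isproj P \<and> P * \<psi> \<kappa> = \<psi> \<kappa> * P \<and>
     P * \<phi> (rf (\<lambda>t. t - clip (- \<rho>) \<rho> (t - 1/2))) = \<phi> (rf (\<lambda>t. t - clip (- \<rho>) \<rho> (t - 1/2))) * P \<and>
     (\<forall>z. \<phi> (rf (\<lambda>t. cap (fr \<rho> t))) * z = 0 \<longrightarrow> P * z = \<phi> (rf (\<lambda>t. eta (fr \<rho> t))) * z)"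
proof -
  define a where "a j z = complex_of_real (cj j z)" for j z
  have ac: "continuous_on UNIV (a j)" if "j \<in> J" for j unfolding a_def by (intro continuous_intros cc that)
  have "\<exists>u \<chi>. calc (sphere 0 1) u \<chi> \<and> (\<forall>F. continuous_on UNIV F \<longrightarrow> (\<forall>t. 1/2 \<le> \<bar>t\<bar> \<longrightarrow> F t = 0) \<longrightarrow>
     \<chi> (\<lambda>\<zeta>. complex_of_real (F (arho \<zeta>))) = bx (a j) (rf (\<lambda>t. F (fr \<rho> t))))" if j: "j \<in> J" for j
  proof (rule loop[OF ac[OF j]])
    show "a j z * a j z = a j z" if "z \<in> sphere 0 1" "\<And>y. y \<in> Y \<Longrightarrow> \<rho> / 2 < cmod (z - y)" for z
      using part[OF that] j by (auto simp: a_def)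
  qed (simp add: a_def)
  then obtain u \<chi> where u: "\<And>j. j \<in> J \<Longrightarrow> calc (sphere 0 1) (u j) (\<chi> j)"
    and chi: "\<And>j F. j \<in> J \<Longrightarrow> continuous_on UNIV F \<Longrightarrow> (\<And>t. 1/2 \<le> \<bar>t\<bar> \<Longrightarrow> F t = 0) \<Longrightarrow>
     \<chi> j (\<lambda>\<zeta>. complex_of_real (F (arho \<zeta>))) = bx (a j) (rf (\<lambda>t. F (fr \<rho> t)))"
    by metis
  \<comment> \<open>The Borel function \<open>F\<close> of the loop unitary of cell
    \<open>j\<close>. For continuous \<open>F\<close> vanishing beyond 1/2 it is
    \<open>a j (w) * F (fr \<rho> s)\<close>, independent of any choice of lift.\<close>
  define D where "D F j = \<chi> j (\<lambda>\<zeta>. complex_of_real (F (arho \<zeta>)))" for F :: "real \<Rightarrow> real" and j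
  define bt where "bt x = (if 0 < x then 1 else 0) - eta x" for x :: real
  have er: "0 \<le> eta x" "eta x \<le> 1" for x by (auto simp: eta_def clip_def)
  have cr: "0 \<le> cap x" "cap x \<le> 1" for x by (auto simp: cap_def clip_def)
  have btr: "\<bar>bt x\<bar> \<le> 1" for x using er[of x] by (simp add: bt_def)
  \<comment> \<open>The continuous \<open>cap\<close> is 1 on the support of the discontinuous
    \<open>bt\<close>, so \<open>D cap j\<close> localises \<open>b j\<close>.\<close>
  have btc: "bt x = bt x * cap x" for x
    using eta_high[of x] eta_low[of x] cap_one[of x] by (cases "\<bar>x\<bar> \<le> 1/4") (auto simp: bt_def)
  have lD: "lb (sphere 0 1) (\<lambda>\<zeta>. complex_of_real (F (arho \<zeta>)))" if "\<And>x. \<bar>F x\<bar> \<le> 1" for F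
    by (rule lb_bounded[of _ _ 1]) (simp add: that)
  have Dm: "D F j * D G j = D (\<lambda>x. F x * G x) j" if "j \<in> J" "\<And>x. \<bar>F x\<bar> \<le> 1" "\<And>x. \<bar>G x\<bar> \<le> 1" for F G j
    using calc_mult[OF u[OF that(1)] lD[of F, OF that(2)] lD[of G, OF that(3)]] by (simp add: D_def)
  have Dc: "D F j = bx (a j) (rf (\<lambda>t. F (fr \<rho> t)))" if "j \<in> J" "continuous_on UNIV F" "\<And>t. 1/2 \<le> \<bar>t\<bar> \<Longrightarrow> F t = 0" for F j
    using chi[of j F, OF that] by (simp add: D_def)
  have Ds: "star (D F j) = D F j" if "j \<in> J" "\<And>x. \<bar>F x\<bar> \<le> 1" for F j
    using calc_star[OF u[OF that(1)] lD[of F, OF that(2)]] by (simp add: D_def)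
  define b where "b = D bt"
  have frc: "continuous_on UNIV (\<lambda>t. F (fr \<rho> t))" if "continuous_on UNIV F" for F :: "real \<Rightarrow> real"
    using continuous_on_compose2[OF that fr_cont[OF rho(1), of UNIV]] by simp
  have bcap: "D cap j * b j = b j" "b j * D cap j = b j" if "j \<in> J" for j
  proof -
    have "(\<lambda>x. bt x * cap x) = bt" by (rule ext) (rule btc[symmetric])
    moreover from this have "(\<lambda>x. cap x * bt x) = bt" by (simp add: mult.commute)
    moreover have "\<bar>cap x\<bar> \<le> 1" for x using cr[of x] by simp
    ultimately show "D cap j * b j = b j" "b j * D cap j = b j" unfolding b_def using Dm[of j cap bt, OF that _ btr] Dm[of j bt cap, OF that btr] by simp_all
  qed
  let ?C = "rf (\<lambda>t. cap (fr \<rho> t))" and ?e = "rf (\<lambda>t. eta (fr \<rho> t))" and ?S = "rf (\<lambda>t. t - clip (- \<rho>) \<rho> (t - 1/2))"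
  have cC: "continuous_on UNIV ?C" and ce: "continuous_on UNIV ?e"
    by (intro rf_cont frc cap_cont eta_cont)+
  have cS: "continuous_on UNIV ?S" by (intro rf_cont continuous_intros)
  have Dcap: "D cap j = bx (a j) ?C" if "j \<in> J" for j
    by (rule Dc[OF that cap_cont cap_zero])
  define H where "H = \<phi> ?e"
  \<comment> \<open>\<open>b j\<close> absorbs \<open>a j\<close> of the phase and
    \<open>cap\<close> of the window on either side, so functions of \<open>w\<close> and
    \<open>s\<close> act on it through their values on these supports.\<close>
  have b1: "b j = \<psi> (a j) * (\<phi> ?C * b j)" "b j = b j * (\<psi> (a j) * \<phi> ?C)" if "j \<in> J" for j
    using bcap[OF that] Dcap[OF that] by (simp_all add: bx_def mult.assoc)
  have bb: "b i * b j = 0" if "i \<in> J" "j \<in> J" "i \<noteq> j" for i j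
  proof -
    have "bx (a i) ?C * bx (a j) ?C = bx (\<lambda>z. a i z * a j z) (\<lambda>z. ?C z * ?C z)"
      by (rule bx_mult[OF ac[OF that(1)] cC ac[OF that(2)] cC])
    also have "\<dots> = 0"
      by (rule bx_zero_left) (use disj[OF that] in \<open>simp add: a_def flip: of_real_mult\<close>)
    finally have "D cap i * D cap j = 0" using Dcap that by simp
    moreover have "b i * b j = b i * (D cap i * D cap j) * b j"
      using bcap[OF that(1)] bcap[OF that(2)] by (metis mult.assoc)
    ultimately show ?thesis by simp
  qed
  have sH: "star H = H" unfolding H_def using calc_star[OF c lb_cont[OF ce]] by (simp add: rf_cnj)
  have sb: "star (b j) = b j" if "j \<in> J" for j unfolding b_def by (rule Ds[OF that btr])
  have ae: "\<bar>eta x\<bar> \<le> 1" and acap: "\<bar>cap x\<bar> \<le> 1" for x using er[of x] cr[of x] by simp_all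
  \<comment> \<open>Beside \<open>D cap j\<close> everything is continuous, so \<open>eta\<close> of
    the modulus and \<open>eta\<close> of the loop unitary agree.\<close>
  have Hb: "H * b j = D eta j * b j" "b j * H = b j * D eta j" if j: "j \<in> J" for j
  proof -
    have "H * D cap j = bx (\<lambda>z. 1) ?e * bx (a j) ?C" by (simp add: Dcap[OF j] H_def bx_def calc_one[OF p])
    also have "\<dots> = bx (\<lambda>z. 1 * a j z) (\<lambda>z. ?e z * ?C z)" by (rule bx_mult) (simp_all add: ce ac[OF j] cC)
    also have "\<dots> = D (\<lambda>x. eta x * cap x) j"
      by (subst Dc[OF j]) (auto simp: rf_mult cap_zero intro!: continuous_intros eta_cont cap_cont)
    also have "\<dots> = D eta j * D cap j" using Dm[OF j, of eta cap] ae acap by simp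
    finally have "H * D cap j * b j = D eta j * D cap j * b j" by simp
    then show 1: "H * b j = D eta j * b j" using bcap(1)[OF j] by (simp add: mult.assoc)
    have "star (H * b j) = star (D eta j * b j)" using 1 by simp
    then show "b j * H = b j * D eta j" using sH sb[OF j] Ds[of j eta, OF j ae] by (simp add: star_mult)
  qed
  \<comment> \<open>\<open>eta^2 - eta\<close> lives in the window. There the cells add up to 1 away
    from \<open>Y\<close>, and \<open>near_zero\<close> disposes of the rest, so the failure of
    \<open>H\<close> to be idempotent splits over the cells.\<close>
  have HH: "H * H = H + (\<Sum>j\<in>J. D eta j * D eta j - D eta j)"
  proof -
    let ?F = "\<lambda>x. eta x * eta x - eta x"
    let ?f = "rf (\<lambda>t. ?F (fr \<rho> t))"
    have Fz: "?F t = 0" if "1/2 \<le> \<bar>t\<bar>" for t using that eta_high[of t] eta_low[of t] by (cases "0 \<le> t") auto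
    have Fc: "continuous_on UNIV ?F" by (intro continuous_intros eta_cont)
    have fc: "continuous_on UNIV ?f" using frc[OF Fc] by (rule rf_cont)
    have fsupp: "\<bar>Re z - 1/2\<bar> \<le> \<rho>" if "?f z \<noteq> 0" for z
      using that fr_inside[OF rho(1), of "Re z"] Fz[of 1] Fz[of "-1"] by (force simp: rf_def)
    have "bx (\<lambda>z. 1 - (\<Sum>j\<in>J. a j z)) ?f = 0"
    proof (rule near_zero[OF _ _ fc fsupp])
      show "continuous_on UNIV (\<lambda>z. 1 - (\<Sum>j\<in>J. a j z))" by (intro continuous_intros ac)
      show "1 - (\<Sum>j\<in>J. a j z) = 0" if "z \<in> sphere 0 1" "\<And>y. y \<in> Y \<Longrightarrow> \<rho> / 2 < cmod (z - y)" for z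
        using part[OF that] unfolding a_def by (metis diff_self of_real_1 of_real_sum)
    qed
    moreover have "bx (\<lambda>z. 1 - (\<Sum>j\<in>J. a j z)) ?f = \<phi> ?f - bx (\<lambda>z. \<Sum>j\<in>J. a j z) ?f"
      using bx_diff_left[of "\<lambda>z. 1" "\<lambda>z. \<Sum>j\<in>J. a j z" ?f] lb_cont[OF continuous_on_sum[of J UNIV a], of "sphere 0 1"] ac
      by (simp add: bx_def calc_one[OF p])
    moreover have "bx (\<lambda>z. \<Sum>j\<in>J'. a j z) ?f = (\<Sum>j\<in>J'. bx (a j) ?f)" if "J' \<subseteq> J" for J'
      using finite_subset[OF that J] that
    proof (induction J' rule: finite_induct)
      case empty
      then show ?case by (simp add: bx_def calc_zero[OF p])
    next
      case (insert i J')
      have "lb (sphere 0 1) (a i)" "lb (sphere 0 1) (\<lambda>z. \<Sum>j\<in>J'. a j z)"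
        using insert.prems ac by (auto intro!: lb_cont continuous_on_sum)
      then show ?case using insert calc_add[OF p, of "a i" "\<lambda>z. \<Sum>j\<in>J'. a j z"] by (simp add: bx_def distrib_right)
    qed
    ultimately have "\<phi> ?f = (\<Sum>j\<in>J. bx (a j) ?f)" by simp
    also have "\<dots> = (\<Sum>j\<in>J. D eta j * D eta j - D eta j)"
    proof (rule sum.cong[OF refl])
      fix j assume j: "j \<in> J"
      have "bx (a j) ?f = D ?F j" using Dc[of j ?F, OF j Fc Fz] by simp
      also have "\<dots> = D (\<lambda>x. eta x * eta x) j - D eta j"
        unfolding D_def using calc_diff[OF u[OF j] lD[of "\<lambda>x. eta x * eta x"] lD[of eta, OF ae]] er
        by (simp add: mult_le_one abs_mult)
      also have "D (\<lambda>x. eta x * eta x) j = D eta j * D eta j" using Dm[OF j, of eta eta] ae by simp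
      finally show "bx (a j) ?f = D eta j * D eta j - D eta j" .
    qed
    also have "\<phi> ?f = H * H - H"
    proof -
      note le = lb_cont[OF ce, of NN]
      have "?f = (\<lambda>z. ?e z * ?e z - ?e z)" by (simp add: rf_def fun_eq_iff)
      then show ?thesis unfolding H_def calc_mult[OF c le le, symmetric] using calc_diff[OF c lb_mult[OF le le] le] by simp
    qed
    finally show ?thesis by (simp add: algebra_simps)
  qed
  \<comment> \<open>\<open>D eta j + b j\<close> is an indicator of the loop unitary, hence
    idempotent.\<close>
  have loc: "D eta j * D eta j - D eta j + D eta j * b j + b j * D eta j + b j * b j = b j" if j: "j \<in> J" for j
  proof -
    let ?i = "\<lambda>x::real. if 0 < x then 1 else (0::real)"
    have "D eta j + b j = D ?i j"
      unfolding D_def b_def using calc_add[OF u[OF j] lD[of eta, OF ae] lD[of bt, OF btr]]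
      by (simp add: bt_def flip: of_real_add)
    moreover have "D ?i j * D ?i j = D (\<lambda>x. ?i x * ?i x) j" by (rule Dm[OF j]) auto
    moreover have "(\<lambda>x. ?i x * ?i x) = ?i" by auto
    ultimately have "(D eta j + b j) * (D eta j + b j) = D eta j + b j" by metis
    then show ?thesis by (simp add: distrib_left distrib_right algebra_simps)
  qed
  define B where "B = sum b J"
  have BB: "B * B = (\<Sum>j\<in>J. b j * b j)"
  proof -
    have "B * B = (\<Sum>i\<in>J. \<Sum>j\<in>J. b i * b j)" by (simp add: B_def sum_product)
    also have "\<dots> = (\<Sum>i\<in>J. \<Sum>j\<in>J. if j = i then b i * b i else 0)"
      using bb by (intro sum.cong refl) auto
    finally show ?thesis using J by simp
  qed
  have HB: "H * B = (\<Sum>j\<in>J. D eta j * b j)" "B * H = (\<Sum>j\<in>J. b j * D eta j)"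
    unfolding B_def sum_distrib_left sum_distrib_right using Hb by (auto intro!: sum.cong)
  let ?P = "H + B"
  have "?P * ?P = H * H + H * B + B * H + B * B" by (simp add: distrib_left distrib_right add.assoc)
  also have "\<dots> = H + (\<Sum>j\<in>J. D eta j * D eta j - D eta j + D eta j * b j + b j * D eta j + b j * b j)"
    unfolding HH HB BB by (simp add: sum.distrib add.assoc)
  also have "\<dots> = ?P" using loc by (simp add: B_def)
  finally have PP: "?P * ?P = ?P" .
  have sP: "star ?P = ?P" by (simp add: star_add sH B_def star_sum sb)
  have bk: "b j * \<psi> \<kappa> = \<psi> \<kappa> * b j" if j: "j \<in> J" for j
  proof -
    note la = lb_cont[OF ac[OF j], of "sphere 0 1"] and lk = lb_cont[OF kc, of "sphere 0 1"]
    have ka: "\<psi> \<kappa> * \<psi> (a j) = sc (\<mu> j) * \<psi> (a j)" "\<psi> (a j) * \<psi> \<kappa> = sc (\<mu> j) * \<psi> (a j)"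
    proof -
      have *: "(\<lambda>z. \<kappa> z * a j z) = (\<lambda>z. \<mu> j * a j z)" "(\<lambda>z. a j z * \<kappa> z) = (\<lambda>z. \<mu> j * a j z)"
        using const[OF j] by (auto simp: a_def fun_eq_iff)
      show "\<psi> \<kappa> * \<psi> (a j) = sc (\<mu> j) * \<psi> (a j)"
        using calc_mult[OF p lk la] calc_scale[OF p la, of "\<mu> j"] unfolding * by simp
      show "\<psi> (a j) * \<psi> \<kappa> = sc (\<mu> j) * \<psi> (a j)"
        using calc_mult[OF p la lk] calc_scale[OF p la, of "\<mu> j"] unfolding * by simp
    qed
    have "\<psi> \<kappa> * b j = (\<psi> \<kappa> * \<psi> (a j)) * (\<phi> ?C * b j)" using b1(1)[OF j] by (metis mult.assoc)
    also have "\<dots> = sc (\<mu> j) * b j" unfolding ka using b1(1)[OF j] by (metis mult.assoc)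
    finally have 1: "\<psi> \<kappa> * b j = sc (\<mu> j) * b j" .
    have "b j * \<psi> \<kappa> = b j * \<psi> (a j) * (\<phi> ?C * \<psi> \<kappa>)" using b1(2)[OF j] by (metis mult.assoc)
    also have "\<dots> = b j * (\<psi> (a j) * \<psi> \<kappa>) * \<phi> ?C" using comm[OF kc cC] by (simp add: mult.assoc)
    also have "\<dots> = (b j * sc (\<mu> j)) * (\<psi> (a j) * \<phi> ?C)" unfolding ka by (simp add: mult.assoc)
    also have "\<dots> = sc (\<mu> j) * b j" unfolding sc_comm[of "b j"] using b1(2)[OF j] by (metis mult.assoc)
    finally show ?thesis using 1 by simp
  qed
  have bS: "b j * \<phi> ?S = \<phi> ?S * b j" if j: "j \<in> J" for j
  proof -
    note lS = lb_cont[OF cS, of NN] and lC = lb_cont[OF cC, of NN]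
    have SC: "\<phi> ?S * \<phi> ?C = sc (1/2) * \<phi> ?C" "\<phi> ?C * \<phi> ?S = sc (1/2) * \<phi> ?C"
    proof -
      have "cap (fr \<rho> t) = 0 \<or> t - clip (- \<rho>) \<rho> (t - 1/2) = 1/2" for t
        using cap_zero[of 1] cap_zero[of "-1"] fr_inside[OF rho(1), of t] by (force simp: clip_def)
      then have *: "(\<lambda>z. ?S z * ?C z) = (\<lambda>z. (1/2) * ?C z)" "(\<lambda>z. ?C z * ?S z) = (\<lambda>z. (1/2) * ?C z)"
        unfolding rf_def fun_eq_iff by (metis mult.commute mult_zero_left of_real_0 of_real_divide of_real_1 of_real_numeral)+
      show "\<phi> ?S * \<phi> ?C = sc (1/2) * \<phi> ?C"
        using calc_mult[OF c lS lC] calc_scale[OF c lC, of "1/2"] unfolding * by simp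
      show "\<phi> ?C * \<phi> ?S = sc (1/2) * \<phi> ?C"
        using calc_mult[OF c lC lS] calc_scale[OF c lC, of "1/2"] unfolding * by simp
    qed
    have b2: "b j = \<phi> ?C * (\<psi> (a j) * b j)" using b1(1)[OF j] comm[OF ac[OF j] cC] by (metis mult.assoc)
    have "\<phi> ?S * b j = (\<phi> ?S * \<phi> ?C) * (\<psi> (a j) * b j)" using b2 by (metis mult.assoc)
    also have "\<dots> = sc (1/2) * b j" unfolding SC using b2 by (metis mult.assoc)
    finally have 1: "\<phi> ?S * b j = sc (1/2) * b j" .
    have "b j * \<phi> ?S = b j * \<psi> (a j) * (\<phi> ?C * \<phi> ?S)" using b1(2)[OF j] by (metis mult.assoc)
    also have "\<dots> = (b j * \<psi> (a j) * sc (1/2)) * \<phi> ?C" unfolding SC by (simp add: mult.assoc)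
    also have "\<dots> = sc (1/2) * b j" unfolding sc_comm[of "b j * \<psi> (a j)"] using b1(2)[OF j] by (metis mult.assoc)
    finally show ?thesis using 1 by simp
  qed
  have "?P * \<psi> \<kappa> = \<psi> \<kappa> * ?P"
    using comm[OF kc ce] bk by (simp add: H_def B_def distrib_left distrib_right sum_distrib_left sum_distrib_right)
  moreover have "?P * \<phi> ?S = \<phi> ?S * ?P"
  proof -
    have "H * \<phi> ?S = \<phi> ?S * H"
      using calc_mult[OF c, of ?e ?S] calc_mult[OF c, of ?S ?e] lb_cont[OF ce, of NN] lb_cont[OF cS, of NN]
      by (simp add: H_def mult.commute)
    then show ?thesis using bS by (simp add: B_def distrib_left distrib_right sum_distrib_left sum_distrib_right)
  qed
  moreover have "?P * z = \<phi> ?e * z" if z: "\<phi> ?C * z = 0" for z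
  proof -
    have "b j * z = 0" if "j \<in> J" for j using b1(2)[OF that] z by (metis mult.assoc mult_zero_right)
    then show ?thesis by (simp add: B_def H_def distrib_right sum_distrib_right)
  qed
  ultimately show ?thesis using PP sP unfolding isproj_def by blast
qed

end

text \<open>After holes have been punched into \<open>x\<close> at the exceptional points scaled to
  radius 1/2, \<open>cut\<close> applies to the perturbed \<open>x'\<close>. Locality of
  \<open>punch\<close> brings the claims about large and small values of the modulus back to the
  original calculus \<open>\<phi>\<close>, as those parts keep away from the circle of radius
  1/2.\<close>

lemma cut_normal:
  assumes x: "qnormal x" and c: "calc NN s \<phi>" and s: "s * s = star x * x" and e: "0 < \<epsilon>"
  shows "\<exists>P. isproj P \<and> norm (P * x - x * P) \<le> \<epsilon> \<and>
     (\<forall>g. continuous_on UNIV g \<longrightarrow> (\<forall>t<1/2+\<epsilon>. g t = 0) \<longrightarrow> P * \<phi> (rf g) = \<phi> (rf g)) \<and>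
     (\<forall>g. continuous_on UNIV g \<longrightarrow> (\<forall>t>1/2-\<epsilon>. g t = 0) \<longrightarrow> P * \<phi> (rf g) = 0)"
proof -
  \<comment> \<open>The cell size. The product \<open>h * (norm x + 1)\<close> bounds the error made
    by rounding the phase, since \<open>norm x'\<close> is at most
    \<open>norm x + 1\<close>.\<close>
  define h where "h = min 1 (\<epsilon> / (8 * (norm x + 2)))"
  have nx: "0 < norm x + 2" using norm_ge_zero[of x] by linarith
  have h: "0 < h" "h \<le> 1" "h * (norm x + 1) \<le> \<epsilon> / 8"
  proof -
    show "0 < h" "h \<le> 1" using e nx by (simp_all add: h_def)
    have "h * (norm x + 1) \<le> \<epsilon> / (8 * (norm x + 2)) * (norm x + 2)"
      using e nx by (intro mult_mono) (auto simp: h_def)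
    also have "\<dots> = \<epsilon> / 8" using nx by (simp add: field_simps)
    finally show "h * (norm x + 1) \<le> \<epsilon> / 8" .
  qed
  obtain Y where part: "finite Y \<and> (\<forall>r>0. \<exists>(J :: (int \<times> int) set) c \<mu> \<kappa>. finite J \<and>
     (\<forall>j\<in>J. continuous_on UNIV (c j)) \<and> continuous_on UNIV \<kappa> \<and>
     (\<forall>j\<in>J. \<forall>z. 0 \<le> c j z \<and> c j z \<le> (1::real)) \<and>
     (\<forall>i\<in>J. \<forall>j\<in>J. i \<noteq> j \<longrightarrow> (\<forall>z. c i z * c j z = 0)) \<and>
     (\<forall>z\<in>sphere 0 1. (\<forall>y\<in>Y. r < cmod (z - y)) \<longrightarrow> (\<Sum>j\<in>J. c j z) = 1 \<and> (\<forall>j\<in>J. c j z = 0 \<or> c j z = 1)) \<and>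
     (\<forall>z\<in>sphere 0 1. cmod (\<kappa> z - z) \<le> h) \<and> (\<forall>j\<in>J. \<forall>z. c j z \<noteq> 0 \<longrightarrow> \<kappa> z = \<mu> j)) \<and> (\<forall>y\<in>Y. cmod y = 1)"
    using circle_partition[OF h(1)] by (rule exE)
  have Y: "finite Y" "\<And>y. y \<in> Y \<Longrightarrow> cmod y = 1" using part by simp_all
  define L where "L = (\<lambda>y. y / 2) ` Y"
  have L: "finite L" "\<And>l. l \<in> L \<Longrightarrow> cmod l = 1/2" using Y by (auto simp: L_def norm_divide)
  define e1 where "e1 = min 1 (\<epsilon> / 8)"
  have e1: "e1 > 0" "e1 \<le> 1" "e1 \<le> \<epsilon> / 8" using e by (auto simp: e1_def)
  obtain x' r where x': "qnormal x'" "r > 0" "norm (x' - x) \<le> e1"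
    "\<And>l y. l \<in> L \<Longrightarrow> r * norm y \<le> norm ((x' - sc l) * y)"
    "\<And>z. star z = z \<Longrightarrow> z * x = x * z \<Longrightarrow> (\<forall>l\<in>L. \<forall>y. \<epsilon> * norm (z * y) \<le> norm ((x - sc l) * (z * y))) \<Longrightarrow>
       (x' - x) * z = 0 \<and> z * (x' - x) = 0"
    using punch[OF L(1) x e1(1) e] by blast
  obtain w \<phi>' where w: "isunit w" "calc NN (star x' * x') \<phi>'" "x' = w * \<phi>' rt"
     "\<And>f. continuous_on NN f \<Longrightarrow> w * \<phi>' f = \<phi>' f * w"
    using normal_polar[OF x'(1)] by blast
  define s' where "s' = \<phi>' rt"
  define \<phi>s where "\<phi>s f = \<phi>' (\<lambda>z. f (rt z))" for f
  have cs: "calc NN s' \<phi>s"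
    unfolding s'_def \<phi>s_def by (rule calc_comp[OF w(2) lb_cont[OF rt_continuous]]) (auto simp: rt_def NN_def)
  obtain \<psi> where ps: "calc (sphere 0 1) w \<psi>" using calc_unitary(2)[of w] w(1) by (auto simp: isunit_def)
  define \<rho> where "\<rho> = min (r / 4) (min (\<epsilon> / 16) (\<epsilon> / 2))"
  have rho: "\<rho> > 0" "2 * \<rho> < r" "\<rho> \<le> \<epsilon> / 16" "\<rho> < \<epsilon>" using x'(2) e by (auto simp: \<rho>_def min_def)
  interpret pu: punched w s' \<psi> \<phi>s Y r \<rho>
  proof
    show "w * s' = s' * w" unfolding s'_def by (rule w(4)[OF rt_continuous])
    show "r * norm z \<le> norm ((w * s' - sc (y / 2)) * z)" if "y \<in> Y" for y z
      using x'(4)[of "y / 2" z] that w(3) by (simp add: L_def s'_def)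
  qed (use cs ps w Y rho in auto)
  have "0 < \<rho> / 2" using rho by simp
  from part[THEN conjunct2, THEN conjunct1, rule_format, OF this] obtain J :: "(int \<times> int) set" and cj :: "int \<times> int \<Rightarrow> complex \<Rightarrow> real" and \<mu> \<kappa> where J: "finite J" "\<forall>j\<in>J. continuous_on UNIV (cj j)" "continuous_on UNIV \<kappa>"
     "\<forall>i\<in>J. \<forall>j\<in>J. i \<noteq> j \<longrightarrow> (\<forall>z. cj i z * cj j z = 0)"
     "\<forall>z\<in>sphere 0 1. (\<forall>y\<in>Y. \<rho> / 2 < cmod (z - y)) \<longrightarrow> (\<Sum>j\<in>J. cj j z) = 1 \<and> (\<forall>j\<in>J. cj j z = 0 \<or> cj j z = 1)"
     "\<forall>z\<in>sphere 0 1. cmod (\<kappa> z - z) \<le> h" "\<forall>j\<in>J. \<forall>z. cj j z \<noteq> 0 \<longrightarrow> \<kappa> z = \<mu> j" by (elim exE conjE) (rule that, assumption+)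
  have "\<exists>P. isproj P \<and> P * \<psi> \<kappa> = \<psi> \<kappa> * P \<and>
     P * \<phi>s (rf (\<lambda>t. t - clip (- \<rho>) \<rho> (t - 1/2))) = \<phi>s (rf (\<lambda>t. t - clip (- \<rho>) \<rho> (t - 1/2))) * P \<and>
     (\<forall>z. \<phi>s (rf (\<lambda>t. cap (fr \<rho> t))) * z = 0 \<longrightarrow> P * z = \<phi>s (rf (\<lambda>t. eta (fr \<rho> t))) * z)"
    by (rule pu.cut[of J cj \<kappa> \<mu>]) (use J in auto)
  then obtain P where P: "isproj P" "P * \<psi> \<kappa> = \<psi> \<kappa> * P"
     "P * \<phi>s (rf (\<lambda>t. t - clip (- \<rho>) \<rho> (t - 1/2))) = \<phi>s (rf (\<lambda>t. t - clip (- \<rho>) \<rho> (t - 1/2))) * P"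
     "\<And>z. \<phi>s (rf (\<lambda>t. cap (fr \<rho> t))) * z = 0 \<Longrightarrow> P * z = \<phi>s (rf (\<lambda>t. eta (fr \<rho> t))) * z" by blast
  have near: "norm (P * x - x * P) \<le> \<epsilon>"
  proof -
    let ?S = "rf (\<lambda>t. t - clip (- \<rho>) \<rho> (t - 1/2))"
    \<comment> \<open>Commutes with \<open>P\<close> exactly and is near \<open>x\<close>: the phase
      is rounded to cell centres on the cells and the modulus to 1/2 in the window.\<close>
    let ?y = "\<psi> \<kappa> * \<phi>s ?S"
    have k1: "norm (w - \<psi> \<kappa>) \<le> h"
    proof -
      have "w - \<psi> \<kappa> = \<psi> (\<lambda>z. z - \<kappa> z)" using calc_diff[OF ps lb_id lb_cont[OF J(3)]] by (simp add: calc_id[OF ps])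
      moreover have "norm (\<psi> (\<lambda>z. z - \<kappa> z)) \<le> h"
        by (rule calc_norm[OF ps]) (use J(6) h in \<open>auto simp: norm_minus_commute\<close>)
      ultimately show ?thesis by simp
    qed
    have k2: "norm (s' - \<phi>s ?S) \<le> \<rho>"
    proof -
      have cS: "continuous_on UNIV ?S" by (intro rf_cont continuous_intros)
      have "s' - \<phi>s ?S = \<phi>s (\<lambda>z. z - ?S z)" using calc_diff[OF cs lb_id lb_cont[OF cS]] by (simp add: calc_id[OF cs])
      also have "\<dots> = \<phi>s (rf (\<lambda>t. clip (- \<rho>) \<rho> (t - 1/2)))"
        by (rule calc_cong[OF cs]) (auto simp: NN_def rf_def complex_eq_iff)
      also have "norm \<dots> \<le> \<rho>" by (rule calc_norm[OF cs]) (use rho in \<open>auto simp: rf_def clip_def\<close>)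
      finally show ?thesis .
    qed
    have nx': "norm x' \<le> norm x + 1" using norm_triangle_ineq[of "x' - x" x] x'(3) e1 by simp
    have xw: "x' = w * s'" by (simp add: s'_def w(3)[symmetric])
    then have ns: "norm s' \<le> norm x + 1" using nx' norm_unit_mult[OF w(1), of s'] by simp
    have "norm (\<psi> \<kappa>) \<le> norm w + h" using k1 norm_triangle_ineq2[of "\<psi> \<kappa>" w] by (simp add: norm_minus_commute)
    then have nk: "norm (\<psi> \<kappa>) \<le> 2" using isunit_norm[OF w(1)] h by simp
    have "x' - ?y = (w - \<psi> \<kappa>) * s' + \<psi> \<kappa> * (s' - \<phi>s ?S)" by (simp add: xw algebra_simps)
    then have "norm (x' - ?y) \<le> norm ((w - \<psi> \<kappa>) * s') + norm (\<psi> \<kappa> * (s' - \<phi>s ?S))" by (simp add: norm_triangle_ineq)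
    also have "norm ((w - \<psi> \<kappa>) * s') \<le> h * (norm x + 1)" by (rule norm_mult_le[OF k1 ns])
    also have "norm (\<psi> \<kappa> * (s' - \<phi>s ?S)) \<le> 2 * \<rho>" by (rule norm_mult_le[OF nk k2])
    finally have "norm (x' - ?y) \<le> \<epsilon> / 4" using h rho by linarith
    then have d: "norm (x - ?y) \<le> \<epsilon> / 2"
      using norm_triangle_ineq[of "x - x'" "x' - ?y"] x'(3) e1 e by (simp add: norm_minus_commute)
    have Py: "P * ?y = ?y * P" using P(2,3) by (metis mult.assoc)
    have "P * x - x * P = P * (x - ?y) - (x - ?y) * P" using Py by (simp add: left_diff_distrib right_diff_distrib)
    then have "norm (P * x - x * P) \<le> norm (P * (x - ?y)) + norm ((x - ?y) * P)" by (simp add: norm_triangle_ineq4)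
    also have "norm (P * (x - ?y)) \<le> 1 * (\<epsilon> / 2)" by (rule norm_mult_le[OF isproj_norm[OF P(1)] d])
    also have "norm ((x - ?y) * P) \<le> (\<epsilon> / 2) * 1" by (rule norm_mult_le[OF d isproj_norm[OF P(1)]])
    finally show ?thesis by simp
  qed
  have ss: "star s = s"
    using calc_star[OF c lb_id] calc_cong[OF c, of cnj "\<lambda>z. z"] calc_id[OF c] by (auto simp: NN_def complex_eq_iff)
  \<comment> \<open>The calculus of \<open>star x * x\<close> induced by \<open>\<phi>\<close>, in a
    form comparable with the polar calculus \<open>\<phi>'\<close> of
    \<open>star x' * x'\<close>.\<close>
  define \<phi>2 where "\<phi>2 f = \<phi> (\<lambda>z. f (z * z))" for f
  have c2: "calc NN (star x * x) \<phi>2"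
  proof -
    have "calc NN (\<phi> (\<lambda>z. z * z)) \<phi>2" unfolding \<phi>2_def
      by (rule calc_comp[OF c]) (auto simp: NN_def)
    then show ?thesis using calc_mult[OF c lb_id lb_id] by (simp add: calc_id[OF c] s)
  qed
  have rtsq: "rt (z * z) = z" if "z \<in> NN" for z
    using that by (auto simp: rt_def NN_def complex_eq_iff real_sqrt_mult)
  have f2: "\<phi>2 (\<lambda>z. f (rt z)) = \<phi> f" for f
    unfolding \<phi>2_def by (rule calc_cong[OF c]) (simp add: rtsq)
  have xs: "x * s = s * x"
  proof -
    have sxx: "star (star x * x) = star x * x" by (simp add: star_mult)
    have 1: "x * (star x * x) = star x * x * x" using x unfolding qnormal_def by (metis mult.assoc)
    have "x * \<phi>2 rt = \<phi>2 rt * x"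
      by (rule calc_commute[OF c2 closed_NN rt_continuous 1]) (use 1 sxx in simp)
    then show ?thesis using f2[of "\<lambda>z. z"] by (simp add: calc_id[OF c])
  qed
  \<comment> \<open>If \<open>g\<close> vanishes near 1/2, then \<open>\<phi> (rf g)\<close> stays
    at distance \<open>\<epsilon>\<close> from the punched points, does not see the change from
    \<open>x\<close> to \<open>x'\<close>, and so intertwines the two calculi. Outside the window
    \<open>P\<close> acts as \<open>eta\<close>, which is 0 or 1 there.\<close>
  have Pz: "P * \<phi> (rf g) = \<phi> (rf (\<lambda>t. g t * eta (fr \<rho> t)))"
    if g: "continuous_on UNIV g" and low: "\<And>t. \<bar>t - 1/2\<bar> < \<epsilon> \<Longrightarrow> g t = 0"
      and away: "\<And>y. (1/2 + \<epsilon>) * norm (\<phi> (rf g) * y) \<le> norm (x * (\<phi> (rf g) * y)) \<or> norm (x * (\<phi> (rf g) * y)) \<le> (1/2 - \<epsilon>) * norm (\<phi> (rf g) * y)" for g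
  proof -
    let ?z = "\<phi> (rf g)"
    have cg: "continuous_on S (rf g)" for S by (rule rf_cont[OF g])
    have sz: "star ?z = ?z" using calc_star[OF c rf_lb[OF g]] by (simp add: rf_cnj)
    have zx: "?z * x = x * ?z"
      using calc_commute[OF c closed_NN cg, of x] xs ss by simp
    have "(x' - x) * ?z = 0 \<and> ?z * (x' - x) = 0"
    proof (rule x'(5)[OF sz zx], intro ballI allI)
      fix l y assume l: "l \<in> L"
      let ?v = "?z * y"
      have "norm (sc l * ?v) = 1/2 * norm ?v"
      proof -
        have "sc l * ?v = sc (1/2) * (sc (2 * l) * ?v)" by (simp flip: sc_mult mult.assoc)
        then have le: "norm (sc l * ?v) \<le> 1/2 * norm ?v" using norm_mult_le[of "sc l" "1/2" ?v "norm ?v"] L(2)[OF l] by simp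
        have l0: "l \<noteq> 0" using L(2)[OF l] by auto
        have "?v = sc (1 / l) * (sc l * ?v)" using l0 by (simp flip: sc_mult mult.assoc)
        then have "norm ?v \<le> 2 * norm (sc l * ?v)"
          using norm_mult_le[of "sc (1 / l)" 2 "sc l * ?v"] L(2)[OF l] by (simp add: norm_divide)
        then show ?thesis using le by simp
      qed
      then show "\<epsilon> * norm ?v \<le> norm ((x - sc l) * ?v)"
        using away[of y] norm_triangle_ineq2[of "x * ?v" "sc l * ?v"] norm_triangle_ineq2[of "sc l * ?v" "x * ?v"]
        by (auto simp: left_diff_distrib norm_minus_commute algebra_simps)
    qed
    then have xz: "x' * ?z = x * ?z" "?z * x' = ?z * x" by (simp_all add: algebra_simps)
    have sxz: "star x' * ?z = star x * ?z" using arg_cong[OF xz(2), of star] by (simp add: star_mult sz)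
    have zsx: "?z * star x = star x * ?z" by (rule commute_star[OF sz zx])
    have int: "?z * (star x * x) = star x' * x' * ?z"
      using zx zsx xz sxz by (metis mult.assoc)
    have tr: "?z * \<phi> f = \<phi>s f * ?z" if "continuous_on UNIV f" for f
    proof -
      have "?z * \<phi>2 (\<lambda>z. f (rt z)) = \<phi>' (\<lambda>z. f (rt z)) * ?z"
      proof (rule calc_intertwine[OF c2 w(2) closed_NN])
        show "continuous_on NN (\<lambda>z. f (rt z))"
          by (rule continuous_on_compose2[OF that rt_continuous]) simp
      qed (use int in \<open>simp_all add: star_mult\<close>)
      then show ?thesis by (simp add: f2 \<phi>s_def)
    qed
    have fc: "continuous_on UNIV (\<lambda>t. F (fr \<rho> t))" if "continuous_on UNIV F" for F :: "real \<Rightarrow> real"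
      using continuous_on_compose2[OF that fr_cont[OF rho(1), of UNIV]] by simp
    have gc0: "g t * cap (fr \<rho> t) = 0" for t
    proof (cases "\<bar>t - 1/2\<bar> < \<epsilon>")
      case False
      then have "fr \<rho> t = 1 \<or> fr \<rho> t = -1" using fr_inside[OF rho(1), of t] rho by fastforce
      then show ?thesis using cap_zero[of 1] cap_zero[of "-1"] by auto
    qed (simp add: low)
    have "\<phi>s (rf (\<lambda>t. cap (fr \<rho> t))) * ?z = ?z * \<phi> (rf (\<lambda>t. cap (fr \<rho> t)))"
      by (rule tr[symmetric]) (intro rf_cont fc cap_cont)
    also have "\<dots> = \<phi> (rf (\<lambda>t. g t * cap (fr \<rho> t)))"
      using calc_mult[OF c rf_lb[OF g] rf_lb[OF fc[OF cap_cont]]] by (simp add: rf_mult)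
    also have "\<dots> = 0" by (rule calc_zero'[OF c]) (simp add: rf_def gc0)
    finally have "P * ?z = \<phi>s (rf (\<lambda>t. eta (fr \<rho> t))) * ?z" by (rule P(4))
    also have "\<dots> = ?z * \<phi> (rf (\<lambda>t. eta (fr \<rho> t)))"
      by (rule tr[symmetric]) (intro rf_cont fc eta_cont)
    also have "\<dots> = \<phi> (rf (\<lambda>t. g t * eta (fr \<rho> t)))"
      using calc_mult[OF c rf_lb[OF g] rf_lb[OF fc[OF eta_cont]]] by (simp add: rf_mult)
    finally show ?thesis .
  qed
  have xsv: "norm (x * v) = norm (s * v)" for v
  proof (rule norm_same_cstar)
    have "star (x * v) * (x * v) = star v * ((star x * x) * v)" by (simp add: star_mult mult.assoc)
    also have "\<dots> = star (s * v) * (s * v)" unfolding s[symmetric] by (simp add: star_mult ss mult.assoc)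
    finally show "star (x * v) * (x * v) = star (s * v) * (s * v)" .
  qed
  have high: "P * \<phi> (rf g) = \<phi> (rf g)" if g: "continuous_on UNIV g" "\<And>t. t < 1/2 + \<epsilon> \<Longrightarrow> g t = 0" for g
  proof -
    have "(1/2 + \<epsilon>) * norm (\<phi> (rf g) * y) \<le> norm (x * (\<phi> (rf g) * y))" for y
    proof -
      define i where "i = rf (\<lambda>t. 1 / max (1/2 + \<epsilon>) t)"
      have ic: "continuous_on UNIV i" unfolding i_def using e by (intro rf_cont continuous_intros) (auto simp: max_def)
      have "\<phi> i * \<phi> (\<lambda>z. z) * \<phi> (rf g) = \<phi> (\<lambda>z. i z * z * rf g z)"
        using calc_mult[OF c lb_mult[OF lb_cont[OF ic] lb_id] rf_lb[OF g(1)]] calc_mult[OF c lb_cont[OF ic] lb_id] by simp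
      also have "\<dots> = \<phi> (rf g)"
      proof (rule calc_cong[OF c])
        fix z assume "z \<in> NN"
        then have z: "z = complex_of_real (Re z)" by (simp add: NN_def complex_eq_iff)
        have "1 / max (1/2 + \<epsilon>) t * t * g t = g t" for t using g(2)[of t] e by (cases "t < 1/2 + \<epsilon>") (auto simp: max_def)
        from this[of "Re z"] show "i z * z * rf g z = rf g z" unfolding i_def rf_def by (subst (2) z) (metis of_real_mult)
      qed
      finally have "\<phi> (rf g) * y = \<phi> i * (s * (\<phi> (rf g) * y))" unfolding calc_id[OF c] by (metis mult.assoc)
      moreover have "norm (\<phi> i) \<le> 1 / (1/2 + \<epsilon>)"
        by (rule calc_norm[OF c]) (use e in \<open>auto simp: i_def rf_def norm_divide max_def intro!: divide_left_mono mult_pos_pos\<close>)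
      ultimately have "norm (\<phi> (rf g) * y) \<le> 1 / (1/2 + \<epsilon>) * norm (s * (\<phi> (rf g) * y))" by (metis norm_mult_le order_refl)
      then show ?thesis using e unfolding xsv by (simp add: field_simps)
    qed
    then have "P * \<phi> (rf g) = \<phi> (rf (\<lambda>t. g t * eta (fr \<rho> t)))" using g by (intro Pz) auto
    also have "(\<lambda>t. g t * eta (fr \<rho> t)) = g"
    proof
      fix t show "g t * eta (fr \<rho> t) = g t"
        using g(2)[of t] fr_high[OF rho(1), of t] rho by (cases "t < 1/2 + \<epsilon>") (auto simp: eta_high)
    qed
    finally show ?thesis .
  qed
  have lowz: "P * \<phi> (rf g) = 0" if g: "continuous_on UNIV g" "\<And>t. t > 1/2 - \<epsilon> \<Longrightarrow> g t = 0" for g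
  proof -
    have "norm (x * (\<phi> (rf g) * y)) \<le> (1/2 - \<epsilon>) * norm (\<phi> (rf g) * y)" for y
    proof (cases "\<epsilon> \<le> 1/2")
      case True
      define i where "i = rf (\<lambda>t. min (1/2 - \<epsilon>) t)"
      have ic: "continuous_on UNIV i" unfolding i_def by (intro rf_cont continuous_intros)
      have "s * \<phi> (rf g) = \<phi> (\<lambda>z. z * rf g z)" using calc_mult[OF c lb_id rf_lb[OF g(1)]] by (simp add: calc_id[OF c])
      also have "\<dots> = \<phi> (\<lambda>z. i z * rf g z)"
        using g(2) by (intro calc_cong[OF c]) (auto simp: i_def rf_def NN_def complex_eq_iff min_def not_le)
      finally have "s * (\<phi> (rf g) * y) = \<phi> i * (\<phi> (rf g) * y)"
        using calc_mult[OF c lb_cont[OF ic] rf_lb[OF g(1)]] by (simp add: mult.assoc[symmetric])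
      moreover have "norm (\<phi> i) \<le> 1/2 - \<epsilon>"
        by (rule calc_norm[OF c]) (use True in \<open>auto simp: i_def rf_def NN_def\<close>)
      ultimately show ?thesis unfolding xsv by (simp add: norm_mult_le)
    next
      case False
      then have "\<phi> (rf g) = 0" using g(2) by (intro calc_zero'[OF c]) (auto simp: rf_def NN_def)
      then show ?thesis by simp
    qed
    then have "P * \<phi> (rf g) = \<phi> (rf (\<lambda>t. g t * eta (fr \<rho> t)))" using g by (intro Pz) auto
    also have "(\<lambda>t. g t * eta (fr \<rho> t)) = (\<lambda>t. 0)"
    proof
      fix t show "g t * eta (fr \<rho> t) = 0"
        using g(2)[of t] fr_low[OF rho(1), of t] rho by (cases "t > 1/2 - \<epsilon>") (auto simp: eta_low)
    qed
    also have "rf (\<lambda>t. 0) = (\<lambda>z. 0)" by (simp add: rf_def fun_eq_iff)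
    finally show ?thesis by (simp add: calc_zero[OF c])
  qed
  show ?thesis using P(1) near high lowz by blast
qed

section \<open>Almost commuting projections for a unitary element\<close>

lemma absorb: "a * b = c \<Longrightarrow> a * (b * x) = c * (x :: 'a :: semigroup_mult)"
  by (simp add: mult.assoc[symmetric])

lemma norm_eq_zeroI: "norm x \<le> c * norm x \<Longrightarrow> c < 1 \<Longrightarrow> x = (0 :: 'a :: real_normed_vector)"
proof -
  assume a: "norm x \<le> c * norm x" "c < 1"
  then have "(1 - c) * norm x \<le> 0" by (simp add: left_diff_distrib)
  then have "norm x \<le> 0" using a(2) by (simp add: mult_le_0_iff)
  then show ?thesis by simp
qed

section \<open>Functions on half circles and arcs\<close>

lemma circle_real: "z \<in> sphere 0 1 \<Longrightarrow> Im z = 0 \<Longrightarrow> Re z = 1 \<or> Re z = - 1"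
proof -
  assume "z \<in> sphere 0 1" "Im z = 0"
  then have "\<bar>Re z\<bar> = 1" by (simp add: cmod_eq_Re)
  then show ?thesis by linarith
qed

lemma circle_cnj: "z \<in> sphere 0 1 \<Longrightarrow> cnj z \<in> sphere 0 1"
  by simp

definition topf :: "(real \<Rightarrow> real) \<Rightarrow> complex \<Rightarrow> complex" where
  "topf F z = complex_of_real (if 0 < Im z then F (Re z) else 0)"

lemma continuous_on_topf:
  assumes "continuous_on UNIV F" "F 1 = 0" "F (- 1) = 0"
  shows "continuous_on (sphere 0 1) (topf F)"
proof -
  let ?A = "sphere 0 1 \<inter> {z. 0 \<le> Im z}" and ?B = "sphere 0 1 \<inter> {z. Im z \<le> 0}"
  have "topf F z = rf F z" if "z \<in> ?A" for z
    using that circle_real[of z] assms by (cases "Im z = 0") (auto simp: topf_def rf_def)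
  then have "continuous_on ?A (topf F)"
    using rf_cont[OF assms(1), of ?A] continuous_on_cong[OF refl, of ?A "topf F" "rf F"] by simp
  moreover have "continuous_on ?B (topf F)"
    by (subst continuous_on_cong[OF refl, of ?B "topf F" "\<lambda>z. 0"]) (auto simp: topf_def)
  ultimately have "continuous_on (?A \<union> ?B) (topf F)"
    by (rule continuous_on_closed_Un[rotated 2]) (intro closed_Int closed_sphere closed_halfspace_Im_le closed_halfspace_Im_ge)+
  moreover have "?A \<union> ?B = sphere 0 1" by auto
  ultimately show ?thesis by metis
qed

lemma continuous_on_cut_Re:
  assumes g: "continuous_on (sphere 0 1) g" "\<And>z. z \<in> sphere 0 1 \<Longrightarrow> Re z = c \<Longrightarrow> g z = (0::complex)"
  shows "continuous_on (sphere 0 1) (\<lambda>z. (if Re z \<le> c then 1 else 0) * g z)" (is "continuous_on _ ?g")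
proof -
  let ?A = "sphere 0 1 \<inter> {z. Re z \<le> c}" and ?B = "sphere 0 1 \<inter> {z. c \<le> Re z}"
  have "continuous_on ?A g" by (rule continuous_on_subset[OF g(1)]) auto
  then have "continuous_on ?A ?g" by (subst continuous_on_cong[OF refl, of ?A ?g g]) auto
  moreover have "continuous_on ?B ?g"
    by (subst continuous_on_cong[OF refl, of ?B ?g "\<lambda>z. 0"]) (use g(2) in auto)
  ultimately have "continuous_on (?A \<union> ?B) ?g"
    by (rule continuous_on_closed_Un[rotated 2]) (intro closed_Int closed_sphere closed_halfspace_Re_le closed_halfspace_Re_ge)+
  moreover have "?A \<union> ?B = sphere 0 1" by auto
  ultimately show ?thesis by metis
qed

text \<open>One cut of the spectrum of \<open>u\<close> at real parts between \<open>cb\<close> and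
  \<open>ca\<close>. A vertical line meets the circle in two conjugate points, which
  \<open>sg\<close> exchanges.\<close>

locale arc_cut =
  fixes u v :: q and \<Phi> :: "(complex \<Rightarrow> complex) \<Rightarrow> q" and ca cb :: real
  assumes c: "calc (sphere 0 1) u \<Phi>" and sgc: "\<And>f. lb (sphere 0 1) f \<Longrightarrow> sg (\<Phi> f) = \<Phi> (\<lambda>z. cnj (f (cnj z)))"
    and u: "isunit u" and v: "isunit v" and sgv: "sg v = v" and uv: "u * v = v * u"
    and levels: "- 1 < cb" "cb < ca" "ca < 1"
begin

lemma comm: "lb (sphere 0 1) a \<Longrightarrow> lb (sphere 0 1) b \<Longrightarrow> \<Phi> a * \<Phi> b = \<Phi> b * \<Phi> a"
  using calc_mult[OF c, of a b] calc_mult[OF c, of b a] by (simp add: mult.commute)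

lemma lbc: "continuous_on (sphere 0 1) g \<Longrightarrow> lb (sphere 0 1) g"
  by (rule lb_continuous[OF closed_sphere])

lemma comm_v: "continuous_on (sphere 0 1) g \<Longrightarrow> \<Phi> g * v = v * \<Phi> g"
proof -
  assume g: "continuous_on (sphere 0 1) g"
  have "v * star u = star u * (u * v) * star u" using isunitD[OF u] by (simp add: mult.assoc)
  also have "\<dots> = star u * v" unfolding uv using isunitD[OF u] by (simp add: mult.assoc)
  finally show ?thesis using calc_commute[OF c closed_sphere g, of v] uv by simp
qed

text \<open>The arc to the left of \<open>ca\<close>. As a Borel projection of a lift,
  \<open>f\<close> is fixed by \<open>sg\<close> and commutes with the functions of
  \<open>u\<close>, but it may fail to commute with \<open>v\<close>, since \<open>ind\<close>
  jumps.\<close>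

definition ind :: "complex \<Rightarrow> complex" where "ind z = (if Re z \<le> ca then 1 else 0)"
definition f where "f = \<Phi> ind"
text \<open>A quarter of the smaller gap: \<open>bump\<close> reaches only \<open>2 * dd\<close>
  away from \<open>ca\<close> and thus stays within the plateau of \<open>ramp\<close>.\<close>

definition dd where "dd = min (ca - cb) (1 - ca) / 4"
definition bump :: "real \<Rightarrow> real" where "bump t = clip 0 1 (2 - \<bar>t - ca\<bar> / dd)"
definition ramp :: "real \<Rightarrow> real" where "ramp t = clip 0 1 (min ((t - cb) * 2 / (ca - cb)) ((1 - t) * 2 / (1 - ca)))"
definition S where "S = \<Phi> (topf ramp)"
text \<open>Functions supported in the arc and off the neighbourhood of its ends; on them
  compressing \<open>v\<close> to the arc changes nothing.\<close>

definition inner :: "(complex \<Rightarrow> complex) \<Rightarrow> bool" where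
  "inner g \<longleftrightarrow> continuous_on (sphere 0 1) g \<and> (\<forall>z\<in>sphere 0 1. \<not> Re z \<le> ca \<longrightarrow> g z = 0) \<and>
     (\<forall>z\<in>sphere 0 1. bump (Re z) \<noteq> 0 \<longrightarrow> g z = 0)"

lemma dd: "dd > 0" "4 * dd \<le> ca - cb" "4 * dd \<le> 1 - ca" using levels by (auto simp: dd_def)

lemma bump_cont: "continuous_on UNIV bump" unfolding bump_def using dd by (intro continuous_intros) auto
lemma ramp_cont: "continuous_on UNIV ramp" unfolding ramp_def using levels by (intro continuous_intros) auto

lemma bump_near: "bump t \<noteq> 0 \<Longrightarrow> \<bar>t - ca\<bar> < 2 * dd"
proof (rule ccontr)
  assume b: "bump t \<noteq> 0" and "\<not> \<bar>t - ca\<bar> < 2 * dd"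
  then have "2 - \<bar>t - ca\<bar> / dd \<le> 0" using dd(1) by (simp add: field_simps)
  then show False using b by (simp add: bump_def clip_def)
qed

lemma bump_ends: "bump 1 = 0" "bump (- 1) = 0"
  using bump_near[of 1] bump_near[of "- 1"] dd levels by linarith+
lemma bump_ca: "bump ca = 1" by (simp add: bump_def clip_def)

lemma ramp_low: "t \<le> cb \<Longrightarrow> ramp t = 0"
proof -
  assume "t \<le> cb"
  then have "(t - cb) * 2 / (ca - cb) \<le> 0" using levels by (intro divide_nonpos_pos) auto
  then show ?thesis by (simp add: ramp_def clip_def)
qed

lemma ramp_ends: "ramp 1 = 0" "ramp (- 1) = 0"
  using ramp_low[of "-1"] levels by (auto simp: ramp_def clip_def)

lemma ramp_bump: "bump t \<noteq> 0 \<Longrightarrow> ramp t = 1"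
proof -
  assume "bump t \<noteq> 0"
  then have "\<bar>t - ca\<bar> < 2 * dd" by (rule bump_near)
  then have "1 \<le> (t - cb) * 2 / (ca - cb)" "1 \<le> (1 - t) * 2 / (1 - ca)"
    using dd levels by (simp_all add: field_simps)
  then show ?thesis by (simp add: ramp_def clip_def)
qed

lemma ramp_range: "0 \<le> ramp t" "ramp t \<le> 1" by (auto simp: ramp_def clip_def)

lemma lbs: "lb (sphere 0 1) ind" "lb (sphere 0 1) (topf bump)" "lb (sphere 0 1) (topf ramp)"
  "continuous_on (sphere 0 1) (topf bump)" "continuous_on (sphere 0 1) (topf ramp)"
proof -
  show "lb (sphere 0 1) ind" by (rule lb_bounded[of _ _ 1]) (simp add: ind_def)
  show 1: "continuous_on (sphere 0 1) (topf bump)" "continuous_on (sphere 0 1) (topf ramp)"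
    by (intro continuous_on_topf bump_cont ramp_cont bump_ends ramp_ends)+
  then show "lb (sphere 0 1) (topf bump)" "lb (sphere 0 1) (topf ramp)" by (simp_all add: lbc)
qed

lemma topf_cnj: "cnj (topf F z) = topf F z" by (simp add: topf_def)

lemma continuous_on_cnj_arg: "continuous_on (sphere 0 1) g \<Longrightarrow> continuous_on (sphere 0 1) (\<lambda>z. g (cnj z))"
  by (rule continuous_on_compose2[of "sphere 0 1" g _ cnj]) (auto intro!: continuous_intros)

lemma f_simps: "star f = f" "f * f = f" "sg f = f"
proof -
  show "star f = f" unfolding f_def calc_star[OF c lbs(1)] by (rule arg_cong[of _ _ \<Phi>]) (auto simp: ind_def)
  show "f * f = f" unfolding f_def calc_mult[OF c lbs(1) lbs(1), symmetric] by (rule arg_cong[of _ _ \<Phi>]) (auto simp: ind_def)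
  show "sg f = f" unfolding f_def sgc[OF lbs(1)] by (rule arg_cong[of _ _ \<Phi>]) (auto simp: ind_def)
qed

lemma f_mult: "lb (sphere 0 1) g \<Longrightarrow> f * \<Phi> g = \<Phi> (\<lambda>z. ind z * g z)" "lb (sphere 0 1) g \<Longrightarrow> \<Phi> g * f = \<Phi> (\<lambda>z. ind z * g z)"
  using calc_mult[OF c lbs(1), of g] comm[OF lbs(1), of g] by (simp_all add: f_def)

lemma f_inner: "inner g \<Longrightarrow> f * \<Phi> g = \<Phi> g" "inner g \<Longrightarrow> \<Phi> g * f = \<Phi> g"
  using f_mult[of g] calc_cong[OF c, of "\<lambda>z. ind z * g z" g] by (auto simp: inner_def lbc ind_def)

lemma inner_cnj: "inner g \<Longrightarrow> inner (\<lambda>z. cnj (g z))" "inner g \<Longrightarrow> inner (\<lambda>z. cnj (g (cnj z)))"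
proof -
  assume "inner g"
  then show "inner (\<lambda>z. cnj (g z))" by (auto simp: inner_def intro!: continuous_intros)
next
  assume g: "inner g"
  then have "continuous_on (sphere 0 1) (\<lambda>z. g (cnj z))" unfolding inner_def by (intro continuous_on_cnj_arg) auto
  moreover have "g (cnj z) = 0" if "z \<in> sphere 0 1" "\<not> Re z \<le> ca \<or> bump (Re z) \<noteq> 0" for z
    using g that unfolding inner_def by (metis circle_cnj complex_cnj(1) complex_cnj_cnj cnj.sel(1))
  ultimately show "inner (\<lambda>z. cnj (g (cnj z)))" by (auto simp: inner_def intro!: continuous_intros)
qed

lemma innerI:
  assumes "continuous_on (sphere 0 1) g" "\<And>z. z \<in> sphere 0 1 \<Longrightarrow> bump (Re z) \<noteq> 0 \<Longrightarrow> g z = 0"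
  shows "inner (\<lambda>z. ind z * g z)"
proof -
  have "continuous_on (sphere 0 1) (\<lambda>z. ind z * g z)"
    unfolding ind_def by (rule continuous_on_cut_Re) (use assms bump_ca in auto)
  then show ?thesis using assms by (auto simp: inner_def ind_def)
qed

text \<open>The compression \<open>f * v * f + (1 - f)\<close> fails to be unitary only near the two end points of the arc, where its
  polar part is replaced by partial isometries \<open>z\<close> and \<open>sg z\<close> respecting top and bottom; that such a \<open>z\<close> exists is
  where the symmetry \<open>sg\<close> enters.\<close>

lemma exists_compression_unitary:
  "\<exists>w. isunit w \<and> sg w = w \<and> f * w = w * f \<and> S * w = w * S \<and> (\<forall>g. inner g \<longrightarrow> w * \<Phi> g = v * \<Phi> g \<and> \<Phi> g * w = \<Phi> g * v)"
proof -
  note fs = f_simps and fa = absorb[OF f_simps(2)] and vv = isunitD[OF v]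
  define bt where "bt = topf bump"
  define ab where "ab = (\<lambda>z. topf bump (cnj z))"
  define Sb where "Sb = (\<lambda>z. topf ramp (cnj z))"
  define kt where "kt = \<Phi> bt"
  define kb where "kb = \<Phi> ab"
  define S2 where "S2 = \<Phi> Sb"
  have cat: "continuous_on (sphere 0 1) bt" "continuous_on (sphere 0 1) ab" "continuous_on (sphere 0 1) Sb"
    unfolding bt_def ab_def Sb_def by (intro lbs continuous_on_cnj_arg)+
  note lat = cat[THEN lbc]
  have sk: "star kt = kt" "star kb = kb" "star S = S" "star S2 = S2" "sg kt = kb" "sg kb = kt" "sg S = S2" "sg S2 = S"
    unfolding kt_def kb_def S_def S2_def calc_star[OF c lat(1)] calc_star[OF c lat(2)] calc_star[OF c lat(3)] calc_star[OF c lbs(3)]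
      sgc[OF lat(1)] sgc[OF lat(2)] sgc[OF lat(3)] sgc[OF lbs(3)]
    by (simp_all add: bt_def ab_def Sb_def topf_cnj)
  have kk: "kt * kb = 0" "S * kt = kt" "S * kb = 0" "S * S2 = 0"
  proof -
    have "kt * kb = \<Phi> (\<lambda>z. bt z * ab z)" using calc_mult[OF c lat(1,2)] by (simp add: kt_def kb_def)
    also have "\<dots> = 0" by (rule calc_zero'[OF c]) (simp add: bt_def ab_def topf_def)
    finally show "kt * kb = 0" .
    have "S * kt = \<Phi> (\<lambda>z. topf ramp z * bt z)" using calc_mult[OF c lbs(3) lat(1)] by (simp add: kt_def S_def)
    also have "\<dots> = kt" unfolding kt_def by (rule calc_cong[OF c]) (use ramp_bump in \<open>auto simp: bt_def topf_def\<close>)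
    finally show "S * kt = kt" .
    have "S * kb = \<Phi> (\<lambda>z. topf ramp z * ab z)" using calc_mult[OF c lbs(3) lat(2)] by (simp add: kb_def S_def)
    also have "\<dots> = 0" by (rule calc_zero'[OF c]) (simp add: ab_def topf_def)
    finally show "S * kb = 0" .
    have "S * S2 = \<Phi> (\<lambda>z. topf ramp z * Sb z)" using calc_mult[OF c lbs(3) lat(3)] by (simp add: S2_def S_def)
    also have "\<dots> = 0" by (rule calc_zero'[OF c]) (simp add: Sb_def topf_def)
    finally show "S * S2 = 0" .
  qed
  have km: "kt * S = S * kt" "kb * S = S * kb" "kb * kt = kt * kb" "f * kt = kt * f" "f * kb = kb * f" "f * S = S * f" "S2 * S = S * S2"
    unfolding kt_def kb_def S_def S2_def f_def by (intro comm lat lbs)+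
  have vm: "kt * v = v * kt" "S * v = v * S" unfolding kt_def S_def by (intro comm_v cat lbs)+
  have kg: "kt * \<Phi> g = 0" "\<Phi> g * kt = 0" "kb * \<Phi> g = 0" "\<Phi> g * kb = 0" if g: "inner g" for g
  proof -
    have lg: "lb (sphere 0 1) g" using g by (simp add: inner_def lbc)
    have "bt z * g z = 0 \<and> ab z * g z = 0" if "z \<in> sphere 0 1" for z
      using g that by (auto simp: inner_def bt_def ab_def topf_def)
    then show "kt * \<Phi> g = 0" "kb * \<Phi> g = 0"
      using calc_mult[OF c lat(1) lg] calc_mult[OF c lat(2) lg] calc_zero'[OF c, of "\<lambda>z. bt z * g z"] calc_zero'[OF c, of "\<lambda>z. ab z * g z"]
      by (simp_all add: kt_def kb_def)
    then show "\<Phi> g * kt = 0" "\<Phi> g * kb = 0" using comm[OF lg lat(1)] comm[OF lg lat(2)] by (simp_all add: kt_def kb_def)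
  qed
  \<comment> \<open>\<open>z0\<close> is what leaks out of the arc under \<open>v\<close>, and
    \<open>h\<close> measures the defect of the compression \<open>y\<close>, as
    \<open>star y * y = 1 - h\<close>.\<close>
  define z0 where "z0 = (1 - f) * v * f"
  define h where "h = star z0 * z0"
  define y where "y = f * v * f + (1 - f)"
  have sh: "star h = h" by (simp add: h_def star_mult)
  have sgh: "sg h = h" by (simp add: h_def z0_def sg_mult sg_star sg_diff sgv fs)
  have sgy: "sg y = y" by (simp add: y_def sg_mult sg_add sg_diff sgv fs)
  have hf: "h * f = h" by (simp add: h_def z0_def mult.assoc fs)
  have fh: "f * h = h" using arg_cong[OF hf, of star] by (simp add: star_mult sh fs)
  have h: "h = f - f * (star v * (f * (v * f)))"
  proof -
    have "h = f * (star v * ((1 - f) * ((1 - f) * (v * f))))" by (simp add: h_def z0_def star_mult star_diff fs mult.assoc)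
    also have "(1 - f) * ((1 - f) * (v * f)) = v * f - f * (v * f)" by (simp add: left_diff_distrib right_diff_distrib fa)
    finally show ?thesis by (simp add: right_diff_distrib vv fs)
  qed
  have yy: "star y * y = 1 - h"
    unfolding h y_def by (simp add: star_add star_diff star_mult fs distrib_left distrib_right left_diff_distrib right_diff_distrib mult.assoc fa)
  have hg: "h * \<Phi> g = 0" if "continuous_on (sphere 0 1) g" "f * \<Phi> g = \<Phi> g" for g
  proof -
    have "z0 * \<Phi> g = (1 - f) * (v * \<Phi> g)" using that(2) by (simp add: z0_def mult.assoc)
    also have "\<dots> = (1 - f) * \<Phi> g * v" unfolding comm_v[OF that(1), symmetric] by (simp add: mult.assoc)
    also have "\<dots> = 0" using that(2) by (simp add: left_diff_distrib)
    finally show ?thesis by (simp add: h_def mult.assoc)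
  qed
  have hin: "h * \<Phi> g = 0" "\<Phi> g * h = 0" if g: "inner g" for g
  proof -
    show "h * \<Phi> g = 0" using g f_inner hg by (simp add: inner_def)
    have "h * \<Phi> (\<lambda>z. cnj (g z)) = 0" using inner_cnj(1)[OF g] f_inner hg by (simp add: inner_def)
    moreover have "star (\<Phi> g) = \<Phi> (\<lambda>z. cnj (g z))" using g by (intro calc_star[OF c]) (simp add: inner_def lbc)
    ultimately have "star (\<Phi> g * h) = 0" by (simp add: star_mult sh)
    then show "\<Phi> g * h = 0" by (metis star_star star_zero)
  qed
  \<comment> \<open>The defect sits at the two ends. The function \<open>1 - bt - ab\<close>
    vanishes on the line \<open>Re z = ca\<close>, so it stays continuous when cut off by
    \<open>ind\<close>; hence it commutes with \<open>v\<close>, and \<open>h\<close> kills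
    it.\<close>
  have hk: "h * kt + h * kb = h"
  proof -
    let ?g = "\<lambda>z. 1 - (bt z + ab z)"
    have gc: "continuous_on (sphere 0 1) ?g" by (intro continuous_intros cat)
    have "?g z = 0" if "z \<in> sphere 0 1" "Re z = ca" for z
      using that circle_real[of z] levels bump_ca by (cases "Im z = 0") (auto simp: bt_def ab_def topf_def)
    then have "continuous_on (sphere 0 1) (\<lambda>z. ind z * ?g z)" unfolding ind_def by (intro continuous_on_cut_Re gc) auto
    moreover have "f * \<Phi> (\<lambda>z. ind z * ?g z) = \<Phi> (\<lambda>z. ind z * ?g z)"
      using f_mult(1)[OF lbc[OF gc]] by (metis fa)
    ultimately have "h * \<Phi> (\<lambda>z. ind z * ?g z) = 0" by (rule hg)
    then have "h * (f * \<Phi> ?g) = 0" using f_mult(1)[OF lbc[OF gc]] by simp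
    moreover have "\<Phi> ?g = 1 - (kt + kb)"
      using calc_diff[OF c, of "\<lambda>z. 1" "\<lambda>z. bt z + ab z"] calc_add[OF c lat(1,2)] lat by (simp add: calc_one[OF c] kt_def kb_def lb_add)
    ultimately have "h * f * (1 - (kt + kb)) = 0" by (simp add: mult.assoc)
    then show ?thesis unfolding hf by (simp add: right_diff_distrib distrib_left)
  qed
  have comm_h: "e * h = h * e" if e: "star e = e" "e * v = v * e" "e * f = f * e" for e
  proof -
    have "e * star v = star v * e" using arg_cong[OF e(2), of star] e(1) by (simp add: star_mult)
    then show ?thesis unfolding h using e(2,3) by (simp add: left_diff_distrib right_diff_distrib) (metis mult.assoc)
  qed
  have kth: "kt * h = h * kt" by (rule comm_h) (simp_all add: sk vm km)
  have Sh: "S * h = h * S" by (rule comm_h) (simp_all add: sk vm km)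
  define ht where "ht = h * kt"
  have htk: "ht * kt = ht" "kt * ht = ht"
  proof -
    have "(h * kt + h * kb) * kt = h * kt" by (simp add: hk)
    then have "h * (kt * kt) = h * kt" by (simp add: distrib_right mult.assoc km kk)
    then show 1: "ht * kt = ht" by (simp add: ht_def mult.assoc)
    show "kt * ht = ht" using 1 kth by (simp add: ht_def) (metis mult.assoc)
  qed
  have "ht = star (z0 * kt) * (z0 * kt)"
    using htk(2) by (simp add: star_mult sk ht_def h_def mult.assoc)
  then obtain \<phi> where ph: "calc NN ht \<phi>" using calc_psd[of "z0 * kt"] by metis
  \<comment> \<open>Selects the large part of the top defect. Writing \<open>i4\<close> as
    \<open>z\<close> times the bounded function \<open>r4\<close> makes \<open>Et\<close> inherit
    the localisation of \<open>ht\<close>.\<close>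
  define i4 where "i4 z = (if 1/4 < Re z then 1 else 0 :: complex)" for z
  define r4 where "r4 z = (if 1/4 < Re z then 1 / z else 0 :: complex)" for z
  have li: "lb NN i4" "lb NN r4"
  proof -
    show "lb NN i4" by (rule lb_bounded[of _ _ 1]) (simp add: i4_def)
    show "lb NN r4"
    proof (rule lb_bounded[of _ _ 4])
      fix z show "cmod (r4 z) \<le> 4"
      proof (cases "1/4 < Re z")
        case True
        then have "1/4 \<le> cmod z" using complex_Re_le_cmod[of z] by linarith
        then show ?thesis using True by (simp add: r4_def norm_divide divide_le_eq)
      qed (simp add: r4_def)
    qed
  qed
  define Et where "Et = \<phi> i4"
  have Et1: "Et = \<phi> r4 * ht" "Et = ht * \<phi> r4" "Et * Et = Et" "star Et = Et" "ht * Et = Et * ht"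
  proof -
    have "(\<lambda>z. r4 z * z) = i4" "(\<lambda>z. z * r4 z) = i4" "(\<lambda>z. i4 z * i4 z) = i4" "(\<lambda>z. cnj (i4 z)) = i4"
      by (auto simp: i4_def r4_def fun_eq_iff)
    then show "Et = \<phi> r4 * ht" "Et = ht * \<phi> r4" "Et * Et = Et" "star Et = Et"
      using calc_mult[OF ph li(2) lb_id] calc_mult[OF ph lb_id li(2)] calc_mult[OF ph li(1) li(1)] calc_star[OF ph li(1)]
      by (simp_all add: Et_def calc_id[OF ph])
    show "ht * Et = Et * ht"
      using calc_mult[OF ph li(1) lb_id] calc_mult[OF ph lb_id li(1)] by (simp add: Et_def calc_id[OF ph] mult.commute)
  qed
  have hEn: "norm (ht - ht * Et) \<le> 1/4"
  proof -
    have "ht - ht * Et = \<phi> (\<lambda>z. z - z * i4 z)"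
      using calc_diff[OF ph lb_id, of "\<lambda>z. z * i4 z"] calc_mult[OF ph lb_id li(1)] li by (simp add: Et_def calc_id[OF ph] lb_mult)
    also have "norm \<dots> \<le> 1/4" by (rule calc_norm[OF ph]) (auto simp: i4_def NN_def cmod_eq_Re)
    finally show ?thesis .
  qed
  have Etk: "Et * kt = Et" "kt * Et = Et" "Et * f = Et" "f * Et = Et"
  proof -
    show "Et * kt = Et" unfolding Et1(1) by (simp add: mult.assoc htk)
    show "kt * Et = Et" unfolding Et1(2) by (simp add: absorb[OF htk(2)])
    have "ht * f = ht" unfolding ht_def using km(4) hf by (metis mult.assoc)
    then show "Et * f = Et" unfolding Et1(1) by (simp add: mult.assoc)
    have "f * ht = ht" unfolding ht_def by (simp add: absorb[OF fh])
    then show "f * Et = Et" unfolding Et1(2) by (simp add: absorb)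
  qed
  define Eb where "Eb = sg Et"
  have Ebk: "Eb * kb = Eb" "kb * Eb = Eb" "Eb * f = Eb" "f * Eb = Eb" "Eb * Eb = Eb" "star Eb = Eb" "sg Eb = Et"
    using Etk[THEN arg_cong[of _ _ sg]] Et1(3,4)[THEN arg_cong[of _ _ sg]] by (simp_all add: Eb_def sg_mult sk fs sg_star)
  have EE: "Et * Eb = 0" "Eb * Et = 0"
  proof -
    have "Et * Eb = Et * (kt * kb) * Eb" using Etk(1) Ebk(2) by (metis mult.assoc)
    then show "Et * Eb = 0" by (simp add: kk)
    have "Eb * Et = Eb * (kb * kt) * Et" using Etk(2) Ebk(1) by (metis mult.assoc)
    then show "Eb * Et = 0" by (simp add: kk km)
  qed
  define E where "E = Et + Eb"
  have Es: "star E = E" "E * E = E" "sg E = E" "E * f = E" "f * E = E" "Et * E = Et" "E * Et = Et" "E * Eb = Eb"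
    unfolding E_def by (simp_all add: star_add sg_add distrib_left distrib_right EE Et1(3,4) Ebk Etk add.commute Eb_def[symmetric])
  have SE: "S * Et = Et" "Et * S = Et" "S * Eb = 0" "Eb * S = 0"
    using Etk(1,2) Ebk(1,2) kk(2,3) km(1,2) by (metis mult.assoc mult_zero_left mult_zero_right)+
  have Eg: "E * \<Phi> g = 0" "\<Phi> g * E = 0" if "inner g" for g
  proof -
    have "Et * \<Phi> g = 0" "Eb * \<Phi> g = 0" "\<Phi> g * Et = 0" "\<Phi> g * Eb = 0"
      using Etk(1,2) Ebk(1,2) kg[OF that] by (metis mult.assoc mult_zero_left mult_zero_right)+
    then show "E * \<Phi> g = 0" "\<Phi> g * E = 0" by (simp_all add: E_def distrib_left distrib_right)
  qed
  have hEt: "h * Et = ht * Et" "Et * h = h * Et"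
  proof -
    show 1: "h * Et = ht * Et" using Etk(2) by (metis ht_def mult.assoc)
    have "Et * h = Et * ht" using Etk(1) kth by (metis ht_def mult.assoc)
    then show "Et * h = h * Et" using 1 Et1(5) by simp
  qed
  have hEb: "h * Eb = sg (ht * Et)" "Eb * h = h * Eb"
    using hEt[THEN arg_cong[of _ _ sg]] by (simp_all add: sg_mult sgh Eb_def[symmetric])
  have hE: "E * h = h * E" by (simp add: E_def distrib_left distrib_right hEt hEb)
  define q0 where "q0 = 1 - E"
  have q0: "star q0 = q0" "q0 * q0 = q0" "sg q0 = q0" "q0 * E = 0" "E * q0 = 0" "q0 * h = h * q0" "q0 * Et = 0" "q0 * Eb = 0"
    by (simp_all add: q0_def star_diff sg_diff left_diff_distrib right_diff_distrib Es hE)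
  \<comment> \<open>Off \<open>E\<close> each of the two ends contributes a defect of at most 1/4,
    so \<open>1 - h\<close> stays at least 1/2 there and the polar part is controlled.\<close>
  have hq: "norm (h * q0) \<le> 1/2"
  proof -
    have "h * q0 = (h * kt + h * kb) - h * E" by (simp add: q0_def right_diff_distrib hk)
    also have "h * kb = sg ht" by (simp add: ht_def sg_mult sgh sk)
    also have "h * kt = ht" by (simp add: ht_def)
    also have "h * E = ht * Et + sg (ht * Et)" by (simp add: E_def distrib_left hEt(1) hEb(1))
    finally have "h * q0 = (ht - ht * Et) + sg (ht - ht * Et)" by (simp add: sg_diff)
    then have "norm (h * q0) \<le> norm (ht - ht * Et) + norm (ht - ht * Et)" by (metis norm_sg norm_triangle_ineq)
    then show ?thesis using hEn by simp
  qed
  obtain W \<phi>' where W: "star W * W = 1" "W * star W = 1" "calc NN (star y * y) \<phi>'" "y = qc W * \<phi>' rt" "sg W = W"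
    using polar_lift[of y] sgy by blast
  define w where "w = qc W"
  have bW: "bd W" using W(1) by (rule bd_unitary)
  have w: "isunit w" "sg w = w" using W bW by (simp_all add: w_def isunit_def qc_star qc_mult bd_star qc_one qc_sg)
  note ww = isunitD[OF w(1)]
  have p: "calc NN (1 - h) \<phi>'" using W(3) by (simp add: yy)
  have s1h: "star (1 - h) = 1 - h" by (simp add: star_diff sh)
  \<comment> \<open>The inverse square root truncated at 1/4. On \<open>q0\<close> the truncation is
    harmless, so \<open>m = w * q0\<close> is expressed through a continuous function of
    \<open>1 - h\<close>, and what commutes with \<open>y\<close>, \<open>h\<close> and
    \<open>E\<close> commutes with \<open>m\<close>.\<close>
  define xi where "xi z = complex_of_real (1 / sqrt (max (Re z) (1/4)))" for z
  have xic: "continuous_on A xi" for A unfolding xi_def by (intro continuous_intros) (auto simp: max_def)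
  have rtc: "continuous_on A rt" for A by (rule rt_continuous)
  define gg where "gg z = 1 - rt z * xi z" for z
  have ggc: "continuous_on A gg" for A unfolding gg_def by (intro continuous_intros xic rtc)
  have com': "e * \<phi>' g = \<phi>' g * e" if "continuous_on UNIV g" "e * h = h * e" for e g
    by (rule calc_commute[OF p closed_NN calc_lb_cont[OF that(1)]]) (simp_all only: s1h, simp_all add: left_diff_distrib right_diff_distrib that)
  \<comment> \<open>\<open>gg\<close> lives where \<open>1 - h\<close> is below 1/4,
    \<open>q0\<close> where \<open>h\<close> is at most 1/2; the two bounds add up to
    \<open>3/4 < 1\<close>.\<close>
  have zq: "\<phi>' gg * q0 = 0"
  proof -
    let ?z = "\<phi>' gg * q0"
    have z1: "?z = q0 * ?z" using com'[OF ggc, of q0] q0(2,6) by (metis mult.assoc)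
    define i where "i = rf (\<lambda>t. min t (1/4))"
    have ic: "continuous_on UNIV i" unfolding i_def by (intro rf_cont continuous_intros)
    have "(1 - h) * ?z = \<phi>' (\<lambda>z. z * gg z) * q0"
      using calc_mult[OF p lb_id lb_cont[OF ggc]] by (simp add: calc_id[OF p] mult.assoc)
    also have "\<phi>' (\<lambda>z. z * gg z) = \<phi>' (\<lambda>z. i z * gg z)"
    proof (rule calc_cong[OF p])
      fix z assume z: "z \<in> NN"
      show "z * gg z = i z * gg z"
      proof (cases "Re z \<le> 1/4")
        case True
        then show ?thesis using z by (simp add: i_def rf_def NN_def complex_eq_iff)
      next
        case False
        then have "gg z = 0" by (simp add: gg_def rt_def xi_def max_def flip: of_real_mult)
        then show ?thesis by simp
      qed
    qed
    also have "\<dots> = \<phi>' i * \<phi>' gg" by (rule calc_mult[OF p lb_cont[OF ic] lb_cont[OF ggc]])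
    finally have 1: "(1 - h) * ?z = \<phi>' i * ?z" by (simp add: mult.assoc)
    have 2: "h * ?z = h * q0 * ?z" using z1 by (metis mult.assoc)
    have "norm (\<phi>' i * ?z) \<le> 1/4 * norm ?z"
      by (intro norm_mult_le calc_norm[OF p]) (auto simp: i_def rf_def NN_def)
    moreover have "norm (h * q0 * ?z) \<le> 1/2 * norm ?z" by (intro norm_mult_le hq) simp
    moreover have "?z = \<phi>' i * ?z + h * q0 * ?z" using 1 2 by (metis diff_add_cancel left_diff_distrib mult_1)
    then have "norm ?z \<le> norm (\<phi>' i * ?z) + norm (h * q0 * ?z)" by (metis norm_triangle_ineq)
    ultimately have "norm ?z \<le> 3/4 * norm ?z" by linarith
    then show ?thesis by (rule norm_eq_zeroI) simp
  qed
  define X' where "X' = \<phi>' xi"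
  define m where "m = w * q0"
  have m: "m = y * X' * q0"
  proof -
    have "\<phi>' rt * X' = \<phi>' (\<lambda>z. rt z * xi z)" using calc_mult[OF p lb_cont[OF rtc] lb_cont[OF xic]] by (simp add: X'_def)
    moreover have "\<phi>' gg = 1 - \<phi>' (\<lambda>z. rt z * xi z)"
      using calc_diff[OF p, of "\<lambda>z. 1" "\<lambda>z. rt z * xi z"] lb_mult[OF lb_cont[OF rtc] lb_cont[OF xic], of NN]
      by (simp add: calc_one[OF p] gg_def[abs_def])
    ultimately have "\<phi>' rt * X' = 1 - \<phi>' gg" by simp
    then have "\<phi>' rt * X' * q0 = q0" using zq by (simp add: left_diff_distrib)
    then show ?thesis unfolding m_def by (subst W(4)) (simp add: w_def mult.assoc)
  qed
  have m_comm: "e * m = m * e" if e: "e * y = y * e" "e * h = h * e" "e * E = E * e" for e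
  proof -
    have "e * X' = X' * e" unfolding X'_def by (rule com'[OF xic e(2)])
    moreover have "e * q0 = q0 * e" using e(3) by (simp add: q0_def left_diff_distrib right_diff_distrib)
    ultimately show ?thesis unfolding m using e(1) by (metis mult.assoc)
  qed
  \<comment> \<open>Where \<open>h\<close> vanishes, \<open>1 - h\<close> acts as 1 and
    \<open>xi 1 = 1\<close>.\<close>
  have X1: "e * X' = e" if e: "e * h = 0" for e
  proof -
    obtain \<phi>1 where "calc NN (star 1 * 1) \<phi>1" using calc_psd by blast
    then have c1: "calc NN 1 \<phi>1" by simp
    have "e * X' = \<phi>1 xi * e" unfolding X'_def
      by (rule calc_intertwine[OF p c1 closed_NN xic]) (simp_all only: s1h star_one, simp_all add: right_diff_distrib e)
    also have "\<phi>1 xi = sc (xi 1)" by (rule calc_of_one[OF c1 closed_NN xic]) (simp add: NN_def)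
    finally show ?thesis by (simp add: xi_def)
  qed
  have fm: "f * m = m * f"
    by (rule m_comm) (simp_all add: y_def distrib_left distrib_right left_diff_distrib right_diff_distrib mult.assoc fs fa hf fh Es)
  have Sm: "S * m = m * S"
  proof (rule m_comm)
    have "S * (f * v * f) = f * v * f * S" using vm(2) km(6) by (metis mult.assoc)
    then show "S * y = y * S" using km(6) by (simp add: y_def distrib_left distrib_right left_diff_distrib right_diff_distrib)
    show "S * E = E * S" by (simp add: E_def distrib_left distrib_right SE)
  qed (rule Sh)
  have f1m: "(1 - f) * m = 1 - f"
  proof -
    have "(1 - f) * h = 0" by (simp add: left_diff_distrib fh)
    from X1[OF this] have 1: "(1 - f) * X' = 1 - f" .
    have "(1 - f) * y = 1 - f" by (simp add: y_def distrib_left left_diff_distrib right_diff_distrib mult.assoc fs fa)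
    then have "(1 - f) * m = (1 - f) * X' * q0" unfolding m by (metis mult.assoc)
    also have "\<dots> = 1 - f" unfolding 1 by (simp add: q0_def left_diff_distrib right_diff_distrib Es)
    finally show ?thesis .
  qed
  have yg: "\<Phi> g * y = y * \<Phi> g" "y * \<Phi> g = v * \<Phi> g" if g: "inner g" for g
  proof -
    have gv: "\<Phi> g * v = v * \<Phi> g" using g by (intro comm_v) (simp add: inner_def)
    have "y * \<Phi> g = f * v * \<Phi> g" using f_inner[OF g] by (simp add: y_def distrib_right left_diff_distrib mult.assoc)
    also have "\<dots> = v * \<Phi> g" using gv f_inner[OF g] by (metis mult.assoc)
    finally show 1: "y * \<Phi> g = v * \<Phi> g" .
    have "\<Phi> g * y = \<Phi> g * v * f" using f_inner[OF g] by (simp add: y_def distrib_left right_diff_distrib mult.assoc[symmetric])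
    also have "\<dots> = v * \<Phi> g" using gv f_inner[OF g] by (metis mult.assoc)
    finally show "\<Phi> g * y = y * \<Phi> g" using 1 by simp
  qed
  have mg: "m * \<Phi> g = v * \<Phi> g" "\<Phi> g * m = m * \<Phi> g" if g: "inner g" for g
  proof -
    show 2: "\<Phi> g * m = m * \<Phi> g" by (rule m_comm) (use yg[OF g] hin[OF g] Eg[OF g] in simp_all)
    have "\<Phi> g * X' = \<Phi> g" by (rule X1[OF hin(2)[OF g]])
    moreover have "\<Phi> g * q0 = \<Phi> g" by (simp add: q0_def right_diff_distrib Eg[OF g])
    ultimately have "\<Phi> g * m = v * \<Phi> g" unfolding m using yg[OF g] by (metis mult.assoc com'[OF xic] X'_def hin[OF g])
    then show "m * \<Phi> g = v * \<Phi> g" using 2 by simp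
  qed
  \<comment> \<open>The cokernel projection of \<open>m\<close>. It is equivalent to the kernel
    projection \<open>E\<close> through \<open>w * E\<close>, which is the equality of total
    dimensions at both ends together.\<close>
  define E' where "E' = w * E * star w"
  have E'm: "E' = 1 - m * star m"
    by (simp add: E'_def m_def q0_def star_mult star_diff Es left_diff_distrib right_diff_distrib mult.assoc ww absorb[OF Es(2)])
  have E's: "star E' = E'" "E' * E' = E'" "sg E' = E'"
    by (simp_all add: E'_def star_mult sg_mult sg_star w Es mult.assoc ww absorb[OF Es(2)])
  have E'c: "e * E' = E' * e" if e: "star e = e" "e * m = m * e" for e
  proof -
    have "e * star m = star m * e" using arg_cong[OF e(2), of star] e(1) by (simp add: star_mult)
    then show ?thesis unfolding E'm using e(2) by (simp add: left_diff_distrib right_diff_distrib) (metis mult.assoc)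
  qed
  have E'S: "S * E' = E' * S" by (rule E'c) (simp_all add: sk Sm)
  have E'f: "E' * f = E'" "f * E' = E'"
  proof -
    have "m * (1 - f) = 1 - f" using f1m fm by (simp add: left_diff_distrib right_diff_distrib)
    moreover have "star m * (1 - f) = 1 - f" using arg_cong[OF f1m, of star] by (simp add: star_mult star_diff fs)
    ultimately have "E' * (1 - f) = 0" unfolding E'm by (simp add: left_diff_distrib mult.assoc)
    then show 1: "E' * f = E'" by (simp add: right_diff_distrib)
    show "f * E' = E'" using arg_cong[OF 1, of star] by (simp add: star_mult E's fs)
  qed
  have E'g: "E' * \<Phi> g = 0" "\<Phi> g * E' = 0" if g: "inner g" for g
  proof -
    have *: "E' * \<Phi> g = 0" if g: "inner g" for g
    proof -
      have gv: "\<Phi> g * v = v * \<Phi> g" using g by (intro comm_v) (simp add: inner_def)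
      have sg': "star (\<Phi> (\<lambda>z. cnj (g z))) = \<Phi> g"
        using calc_star[OF c, of "\<lambda>z. cnj (g z)"] inner_cnj(1)[OF g] by (simp add: inner_def lbc)
      have "\<Phi> (\<lambda>z. cnj (g z)) * m = v * \<Phi> (\<lambda>z. cnj (g z))" using mg[OF inner_cnj(1)[OF g]] by simp
      then have "star m * \<Phi> g = \<Phi> g * star v" using arg_cong[of _ _ star] sg' by (metis star_mult)
      then have "m * star m * \<Phi> g = (m * \<Phi> g) * star v" by (simp add: mult.assoc)
      also have "\<dots> = \<Phi> g" unfolding mg(1)[OF g] gv[symmetric] by (simp add: mult.assoc vv)
      finally show ?thesis unfolding E'm by (simp add: left_diff_distrib)
    qed
    show "E' * \<Phi> g = 0" by (rule *[OF g])
    have "star (\<Phi> g * E') = E' * \<Phi> (\<lambda>z. cnj (g z))"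
      using calc_star[OF c, of g] g by (simp add: star_mult E's inner_def lbc)
    then show "\<Phi> g * E' = 0" using *[OF inner_cnj(1)[OF g]] by (metis star_star star_zero)
  qed
  have E'in: "E' * \<Phi> g = 0" if g: "continuous_on (sphere 0 1) g" "\<And>z. z \<in> sphere 0 1 \<Longrightarrow> bump (Re z) \<noteq> 0 \<Longrightarrow> g z = 0" for g
  proof -
    have "E' * (f * \<Phi> g) = 0" unfolding f_mult(1)[OF lbc[OF g(1)]] by (rule E'g(1)[OF innerI[OF g]])
    then show ?thesis by (simp add: absorb[OF E'f(1)])
  qed
  have bIm: "Im z \<noteq> 0" if "z \<in> sphere 0 1" "bump (Re z) \<noteq> 0" for z
    using circle_real[OF that(1)] bump_ends that(2) by auto
  have E'SS: "E' * (S * S) = E' * S"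
  proof -
    let ?g = "\<lambda>z. topf ramp z * topf ramp z - topf ramp z"
    have "E' * \<Phi> ?g = 0"
    proof (rule E'in)
      show "continuous_on (sphere 0 1) ?g" by (intro continuous_intros lbs)
    qed (simp add: topf_def ramp_bump)
    moreover have "\<Phi> ?g = S * S - S"
      using calc_diff[OF c lb_mult[OF lbs(3) lbs(3)] lbs(3)] calc_mult[OF c lbs(3) lbs(3)] by (simp add: S_def)
    ultimately show ?thesis by (simp add: right_diff_distrib)
  qed
  have E'S2: "E' * S + E' * S2 = E'"
  proof -
    let ?g = "\<lambda>z. 1 - (topf ramp z + Sb z)"
    have "E' * \<Phi> ?g = 0"
    proof (rule E'in)
      show "continuous_on (sphere 0 1) ?g" by (intro continuous_intros lbs cat)
      show "?g z = 0" if "z \<in> sphere 0 1" "bump (Re z) \<noteq> 0" for z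
        using bIm[OF that] ramp_bump[OF that(2)] by (cases "0 < Im z") (auto simp: topf_def Sb_def)
    qed
    moreover have "\<Phi> ?g = 1 - (S + S2)"
      using calc_diff[OF c, of "\<lambda>z. 1" "\<lambda>z. topf ramp z + Sb z"] calc_add[OF c lbs(3) lat(3)] lbs lat
      by (simp add: S_def S2_def calc_one[OF c] lb_add)
    ultimately show ?thesis by (simp add: right_diff_distrib distrib_left)
  qed
  \<comment> \<open>\<open>E'\<close> lives near the ends of the arc, where \<open>topf ramp\<close>
    is 1 on top and 0 below; so multiplying by \<open>S\<close> cuts out its top half as an exact
    projection.\<close>
  define Ft where "Ft = E' * S"
  have sgFt: "sg Ft = E' * S2" by (simp add: Ft_def sg_mult E's sk)
  have Ft: "star Ft = Ft" "Ft * Ft = Ft" "Ft * sg Ft = 0" "Ft + sg Ft = E'" "S * Ft = Ft" "f * Ft = Ft" "E' * Ft = Ft" "S * sg Ft = 0"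
  proof -
    show "star Ft = Ft" by (simp add: Ft_def star_mult E's sk E'S)
    have "Ft * Ft = E' * (E' * (S * S))" unfolding Ft_def using E'S by (metis mult.assoc)
    then show "Ft * Ft = Ft" by (simp add: E'SS absorb[OF E's(2)] Ft_def)
    have "Ft * sg Ft = E' * (E' * (S * S2))" unfolding sgFt unfolding Ft_def using E'S by (metis mult.assoc)
    then show "Ft * sg Ft = 0" by (simp add: kk)
    show "Ft + sg Ft = E'" unfolding sgFt unfolding Ft_def by (rule E'S2)
    show "S * Ft = Ft" unfolding Ft_def using E'S E'SS by (metis mult.assoc)
    show "f * Ft = Ft" unfolding Ft_def by (simp add: absorb[OF E'f(2)])
    show "E' * Ft = Ft" unfolding Ft_def by (simp add: absorb[OF E's(2)])
    have "S * sg Ft = E' * (S * S2)" unfolding sgFt using E'S by (metis mult.assoc)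
    then show "S * sg Ft = 0" by (simp add: kk)
  qed
  have "\<exists>z. star z * z = Et \<and> z * star z = Ft"
  proof (rule halve_equivalence)
    show "star (w * E) * (w * E) = Et + sg Et" by (simp add: star_mult Es mult.assoc ww) (simp add: E_def Eb_def)
    show "w * E * star (w * E) = Ft + sg Ft" by (simp add: Ft star_mult Es mult.assoc E'_def absorb[OF Es(2)])
  qed (use Et1(3,4) EE Ft in \<open>simp_all add: Eb_def[symmetric]\<close>)
  then obtain z where z: "star z * z = Et" "z * star z = Ft" by blast
  have zE: "z * Et = z" "Ft * z = z"
  proof -
    have "star (z - z * Et) * (z - z * Et) = (1 - Et) * (star z * z) * (1 - Et)"
      by (simp add: star_diff star_mult Et1(3,4) left_diff_distrib right_diff_distrib mult.assoc)
    also have "\<dots> = 0" by (simp add: z left_diff_distrib right_diff_distrib Et1(3,4))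
    finally have "(norm (z - z * Et))\<^sup>2 = 0" using norm_cstar[of "z - z * Et"] by simp
    then show "z * Et = z" by simp
    have "(z - Ft * z) * star (z - Ft * z) = (1 - Ft) * (z * star z) * (1 - Ft)"
      by (simp add: star_diff star_mult Ft left_diff_distrib right_diff_distrib mult.assoc)
    also have "\<dots> = 0" by (simp add: z left_diff_distrib right_diff_distrib Ft)
    finally have "(norm (z - Ft * z))\<^sup>2 = 0" using norm_cstar[of "star (z - Ft * z)"] by simp
    then show "Ft * z = z" by simp
  qed
  define z' where "z' = sg z"
  have z': "star z' * z' = Eb" "z' * star z' = sg Ft" "z' * Eb = z'" "sg Ft * z' = z'"
    using z[THEN arg_cong[of _ _ sg]] zE[THEN arg_cong[of _ _ sg]] by (simp_all add: sg_mult sg_star Eb_def z'_def)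
  have sgFs: "star (sg Ft) = sg Ft" using Ft(1)[THEN arg_cong[of _ _ sg]] by (simp add: sg_star)
  have FF: "sg Ft * Ft = 0" using Ft(3)[THEN arg_cong[of _ _ sg]] by (simp add: sg_mult)
  have EF: "E' * sg Ft = sg Ft" using Ft(7)[THEN arg_cong[of _ _ sg]] by (simp add: sg_mult E's)
  have mE: "star m * E' = 0" by (simp add: m_def E'_def star_mult q0 mult.assoc ww absorb[OF q0(4)])
  have mz: "star m * z = 0" "star m * z' = 0"
  proof -
    have "star m * z = star m * E' * (Ft * z)" using zE(2) Ft(7) by (metis mult.assoc)
    then show "star m * z = 0" by (simp add: mE)
    have "star m * z' = star m * E' * (sg Ft * z')" using z'(4) EF by (metis mult.assoc)
    then show "star m * z' = 0" by (simp add: mE)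
  qed
  have zm: "star z * m = 0" "star z' * m = 0" using mz[THEN arg_cong[of _ _ star]] by (simp_all add: star_mult)
  have zz: "star z * z' = 0" "star z' * z = 0"
  proof -
    have "star z * z' = star (Ft * z) * (sg Ft * z')" by (simp add: zE z')
    also have "\<dots> = star z * (Ft * sg Ft) * z'" by (simp add: star_mult Ft(1) mult.assoc)
    finally show 1: "star z * z' = 0" by (simp add: Ft(3))
    show "star z' * z = 0" using arg_cong[OF 1, of star] unfolding star_mult by simp
  qed
  have zz': "z * star z' = 0" "z' * star z = 0"
  proof -
    have "z * star z' = z * Et * star (z' * Eb)" by (simp add: zE z')
    also have "\<dots> = z * (Et * Eb) * star z'" by (simp add: star_mult Ebk mult.assoc)
    finally show 1: "z * star z' = 0" by (simp add: EE)
    show "z' * star z = 0" using arg_cong[OF 1, of star] unfolding star_mult by simp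
  qed
  have mz': "m * star z = 0" "m * star z' = 0"
  proof -
    have "m * star z = w * (q0 * Et) * star z" unfolding m_def using zE(1) Et1(4) by (metis mult.assoc star_mult)
    then show "m * star z = 0" by (simp add: q0)
    have "m * star z' = w * (q0 * Eb) * star z'" unfolding m_def using z'(3) Ebk(6) by (metis mult.assoc star_mult)
    then show "m * star z' = 0" by (simp add: q0)
  qed
  have zm': "z * star m = 0" "z' * star m = 0" using mz'[THEN arg_cong[of _ _ star]] by (simp_all add: star_mult)
  \<comment> \<open>The polar part off the defect, plus partial isometries from the top defect to
    the top cokernel and, mirrored by \<open>sg\<close>, from bottom to bottom. Respecting top and
    bottom is what makes \<open>x\<close> commute with \<open>S\<close>.\<close>
  define x where "x = m + z + z'"
  have smm: "star m * m = q0" by (simp add: m_def star_mult q0 mult.assoc ww)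
  have "star x * x = q0 + Et + Eb"
    by (simp add: x_def star_add distrib_left distrib_right mz zm zz z z' smm)
  then have 1: "star x * x = 1" by (simp add: q0_def E_def)
  have "x * star x = m * star m + Ft + sg Ft"
    by (simp add: x_def star_add distrib_left distrib_right mz' zm' zz' z z')
  then have 2: "x * star x = 1" using Ft(4) E'm by (simp add: add.assoc)
  have "isunit x" using 1 2 by (simp add: isunit_def)
  moreover have "sg x = x" by (simp add: x_def sg_add z'_def m_def sg_mult w q0 add.assoc add.commute[of "sg z"])
  moreover have "f * x = x * f"
  proof -
    have "f * z = z" "z * f = z" using zE Ft(6) Etk(3) by (metis mult.assoc)+
    moreover from this have "f * z' = z'" "z' * f = z'" by (metis fs(3) sg_mult z'_def)+
    ultimately show ?thesis by (simp add: x_def distrib_left distrib_right fm)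
  qed
  moreover have "S * x = x * S"
  proof -
    have "S * z = z" "z * S = z" using zE Ft(5) SE(2) by (metis mult.assoc)+
    moreover have "S * z' = 0" "z' * S = 0" using z' Ft(8) SE(4) by (metis mult.assoc mult_zero_left mult_zero_right)+
    ultimately show ?thesis by (simp add: x_def distrib_left distrib_right Sm)
  qed
  moreover have "x * \<Phi> g = v * \<Phi> g \<and> \<Phi> g * x = \<Phi> g * v" if g: "inner g" for g
  proof -
    have gv: "\<Phi> g * v = v * \<Phi> g" using g by (intro comm_v) (simp add: inner_def)
    have "Et * \<Phi> g = 0" "Eb * \<Phi> g = 0" using Eg(1)[OF g] Es(6) EE(2) Ebk(5) by (metis E_def mult.assoc distrib_left add_0 mult_zero_right)+
    then have 1: "z * \<Phi> g = 0" "z' * \<Phi> g = 0" using zE(1) z'(3) by (metis mult.assoc mult_zero_right)+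
    have "\<Phi> g * Ft = 0" "\<Phi> g * sg Ft = 0" using E'g(2)[OF g] Ft(7) EF by (metis mult.assoc mult_zero_left)+
    then have 2: "\<Phi> g * z = 0" "\<Phi> g * z' = 0" using zE(2) z'(4) by (metis mult.assoc mult_zero_left)+
    show ?thesis using 1 2 mg[OF g] gv by (simp add: x_def distrib_left distrib_right)
  qed
  ultimately show ?thesis by blast
qed

end

text \<open>The repaired unitary \<open>w\<close> commutes with the top plateau \<open>s\<close>, so
  \<open>x = s * w\<close> is normal with modulus \<open>s\<close>. At modulus 1/2,
  \<open>cut_normal\<close> cuts on the flank of \<open>ramp\<close> next to \<open>cb\<close>; the
  jump of \<open>s\<close> at \<open>ca\<close> is covered by adding \<open>1 - f\<close>. The
  mirror image \<open>sg P\<close> makes the same cut at the bottom.\<close>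

lemma (in arc_cut) cut_unitary:
  assumes e: "0 < \<epsilon>"
  shows "\<exists>P. isproj P \<and> sg P = P \<and> norm (P * v - v * P) \<le> \<epsilon> \<and>
   (\<forall>h \<kappa> \<kappa>'. lb (sphere 0 1) h \<longrightarrow> (\<forall>z\<in>sphere 0 1. 0 < Im z \<longrightarrow> cb < Re z \<longrightarrow> Re z \<le> ca \<longrightarrow> h z = \<kappa>) \<longrightarrow>
     (\<forall>z\<in>sphere 0 1. Im z < 0 \<longrightarrow> cb < Re z \<longrightarrow> Re z \<le> ca \<longrightarrow> h z = \<kappa>') \<longrightarrow> P * \<Phi> h = \<Phi> h * P) \<and>
   (\<forall>h. lb (sphere 0 1) h \<longrightarrow> (\<forall>z\<in>sphere 0 1. Re z \<le> ca \<longrightarrow> h z = 0) \<longrightarrow> P * \<Phi> h = \<Phi> h) \<and>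
   (\<forall>h. lb (sphere 0 1) h \<longrightarrow> (\<forall>z\<in>sphere 0 1. cb < Re z \<longrightarrow> h z = 0) \<longrightarrow> P * \<Phi> h = 0)"
proof -
  note fs = f_simps
  obtain w where w: "isunit w" "sg w = w" "f * w = w * f" "S * w = w * S"
    "\<And>g. inner g \<Longrightarrow> w * \<Phi> g = v * \<Phi> g" "\<And>g. inner g \<Longrightarrow> \<Phi> g * w = \<Phi> g * v"
    using exists_compression_unitary by blast
  note ww = isunitD[OF w(1)]
  define st where "st z = ind z * topf ramp z" for z
  define s where "s = \<Phi> st"
  have st: "st z = complex_of_real (Re (st z))" "0 \<le> Re (st z)" "Re (st z) \<le> 1" for z
    using ramp_range by (auto simp: st_def ind_def topf_def)
  have st0: "Im z > 0 \<and> cb < Re z \<and> Re z \<le> ca" if "Re (st z) \<noteq> 0" for z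
    using that ramp_low[of "Re z"] by (cases "Re z \<le> cb") (auto simp: st_def ind_def topf_def not_less split: if_splits)
  have lst: "lb (sphere 0 1) st" unfolding st_def[abs_def] by (intro lb_mult lbs)
  have sfS: "s = f * S" using f_mult(1)[OF lbs(3)] by (simp add: s_def S_def st_def[abs_def])
  define \<phi> where "\<phi> F = \<Phi> (\<lambda>z. F (st z))" for F
  have cs: "calc NN s \<phi>" unfolding s_def \<phi>_def
    by (rule calc_comp[OF c lst]) (use st in \<open>auto simp: NN_def complex_eq_iff\<close>)
  have ws: "w * s = s * w" unfolding sfS using w(3,4) by (metis mult.assoc)
  have ss: "star s = s"
  proof -
    have "(\<lambda>z. cnj (st z)) = st" by (auto simp: st_def ind_def topf_def)
    then show ?thesis unfolding s_def calc_star[OF c lst] by simp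
  qed
  have wsc: "w * \<phi> g = \<phi> g * w" if "continuous_on UNIV g" for g
    by (rule calc_commute[OF cs closed_NN calc_lb_cont[OF that]]) (simp_all add: ws ss)
  define x where "x = s * w"
  have xx: "s * s = star x * x"
  proof -
    have "star x * x = star w * (s * (s * w))" by (simp add: x_def star_mult ss mult.assoc)
    also have "s * (s * w) = w * (s * s)" using ws by (metis mult.assoc)
    finally show ?thesis by (simp add: ww)
  qed
  have nx: "qnormal x"
    unfolding qnormal_def xx[symmetric] by (simp add: x_def star_mult ss mult.assoc ww)
  \<comment> \<open>Recovering \<open>w\<close> from \<open>x\<close> costs a factor 8 on an error
    \<open>3 * e'\<close>, and top and bottom together double it, whence 48.\<close>
  define e' where "e' = min (\<epsilon> / 48) (1/8)"
  have e': "0 < e'" "e' \<le> 1/8" "48 * e' \<le> \<epsilon>" using e by (auto simp: e'_def)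
  obtain P where P: "isproj P" "norm (P * x - x * P) \<le> e'"
    and hi: "\<And>g. continuous_on UNIV g \<Longrightarrow> (\<And>t. t < 1/2 + e' \<Longrightarrow> g t = 0) \<Longrightarrow> P * \<phi> (rf g) = \<phi> (rf g)"
    and lo: "\<And>g. continuous_on UNIV g \<Longrightarrow> (\<And>t. t > 1/2 - e' \<Longrightarrow> g t = 0) \<Longrightarrow> P * \<phi> (rf g) = 0"
    using cut_normal[OF nx cs xx e'(1)] by metis
  have PP: "star P = P" "P * P = P" using P(1) by (simp_all add: isproj_def)
  have srf: "star (\<phi> (rf g)) = \<phi> (rf g)" if "continuous_on UNIV g" for g
    using calc_star[OF cs rf_lb[OF that]] by (simp add: rf_cnj)
  have lsrf: "lb (sphere 0 1) (\<lambda>z. rf g (st z))" if "continuous_on UNIV g" for g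
  proof -
    note l = rf_lb[OF that, of NN]
    obtain B where B: "\<And>z. z \<in> NN \<Longrightarrow> cmod z \<le> 1 \<Longrightarrow> cmod (rf g z) \<le> B"
      using l unfolding lb_def by blast
    have "cmod (st z) \<le> 1" "st z \<in> NN" for z using st[of z] by (auto simp: NN_def complex_eq_iff cmod_eq_Re)
    then show ?thesis by (intro lb_bounded[of _ _ B]) (auto intro: B)
  qed
  \<comment> \<open>\<open>m\<close> is 1 wherever \<open>P\<close> can live, \<open>so\<close>
    rounds the window to 1/2, and \<open>jo\<close> inverts \<open>so\<close> on the support of
    \<open>m\<close>. As \<open>jo\<close> is constant across the window, \<open>P\<close> commutes
    with it exactly, so the commutator with \<open>x\<close> bounds the one with
    \<open>w\<close>.\<close>
  define m where "m t = clip 0 1 (8 * t - 1)" for t :: real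
  define so where "so t = t - clip (- e') e' (t - 1/2)" for t :: real
  define jo where "jo t = m t / max (so t) (1/8)" for t :: real
  define n where "n t = clip 0 1 (4 * t - 3)" for t :: real
  have mc: "continuous_on UNIV m" and soc: "continuous_on UNIV so" and nc: "continuous_on UNIV n"
    unfolding m_def so_def n_def by (intro continuous_intros)+
  have joc: "continuous_on UNIV jo" unfolding jo_def by (intro continuous_intros mc soc) (auto simp: max_def)
  have m0: "m t = 0" if "t \<le> 1/8" for t using that by (simp add: m_def clip_def)
  have m1: "m t = 1" if "1/4 \<le> t" for t using that by (simp add: m_def clip_def)
  have n0: "n t = 0" if "t \<le> 3/4" for t using that by (simp add: n_def clip_def)
  have n1: "n 1 = 1" by (simp add: n_def clip_def)
  define M where "M = \<phi> (rf m)"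
  define N where "N = \<phi> (rf n)"
  define So where "So = \<phi> (rf so)"
  define Jo where "Jo = \<phi> (rf jo)"
  have sM: "star M = M" and sN: "star N = N" unfolding M_def N_def by (intro srf mc nc)+
  have PM: "P * M = P" "M * P = P"
  proof -
    have "P * \<phi> (rf (\<lambda>t. 1 - m t)) = 0"
      by (rule lo) (use m1 e' in \<open>auto intro!: continuous_intros mc\<close>)
    moreover have "rf (\<lambda>t. 1 - m t) = (\<lambda>z. 1 - rf m z)" by (simp add: rf_def fun_eq_iff)
    ultimately show 1: "P * M = P"
      using calc_diff[OF cs, of "\<lambda>z. 1" "rf m"] rf_lb[OF mc] by (simp add: calc_one[OF cs] M_def right_diff_distrib)
    show "M * P = P" using arg_cong[OF 1, of star] by (simp add: star_mult PP sM)
  qed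
  have JS: "Jo * So = M"
  proof -
    have "jo t * so t = m t" if "0 \<le> t" for t
    proof (cases "t \<le> 1/8")
      case False
      then have "1/8 \<le> so t" using e' by (auto simp: so_def clip_def max_def min_def)
      then show ?thesis by (simp add: jo_def max_def)
    qed (simp add: jo_def m0)
    then have "\<phi> (\<lambda>z. rf jo z * rf so z) = M" unfolding M_def
      by (intro calc_cong[OF cs]) (simp add: rf_def NN_def flip: of_real_mult)
    then show ?thesis using calc_mult[OF cs rf_lb[OF joc] rf_lb[OF soc]] by (simp add: Jo_def So_def)
  qed
  have PJ: "P * Jo = Jo * P"
  proof -
    have jw: "jo t = jo (1/2)" if "\<bar>t - 1/2\<bar> \<le> e'" for t
      using that e' m1[of t] by (auto simp: jo_def m1 so_def clip_def)
    \<comment> \<open>Apart from a constant, \<open>jo\<close> splits into a part below the window,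
      which \<open>P\<close> kills, and a part above it, which \<open>P\<close> fixes.\<close>
    define g1 where "g1 t = jo (min t (1/2 - e')) - jo (1/2)" for t
    define g2 where "g2 t = jo (max t (1/2 + e')) - jo (1/2)" for t
    have g1c: "continuous_on UNIV g1" unfolding g1_def
      by (intro continuous_intros continuous_on_compose2[OF joc]) auto
    have g2c: "continuous_on UNIV g2" unfolding g2_def
      by (intro continuous_intros continuous_on_compose2[OF joc]) auto
    have 1: "P * \<phi> (rf g1) = 0" by (rule lo[OF g1c]) (use jw[of "1/2 - e'"] e' in \<open>simp add: g1_def min_def\<close>)
    have 2: "P * \<phi> (rf g2) = \<phi> (rf g2)" by (rule hi[OF g2c]) (use jw[of "1/2 + e'"] e' in \<open>simp add: g2_def max_def\<close>)
    have 3: "\<phi> (rf g1) * P = 0" "\<phi> (rf g2) * P = \<phi> (rf g2)"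
      using arg_cong[OF 1, of star] arg_cong[OF 2, of star] by (simp_all add: star_mult PP srf g1c g2c)
    have dec: "jo t = jo (1/2) + (g1 t + g2 t)" for t
      using jw[of t] jw[of "1/2 - e'"] jw[of "1/2 + e'"] e' by (auto simp: g1_def g2_def min_def max_def abs_le_iff)
    have "Jo = \<phi> (\<lambda>z. complex_of_real (jo (1/2)) + (rf g1 z + rf g2 z))"
      unfolding Jo_def
    proof (rule calc_cong[OF cs])
      fix z show "rf jo z = complex_of_real (jo (1/2)) + (rf g1 z + rf g2 z)"
        using arg_cong[OF dec[of "Re z"], of complex_of_real] unfolding rf_def of_real_add .
    qed
    also have "\<dots> = sc (complex_of_real (jo (1/2))) + (\<phi> (rf g1) + \<phi> (rf g2))"
      using calc_add[OF cs lb_const lb_add[OF rf_lb[OF g1c] rf_lb[OF g2c]]] calc_add[OF cs rf_lb[OF g1c] rf_lb[OF g2c]]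
      by (simp add: calc_const[OF cs])
    finally show ?thesis using 1 2 3 sc_comm[of P] by (simp add: distrib_left distrib_right)
  qed
  have Pw: "norm (P * w - w * P) \<le> 24 * e'"
  proof -
    have 1: "P * w = Jo * (P * (So * w))"
    proof -
      have "P * w = P * M * w" by (simp add: PM)
      also have "\<dots> = (P * Jo) * (So * w)" by (simp add: JS[symmetric] mult.assoc)
      finally show ?thesis by (simp add: PJ mult.assoc)
    qed
    have 2: "w * P = Jo * (So * w * P)"
    proof -
      have "w * P = w * M * P" using PM by (simp add: mult.assoc)
      also have "w * M = M * w" unfolding M_def by (intro wsc rf_cont mc)
      finally show ?thesis by (simp add: JS[symmetric] mult.assoc)
    qed
    have sd: "norm (So - s) \<le> e'"
    proof -
      have "s - So = \<phi> (\<lambda>z. z - rf so z)"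
        using calc_diff[OF cs lb_id rf_lb[OF soc]] by (simp add: calc_id[OF cs] So_def)
      also have "\<dots> = \<phi> (rf (\<lambda>t. clip (- e') e' (t - 1/2)))"
        by (rule calc_cong[OF cs]) (auto simp: NN_def rf_def so_def complex_eq_iff)
      also have "norm \<dots> \<le> e'" by (rule calc_norm[OF cs]) (use e' in \<open>auto simp: rf_def clip_def\<close>)
      finally show ?thesis by (simp add: norm_minus_commute)
    qed
    let ?d = "(So - s) * w"
    have dn: "norm ?d \<le> e'" using norm_mult_le[OF sd, of w 1] isunit_norm[OF w(1)] by simp
    have "P * (So * w) - So * w * P = (P * x - x * P) + (P * ?d - ?d * P)"
      by (simp add: x_def left_diff_distrib right_diff_distrib mult.assoc)
    also have "norm \<dots> \<le> norm (P * x - x * P) + (norm (P * ?d) + norm (?d * P))"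
      by (intro order_trans[OF norm_triangle_ineq] add_mono norm_triangle_ineq4 order_refl)
    also have "\<dots> \<le> e' + (1 * e' + e' * 1)"
      by (intro add_mono P(2) norm_mult_le dn isproj_norm P(1))
    finally have 3: "norm (P * (So * w) - So * w * P) \<le> 3 * e'" by simp
    have "norm Jo \<le> 8" unfolding Jo_def
    proof (rule calc_norm[OF cs])
      fix z :: complex
      have "0 \<le> m (Re z)" "m (Re z) \<le> 1" by (auto simp: m_def clip_def)
      moreover have "1/8 \<le> max (so (Re z)) (1/8)" by simp
      ultimately have "m (Re z) / max (so (Re z)) (1/8) \<le> 1 / (1/8)" by (intro frac_le) auto
      moreover have "0 \<le> m (Re z) / max (so (Re z)) (1/8)" using \<open>0 \<le> m (Re z)\<close> by (intro divide_nonneg_pos) auto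
      ultimately show "cmod (rf jo z) \<le> 8" using \<open>0 \<le> m (Re z)\<close> by (simp add: rf_def jo_def del: of_real_divide)
    qed simp
    from norm_mult_le[OF this 3] show ?thesis by (simp add: 1 2 right_diff_distrib)
  qed
  have Mst: "M = \<Phi> (\<lambda>z. rf m (st z))" and Nst: "N = \<Phi> (\<lambda>z. rf n (st z))" by (simp_all add: M_def N_def \<phi>_def)
  have lM: "lb (sphere 0 1) (\<lambda>z. rf m (st z))" and lN: "lb (sphere 0 1) (\<lambda>z. rf n (st z))" by (intro lsrf mc nc)+
  have lN': "lb (sphere 0 1) (\<lambda>z. rf n (st (cnj z)))"
    by (rule lb_bounded[of _ _ 1]) (simp add: rf_def n_def clip_def)
  have lM': "lb (sphere 0 1) (\<lambda>z. rf m (st (cnj z)))"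
    by (rule lb_bounded[of _ _ 1]) (simp add: rf_def m_def clip_def)
  have sgM: "sg M = \<Phi> (\<lambda>z. rf m (st (cnj z)))" and sgN: "sg N = \<Phi> (\<lambda>z. rf n (st (cnj z)))"
    unfolding Mst Nst sgc[OF lM] sgc[OF lN] by (simp_all add: rf_def)
  have fMN: "M * f = M" "N * f = N" "f * N = N"
    unfolding Mst Nst f_mult(1)[OF lN] f_mult(2)[OF lN] f_mult(2)[OF lM]
    using m0[of 0] n0[of 0] by (auto intro!: calc_cong[OF c] simp: ind_def st_def rf_def)
  have cross: "Re (st z) = 0 \<or> Re (st (cnj z)) = 0" for z using st0[of z] st0[of "cnj z"] by (cases "Re (st z) = 0"; cases "Re (st (cnj z)) = 0") auto
  have MM: "M * sg M = 0" "M * sg N = 0"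
  proof -
    have z: "rf m (st z) * rf m (st (cnj z)) = 0" "rf m (st z) * rf n (st (cnj z)) = 0" for z
      using cross[of z] m0[of 0] n0[of 0] by (auto simp: rf_def)
    have "M * sg M = \<Phi> (\<lambda>z. rf m (st z) * rf m (st (cnj z)))" unfolding sgM unfolding Mst calc_mult[OF c lM lM'] ..
    also have "\<dots> = 0" by (rule calc_zero'[OF c z(1)])
    finally show "M * sg M = 0" .
    have "M * sg N = \<Phi> (\<lambda>z. rf m (st z) * rf n (st (cnj z)))" unfolding sgN unfolding Mst calc_mult[OF c lM lN'] ..
    also have "\<dots> = 0" by (rule calc_zero'[OF c z(2)])
    finally show "M * sg N = 0" .
  qed
  define P' where "P' = sg P"
  have P': "star P' = P'" "P' * P' = P'" "P' * sg M = P'" "sg M * P' = P'" "sg P' = P"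
    using PP[THEN arg_cong[of _ _ sg]] PM[THEN arg_cong[of _ _ sg]] by (simp_all add: P'_def sg_mult sg_star)
  have Pf: "P * f = P" "f * P = P"
  proof -
    show 1: "P * f = P" using PM(1) fMN(1) by (metis mult.assoc)
    show "f * P = P" using arg_cong[OF 1, of star] by (simp add: star_mult PP fs)
  qed
  have P'f: "P' * f = P'" "f * P' = P'"
    using Pf[THEN arg_cong[of _ _ sg]] by (simp_all add: P'_def sg_mult fs)
  have PP': "P * P' = 0" "P' * P = 0"
  proof -
    have "P * P' = P * (M * sg M) * P'" using PM(1) P'(4) by (metis mult.assoc)
    then show 1: "P * P' = 0" by (simp add: MM)
    show "P' * P = 0" using arg_cong[OF 1, of star] unfolding star_mult by (simp add: PP P')
  qed
  define Q where "Q = (1 - f) + P + P'"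
  have Q: "isproj Q" "sg Q = Q"
    unfolding isproj_def Q_def
    by (simp_all add: star_add star_diff sg_add sg_diff fs PP P' P'_def[symmetric] distrib_left distrib_right left_diff_distrib right_diff_distrib Pf P'f PP' add.commute)
  have Pk: "P * \<Phi> h = sc \<kappa> * P" "\<Phi> h * P = sc \<kappa> * P"
    if h: "lb (sphere 0 1) h" "\<And>z. z \<in> sphere 0 1 \<Longrightarrow> 0 < Im z \<Longrightarrow> cb < Re z \<Longrightarrow> Re z \<le> ca \<Longrightarrow> h z = \<kappa>" for h \<kappa>
  proof -
    have eq: "rf m (st z) * h z = \<kappa> * rf m (st z)" if "z \<in> sphere 0 1" for z
      using st0[of z] h(2)[OF that] m0[of 0] by (cases "Re (st z) = 0") (auto simp: rf_def)
    have "M * \<Phi> h = \<Phi> (\<lambda>z. rf m (st z) * h z)" using calc_mult[OF c lM h(1)] by (simp add: Mst)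
    also have "\<dots> = \<Phi> (\<lambda>z. \<kappa> * rf m (st z))" by (rule calc_cong[OF c eq])
    also have "\<dots> = sc \<kappa> * M" using calc_scale[OF c lM] by (simp add: Mst)
    finally have 1: "M * \<Phi> h = sc \<kappa> * M" .
    moreover have "\<Phi> h * M = M * \<Phi> h" unfolding Mst by (rule comm[OF h(1) lM])
    ultimately have 2: "\<Phi> h * M = sc \<kappa> * M" by simp
    have "P * \<Phi> h = P * (M * \<Phi> h)" by (simp add: PM(1) mult.assoc[symmetric])
    also have "\<dots> = sc \<kappa> * (P * M)" unfolding 1 by (metis sc_comm mult.assoc)
    finally show "P * \<Phi> h = sc \<kappa> * P" by (simp add: PM)
    have "\<Phi> h * P = (\<Phi> h * M) * P" by (simp add: PM(2) mult.assoc)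
    then show "\<Phi> h * P = sc \<kappa> * P" unfolding 2 by (simp add: PM(2) mult.assoc)
  qed
  have P'k: "P' * \<Phi> h = sc \<kappa> * P'" "\<Phi> h * P' = sc \<kappa> * P'"
    if h: "lb (sphere 0 1) h" "\<And>z. z \<in> sphere 0 1 \<Longrightarrow> Im z < 0 \<Longrightarrow> cb < Re z \<Longrightarrow> Re z \<le> ca \<Longrightarrow> h z = \<kappa>" for h \<kappa>
  proof -
    let ?h = "\<lambda>z. cnj (h (cnj z))"
    have lh: "lb (sphere 0 1) ?h"
      using h(1) circle_cnj unfolding lb_def by (metis complex_mod_cnj)
    have "?h z = cnj \<kappa>" if "z \<in> sphere 0 1" "0 < Im z" "cb < Re z" "Re z \<le> ca" for z
      using h(2)[of "cnj z"] that circle_cnj[OF that(1)] by simp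
    note 1 = Pk[OF lh this]
    have 2: "sg (\<Phi> ?h) = \<Phi> h" using sgc[OF lh] by simp
    show "P' * \<Phi> h = sc \<kappa> * P'" using arg_cong[OF 1(1), of sg] by (simp add: sg_mult 2 sg_sc P'_def)
    show "\<Phi> h * P' = sc \<kappa> * P'" using arg_cong[OF 1(2), of sg] by (simp add: sg_mult 2 sg_sc P'_def)
  qed
  have Qc: "Q * \<Phi> h = \<Phi> h * Q"
    if h: "lb (sphere 0 1) h" "\<And>z. z \<in> sphere 0 1 \<Longrightarrow> 0 < Im z \<Longrightarrow> cb < Re z \<Longrightarrow> Re z \<le> ca \<Longrightarrow> h z = \<kappa>"
      "\<And>z. z \<in> sphere 0 1 \<Longrightarrow> Im z < 0 \<Longrightarrow> cb < Re z \<Longrightarrow> Re z \<le> ca \<Longrightarrow> h z = \<kappa>'" for h \<kappa> \<kappa>'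
  proof -
    have "f * \<Phi> h = \<Phi> h * f" using f_mult[OF h(1)] by simp
    then show ?thesis using Pk[OF h(1,2)] P'k[OF h(1,3)]
      by (simp add: Q_def distrib_left distrib_right left_diff_distrib right_diff_distrib)
  qed
  have Q1: "Q * \<Phi> h = \<Phi> h" if h: "lb (sphere 0 1) h" "\<And>z. z \<in> sphere 0 1 \<Longrightarrow> Re z \<le> ca \<Longrightarrow> h z = 0" for h
  proof -
    have "f * \<Phi> h = 0" unfolding f_mult(1)[OF h(1)] by (rule calc_zero'[OF c]) (use h(2) in \<open>auto simp: ind_def\<close>)
    then show ?thesis using Pk(1)[of h 0] P'k(1)[of h 0] h by (simp add: Q_def distrib_right left_diff_distrib)
  qed
  have Q0: "Q * \<Phi> h = 0" if h: "lb (sphere 0 1) h" "\<And>z. z \<in> sphere 0 1 \<Longrightarrow> cb < Re z \<Longrightarrow> h z = 0" for h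
  proof -
    have "f * \<Phi> h = \<Phi> h" unfolding f_mult(1)[OF h(1)]
      by (rule calc_cong[OF c]) (use h(2) levels in \<open>force simp: ind_def\<close>)
    then show ?thesis using Pk(1)[of h 0] P'k(1)[of h 0] h by (simp add: Q_def distrib_right left_diff_distrib)
  qed
  \<comment> \<open>\<open>1 - Q = f - P - P'\<close> is absorbed by \<open>f - N - sg N\<close>,
    which is an inner function of \<open>u\<close>: \<open>N\<close> and \<open>sg N\<close> remove
    the ends. There \<open>w\<close> and \<open>v\<close> agree, so the commutator of
    \<open>Q\<close> with \<open>v\<close> becomes one with \<open>w\<close>.\<close>
  define g where "g z = 1 - (rf n (topf ramp z) + rf n (topf ramp (cnj z)))" for z
  have gc: "continuous_on (sphere 0 1) g"
  proof -
    have 1: "continuous_on (sphere 0 1) (\<lambda>z. rf n (topf ramp z))"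
      by (rule continuous_on_compose2[OF rf_cont[OF nc, of UNIV] lbs(5)]) simp
    show ?thesis unfolding g_def by (intro continuous_intros 1 continuous_on_cnj_arg[OF 1])
  qed
  have gin: "inner (\<lambda>z. ind z * g z)"
  proof (rule innerI[OF gc])
    fix z :: complex assume z: "z \<in> sphere 0 1" "bump (Re z) \<noteq> 0"
    have "Im z \<noteq> 0" using circle_real[OF z(1)] bump_ends z(2) by auto
    then show "g z = 0" using ramp_bump[OF z(2)] n1 n0[of 0] by (cases "0 < Im z") (auto simp: g_def topf_def rf_def)
  qed
  have gN: "\<Phi> (\<lambda>z. ind z * g z) = f - N - sg N"
  proof -
    have "\<Phi> (\<lambda>z. ind z * g z) = \<Phi> (\<lambda>z. ind z - (rf n (st z) + rf n (st (cnj z))))"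
      by (rule calc_cong[OF c]) (use n0[of 0] in \<open>auto simp: g_def ind_def st_def rf_def\<close>)
    also have "\<dots> = f - (N + sg N)"
      using calc_diff[OF c lbs(1) lb_add[OF lN lN']] calc_add[OF c lN lN'] unfolding sgN unfolding Nst f_def by simp
    finally show ?thesis by simp
  qed
  define G where "G = f - N - sg N"
  have sgNs: "star (sg N) = sg N" using sN by (metis sg_star)
  have sG: "star G = G" by (simp add: G_def star_diff fs sN sgNs)
  define R where "R = f - P - P'"
  have sR: "star R = R" by (simp add: R_def star_diff fs PP P')
  have PN: "P * N = N" unfolding N_def by (rule hi[OF nc]) (use n0 e' in auto)
  have P'N: "P' * sg N = sg N" using arg_cong[OF PN, of sg] by (simp add: sg_mult P'_def)
  have PsN: "P * sg N = 0" using PM(1) MM(2) by (metis mult.assoc mult_zero_right)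
  have P'sN: "P' * N = 0" using arg_cong[OF PsN, of sg] by (simp add: sg_mult P'_def)
  have fsN: "f * sg N = sg N" using arg_cong[OF fMN(3), of sg] by (simp add: sg_mult fs)
  have RG: "R * G = R"
    by (simp add: R_def G_def left_diff_distrib right_diff_distrib fs Pf P'f PN P'N PsN P'sN fMN fsN)
  have GR: "G * R = R" using arg_cong[OF RG, of star] by (simp add: star_mult sG sR)
  have Gw: "w * G = v * G" "G * w = G * v" using w(5,6)[OF gin] by (simp_all add: gN G_def)
  have vR: "v * R = w * R" "R * v = R * w" using RG GR Gw by (metis mult.assoc)+
  have "Q = 1 - R" by (simp add: Q_def R_def)
  then have "Q * v - v * Q = w * R - R * w" by (simp add: left_diff_distrib right_diff_distrib vR)
  also have "\<dots> = (P * w - w * P) + (P' * w - w * P')"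
    by (simp add: R_def left_diff_distrib right_diff_distrib w(3))
  also have "P' * w - w * P' = sg (P * w - w * P)" by (simp add: P'_def sg_mult sg_diff w(2))
  finally have "norm (Q * v - v * Q) \<le> norm (P * w - w * P) + norm (P * w - w * P)" by (metis norm_sg norm_triangle_ineq)
  then have near: "norm (Q * v - v * Q) \<le> \<epsilon>" using Pw e' by linarith
  show ?thesis
  proof (intro exI[of _ Q] conjI allI impI Q near)
    show "Q * \<Phi> h = \<Phi> h * Q" if "lb (sphere 0 1) h" "\<forall>z\<in>sphere 0 1. 0 < Im z \<longrightarrow> cb < Re z \<longrightarrow> Re z \<le> ca \<longrightarrow> h z = \<kappa>"
      "\<forall>z\<in>sphere 0 1. Im z < 0 \<longrightarrow> cb < Re z \<longrightarrow> Re z \<le> ca \<longrightarrow> h z = \<kappa>'" for h \<kappa> \<kappa>'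
      using that(2,3) by (intro Qc[OF that(1), of \<kappa> \<kappa>']) auto
    show "Q * \<Phi> h = \<Phi> h" if "lb (sphere 0 1) h" "\<forall>z\<in>sphere 0 1. Re z \<le> ca \<longrightarrow> h z = 0" for h
      using that(2) by (intro Q1[OF that(1)]) auto
    show "Q * \<Phi> h = 0" if "lb (sphere 0 1) h" "\<forall>z\<in>sphere 0 1. cb < Re z \<longrightarrow> h z = 0" for h
      using that(2) by (intro Q0[OF that(1)]) auto
  qed
qed

section \<open>Approximation by finite spectrum\<close>

text \<open>The C*-identity iterated by squaring.\<close>

lemma norm_power_selfadj:
  fixes a :: q
  assumes "star a = a"
  shows "star (a ^ n) = a ^ n" "norm (a ^ (2 ^ n)) = norm a ^ (2 ^ n)"
proof -
  have s: "star (a ^ n) = a ^ n" for n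
  proof (induction n)
    case (Suc n)
    then show ?case using assms by (simp add: star_mult power_commutes)
  qed simp
  then show "star (a ^ n) = a ^ n" .
  show "norm (a ^ (2 ^ n)) = norm a ^ (2 ^ n)"
  proof (induction n)
    case (Suc n)
    have "a ^ (2 ^ Suc n) = star (a ^ (2 ^ n)) * a ^ (2 ^ n)" unfolding s by (simp add: power_add[symmetric] mult_2)
    then have "norm (a ^ (2 ^ Suc n)) = (norm (a ^ (2 ^ n)))\<^sup>2" using norm_cstar by metis
    then show ?case unfolding Suc by (simp add: power_mult[symmetric] mult.commute)
  qed simp
qed

text \<open>The \<open>2 ^ n\<close>-th powers of \<open>star (a + b) * (a + b)\<close> have no mixed terms.\<close>

lemma norm_orthogonal_add:
  fixes a b :: q
  assumes ab: "star a * b = 0" "a * star b = 0" and m: "norm a \<le> m" "norm b \<le> m"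
  shows "norm (a + b) \<le> m"
proof (rule ccontr)
  assume "\<not> norm (a + b) \<le> m"
  then have gt: "m < norm (a + b)" by simp
  have ba: "star b * a = 0" "b * star a = 0"
    using arg_cong[OF ab(1), of star] arg_cong[OF ab(2), of star] unfolding star_mult by simp_all
  define A where "A = star a * a"
  define B where "B = star b * b"
  have sa: "star A = A" "star B = B" by (simp_all add: A_def B_def star_mult)
  have AB: "A * B = 0" "B * A = 0"
  proof -
    have "A * B = star a * (a * star b) * b" "B * A = star b * (b * star a) * a" by (simp_all add: A_def B_def mult.assoc)
    then show "A * B = 0" "B * A = 0" by (simp_all add: ab ba)
  qed
  have sum: "star (a + b) * (a + b) = A + B" by (simp add: star_add distrib_left distrib_right ab ba A_def B_def)
  have pw: "(A + B) ^ (2 ^ n) = A ^ (2 ^ n) + B ^ (2 ^ n) \<and> A ^ (2 ^ n) * B ^ (2 ^ n) = 0 \<and> B ^ (2 ^ n) * A ^ (2 ^ n) = 0" for n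
  proof (induction n)
    case (Suc n)
    have sq: "x ^ (2 ^ Suc n) = x ^ (2 ^ n) * x ^ (2 ^ n)" for x :: q by (simp add: power_add[symmetric] mult_2)
    let ?X = "A ^ (2 ^ n)" and ?Y = "B ^ (2 ^ n)"
    have "?X * ?X * (?Y * ?Y) = ?X * (?X * ?Y) * ?Y" "?Y * ?Y * (?X * ?X) = ?Y * (?Y * ?X) * ?X" by (simp_all add: mult.assoc)
    then show ?case unfolding sq using Suc by (simp add: distrib_left distrib_right)
  qed (simp add: AB)
  have le: "norm (a + b) ^ (2 * 2 ^ n) \<le> 2 * m ^ (2 * 2 ^ n)" for n
  proof -
    have "norm (a + b) ^ (2 * 2 ^ n) = norm ((A + B) ^ (2 ^ n))"
      using norm_power_selfadj(2)[of "A + B" n] sa norm_cstar[of "a + b"] sum by (simp add: star_add power_mult)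
    also have "\<dots> \<le> norm (A ^ (2 ^ n)) + norm (B ^ (2 ^ n))" using pw[of n] norm_triangle_ineq by metis
    also have "\<dots> = norm a ^ (2 * 2 ^ n) + norm b ^ (2 * 2 ^ n)"
      using norm_power_selfadj(2)[OF sa(1)] norm_power_selfadj(2)[OF sa(2)] norm_cstar[of a] norm_cstar[of b]
      by (simp add: A_def B_def power_mult)
    also have "\<dots> \<le> m ^ (2 * 2 ^ n) + m ^ (2 * 2 ^ n)" using m by (intro add_mono power_mono) auto
    finally show ?thesis by simp
  qed
  have m0: "0 \<le> m" using m(1) norm_ge_zero[of a] by linarith
  show False
  proof (cases "m = 0")
    case True
    then show False using le[of 0] gt by simp
  next
    case False
    then have m1: "0 < m" using m0 by simp
    \<comment> \<open>A ratio above 1 would have unbounded powers, while all powers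
      \<open>2 * 2 ^ n\<close> are at most 2.\<close>
    define r where "r = norm (a + b) / m"
    have r: "1 < r" using gt m1 by (simp add: r_def)
    obtain n where n: "2 < r ^ n" using real_arch_pow[OF r] by blast
    have "n \<le> 2 * 2 ^ n" using less_exp[of n] by linarith
    then have "r ^ n \<le> r ^ (2 * 2 ^ n)" using r by (intro power_increasing) auto
    also have "\<dots> = norm (a + b) ^ (2 * 2 ^ n) / m ^ (2 * 2 ^ n)" by (simp add: r_def power_divide)
    also have "\<dots> \<le> 2" using le[of n] m1 by (simp add: divide_le_eq)
    finally show False using n by simp
  qed
qed

lemma norm_orthogonal_sum:
  fixes y :: "'i \<Rightarrow> q"
  assumes I: "finite I" and o: "\<And>i j. i \<in> I \<Longrightarrow> j \<in> I \<Longrightarrow> i \<noteq> j \<Longrightarrow> star (y i) * y j = 0 \<and> y i * star (y j) = 0"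
    and m: "\<And>i. i \<in> I \<Longrightarrow> norm (y i) \<le> m" "0 \<le> m"
  shows "norm (sum y I) \<le> m"
  using I o m(1)
proof (induction I rule: finite_induct)
  case (insert i I)
  have "star (y i) * sum y I = 0" "y i * star (sum y I) = 0"
    unfolding star_sum sum_distrib_left using insert.hyps insert.prems(1)[of i] by (auto intro!: sum.neutral)
  then have "norm (y i + sum y I) \<le> m" using insert by (intro norm_orthogonal_add) auto
  then show ?case using insert.hyps by simp
qed (simp add: m(2))

section \<open>Rounding points of the circle by their real parts\<close>

definition lam :: "real \<Rightarrow> complex" where "lam t = Complex t (sqrt (1 - t\<^sup>2))"

lemma lam_values: "lam 1 = 1" "lam (- 1) = - 1" by (simp_all add: lam_def complex_eq_iff)

lemma lam_circle: "\<bar>t\<bar> \<le> 1 \<Longrightarrow> cmod (lam t) = 1"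
  by (simp add: lam_def cmod_def abs_square_le_1)

text \<open>The square root term comes from the imaginary part, which near 1 and -1 varies like the
  square root of the real part.\<close>

lemma lam_near:
  assumes z: "z \<in> sphere 0 1" "0 \<le> Im z" and t: "\<bar>t\<bar> \<le> 1" "\<bar>Re z - t\<bar> \<le> s"
  shows "cmod (z - lam t) \<le> s + sqrt (2 * s)"
proof -
  have s: "(Re z)\<^sup>2 + (Im z)\<^sup>2 = 1" using z by (simp add: cmod_def)
  have rz: "\<bar>Re z\<bar> \<le> 1" using abs_Re_le_cmod[of z] z by simp
  have "1 - (Re z)\<^sup>2 = (Im z)\<^sup>2" using s by simp
  then have iz: "Im z = sqrt (1 - (Re z)\<^sup>2)" using z(2) by simp
  have "\<bar>Im z - sqrt (1 - t\<^sup>2)\<bar> \<le> sqrt \<bar>(1 - (Re z)\<^sup>2) - (1 - t\<^sup>2)\<bar>"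
    unfolding iz using t rz by (intro sqrt_diff_le) (auto simp: abs_square_le_1)
  also have "\<bar>(1 - (Re z)\<^sup>2) - (1 - t\<^sup>2)\<bar> = \<bar>t + Re z\<bar> * \<bar>Re z - t\<bar>"
    by (simp add: abs_mult[symmetric] power2_eq_square algebra_simps abs_minus_commute)
  also have "sqrt \<dots> \<le> sqrt (2 * s)"
    using t rz by (intro real_sqrt_le_mono mult_mono) auto
  finally show ?thesis using cmod_le[of "z - lam t"] t by (simp add: lam_def)
qed

lemma lam_near_cnj:
  assumes z: "z \<in> sphere 0 1" "Im z \<le> 0" and t: "\<bar>t\<bar> \<le> 1" "\<bar>Re z - t\<bar> \<le> s"
  shows "cmod (z - cnj (lam t)) \<le> s + sqrt (2 * s)"
proof -
  have "cmod (cnj (cnj z - lam t)) \<le> s + sqrt (2 * s)"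
    unfolding complex_mod_cnj using z t by (intro lam_near) auto
  then show ?thesis by simp
qed

text \<open>Cuts at successive windows give nested projections \<open>P i\<close>. Their differences
  \<open>q i\<close> are split into top and bottom, marked by the boolean in the index, except for
  the two caps around 1 and -1. The cuts are chosen with the number \<open>K\<close> of levels
  already fixed, so the sum of the commutators can be made small.\<close>

lemma finite_spectrum:
  fixes u v :: q
  assumes u: "isunit u" "sg u = u" and v: "isunit v" "sg v = v" and uv: "u * v = v * u" and e: "0 < \<epsilon>"
  shows "\<exists>(I :: (nat \<times> bool) set) bar val r. finite I \<and> (\<forall>j\<in>I. bar j \<in> I \<and> bar (bar j) = j) \<and> inj_on val I \<and>
    (\<exists>j\<in>I. val j = 1) \<and> (\<forall>j\<in>I. cmod (val j) = 1 \<and> val (bar j) = cnj (val j)) \<and>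
    (\<forall>j\<in>I. isproj (r j) \<and> sg (r j) = r (bar j)) \<and> (\<forall>i\<in>I. \<forall>j\<in>I. i \<noteq> j \<longrightarrow> r i * r j = 0) \<and>
    sum r I = 1 \<and> norm ((\<Sum>j\<in>I. sc (val j) * r j) - u) \<le> \<epsilon> \<and> (\<Sum>j\<in>I. norm (r j * v - v * r j)) \<le> \<epsilon>"
proof -
  obtain \<Phi> where c: "calc (sphere 0 1) u \<Phi>"
    and sgc: "\<And>f. lb (sphere 0 1) f \<Longrightarrow> sg (\<Phi> f) = \<Phi> (\<lambda>z. cnj (f (cnj z)))"
    using calc_unitary(2)[of u] u by (auto simp: isunit_def)
  obtain n0 :: nat where n0: "4 / min (\<epsilon> / 6) ((\<epsilon> / 6)\<^sup>2 / 2) < real n0" using reals_Archimedean2 by blast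
  define K where "K = n0 + 3"
  define N where "N = real K + 1"
  have K: "3 \<le> K" by (simp add: K_def)
  have N: "0 < N" "real n0 < N" by (simp_all add: N_def K_def)
  define s where "s = 4 / N"
  have s0: "0 < s" using N by (simp add: s_def)
  have "4 / min (\<epsilon> / 6) ((\<epsilon> / 6)\<^sup>2 / 2) < N" using n0 N by linarith
  moreover have "0 < min (\<epsilon> / 6) ((\<epsilon> / 6)\<^sup>2 / 2)" using e by simp
  ultimately have "4 < N * min (\<epsilon> / 6) ((\<epsilon> / 6)\<^sup>2 / 2)" by (simp only: pos_divide_less_eq)
  then have sm: "s < min (\<epsilon> / 6) ((\<epsilon> / 6)\<^sup>2 / 2)"
    using N(1) by (simp only: s_def pos_divide_less_eq mult.commute)
  \<comment> \<open>The distance on the circle allowed by \<open>lam_near\<close>. The final error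
    is \<open>E0\<close> for rounding \<open>u\<close> to \<open>\<Phi> \<kappa>\<close> plus
    \<open>2 * E0\<close> for rounding to the values \<open>val j\<close>.\<close>
  define E0 where "E0 = s + sqrt (2 * s)"
  have E0: "3 * E0 \<le> \<epsilon>" "0 < E0"
  proof -
    have "2 * s \<le> (\<epsilon> / 6)\<^sup>2" using sm by simp
    then have "sqrt (2 * s) \<le> \<epsilon> / 6" using e by (intro real_le_lsqrt) auto
    then show "3 * E0 \<le> \<epsilon>" using sm by (simp add: E0_def)
    show "0 < E0" using s0 by (simp add: E0_def add_pos_nonneg)
  qed
  \<comment> \<open>Decreasing levels with spacing \<open>2 / N = s / 2\<close>; as
    \<open>N = K + 1\<close>, the first and the last lie at distance \<open>s / 2\<close> from 1 and
    -1.\<close>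
  define t where "t i = 1 - 2 * (real i + 1) / N" for i
  have t_less: "t j < t i" if "i < j" for i j
    using that N by (simp add: t_def divide_strict_right_mono)
  have t_le: "t j \<le> t i" if "i \<le> j" for i j
    using t_less[of i j] that by (cases "i = j") auto
  have t_step: "t i - t (Suc i) = s / 2" for i using N by (simp add: t_def s_def field_simps)
  have t0: "t 0 = 1 - s / 2" by (simp add: t_def s_def)
  have tK: "t (K - 1) = - 1 + s / 2" using K N by (simp add: t_def s_def N_def field_simps of_nat_diff)
  have t_K: "t (K - 1) \<le> t i" if "i < K" for i using that by (intro t_le) simp
  have t_low: "- 1 < t i" if "i < K" for i using t_K[OF that] tK s0 by linarith
  have t_high: "t i < 1" for i using t_le[of 0 i] t0 s0 by simp
  \<comment> \<open>At most \<open>2 * K\<close> projections \<open>r j\<close> arise, each with a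
    commutator of norm at most \<open>2 * \<delta>\<close>.\<close>
  define \<delta> where "\<delta> = \<epsilon> / (4 * real K)"
  have d: "0 < \<delta>" using e K by (simp add: \<delta>_def)
  define R where "R i P \<longleftrightarrow> isproj P \<and> sg P = P \<and> norm (P * v - v * P) \<le> \<delta> \<and>
   (\<forall>h \<kappa> \<kappa>'. lb (sphere 0 1) h \<longrightarrow> (\<forall>z\<in>sphere 0 1. 0 < Im z \<longrightarrow> t i < Re z \<longrightarrow> Re z \<le> t (i - 1) \<longrightarrow> h z = \<kappa>) \<longrightarrow>
     (\<forall>z\<in>sphere 0 1. Im z < 0 \<longrightarrow> t i < Re z \<longrightarrow> Re z \<le> t (i - 1) \<longrightarrow> h z = \<kappa>') \<longrightarrow> P * \<Phi> h = \<Phi> h * P) \<and>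
   (\<forall>h. lb (sphere 0 1) h \<longrightarrow> (\<forall>z\<in>sphere 0 1. Re z \<le> t (i - 1) \<longrightarrow> h z = 0) \<longrightarrow> P * \<Phi> h = \<Phi> h) \<and>
   (\<forall>h. lb (sphere 0 1) h \<longrightarrow> (\<forall>z\<in>sphere 0 1. t i < Re z \<longrightarrow> h z = 0) \<longrightarrow> P * \<Phi> h = 0)" for i P
  have "\<exists>P. R i P" if i: "0 < i" "i < K" for i
  proof -
    interpret ca: arc_cut u v \<Phi> "t (i - 1)" "t i"
      using c sgc u v uv t_low[OF i(2)] t_less[of "i - 1" i] t_high[of "i - 1"] i by unfold_locales auto
    show ?thesis unfolding R_def by (rule ca.cut_unitary[OF d])
  qed
  define P0 where "P0 i = (SOME P. R i P)" for i
  have R: "R i (P0 i)" if "0 < i" "i < K" for i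
    unfolding P0_def by (rule someI_ex) (use that \<open>\<And>i. 0 < i \<Longrightarrow> i < K \<Longrightarrow> \<exists>P. R i P\<close> in blast)
  note R' = R[unfolded R_def]
  have P0: "isproj (P0 i)" "sg (P0 i) = P0 i" "norm (P0 i * v - v * P0 i) \<le> \<delta>" if "0 < i" "i < K" for i
    using R'[OF that] by simp_all
  note Pc0 = R'[THEN conjunct2, THEN conjunct2, THEN conjunct2, THEN conjunct1, THEN spec, THEN spec, THEN spec, THEN mp, THEN mp, THEN mp]
  note P10 = R'[THEN conjunct2, THEN conjunct2, THEN conjunct2, THEN conjunct2, THEN conjunct1, THEN spec, THEN mp, THEN mp]
  note P00 = R'[THEN conjunct2, THEN conjunct2, THEN conjunct2, THEN conjunct2, THEN conjunct2, THEN spec, THEN mp, THEN mp]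
  define P where "P i = (if i = 0 then 0 else if i < K then P0 i else 1)" for i
  have Pp: "star (P i) = P i" "P i * P i = P i" "sg (P i) = P i" "norm (P i * v - v * P i) \<le> \<delta>" for i
    using P0[of i] d by (auto simp: P_def isproj_def not_less)
  have Pc: "P i * \<Phi> h = \<Phi> h * P i" if h: "lb (sphere 0 1) h"
    "\<And>i. 0 < i \<Longrightarrow> i < K \<Longrightarrow> \<forall>z\<in>sphere 0 1. 0 < Im z \<longrightarrow> t i < Re z \<longrightarrow> Re z \<le> t (i - 1) \<longrightarrow> h z = \<kappa> i"
    "\<And>i. 0 < i \<Longrightarrow> i < K \<Longrightarrow> \<forall>z\<in>sphere 0 1. Im z < 0 \<longrightarrow> t i < Re z \<longrightarrow> Re z \<le> t (i - 1) \<longrightarrow> h z = \<kappa>' i" for i h \<kappa> \<kappa>'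
    using Pc0[OF _ _ h(1) h(2) h(3), of i] by (simp add: P_def)
  have P1: "P i * \<Phi> h = \<Phi> h" if "0 < i" "lb (sphere 0 1) h" "\<And>z. z \<in> sphere 0 1 \<Longrightarrow> i < K \<Longrightarrow> Re z \<le> t (i - 1) \<Longrightarrow> h z = 0" for i h
    using P10[OF that(1) _ that(2)] that by (simp add: P_def)
  have Pz: "P i * \<Phi> h = 0" if "i < K" "lb (sphere 0 1) h" "\<And>z. z \<in> sphere 0 1 \<Longrightarrow> 0 < i \<Longrightarrow> t i < Re z \<Longrightarrow> h z = 0" for i h
    using P00[OF _ that(1,2)] that by (simp add: P_def)
  \<comment> \<open>The windows \<open>(t i, t (i - 1)]\<close> are disjoint, so the spectral
    projection for \<open>t i < Re z\<close> lies above \<open>P i\<close> and below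
    \<open>P j\<close>.\<close>
  have nest: "P i * P j = P i" "P j * P i = P i" if ij: "i < j" for i j
  proof -
    show 1: "P i * P j = P i"
    proof (cases "0 < i \<and> j < K")
      case True
      let ?h = "\<lambda>z. if t i < Re z then 1 else (0::complex)"
      have lh: "lb (sphere 0 1) ?h" by (rule lb_bounded[of _ _ 1]) simp
      have sh: "star (\<Phi> ?h) = \<Phi> ?h" unfolding calc_star[OF c lh] by (rule arg_cong[of _ _ \<Phi>]) auto
      have "P i * \<Phi> (\<lambda>z. 1 - ?h z) = 0" by (rule Pz) (use True ij lh in \<open>auto intro!: lb_diff\<close>)
      then have a: "P i * \<Phi> ?h = P i" using calc_diff[OF c lb_const lh, of 1] by (simp add: calc_one[OF c] right_diff_distrib)
      have "t (j - 1) \<le> t i" using ij by (intro t_le) simp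
      then have "P j * \<Phi> ?h = \<Phi> ?h" by (intro P1) (use True ij lh in auto)
      from arg_cong[OF this, of star] have b: "\<Phi> ?h * P j = \<Phi> ?h" unfolding star_mult sh Pp .
      have "P i * P j = P i * (\<Phi> ?h * P j)" using a by (simp add: mult.assoc[symmetric])
      then show ?thesis unfolding b a .
    qed (use ij in \<open>auto simp: P_def\<close>)
    show "P j * P i = P i" using arg_cong[OF 1, of star] unfolding star_mult Pp .
  qed
  define q where "q i = P (Suc i) - P i" for i
  have qs: "star (q i) = q i" "sg (q i) = q i" for i by (simp_all add: q_def star_diff sg_diff Pp)
  have qq: "q i * q i = q i" for i using nest[of i "Suc i"] by (simp add: q_def left_diff_distrib right_diff_distrib Pp)
  have qo: "q i * q j = 0" if "i \<noteq> j" for i j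
  proof -
    have *: "q i * q j = 0 \<and> q j * q i = 0" if "i < j" for i j
      using nest[of i j] nest[of i "Suc j"] nest[of "Suc i" "Suc j"] nest[of "Suc i" j] that Pp(2)[of j]
      by (cases "Suc i = j") (auto simp: q_def left_diff_distrib right_diff_distrib)
    show ?thesis using *[of i j] *[of j i] that by (cases "i < j") auto
  qed
  have qsum: "(\<Sum>i<K. q i) = 1"
    unfolding q_def sum_lessThan_telescope using K by (simp add: P_def)
  have qv: "norm (q i * v - v * q i) \<le> 2 * \<delta>" for i
  proof -
    have "q i * v - v * q i = (P (Suc i) * v - v * P (Suc i)) - (P i * v - v * P i)" by (simp add: q_def left_diff_distrib right_diff_distrib)
    then show ?thesis using norm_triangle_ineq4[of "P (Suc i) * v - v * P (Suc i)" "P i * v - v * P i"] Pp(4)[of i] Pp(4)[of "Suc i"] by simp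
  qed
  have qn: "norm (q i) \<le> 1" for i by (rule isproj_norm) (simp add: isproj_def qs qq)
  \<comment> \<open>Two consecutive windows, which is where \<open>q i\<close> lives. At the first
    and the last index the outer bound disappears, leaving a cap.\<close>
  define L where "L i z \<longleftrightarrow> (Suc i < K \<longrightarrow> t (Suc i) < Re z) \<and> (0 < i \<longrightarrow> Re z \<le> t (i - 1))" for i z
  have loc: "q i * \<Phi> h = 0" if i: "i < K" and h: "lb (sphere 0 1) h" "\<And>z. z \<in> sphere 0 1 \<Longrightarrow> L i z \<Longrightarrow> h z = 0" for i h
  proof -
    define h1 where "h1 z = (if 0 < i \<and> t (i - 1) < Re z then h z else 0)" for z
    define h2 where "h2 z = (if 0 < i \<and> t (i - 1) < Re z then 0 else h z)" for z
    have ht: "h2 z = 0 \<or> (Suc i < K \<and> Re z \<le> t (Suc i))" if "z \<in> sphere 0 1" for z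
    proof (rule disjCI)
      assume "\<not> (Suc i < K \<and> Re z \<le> t (Suc i))"
      then show "h2 z = 0" using h(2)[OF that] by (auto simp: h2_def L_def not_less not_le)
    qed
    define i1 where "i1 z = (if 0 < i \<and> t (i - 1) < Re z then 1 else 0 :: complex)" for z
    have li: "lb (sphere 0 1) i1" by (rule lb_bounded[of _ _ 1]) (simp add: i1_def)
    have "h1 = (\<lambda>z. i1 z * h z)" "h2 = (\<lambda>z. (1 - i1 z) * h z)" by (auto simp: h1_def h2_def i1_def)
    then have l1: "lb (sphere 0 1) h1" and l2: "lb (sphere 0 1) h2"
      using li h(1) by (auto intro!: lb_mult lb_diff)
    have "\<Phi> h = \<Phi> h1 + \<Phi> h2" unfolding calc_add[OF c l1 l2, symmetric]
      by (rule arg_cong[of _ _ \<Phi>]) (auto simp: h1_def h2_def)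
    moreover have "P (Suc i) * \<Phi> h1 = \<Phi> h1"
      by (rule P1[OF _ l1]) (use t_le[of "i - 1" i] in \<open>auto simp: h1_def\<close>)
    moreover have "P i * \<Phi> h1 = \<Phi> h1"
    proof (cases "i = 0")
      case True
      then have "\<Phi> h1 = 0" by (intro calc_zero'[OF c]) (simp add: h1_def)
      then show ?thesis by simp
    qed (auto intro!: P1 l1 simp: h1_def)
    moreover have "P (Suc i) * \<Phi> h2 = 0"
    proof (cases "Suc i < K")
      case True
      show ?thesis by (rule Pz[OF True l2]) (use ht in force)
    next
      case False
      then have "\<Phi> h2 = 0" using ht by (intro calc_zero'[OF c]) blast
      then show ?thesis by simp
    qed
    moreover have "P i * \<Phi> h2 = 0"
      by (rule Pz[OF i l2]) (use ht t_le[of i "Suc i"] in force)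
    ultimately show ?thesis by (simp add: q_def left_diff_distrib distrib_left)
  qed
  \<comment> \<open>On the windows \<open>\<bar>Re z\<bar> \<le> 1 - s / 2\<close>, hence
    \<open>(Im z)^2 \<ge> s / 2\<close>. This gap lets the continuous \<open>kt\<close> act as the
    indicator of the top or bottom half.\<close>
  define d0 where "d0 = sqrt (s / 2)"
  have d0: "0 < d0" using s0 by (simp add: d0_def)
  have imd: "d0 \<le> \<bar>Im z\<bar>" if z: "z \<in> sphere 0 1" "t (K - 1) < Re z" "Re z \<le> t 0" for z
  proof -
    have a: "\<bar>Re z\<bar> \<le> 1 - s / 2" using z tK t0 by simp
    then have "(Re z)\<^sup>2 \<le> (1 - s / 2)\<^sup>2" by (metis abs_ge_zero power2_abs power_mono)
    also have "\<dots> \<le> 1 * (1 - s / 2)" unfolding power2_eq_square using a s0 by (intro mult_right_mono) linarith+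
    finally have "s / 2 \<le> (Im z)\<^sup>2" using z(1) by (simp add: cmod_def)
    then have "sqrt (s / 2) \<le> sqrt ((Im z)\<^sup>2)" by (rule real_sqrt_le_mono)
    then show ?thesis by (simp add: d0_def)
  qed
  define kt where "kt b z = complex_of_real (clip 0 1 ((if b then Im z else - Im z) / d0))" for b z
  have ktc: "continuous_on A (kt b)" for A b
    unfolding kt_def using d0 by (cases b) (auto intro!: continuous_intros)
  have kpos: "kt b z = 0" if "if b then Im z \<le> 0 else 0 \<le> Im z" for b z
  proof -
    have "(if b then Im z else - Im z) / d0 \<le> 0" using that d0 by (intro divide_nonpos_pos) (auto split: if_splits)
    then show ?thesis by (simp add: kt_def clip_def)
  qed
  have kone: "kt b z = 1" if "d0 \<le> \<bar>Im z\<bar>" "if b then 0 < Im z else Im z < 0" for b z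
  proof -
    have "1 \<le> (if b then Im z else - Im z) / d0" using that d0 by (auto simp: le_divide_eq split: if_splits)
    then show ?thesis by (simp add: kt_def clip_def)
  qed
  define ends where "ends i \<longleftrightarrow> i = 0 \<or> i = K - 1" for i
  define kk where "kk j = (if ends (fst j) then (\<lambda>z. 1) else kt (snd j))" for j :: "nat \<times> bool"
  have kkc: "continuous_on A (kk j)" for A j unfolding kk_def using ktc by auto
  have lkk: "lb (sphere 0 1) (kk j)" for j by (rule lb_cont[OF kkc])
  have Lmid: "d0 \<le> \<bar>Im z\<bar>" if "z \<in> sphere 0 1" "i < K" "\<not> ends i" "L i z" for i z
  proof (rule imd[OF that(1)])
    have i: "0 < i" "Suc i < K" using that(2,3) K by (auto simp: ends_def)
    show "t (K - 1) < Re z" using that(4) i t_K[of "Suc i"] by (auto simp: L_def)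
    show "Re z \<le> t 0" using that(4) i t_le[of 0 "i - 1"] by (auto simp: L_def)
  qed
  have windows: "d0 \<le> \<bar>Im z\<bar>" if "0 < i" "i < K" "z \<in> sphere 0 1" "t i < Re z" "Re z \<le> t (i - 1)" for i z
    by (rule imd[OF that(3)]) (use that t_K[of i] t_le[of 0 "i - 1"] in auto)
  have qk: "q i * \<Phi> (kk j) = \<Phi> (kk j) * q i" for i j
  proof -
    have "kt b z = 1" if "0 < i" "i < K" "z \<in> sphere 0 1" "t i < Re z" "Re z \<le> t (i - 1)" "if b then 0 < Im z else Im z < 0" for b i z
      by (rule kone[OF windows[OF that(1-5)] that(6)])
    then have "P i * \<Phi> (kk j) = \<Phi> (kk j) * P i" for i
      by (intro Pc[OF lkk, of _ "\<lambda>_. if ends (fst j) then 1 else if snd j then 1 else 0" "\<lambda>_. if ends (fst j) then 1 else if snd j then 0 else 1"])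
        (use kpos in \<open>auto simp: kk_def less_imp_le\<close>)
    then show ?thesis by (simp add: q_def left_diff_distrib right_diff_distrib)
  qed
  have loc2: "\<Phi> g * q i = \<Phi> g' * q i" if "i < K" "lb (sphere 0 1) g" "lb (sphere 0 1) g'" "\<And>z. z \<in> sphere 0 1 \<Longrightarrow> L i z \<Longrightarrow> g z = g' z" for g g' i
  proof -
    let ?h = "\<lambda>z. cnj (g z - g' z)"
    have lh: "lb (sphere 0 1) ?h" "lb (sphere 0 1) (\<lambda>z. g z - g' z)" using that by (intro lb_cnj lb_diff; simp)+
    have "q i * \<Phi> ?h = 0" by (rule loc) (use that lh in auto)
    from arg_cong[OF this, of star] have "\<Phi> (\<lambda>z. g z - g' z) * q i = 0"
      unfolding star_mult calc_star[OF c lh(1)] qs by simp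
    then show ?thesis using calc_diff[OF c that(2,3)] by (simp add: left_diff_distrib)
  qed
  \<comment> \<open>The unsplit caps occur once, with the boolean \<open>True\<close>, and
    \<open>bar\<close> fixes them.\<close>
  define I where "I = Sigma {..<K} (\<lambda>i. if ends i then {True} else UNIV)"
  define bar where "bar j = (if ends (fst j) then j else (fst j, \<not> snd j))" for j :: "nat \<times> bool"
  \<comment> \<open>The caps are rounded to exactly 1 and -1, whose values are real, as
    \<open>bar\<close> requires.\<close>
  define T where "T i = (if i = 0 then 1 else if i = K - 1 then - 1 else t i)" for i
  define val where "val j = (if snd j then lam (T (fst j)) else cnj (lam (T (fst j))))" for j :: "nat \<times> bool"
  define r where "r j = \<Phi> (kk j) * q (fst j)" for j
  have If: "finite I" by (simp add: I_def)
  have IK: "fst j < K" if "j \<in> I" for j using that by (auto simp: I_def)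
  have Iend: "snd j" if "j \<in> I" "ends (fst j)" for j using that by (auto simp: I_def)
  have barI: "bar j \<in> I" "bar (bar j) = j" if "j \<in> I" for j using that by (auto simp: I_def bar_def)
  have T1: "\<bar>T i\<bar> \<le> 1" if "i < K" for i using t_low[OF that] t_high[of i] by (auto simp: T_def abs_le_iff)
  have Tm: "\<bar>T i\<bar> < 1" if "i < K" "\<not> ends i" for i using t_low[OF that(1)] t_high[of i] that by (auto simp: T_def ends_def)
  have T_less: "T j < T i" if "i < j" "j < K" for i j
    using that t_less[OF that(1)] t_low[of i] t_high[of j] K by (auto simp: T_def)
  have T_inj: "i = j" if "T i = T j" "i < K" "j < K" for i j
    using T_less[of i j] T_less[of j i] that by (metis less_irrefl linorder_neqE_nat)
  have Imval: "0 < sqrt (1 - (T i)\<^sup>2)" if "i < K" "\<not> ends i" for i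
    using Tm[OF that] by (simp add: abs_square_less_1)
  have vinj: "inj_on val I"
  proof (rule inj_onI)
    fix j j' assume j: "j \<in> I" "j' \<in> I" "val j = val j'"
    have "Re (val j) = T (fst j)" for j by (simp add: val_def lam_def)
    then have f: "fst j = fst j'" using T_inj IK j by metis
    show "j = j'"
    proof (cases "ends (fst j)")
      case True
      then show ?thesis using f Iend[OF j(1)] Iend[OF j(2)] by (simp add: prod_eq_iff)
    next
      case False
      then have "0 < sqrt (1 - (T (fst j))\<^sup>2)" using Imval IK j by blast
      then have "snd j = snd j'" using arg_cong[OF j(3), of Im] f by (auto simp: val_def lam_def split: if_splits)
      then show ?thesis using f by (simp add: prod_eq_iff)
    qed
  qed
  have Tend: "cnj (lam (T i)) = lam (T i)" if "ends i" for i
    using that lam_values by (auto simp: T_def ends_def)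
  have vbar: "val (bar j) = cnj (val j)" for j using Tend[of "fst j"] by (auto simp: val_def bar_def)
  have vn: "cmod (val j) = 1" if "j \<in> I" for j using lam_circle[OF T1[OF IK[OF that]]] by (simp add: val_def)
  have sk: "star (\<Phi> (kk j)) = \<Phi> (kk j)" for j
    unfolding calc_star[OF c lkk] by (rule arg_cong[of _ _ \<Phi>]) (auto simp: kk_def kt_def)
  have sgk: "sg (\<Phi> (kk j)) = \<Phi> (kk (bar j))" for j
    unfolding sgc[OF lkk] by (rule arg_cong[of _ _ \<Phi>]) (auto simp: kk_def kt_def bar_def fun_eq_iff)
  have kmul: "\<Phi> (kk i) * \<Phi> (kk j) = \<Phi> (\<lambda>z. kk i z * kk j z)" for i j using calc_mult[OF c lkk lkk] by simp
  have rr: "r i * r j = \<Phi> (\<lambda>z. kk i z * kk j z) * (q (fst i) * q (fst j))" for i j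
  proof -
    have "r i * r j = \<Phi> (kk i) * (q (fst i) * \<Phi> (kk j)) * q (fst j)" by (simp add: r_def mult.assoc)
    then show ?thesis unfolding qk by (simp add: mult.assoc kmul[symmetric])
  qed
  have ro: "r i * r j = 0" if "i \<in> I" "j \<in> I" "i \<noteq> j" for i j
  proof (cases "fst i = fst j")
    case True
    then have "snd i \<noteq> snd j" "\<not> ends (fst j)" using that Iend[of i] Iend[of j] by (auto simp: prod_eq_iff)
    then have "kk i z * kk j z = 0" for z using True kpos[of "snd i" z] kpos[of "snd j" z] by (cases "0 \<le> Im z") (auto simp: kk_def split: if_splits)
    then have "(\<lambda>z. kk i z * kk j z) = (\<lambda>z. 0)" by (rule ext)
    then show ?thesis unfolding rr by (simp only: calc_zero[OF c] mult_zero_left)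
  qed (simp add: rr qo)
  have lmul: "lb (sphere 0 1) (\<lambda>z. kk i z * kk j z)" for i j by (intro lb_mult lkk)
  have rp: "isproj (r j)" if "j \<in> I" for j
  proof -
    have "kk j z * kk j z = kk j z" if "z \<in> sphere 0 1" "L (fst j) z" for z
    proof (cases "ends (fst j)")
      case False
      have "d0 \<le> \<bar>Im z\<bar>" using Lmid[OF that(1) IK False that(2)] \<open>j \<in> I\<close> by simp
      then have "kt (snd j) z = 0 \<or> kt (snd j) z = 1" using kpos[of "snd j" z] kone[of z "snd j"] d0 by (cases "snd j"; cases "0 < Im z") auto
      then show ?thesis using False by (auto simp: kk_def)
    qed (simp add: kk_def)
    then have "r j * r j = r j" unfolding rr qq unfolding r_def by (intro loc2 IK that lmul lkk)
    moreover have "star (r j) = r j" by (simp add: r_def star_mult sk qs qk)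
    ultimately show ?thesis by (simp add: isproj_def)
  qed
  have rsum: "sum r I = 1"
  proof -
    have "sum r I = (\<Sum>i<K. \<Sum>b\<in>(if ends i then {True} else UNIV). r (i, b))"
      unfolding I_def by (subst sum.Sigma) auto
    also have "\<dots> = (\<Sum>i<K. q i)"
    proof (rule sum.cong[OF refl])
      fix i assume i: "i \<in> {..<K}"
      show "(\<Sum>b\<in>(if ends i then {True} else UNIV). r (i, b)) = q i"
      proof (cases "ends i")
        case True
        then show ?thesis by (simp add: r_def kk_def calc_one[OF c])
      next
        case False
        have ll: "lb (sphere 0 1) (kt b)" for b by (rule lb_cont[OF ktc])
        have "r (i, True) + r (i, False) = \<Phi> (\<lambda>z. kt True z + kt False z) * q i"
          using False calc_add[OF c ll ll, of True False] by (simp add: r_def kk_def distrib_right)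
        also have "\<dots> = \<Phi> (\<lambda>z. 1) * q i"
        proof (rule loc2)
          fix z :: complex assume z: "z \<in> sphere 0 1" "L i z"
          have "d0 \<le> \<bar>Im z\<bar>" using Lmid[OF z(1) _ False z(2)] i by simp
          then show "kt True z + kt False z = 1"
            using kpos[of True z] kpos[of False z] kone[of z True] kone[of z False] d0 by (cases "0 < Im z") auto
        qed (use i ll in \<open>auto intro!: lb_add\<close>)
        finally show ?thesis using False by (simp add: UNIV_bool calc_one[OF c] add.commute)
      qed
    qed
    finally show ?thesis using qsum by simp
  qed
  have rv: "norm (r j * v - v * r j) \<le> 2 * \<delta>" for j
  proof -
    have "v * star u = star u * (u * v) * star u" using isunitD[OF u(1)] by (simp add: mult.assoc)
    also have "\<dots> = star u * v" unfolding uv using isunitD[OF u(1)] by (simp add: mult.assoc)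
    finally have kv: "v * \<Phi> (kk j) = \<Phi> (kk j) * v"
      using calc_commute[OF c closed_sphere kkc, of v j] uv by simp
    have "r j * v - v * r j = \<Phi> (kk j) * (q (fst j) * v - v * q (fst j))"
      using kv by (simp add: r_def right_diff_distrib mult.assoc[symmetric])
    moreover have "norm (\<Phi> (kk j)) \<le> 1" by (rule calc_norm[OF c]) (auto simp: kk_def kt_def clip_def)
    ultimately show ?thesis using norm_mult_le[OF _ qv, of "\<Phi> (kk j)" 1 "fst j"] by simp
  qed
  have cardI: "real (card I) \<le> 2 * real K"
  proof -
    have "I \<subseteq> {..<K} \<times> UNIV" by (auto simp: I_def)
    then have "card I \<le> card ({..<K} \<times> (UNIV :: bool set))" by (intro card_mono) auto
    also have "\<dots> = K * 2" by (simp add: card_cartesian_product)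
    finally show ?thesis by linarith
  qed
  have rvs: "(\<Sum>j\<in>I. norm (r j * v - v * r j)) \<le> \<epsilon>"
  proof -
    have "(\<Sum>j\<in>I. norm (r j * v - v * r j)) \<le> real (card I) * (2 * \<delta>)" by (rule sum_bounded_above[OF rv])
    also have "\<dots> \<le> 2 * real K * (2 * \<delta>)" using cardI d by (intro mult_right_mono) auto
    also have "\<dots> = \<epsilon>" using K by (simp add: \<delta>_def)
    finally show ?thesis .
  qed
  \<comment> \<open>The number of the window containing \<open>z\<close>; the values 0 and from
    \<open>K\<close> on stand for the caps. The step function \<open>\<kappa>\<close> is constant on
    the top and on the bottom half of each window, so \<open>\<Phi> \<kappa>\<close> commutes
    exactly with every \<open>P i\<close>, which \<open>u\<close> itself need not do.\<close>
  define ix where "ix z = nat \<lfloor>(1 - Re z) * N / 2\<rfloor>" for z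
  define \<kappa> where "\<kappa> z = (if 0 < Im z then lam else (\<lambda>t. cnj (lam t))) (if ix z = 0 then 1 else if K \<le> ix z then - 1 else t (ix z))" for z
  have ixw: "ix z = i" if "0 < i" "t i < Re z" "Re z \<le> t (i - 1)" for i z
  proof -
    have "real (i - 1) + 1 = real i" using that(1) by simp
    then have "2 * real i / N \<le> 1 - Re z" "1 - Re z < 2 * (real i + 1) / N" using that(2,3) by (simp_all add: t_def)
    then have "real i \<le> (1 - Re z) * N / 2" "(1 - Re z) * N / 2 < real i + 1" using N(1) by (simp_all add: field_simps)
    then have "\<lfloor>(1 - Re z) * N / 2\<rfloor> = int i" by (intro floor_unique) auto
    then show ?thesis by (simp add: ix_def)
  qed
  have kap: "cmod (z - \<kappa> z) \<le> E0" if z: "z \<in> sphere 0 1" for z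
  proof -
    have rz: "\<bar>Re z\<bar> \<le> 1" using abs_Re_le_cmod[of z] z by simp
    define x where "x = (if ix z = 0 then 1 else if K \<le> ix z then - 1 else t (ix z))"
    have nn: "0 \<le> (1 - Re z) * N / 2" using rz N by (intro divide_nonneg_pos mult_nonneg_nonneg) auto
    then have "real (ix z) \<le> (1 - Re z) * N / 2" "(1 - Re z) * N / 2 < real (ix z) + 1"
      unfolding ix_def by (simp_all add: of_nat_nat) linarith+
    then have b: "2 * real (ix z) / N \<le> 1 - Re z" "1 - Re z < 2 * (real (ix z) + 1) / N" using N(1) by (simp_all add: field_simps)
    have "\<bar>Re z - x\<bar> \<le> s"
    proof (cases "ix z = 0")
      case True
      then show ?thesis using b rz s0 by (simp add: x_def s_def)
    next
      case False
      show ?thesis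
      proof (cases "K \<le> ix z")
        case True
        then have "2 * real K / N \<le> 2 * real (ix z) / N" using N by (intro divide_right_mono) auto
        moreover have "2 * real K / N = 2 - s / 2" using N by (simp add: s_def N_def field_simps)
        ultimately have "Re z \<le> - 1 + s / 2" using b(1) by linarith
        then show ?thesis using False True rz s0 by (simp add: x_def abs_le_iff)
      next
        case f2: False
        have "t (ix z) = 1 - 2 * (real (ix z) + 1) / N" "2 * (real (ix z) + 1) / N = 2 * real (ix z) / N + s / 2"
          using N by (simp_all add: t_def s_def field_simps)
        then show ?thesis using False f2 b s0 by (simp add: x_def abs_le_iff)
      qed
    qed
    moreover have "\<bar>x\<bar> \<le> 1" using t_low[of "ix z"] t_high[of "ix z"] by (auto simp: x_def abs_le_iff)
    ultimately show ?thesis using lam_near[OF z, of x s] lam_near_cnj[OF z, of x s] by (auto simp: \<kappa>_def x_def[symmetric] E0_def)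
  qed
  have lk: "lb (sphere 0 1) \<kappa>"
  proof (rule lb_bounded)
    fix z :: complex assume z: "z \<in> sphere 0 1"
    show "cmod (\<kappa> z) \<le> 1 + E0" using kap[OF z] norm_triangle_ineq2[of "\<kappa> z" z] z by (simp add: norm_minus_commute)
  qed
  have Pk: "P i * \<Phi> \<kappa> = \<Phi> \<kappa> * P i" for i
    by (rule Pc[OF lk, of "\<lambda>i. lam (t i)" "\<lambda>i. cnj (lam (t i))"]) (use ixw in \<open>auto simp: \<kappa>_def\<close>)
  have rk: "r j * \<Phi> \<kappa> = \<Phi> \<kappa> * r j" for j
  proof -
    have 1: "q i * \<Phi> \<kappa> = \<Phi> \<kappa> * q i" for i using Pk by (simp add: q_def left_diff_distrib right_diff_distrib)
    have 2: "\<Phi> (kk j) * \<Phi> \<kappa> = \<Phi> \<kappa> * \<Phi> (kk j)"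
      using calc_mult[OF c lkk lk, of j] calc_mult[OF c lk lkk, of j] by (simp add: mult.commute)
    show ?thesis unfolding r_def using 1 2 by (metis mult.assoc)
  qed
  \<comment> \<open>Since \<open>\<Phi> \<kappa>\<close> commutes with the \<open>r j\<close>, these
    errors are mutually orthogonal. Their sum is bounded by the largest norm, independently of the
    number of summands.\<close>
  define y where "y j = (\<Phi> \<kappa> - sc (val j)) * r j" for j
  have yr: "y j = r j * (\<Phi> \<kappa> - sc (val j))" for j
    unfolding y_def using rk[of j] sc_comm[of "r j"] by (simp add: left_diff_distrib right_diff_distrib)
  have rs: "star (r j) = r j" if "j \<in> I" for j using rp[OF that] by (simp add: isproj_def)
  have nearL: "cmod (z - val j) \<le> E0" if j: "j \<in> I" and z: "z \<in> sphere 0 1" "L (fst j) z" "kk j z \<noteq> 0" for j z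
  proof -
    let ?i = "fst j"
    have rz: "\<bar>Re z\<bar> \<le> 1" using abs_Re_le_cmod[of z] z by simp
    have st: "t 1 = 1 - s" "t (K - 2) = - 1 + s" "s / 2 = t (?i - 1) - t (Suc (?i - 1))" "t ?i - t (Suc ?i) = s / 2"
      using t_step[of 0] t0 t_step[of "K - 2"] tK K t_step[of "?i - 1"] t_step[of ?i] by (simp_all add: Suc_diff_Suc numeral_2_eq_2)
    have cl: "\<bar>Re z - T ?i\<bar> \<le> s"
    proof (cases "?i = 0")
      case True
      then show ?thesis using z(2) K st rz by (simp add: L_def T_def)
    next
      case False
      show ?thesis
      proof (cases "?i = K - 1")
        case True
        then show ?thesis using False z(2) K st rz by (simp add: L_def T_def numeral_2_eq_2)
      next
        case f2: False
        have "Suc (?i - 1) = ?i" "Suc ?i < K" using False f2 IK[OF j] by auto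
        moreover have "t (Suc ?i) < Re z" "Re z \<le> t (?i - 1)" using z(2) False \<open>Suc ?i < K\<close> by (simp_all add: L_def)
        moreover have "T ?i = t ?i" using False f2 by (simp add: T_def)
        ultimately show ?thesis using st(3,4) s0 by (simp only: abs_le_iff) linarith
      qed
    qed
    have one: "\<bar>T ?i\<bar> \<le> 1" by (rule T1[OF IK[OF j]])
    show ?thesis
    proof (cases "ends ?i")
      case True
      then show ?thesis using Tend[OF True] lam_near[OF z(1) _ one cl] lam_near_cnj[OF z(1) _ one cl]
        by (cases "0 \<le> Im z") (auto simp: val_def E0_def)
    next
      case False
      have "\<not> (if snd j then Im z \<le> 0 else 0 \<le> Im z)"
      proof
        assume "if snd j then Im z \<le> 0 else 0 \<le> Im z"
        from kpos[OF this] show False using z(3) False by (simp add: kk_def)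
      qed
      then have "if snd j then 0 < Im z else Im z < 0" by (simp split: if_splits)
      then show ?thesis using lam_near[OF z(1) _ one cl] lam_near_cnj[OF z(1) _ one cl]
        by (cases "snd j") (auto simp: val_def E0_def)
    qed
  qed
  have yn: "norm (y j) \<le> 2 * E0" if j: "j \<in> I" for j
  proof -
    let ?g = "\<lambda>z. (\<kappa> z - val j) * kk j z"
    let ?h = "\<lambda>z. if L (fst j) z then ?g z else 0"
    have kk1: "cmod (kk j z) \<le> 1" for z by (auto simp: kk_def kt_def clip_def)
    have hb: "cmod (?h z) \<le> 2 * E0" if z: "z \<in> sphere 0 1" for z
    proof (cases "L (fst j) z \<and> kk j z \<noteq> 0")
      case True
      have "cmod (\<kappa> z - val j) \<le> cmod (z - \<kappa> z) + cmod (z - val j)"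
        using norm_triangle_ineq[of "\<kappa> z - z" "z - val j"] by (simp add: norm_minus_commute)
      then have "cmod (\<kappa> z - val j) \<le> 2 * E0" using kap[OF z] nearL[OF j z] True by fastforce
      then have "cmod (\<kappa> z - val j) * cmod (kk j z) \<le> 2 * E0 * 1" using kk1[of z] E0(2) by (intro mult_mono) auto
      then show ?thesis using True by (simp add: norm_mult)
    qed (use E0(2) in auto)
    have lg: "lb (sphere 0 1) ?g" by (intro lb_mult lb_diff lk lkk lb_const)
    have lh: "lb (sphere 0 1) ?h" by (rule lb_bounded[OF hb])
    have "y j = \<Phi> ?g * q (fst j)"
      using calc_mult[OF c lb_diff[OF lk lb_const] lkk, of "val j" j] calc_diff[OF c lk lb_const, of "val j"]
      by (simp add: y_def r_def calc_const[OF c] mult.assoc)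
    also have "\<dots> = \<Phi> ?h * q (fst j)" by (rule loc2[OF IK[OF j] lg lh]) simp
    also have "norm \<dots> \<le> 2 * E0 * 1" by (intro norm_mult_le qn calc_norm[OF c] hb) (use E0 in auto)
    finally show ?thesis by simp
  qed
  have yo: "star (y i) * y j = 0 \<and> y i * star (y j) = 0" if ij: "i \<in> I" "j \<in> I" "i \<noteq> j" for i j
  proof
    have "star (y i) = star (\<Phi> \<kappa> - sc (val i)) * r i" unfolding yr[of i] star_mult rs[OF ij(1)] ..
    then have "star (y i) * y j = star (\<Phi> \<kappa> - sc (val i)) * (r i * r j) * (\<Phi> \<kappa> - sc (val j))"
      unfolding yr[of j] by (simp only: mult.assoc)
    then show "star (y i) * y j = 0" by (simp add: ro[OF ij])
    have "y i * star (y j) = (\<Phi> \<kappa> - sc (val i)) * (r i * r j) * star (\<Phi> \<kappa> - sc (val j))"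
      by (simp add: y_def star_mult rs[OF ij(2)] mult.assoc)
    then show "y i * star (y j) = 0" by (simp add: ro[OF ij])
  qed
  have near: "norm ((\<Sum>j\<in>I. sc (val j) * r j) - u) \<le> \<epsilon>"
  proof -
    have ys: "norm (sum y I) \<le> 2 * E0" by (rule norm_orthogonal_sum[OF If yo yn]) (use E0 in auto)
    have "sum y I = \<Phi> \<kappa> * sum r I - (\<Sum>j\<in>I. sc (val j) * r j)"
      by (simp add: y_def left_diff_distrib sum_subtractf sum_distrib_left)
    then have "(\<Sum>j\<in>I. sc (val j) * r j) - u = - (u - \<Phi> \<kappa>) - sum y I" by (simp add: rsum)
    then have "norm ((\<Sum>j\<in>I. sc (val j) * r j) - u) \<le> norm (u - \<Phi> \<kappa>) + norm (sum y I)" by (metis norm_minus_cancel norm_triangle_ineq4)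
    also have "u - \<Phi> \<kappa> = \<Phi> (\<lambda>z. z - \<kappa> z)" using calc_diff[OF c lb_id lk] by (simp add: calc_id[OF c])
    also have "norm \<dots> \<le> E0" by (rule calc_norm[OF c kap]) (use E0 in auto)
    finally show ?thesis using ys E0 by linarith
  qed
  have one: "\<exists>j\<in>I. val j = 1"
    by (rule bexI[of _ "(0, True)"]) (use K in \<open>auto simp: I_def val_def T_def lam_values ends_def\<close>)
  have rsg: "sg (r j) = r (bar j)" for j
    by (simp add: r_def sg_mult sgk qs) (simp add: bar_def)
  show ?thesis
    by (intro exI[of _ I] exI[of _ bar] exI[of _ val] exI[of _ r] conjI ballI impI)
      (use If barI vinj one vn vbar rp rsg ro rsum near rvs in simp_all)
qed

section \<open>Commuting lifts\<close>

lemma fc_sc: "fc (sc a) g = sc (g a)"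
proof -
  have "is_dec (sc a) 1 (\<lambda>i k. a)" by (simp add: is_dec_def dgf_const)
  from fc_dec[OF this, of g] show ?thesis by (simp add: dgf_const)
qed

lemma calc_scalar: "a \<in> sphere 0 1 \<Longrightarrow> calc (sphere 0 1) (sc a) (\<lambda>g. sc (g a))"
proof -
  assume a: "a \<in> sphere 0 1"
  then have "cnj a * a = 1" by (simp add: complex_norm_square[symmetric] mult.commute)
  then have 1: "star (sc a) * sc a = (1 :: fam)" "nrm (sc a)" by (simp_all add: nrm_def star_sc mult.commute flip: sc_mult)
  then have "sp (sc a) \<subseteq> sphere 0 1" by (intro sp_unitary)
  then show ?thesis unfolding calc_def using 1 by (intro exI[of _ "sc a"]) (simp add: fc_sc qc_sc fun_eq_iff)
qed

lift_definition glue :: "(idx \<Rightarrow> bool) \<Rightarrow> fam \<Rightarrow> fam \<Rightarrow> fam" is "\<lambda>b x y i. if b i then x i else y i" by auto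

lemma fam_eqD: "x = y \<Longrightarrow> fib x i = fib y i" by simp

text \<open>\<open>star V * Y\<close> is within 1/2 of the identity in this fibre, so a vector in
  the kernel of \<open>Y\<close> is at most half as long as itself.\<close>

lemma isometry_kernel:
  assumes V: "star V * V = (1 :: fam)" and b: "fn (Y - V) i \<le> 1/2"
    and v: "v \<in> carrier_vec (dm i)" "fib Y i *\<^sub>v v = 0\<^sub>v (dm i)"
  shows "v = 0\<^sub>v (dm i)"
proof -
  let ?n = "dm i"
  define X where "X = 1 - star V * Y"
  have X: "X = star V * (V - Y)" using V by (simp add: X_def right_diff_distrib)
  have "fn X i \<le> fn V i * fn (V - Y) i" unfolding X using fn_mult[of "star V" "V - Y" i] by simp
  also have "\<dots> \<le> 1 * (1/2)" using fn_unitary[OF V, of i] b fn_diff_comm[of V Y i] by simp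
  finally have Xn: "fn X i \<le> 1/2" by simp
  have "fib 1 i = fib (star V * Y + X) i" by (simp add: X_def)
  then have "1\<^sub>m ?n = fib (star V) i * fib Y i + fib X i" by (simp add: fibs)
  then have "v = (fib (star V) i * fib Y i + fib X i) *\<^sub>v v" using v(1) by (metis one_mult_mat_vec)
  also have "\<dots> = (fib (star V) i * fib Y i) *\<^sub>v v + fib X i *\<^sub>v v"
    by (rule add_mult_distrib_mat_vec[of _ ?n ?n]) (use v in \<open>simp_all add: mult_carrier_mat[of _ ?n ?n _ ?n]\<close>)
  also have "(fib (star V) i * fib Y i) *\<^sub>v v = fib (star V) i *\<^sub>v (fib Y i *\<^sub>v v)"
    by (rule assoc_mult_mat_vec[of _ ?n ?n _ ?n]) (use v in simp_all)
  also have "\<dots> = 0\<^sub>v ?n" unfolding v(2) by (rule eq_vecI) (simp_all add: scalar_prod_def)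
  also have "0\<^sub>v ?n + fib X i *\<^sub>v v = fib X i *\<^sub>v v"
    by (rule left_zero_vec) (use mult_mat_vec_carrier[of "fib X i" ?n ?n v] v(1) in simp)
  finally have "l2_norm_vec v = l2_norm_vec (fib X i *\<^sub>v v)" by simp
  also have "\<dots> \<le> op_norm (fib X i) * l2_norm_vec v" by (rule op_norm_ge) (use v in simp)
  also have "\<dots> \<le> 1/2 * l2_norm_vec v" using Xn by (intro mult_right_mono) (simp_all add: fn_def)
  finally have "l2_norm_vec v = 0" using l2_nonneg[of v] by linarith
  then show ?thesis using v(1) l2_zero_iff[of v] by auto
qed

text \<open>The polar part of \<open>T\<close> inherits the commutation with \<open>U\<close>,
  because the modulus does and is invertible. The estimate: \<open>star y * y\<close> deviates from
  1 by at most \<open>3 * e\<close>, its square root by no more, and \<open>T\<close> from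
  \<open>V\<close> by \<open>e\<close>.\<close>

lemma unitary_near:
  assumes V: "star V * V = 1" "V * star V = 1" "sg V = (V :: fam)" and T: "bd T" "sg T = T"
    and U: "star U * U = 1" "U * star U = 1" "U * T = T * U"
    and e: "norm (qc T - qc V) \<le> e" "e \<le> 1/4"
  shows "\<exists>W. star W * W = 1 \<and> W * star W = 1 \<and> sg W = W \<and> U * W = W * U \<and> norm (qc W - qc V) \<le> 4 * e"
proof -
  have bV: "bd V" using V(1) by (rule bd_unitary)
  define b where "b i \<longleftrightarrow> fn (T - V) i \<le> 1/2" for i
  have "fnl (T - V) < 1/2" using e norm_qc[of "T - V"] bV T(1) by (simp add: qc_diff bd_diff)
  then have evb: "eventually b cofinite" using fnl_less[of "T - V" "1/2"] bV T(1) unfolding b_def by auto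
  \<comment> \<open>At the finitely many indices where \<open>T\<close> is far from \<open>V\<close>
    the identity is substituted: it is injective, fixed by \<open>sg\<close> and commutes with
    \<open>U\<close>, and the class stays the same.\<close>
  define Y where "Y = glue b T 1"
  have fY: "fib Y i = (if b i then fib T i else 1\<^sub>m (dm i))" for i by (simp add: Y_def glue.rep_eq fibs)
  have sgY: "sg Y = Y"
  proof (rule fam_eqI)
    fix i show "fib (sg Y) i = fib Y i"
      using fam_eqD[OF T(2), of i] by (simp add: fibs fY right_mult_one_mat[of _ "dm i" "dm i"] Jm_unitary)
  qed
  have UY: "U * Y = Y * U"
  proof (rule fam_eqI)
    fix i show "fib (U * Y) i = fib (Y * U) i"
      using fam_eqD[OF U(3), of i] by (simp add: fibs fY left_mult_one_mat[of _ "dm i" "dm i"] right_mult_one_mat[of _ "dm i" "dm i"])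
  qed
  obtain B where B: "\<And>i. fn T i \<le> B" using T(1) by (auto simp: bd_def)
  have bY: "bd Y" unfolding bd_def
  proof (intro exI allI)
    fix i show "fn Y i \<le> max B 1" using B[of i] op_norm_one_le[of "dm i"] by (simp add: fn_def fY le_max_iff_disj)
  qed
  have nlY: "nl (Y - T)" unfolding nl_def
  proof (intro allI impI)
    fix \<epsilon> :: real assume "\<epsilon> > 0"
    show "\<forall>\<^sub>F i in cofinite. fn (Y - T) i \<le> \<epsilon>"
      using evb
    proof eventually_elim
      case (elim i)
      then have "fib (Y - T) i = fib 0 i" by (simp add: fibs fY minus_r_inv_mat[of _ "dm i" "dm i"])
      then have "fn (Y - T) i = fn 0 i" by (simp add: fn_def)
      then show ?case using \<open>\<epsilon> > 0\<close> by simp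
    qed
  qed
  have qY: "qc Y = qc T" using qc_eq_iff[OF bY T(1)] nlY by simp
  have inj: "v = 0\<^sub>v (dm i)" if v: "v \<in> carrier_vec (dm i)" "fib Y i *\<^sub>v v = 0\<^sub>v (dm i)" for i v
  proof (cases "b i")
    case True
    then show ?thesis using isometry_kernel[OF V(1), of T i v] v by (simp add: fY b_def)
  qed (use v in \<open>simp add: fY\<close>)
  let ?G = "star Y * Y"
  obtain W where W: "star W * W = 1" "W * star W = 1" "Y = W * fc ?G rt" "sg W = W"
    using polar_fam[of Y] inj sgY by blast
  have nG: "nrm ?G" by (simp add: nrm_def star_mult)
  have spG: "sp ?G \<subseteq> NN - {0}" by (rule sp_injective_psd[OF inj])
  have UW: "U * W = W * U"
  proof -
    have "star Y * star U = star U * star Y" using arg_cong[OF UY, of star] unfolding star_mult .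
    then have "U * (star Y * star U) * U = U * (star U * star Y) * U" by simp
    then have sY: "U * star Y = star Y * U" using U(1) absorb[OF U(2)] by (simp add: mult.assoc)
    have "U * ?G = ?G * U" using UY sY by (metis mult.assoc)
    then have UP: "U * fc ?G rt = fc ?G rt * U" by (rule fc_intertwine[OF nG nG])
    define Q where "Q = fc ?G (\<lambda>z. 1 / rt z)"
    have "fc ?G rt * Q = fc ?G (\<lambda>z. rt z * (1 / rt z))" unfolding Q_def by (rule fc_mult[OF nG, symmetric])
    also have "\<dots> = fc ?G (\<lambda>z. 1)"
    proof (rule fc_cong)
      fix z assume "z \<in> sp ?G"
      then have "z \<in> NN - {0}" using spG by blast
      then have "Re z > 0" by (auto simp: NN_def complex_eq_iff less_le)
      then show "rt z * (1 / rt z) = 1" by (simp add: rt_def)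
    qed
    also have "\<dots> = 1" using fc_const[OF nG, of 1] by simp
    finally have PQ: "fc ?G rt * Q = 1" .
    have "U * W * fc ?G rt = W * U * fc ?G rt"
      using UY UP W(3) by (metis mult.assoc)
    then have "U * W * (fc ?G rt * Q) = W * U * (fc ?G rt * Q)" by (metis mult.assoc)
    then show ?thesis unfolding PQ by simp
  qed
  have bW: "bd W" using W(1) by (rule bd_unitary)
  have bG: "bd ?G" using bY by auto
  define y where "y = qc Y"
  define w where "w = qc W"
  define p where "p = qc (fc ?G rt)"
  define v where "v = qc V"
  have vv: "star v * v = 1" using V(1) bV by (simp add: v_def qc_star qc_mult bd_star qc_one)
  have uv: "isunit v" using V bV by (simp add: v_def isunit_def qc_star qc_mult bd_star qc_one)
  have uw: "isunit w" using W bW by (simp add: w_def isunit_def qc_star qc_mult bd_star qc_one)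
  have cG: "calc NN (star y * y) (\<lambda>f. qc (fc ?G f))"
    unfolding calc_def using bG nG spG bY by (intro exI[of _ ?G]) (auto simp: y_def qc_star qc_mult bd_star)
  have lrt: "lb NN rt" by (rule lb_cont[OF rt_continuous])
  have ywp: "y = w * p"
    unfolding y_def w_def p_def by (subst W(3)) (rule qc_mult[symmetric, OF bW bd_fc[OF bG nG sp_psd lrt]])
  have yv: "norm (y - v) \<le> e" using e(1) by (simp add: y_def v_def qY)
  have e0: "0 \<le> e" using yv norm_ge_zero[of "y - v"] by linarith
  have ny: "norm y \<le> 1 + e" using norm_triangle_ineq[of "y - v" v] yv isunit_norm[OF uv] by simp
  have yy: "norm (star y * y - 1) \<le> 3 * e"
  proof -
    have "star y * y - 1 = star y * (y - v) + star (y - v) * v" by (simp add: star_diff left_diff_distrib right_diff_distrib vv)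
    then have "norm (star y * y - 1) \<le> norm (star y * (y - v)) + norm (star (y - v) * v)" by (simp add: norm_triangle_ineq)
    also have "\<dots> \<le> (1 + e) * e + e * 1"
      using ny yv isunit_norm[OF uv] by (intro add_mono norm_mult_le) simp_all
    also have "\<dots> = (2 + e) * e" by (simp add: algebra_simps)
    also have "\<dots> \<le> 3 * e" using e0 e(2) by (intro mult_right_mono) auto
    finally show ?thesis .
  qed
  have p1: "norm (p - 1) \<le> 1 * (3 * e)"
  proof -
    \<comment> \<open>From \<open>sqrt x - 1 = (x - 1) / (1 + sqrt x)\<close>: the quotient is at
      most 1, so passing to the square root does not enlarge the deviation.\<close>
    define k where "k z = complex_of_real (1 / (1 + sqrt (max 0 (Re z))))" for z
    have kc: "continuous_on A k" for A unfolding k_def by (intro continuous_intros) (auto simp: add_nonneg_eq_0_iff)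
    have "p - 1 = qc (fc ?G (\<lambda>z. rt z - 1))" using calc_diff[OF cG lrt lb_const, of 1] by (simp add: calc_one[OF cG] p_def)
    also have "\<dots> = qc (fc ?G (\<lambda>z. k z * (z - 1)))"
    proof (rule calc_cong[OF cG])
      fix z assume z: "z \<in> NN"
      then have zr: "z = complex_of_real (Re z)" "0 \<le> Re z" by (simp_all add: NN_def complex_eq_iff)
      define x where "x = sqrt (Re z)"
      have x: "0 \<le> x" "x * x = Re z" using zr(2) by (simp_all add: x_def)
      have "x - 1 = 1 / (1 + x) * (x * x - 1)"
      proof -
        have "x * x - 1 = (1 + x) * (x - 1)" by (simp add: algebra_simps)
        then show ?thesis using x(1) by simp
      qed
      then have "complex_of_real (x - 1) = complex_of_real (1 / (1 + x)) * (complex_of_real (x * x) - 1)"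
        by (metis of_real_1 of_real_diff of_real_mult)
      then show "rt z - 1 = k z * (z - 1)"
        using zr x by (simp add: rt_def k_def x_def)
    qed
    also have "\<dots> = qc (fc ?G k) * (star y * y - 1)"
      using calc_mult[OF cG lb_cont[OF kc] lb_diff[OF lb_id lb_const], of 1] calc_diff[OF cG lb_id lb_const, of 1]
      by (simp add: calc_id[OF cG] calc_one[OF cG])
    finally have eq: "p - 1 = qc (fc ?G k) * (star y * y - 1)" .
    have "norm (qc (fc ?G k)) \<le> 1"
    proof (rule calc_norm[OF cG])
      fix z show "cmod (k z) \<le> 1"
        unfolding k_def norm_of_real using divide_le_eq_1[of 1 "1 + sqrt (max 0 (Re z))"] by (simp add: add_pos_nonneg)
    qed simp
    then show ?thesis unfolding eq by (rule norm_mult_le[OF _ yy])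
  qed
  have "w - v = - (w * (p - 1)) + (y - v)" by (simp add: ywp right_diff_distrib)
  then have "norm (w - v) \<le> norm (w * (p - 1)) + norm (y - v)" by (metis norm_minus_cancel norm_triangle_ineq)
  also have "\<dots> \<le> 3 * e + e" using p1 yv by (simp add: norm_unit_mult[OF uw])
  finally have "norm (w - v) \<le> 4 * e" by simp
  then show ?thesis using W UW unfolding w_def v_def by blast
qed

text \<open>The approximant \<open>u'\<close> has finite spectrum, so rounding the eigenvalues of a
  unitary lift to the values \<open>val j\<close> changes it only by a null family and produces
  exact spectral projections \<open>E j\<close>. Pinching \<open>V\<close> by them gives
  \<open>T\<close>, which commutes with \<open>U'\<close> and is near \<open>V\<close>.\<close>

lemma commuting_lift:
  fixes U V :: fam
  assumes U: "star U * U = 1" "U * star U = 1" "sg U = U" and V: "star V * V = 1" "V * star V = 1" "sg V = V"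
    and UV: "nl (U * V - V * U)" and e: "0 < \<epsilon>"
  shows "\<exists>U' V'. star U' * U' = 1 \<and> U' * star U' = 1 \<and> sg U' = U' \<and> star V' * V' = 1 \<and> V' * star V' = 1 \<and> sg V' = V' \<and>
    U' * V' = V' * U' \<and> norm (qc U' - qc U) \<le> \<epsilon> \<and> norm (qc V' - qc V) \<le> \<epsilon>"
proof -
  have bU: "bd U" and bV: "bd V" using U(1) V(1) by (auto intro: bd_unitary)
  define u where "u = qc U"
  define v where "v = qc V"
  have u: "isunit u" "sg u = u" using U bU by (simp_all add: u_def isunit_def qc_star qc_mult bd_star qc_one qc_sg)
  have v: "isunit v" "sg v = v" using V bV by (simp_all add: v_def isunit_def qc_star qc_mult bd_star qc_one qc_sg)
  have uv: "u * v = v * u" using qc_eq_iff[of "U * V" "V * U"] UV bU bV by (simp add: u_def v_def qc_mult bd_mult)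
  define e1 where "e1 = min (\<epsilon> / 4) (1/4)"
  have e1: "0 < e1" "e1 \<le> 1/4" "4 * e1 \<le> \<epsilon>" "e1 \<le> \<epsilon>" using e by (auto simp: e1_def)
  obtain I :: "(nat \<times> bool) set" and bar val r where If: "finite I" and barI: "\<forall>j\<in>I. bar j \<in> I \<and> bar (bar j) = j" and vinj: "inj_on val I"
    and one: "\<exists>j\<in>I. val j = 1" and vn: "\<forall>j\<in>I. cmod (val j) = 1 \<and> val (bar j) = cnj (val j)"
    and rp: "\<forall>j\<in>I. isproj (r j) \<and> sg (r j) = r (bar j)" and ro: "\<forall>i\<in>I. \<forall>j\<in>I. i \<noteq> j \<longrightarrow> r i * r j = 0"
    and rs: "sum r I = 1" and near: "norm ((\<Sum>j\<in>I. sc (val j) * r j) - u) \<le> e1" and rv: "(\<Sum>j\<in>I. norm (r j * v - v * r j)) \<le> e1"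
    using finite_spectrum[OF u v uv e1(1)] by (elim exE conjE) (rule that)
  have rr: "r i * r j = (if i = j then r j else 0)" if "i \<in> I" "j \<in> I" for i j using rp ro that by (auto simp: isproj_def)
  have rst: "star (r j) = r j" if "j \<in> I" for j using rp that by (simp add: isproj_def)
  have bb: "bij_betw bar I I" by (rule bij_betwI[of _ _ _ bar]) (use barI in auto)
  define u' where "u' = (\<Sum>j\<in>I. sc (val j) * r j)"
  have ur: "u' * r j = sc (val j) * r j" "r j * u' = sc (val j) * r j" "star u' * r j = sc (cnj (val j)) * r j" "r j * star u' = sc (cnj (val j)) * r j"
    if j: "j \<in> I" for j
  proof -
    have "u' * r j = (\<Sum>i\<in>I. if i = j then sc (val i) * r j else 0)" unfolding u'_def sum_distrib_right
      by (rule sum.cong) (auto simp: mult.assoc rr j)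
    then show 1: "u' * r j = sc (val j) * r j" using If j by simp
    have "r j * u' = (\<Sum>i\<in>I. if i = j then sc (val i) * r j else 0)" unfolding u'_def sum_distrib_left
    proof (rule sum.cong)
      fix i assume i: "i \<in> I"
      have "r j * (sc (val i) * r i) = sc (val i) * (r j * r i)" using sc_comm[of "r j" "val i"] by (metis mult.assoc)
      then show "r j * (sc (val i) * r i) = (if i = j then sc (val i) * r j else 0)" using rr[OF j i] by auto
    qed simp
    then show 2: "r j * u' = sc (val j) * r j" using If j by simp
    show "star u' * r j = sc (cnj (val j)) * r j"
      using arg_cong[OF 2, of star] unfolding star_mult rst[OF j] star_sc sc_comm .
    show "r j * star u' = sc (cnj (val j)) * r j"
      using arg_cong[OF 1, of star] unfolding star_mult rst[OF j] star_sc sc_comm .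
  qed
  have uu': "star u' * u' = 1"
  proof -
    have "star u' * u' = (\<Sum>j\<in>I. star u' * (u' * r j))" using rs by (metis mult.assoc mult_1_right sum_distrib_left)
    also have "\<dots> = sum r I"
    proof (rule sum.cong[OF refl])
      fix j assume j: "j \<in> I"
      have "star u' * (u' * r j) = sc (val j) * (star u' * r j)" unfolding ur(1)[OF j] using sc_comm[of "star u'" "val j"] by (metis mult.assoc)
      also have "\<dots> = sc (val j * cnj (val j)) * r j" unfolding ur(3)[OF j] by (simp add: sc_mult mult.assoc)
      also have "val j * cnj (val j) = 1" using vn j by (simp add: complex_norm_square[symmetric])
      finally show "star u' * (u' * r j) = r j" by simp
    qed
    finally show ?thesis using rs by simp
  qed
  have sgu': "sg u' = u'"
  proof -
    have "sg u' = (\<Sum>j\<in>I. sc (val (bar j)) * r (bar j))" unfolding u'_def sg_sum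
      by (rule sum.cong) (use rp vn in \<open>simp_all add: sg_mult sg_sc\<close>)
    also have "\<dots> = u'" unfolding u'_def by (rule sum.reindex_bij_betw[OF bb])
    finally show ?thesis .
  qed
  obtain W where W: "star W * W = 1" "W * star W = 1" "u' = qc W" "sg W = W" using unitary_lift[OF uu'] sgu' by blast
  have bW: "bd W" using W(1) by (rule bd_unitary)
  have nW: "nrm W" using W by (simp add: nrm_def)
  have spW: "sp W \<subseteq> sphere 0 1" by (rule sp_unitary[OF W(1) nW])
  define \<Phi> where "\<Phi> f = qc (fc W f)" for f
  have c: "calc (sphere 0 1) u' \<Phi>" unfolding calc_def using bW nW spW W(3) by (intro exI[of _ W]) (auto simp: \<Phi>_def fun_eq_iff)
  \<comment> \<open>The least distance between different values; the extra 1 keeps the set nonempty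
    when there is only one value.\<close>
  define \<rho> where "\<rho> = Min (insert 1 ((\<lambda>(i, j). cmod (val i - val j)) ` {(i, j). i \<in> I \<and> j \<in> I \<and> i \<noteq> j}))"
  have fD: "finite {(i, j). i \<in> I \<and> j \<in> I \<and> i \<noteq> j}" by (rule finite_subset[of _ "I \<times> I"]) (use If in auto)
  have rho: "0 < \<rho>"
    unfolding \<rho>_def using fD vinj by (subst Min_gr_iff) (auto simp: inj_on_def)
  have sep: "\<rho> \<le> cmod (val i - val j)" if "i \<in> I" "j \<in> I" "i \<noteq> j" for i j
    unfolding \<rho>_def using fD that by (intro Min_le) auto
  obtain j1 where j1: "j1 \<in> I" "val j1 = 1" using one by blast
  have bar1: "bar j1 = j1"
  proof -
    have "val (bar j1) = val j1" using vn j1 by simp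
    then show ?thesis using vinj barI j1 by (auto simp: inj_on_def)
  qed
  define nearv where "nearv z i \<longleftrightarrow> i \<in> I \<and> cmod (z - val i) < \<rho> / 2" for z i
  \<comment> \<open>Eigenvalues near no value are sent to \<open>j1\<close>, whose value 1 is real,
    so that the rounding stays compatible with conjugation and \<open>U'\<close> remains fixed by
    \<open>sg\<close>.\<close>
  define sel where "sel z = (if \<exists>i. nearv z i then SOME i. nearv z i else j1)" for z
  have uniq: "i = j" if "nearv z i" "nearv z j" for z i j
  proof (rule ccontr)
    assume "i \<noteq> j"
    then have "\<rho> \<le> cmod (val i - val j)" using that by (intro sep) (auto simp: nearv_def)
    also have "\<dots> \<le> cmod (z - val j) + cmod (z - val i)" using norm_triangle_ineq4[of "z - val j" "z - val i"] by simp
    finally show False using that by (simp add: nearv_def)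
  qed
  have sel: "sel z = i" if "nearv z i" for z i
  proof -
    have 1: "nearv z (SOME i. nearv z i)" using that by (rule someI)
    have ex: "\<exists>i. nearv z i" using that by (rule exI)
    show ?thesis unfolding sel_def if_P[OF ex] by (rule uniq[OF 1 that])
  qed
  have selI: "sel z \<in> I" for z
  proof (cases "\<exists>i. nearv z i")
    case True
    then obtain i where "nearv z i" by blast
    then show ?thesis using sel by (auto simp: nearv_def)
  qed (simp add: sel_def j1)
  have nbar: "nearv (cnj z) (bar i)" if "nearv z i" for z i
  proof -
    have "cmod (cnj (z - val i)) < \<rho> / 2" using that unfolding complex_mod_cnj by (simp add: nearv_def)
    then show ?thesis using that vn barI by (simp add: nearv_def)
  qed
  have selbar: "sel (cnj z) = bar (sel z)" for z
  proof (cases "\<exists>i. nearv z i")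
    case True
    then obtain i where i: "nearv z i" by blast
    then show ?thesis using sel[OF i] sel[OF nbar[OF i]] by simp
  next
    case False
    then have "\<not> (\<exists>i. nearv (cnj z) i)" using nbar[of "cnj z"] by (metis complex_cnj_cnj)
    then show ?thesis using False by (simp add: sel_def bar1)
  qed
  define g where "g j z = complex_of_real (clip 0 1 (1 - 2 * cmod (z - val j) / \<rho>))" for j z
  have gc: "continuous_on A (g j)" for A j unfolding g_def using rho by (intro continuous_intros) auto
  have g0: "nearv z j" if "g j z \<noteq> 0" "j \<in> I" for j z
  proof (rule ccontr)
    assume "\<not> nearv z j"
    then have "\<rho> / 2 \<le> cmod (z - val j)" using that by (simp add: nearv_def)
    then have "1 - 2 * cmod (z - val j) / \<rho> \<le> 0" using rho by (simp add: field_simps)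
    then show False using that by (simp add: g_def clip_def)
  qed
  have gv: "g j (val i) = (if i = j then 1 else 0)" if "i \<in> I" "j \<in> I" for i j
  proof (cases "i = j")
    case True then show ?thesis by (simp add: g_def clip_def)
  next
    case False
    have "nearv (val i) i" using that rho by (simp add: nearv_def)
    then show ?thesis using g0[of j "val i"] uniq[of "val i" i j] that False by auto
  qed
  \<comment> \<open>\<open>r i\<close> intertwines \<open>u'\<close> with the scalar
    \<open>val i\<close>, so a continuous function of \<open>u'\<close> is evaluated at
    \<open>val i\<close> on it.\<close>
  have Pg: "\<Phi> (g j) = r j" if j: "j \<in> I" for j
  proof -
    have "r i * \<Phi> (g j) = (if i = j then r j else 0)" if i: "i \<in> I" for i
    proof -
      have "r i * \<Phi> (g j) = sc (g j (val i)) * r i"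
        by (rule calc_intertwine[OF c calc_scalar closed_sphere gc]) (use vn i ur in \<open>simp_all add: star_sc\<close>)
      then show ?thesis using gv[OF i j] by auto
    qed
    then have "sum r I * \<Phi> (g j) = (\<Sum>i\<in>I. if i = j then r j else 0)" unfolding sum_distrib_right by (intro sum.cong) auto
    then show ?thesis using If j rs by simp
  qed
  \<comment> \<open>\<open>X\<close> is discontinuous, so the comparison of calculi does not apply
    to it directly; but it is constant on the support of each continuous \<open>g i\<close>, and
    these represent the \<open>r i\<close>, whose sum is 1.\<close>
  have PX: "\<Phi> X = (\<Sum>i\<in>I. sc (a i) * r i)" if lX: "lb (sphere 0 1) X" and X: "\<And>z. X z = a (sel z)" for X a
  proof -
    have "\<Phi> X * r i = sc (a i) * r i" if i: "i \<in> I" for i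
    proof -
      have "(\<lambda>z. X z * g i z) = (\<lambda>z. a i * g i z)"
      proof
        fix z show "X z * g i z = a i * g i z" using g0[of i z] i sel[of z i] X[of z] by (cases "g i z = 0") auto
      qed
      then have "\<Phi> X * \<Phi> (g i) = sc (a i) * \<Phi> (g i)"
        using calc_mult[OF c lX lb_cont[OF gc]] calc_scale[OF c lb_cont[OF gc], of "a i" i] by metis
      then show ?thesis unfolding Pg[OF i] .
    qed
    then have "\<Phi> X * sum r I = (\<Sum>i\<in>I. sc (a i) * r i)" unfolding sum_distrib_left by (intro sum.cong) auto
    then show ?thesis using rs by simp
  qed
  define \<chi> where "\<chi> j z = (if sel z = j then 1 else 0 :: complex)" for j z
  define R where "R z = val (sel z)" for z
  have lchi: "lb (sphere 0 1) (\<chi> j)" for j by (rule lb_bounded[of _ _ 1]) (simp add: \<chi>_def)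
  have lR: "lb (sphere 0 1) R" by (rule lb_bounded[of _ _ 1]) (use vn selI in \<open>simp add: R_def\<close>)
  define E where "E j = fc W (\<chi> j)" for j
  define U' where "U' = fc W R"
  have bE: "bd (E j)" for j unfolding E_def by (rule bd_fc[OF bW nW spW lchi])
  have qE: "qc (E j) = r j" if j: "j \<in> I" for j
  proof -
    have "qc (E j) = (\<Sum>i\<in>I. sc (if i = j then 1 else 0) * r i)"
      unfolding E_def \<Phi>_def[symmetric] by (rule PX[OF lchi]) (simp add: \<chi>_def)
    also have "\<dots> = (\<Sum>i\<in>I. if i = j then r j else 0)" by (rule sum.cong) auto
    finally show ?thesis using If j by simp
  qed
  have qU': "qc U' = u'"
    unfolding U'_def u'_def \<Phi>_def[symmetric] by (rule PX[OF lR]) (simp add: R_def)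
  have RR: "cnj (R z) * R z = 1" for z
    using vn selI[of z] by (simp add: R_def complex_norm_square[symmetric] mult.commute)
  have U'1: "star U' * U' = 1"
    unfolding U'_def star_fc fc_mult[OF nW, symmetric] RR using fc_const[OF nW, of 1] by simp
  then have U'2: "U' * star U' = 1" by (rule fam_square_inverse)
  have sgU': "sg U' = U'"
  proof -
    have "sg U' = fc W (\<lambda>z. cnj (R (cnj z)))" unfolding U'_def sg_fc[OF nW] W(4) ..
    also have "(\<lambda>z. cnj (R (cnj z))) = R" using vn selI by (simp add: R_def selbar fun_eq_iff)
    finally show ?thesis by (simp add: U'_def)
  qed
  have sgE: "sg (E j) = E (bar j)" if j: "j \<in> I" for j
  proof -
    have "sg (E j) = fc W (\<lambda>z. cnj (\<chi> j (cnj z)))" unfolding E_def sg_fc[OF nW] W(4) ..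
    also have "(\<lambda>z. cnj (\<chi> j (cnj z))) = \<chi> (bar j)"
    proof
      fix z
      have "bar (sel z) = j \<longleftrightarrow> sel z = bar j" using barI selI[of z] j by auto
      then show "cnj (\<chi> j (cnj z)) = \<chi> (bar j) z" by (simp add: \<chi>_def selbar)
    qed
    finally show ?thesis by (simp add: E_def)
  qed
  have UE: "U' * E j = sc (val j) * E j" "E j * U' = sc (val j) * E j" for j
  proof -
    have 1: "(\<lambda>z. R z * \<chi> j z) = (\<lambda>z. val j * \<chi> j z)" "(\<lambda>z. \<chi> j z * R z) = (\<lambda>z. val j * \<chi> j z)"
      by (auto simp: R_def \<chi>_def fun_eq_iff)
    have 2: "fc W (\<lambda>z. val j * \<chi> j z) = sc (val j) * E j"
      using fc_mult[OF nW, of "\<lambda>z. val j" "\<chi> j"] by (simp add: fc_const[OF nW] E_def)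
    show "U' * E j = sc (val j) * E j" "E j * U' = sc (val j) * E j"
      unfolding U'_def E_def fc_mult[OF nW, symmetric] 1 by (simp_all add: 2 E_def)
  qed
  define T where "T = (\<Sum>j\<in>I. E j * V * E j)"
  have bsum: "bd (sum F J)" if "finite J" "\<And>j. j \<in> J \<Longrightarrow> bd (F j)" for F :: "nat \<times> bool \<Rightarrow> fam" and J
    using that by (induction J rule: finite_induct) auto
  have bT: "bd T" unfolding T_def by (intro bsum If bd_mult bE bV)
  have sgT: "sg T = T"
  proof -
    have "sg T = (\<Sum>j\<in>I. E (bar j) * V * E (bar j))" unfolding T_def sg_sum
      by (rule sum.cong) (simp_all add: sg_mult sgE V(3))
    also have "\<dots> = T" unfolding T_def by (rule sum.reindex_bij_betw[OF bb])
    finally show ?thesis .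
  qed
  have UT: "U' * T = T * U'" unfolding T_def sum_distrib_left sum_distrib_right
  proof (rule sum.cong[OF refl])
    fix j
    have "U' * (E j * V * E j) = sc (val j) * E j * V * E j" using UE(1)[of j] by (metis mult.assoc)
    also have "\<dots> = E j * V * (sc (val j) * E j)" using sc_comm[of "E j * V" "val j"] by (metis mult.assoc)
    also have "\<dots> = E j * V * E j * U'" using UE(2)[of j] by (metis mult.assoc)
    finally show "U' * (E j * V * E j) = E j * V * E j * U'" .
  qed
  have qsum: "qc (sum F J) = (\<Sum>j\<in>J. qc (F j))" if "finite J" "\<And>j. j \<in> J \<Longrightarrow> bd (F j)" for F :: "nat \<times> bool \<Rightarrow> fam" and J
    using that
  proof (induction J rule: finite_induct)
    case (insert j J)
    then show ?case using qc_add[of "F j" "sum F J"] bsum[of J F] by simp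
  qed (simp add: qc_zero)
  have qT: "norm (qc T - qc V) \<le> e1"
  proof -
    have 1: "qc T = (\<Sum>j\<in>I. r j * v * r j)" unfolding T_def
      by (subst qsum) (auto simp: If bE bV bd_mult qE v_def qc_mult[symmetric] intro!: sum.cong)
    have 2: "v = (\<Sum>j\<in>I. v * r j)" using rs by (simp add: sum_distrib_left[symmetric])
    have "qc T - v = (\<Sum>j\<in>I. r j * v * r j) - (\<Sum>j\<in>I. v * r j)" by (rule arg_cong2[OF 1 2])
    also have "\<dots> = (\<Sum>j\<in>I. r j * v * r j - v * r j)" by (rule sum_subtractf[symmetric])
    also have "\<dots> = (\<Sum>j\<in>I. (r j * v - v * r j) * r j)"
      by (rule sum.cong) (simp_all add: left_diff_distrib mult.assoc rr)
    also have "norm \<dots> \<le> (\<Sum>j\<in>I. norm ((r j * v - v * r j) * r j))" by (rule norm_sum)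
    also have "\<dots> \<le> (\<Sum>j\<in>I. norm (r j * v - v * r j))"
    proof (rule sum_mono)
      fix j assume "j \<in> I"
      then have "norm (r j) \<le> 1" using rp by (intro isproj_norm) auto
      from norm_mult_le[OF order_refl this] show "norm ((r j * v - v * r j) * r j) \<le> norm (r j * v - v * r j)" by simp
    qed
    finally show ?thesis using rv by (simp add: v_def)
  qed
  obtain V' where V': "star V' * V' = 1" "V' * star V' = 1" "sg V' = V'" "U' * V' = V' * U'" "norm (qc V' - qc V) \<le> 4 * e1"
    using unitary_near[OF V bT sgT U'1 U'2 UT qT e1(2)] by blast
  have "norm (qc V' - qc V) \<le> \<epsilon>" using V'(5) e1(3) by linarith
  moreover have "norm (qc U' - qc U) \<le> \<epsilon>" using near e1(4) by (simp add: qU' u'_def u_def)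
  ultimately show ?thesis using U'1 U'2 sgU' V' by blast
qed

section \<open>Return from families to single matrices of both kinds\<close>

definition inv_unitary :: "bool \<Rightarrow> nat \<Rightarrow> complex mat \<Rightarrow> bool" where
  "inv_unitary b m X \<longleftrightarrow> X \<in> carrier_mat (dm (Idx b m 0)) (dm (Idx b m 0)) \<and>
     adj X * X = 1\<^sub>m (dm (Idx b m 0)) \<and> X * adj X = 1\<^sub>m (dm (Idx b m 0)) \<and>
     Jm (Idx b m 0) * cjm X * adj (Jm (Idx b m 0)) = X"

lemma idx_irrelevant: "dm (Idx b m k) = dm (Idx b m 0)" "Jm (Idx b m k) = Jm (Idx b m 0)"
  by (simp_all add: dm_def Jm_def)

lemma fam_unitary_iff:
  "star X * X = 1 \<and> X * star X = 1 \<and> sg X = X \<longleftrightarrow> (\<forall>b m k. inv_unitary b m (fib X (Idx b m k)))"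
proof -
  have "star X * X = 1 \<and> X * star X = 1 \<and> sg X = X \<longleftrightarrow>
     (\<forall>i. adj (fib X i) * fib X i = 1\<^sub>m (dm i) \<and> fib X i * adj (fib X i) = 1\<^sub>m (dm i) \<and> Jm i * cjm (fib X i) * adj (Jm i) = fib X i)"
    by (metis fam_eqI times_fam.rep_eq star_fam.rep_eq one_fam.rep_eq sg_fam.rep_eq)
  also have "\<dots> \<longleftrightarrow> (\<forall>b m k. inv_unitary b m (fib X (Idx b m k)))"
  proof -
    have "inv_unitary b m (fib X (Idx b m k)) \<longleftrightarrow> (let i = Idx b m k in adj (fib X i) * fib X i = 1\<^sub>m (dm i) \<and> fib X i * adj (fib X i) = 1\<^sub>m (dm i) \<and> Jm i * cjm (fib X i) * adj (Jm i) = fib X i)" for b m k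
      using fib_carrier[of X "Idx b m k"] by (simp add: inv_unitary_def Let_def idx_irrelevant[of b m k])
    then show ?thesis unfolding Let_def by (metis idx.exhaust)
  qed
  finally show ?thesis .
qed

lemma inv_unitary_one: "inv_unitary b m (1\<^sub>m (dm (Idx b m 0)))"
proof -
  have "\<forall>b m k. inv_unitary b m (fib 1 (Idx b m k))" unfolding fam_unitary_iff[symmetric] by simp
  then have "inv_unitary b m (fib 1 (Idx b m 0))" by blast
  then show ?thesis by (simp add: fibs)
qed

text \<open>The \<open>k\<close>-th matrix is stored at the \<open>k\<close>-th copy of its size, so
  a size occurring repeatedly causes no clash; the identity fills all other fibres, where
  commutators are then 0.\<close>

lift_definition sparse :: "bool \<Rightarrow> (nat \<Rightarrow> nat) \<Rightarrow> (nat \<Rightarrow> complex mat) \<Rightarrow> fam" is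
  "\<lambda>b nn UU i. case i of Idx b' m k \<Rightarrow> if b' = b \<and> m = nn k \<and> UU k \<in> carrier_mat (dm i) (dm i) then UU k else 1\<^sub>m (dm i)"
  by (auto split: idx.splits)

lemma sparse_unitary:
  assumes "\<And>k. inv_unitary b (nn k) (UU k)"
  shows "star (sparse b nn UU) * sparse b nn UU = 1" "sparse b nn UU * star (sparse b nn UU) = 1" "sg (sparse b nn UU) = sparse b nn UU"
    "fib (sparse b nn UU) (Idx b (nn k) k) = UU k"
proof -
  have "inv_unitary b' m (fib (sparse b nn UU) (Idx b' m k))" for b' m k
    using assms[of k] inv_unitary_one[of b' m] by (auto simp: sparse.rep_eq idx_irrelevant[of b' m k])
  then show "star (sparse b nn UU) * sparse b nn UU = 1" "sparse b nn UU * star (sparse b nn UU) = 1" "sg (sparse b nn UU) = sparse b nn UU"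
    using fam_unitary_iff by blast+
  show "fib (sparse b nn UU) (Idx b (nn k) k) = UU k"
    using assms[of k] by (simp add: sparse.rep_eq idx_irrelevant[of b _ k] inv_unitary_def)
qed

lemma uniform_commuting:
  assumes e: "0 < \<epsilon>"
  shows "\<exists>\<delta>>0. \<forall>m U V. inv_unitary b m U \<longrightarrow> inv_unitary b m V \<longrightarrow> op_norm (U * V - V * U) \<le> \<delta> \<longrightarrow>
    (\<exists>U' V'. inv_unitary b m U' \<and> inv_unitary b m V' \<and> op_norm (U - U') \<le> \<epsilon> \<and> op_norm (V - V') \<le> \<epsilon> \<and> U' * V' = V' * U')"
proof (rule ccontr)
  define good where "good m U V \<longleftrightarrow> (\<exists>U' V'. inv_unitary b m U' \<and> inv_unitary b m V' \<and> op_norm (U - U') \<le> \<epsilon> \<and> op_norm (V - V') \<le> \<epsilon> \<and> U' * V' = V' * U')" for m U V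
  assume "\<not> ?thesis"
  then have *: "\<exists>m U V. inv_unitary b m U \<and> inv_unitary b m V \<and> op_norm (U * V - V * U) \<le> \<delta> \<and> \<not> good m U V" if "\<delta> > 0" for \<delta>
    using that unfolding good_def by blast
  have "\<exists>m U V. inv_unitary b m U \<and> inv_unitary b m V \<and> op_norm (U * V - V * U) \<le> 1 / (real k + 1) \<and> \<not> good m U V" for k
    by (rule *) simp
  then obtain nn UU VV where nn: "\<And>k. inv_unitary b (nn k) (UU k)" "\<And>k. inv_unitary b (nn k) (VV k)"
    "\<And>k. op_norm (UU k * VV k - VV k * UU k) \<le> 1 / (real k + 1)" "\<And>k. \<not> good (nn k) (UU k) (VV k)" by metis
  let ?U = "sparse b nn UU" and ?V = "sparse b nn VV"
  note U = sparse_unitary[where nn = nn and UU = UU and b = b, OF nn(1)]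
  note V = sparse_unitary[where nn = nn and UU = VV and b = b, OF nn(2)]
  have nl: "nl (?U * ?V - ?V * ?U)" unfolding nl_def
  proof (intro allI impI)
    fix \<eta> :: real assume eta: "\<eta> > 0"
    obtain K :: nat where K: "1 / \<eta> < real K" using reals_Archimedean2 by blast
    have "fn (?U * ?V - ?V * ?U) i \<le> \<eta>" if i: "i \<notin> (\<lambda>k. Idx b (nn k) k) ` {..<K}" for i
    proof (cases "\<exists>k. i = Idx b (nn k) k")
      case True
      then obtain k where k: "i = Idx b (nn k) k" by blast
      then have kK: "K \<le> k" using i by (auto simp: not_less)
      then have "1 / \<eta> < real k + 1" using K by linarith
      then have "1 / (real k + 1) \<le> \<eta>" using eta by (simp add: field_simps)
      moreover have "fn (?U * ?V - ?V * ?U) i = op_norm (UU k * VV k - VV k * UU k)"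
        using U(4)[of k] V(4)[of k] by (simp add: fn_def fibs k)
      ultimately show ?thesis using nn(3)[of k] by linarith
    next
      case False
      obtain b' m k where ii: "i = Idx b' m k" by (cases i)
      have "fib ?U i = 1\<^sub>m (dm i)" "fib ?V i = 1\<^sub>m (dm i)" using False by (auto simp: sparse.rep_eq ii)
      then have "fib (?U * ?V - ?V * ?U) i = fib (1 * 1 - 1 * 1) i" by (simp only: fibs)
      then have "fn (?U * ?V - ?V * ?U) i = fn (1 * 1 - 1 * 1) i" by (simp only: fn_def)
      then show ?thesis using eta by simp
    qed
    then have "{i. \<not> fn (?U * ?V - ?V * ?U) i \<le> \<eta>} \<subseteq> (\<lambda>k. Idx b (nn k) k) ` {..<K}" by blast
    then have "finite {i. \<not> fn (?U * ?V - ?V * ?U) i \<le> \<eta>}" by (rule finite_subset) simp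
    then show "\<forall>\<^sub>F i in cofinite. fn (?U * ?V - ?V * ?U) i \<le> \<eta>" by (simp add: eventually_cofinite)
  qed
  \<comment> \<open>A bound on the limit superior gives bounds in the fibres only for strictly
    larger constants.\<close>
  have e2: "0 < \<epsilon> / 2" using e by simp
  obtain U' V' where U': "star U' * U' = 1" "U' * star U' = 1" "sg U' = U'" and V': "star V' * V' = 1" "V' * star V' = 1" "sg V' = V'"
    and c: "U' * V' = V' * U'" and n: "norm (qc U' - qc ?U) \<le> \<epsilon> / 2" "norm (qc V' - qc ?V) \<le> \<epsilon> / 2"
    using commuting_lift[OF U(1-3) V(1-3) nl e2] by blast
  have ev: "\<forall>\<^sub>F i in cofinite. fn (X - Y) i \<le> \<epsilon>"
    if "star X * X = 1" "star Y * Y = 1" "norm (qc X - qc Y) \<le> \<epsilon> / 2" for X Y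
    using that e norm_qc[of "X - Y"] bd_unitary[of X] bd_unitary[of Y] fnl_less[of "X - Y" \<epsilon>] by (simp add: qc_diff bd_diff)
  have "\<forall>\<^sub>F i in cofinite. fn (U' - ?U) i \<le> \<epsilon> \<and> fn (V' - ?V) i \<le> \<epsilon>"
    using ev[OF U'(1) U(1) n(1)] ev[OF V'(1) V(1) n(2)] by (rule eventually_conj)
  then have fin: "finite {i. \<not> (fn (U' - ?U) i \<le> \<epsilon> \<and> fn (V' - ?V) i \<le> \<epsilon>)}" by (simp only: eventually_cofinite)
  \<comment> \<open>The counterexamples occupy infinitely many indices, while the estimates fail at
    finitely many only; so one of them is not a counterexample.\<close>
  have "infinite (range (\<lambda>k. Idx b (nn k) k))" by (rule range_inj_infinite) (auto simp: inj_def)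
  then have "\<not> range (\<lambda>k. Idx b (nn k) k) \<subseteq> {i. \<not> (fn (U' - ?U) i \<le> \<epsilon> \<and> fn (V' - ?V) i \<le> \<epsilon>)}"
    using fin finite_subset by blast
  then obtain k where k: "fn (U' - ?U) (Idx b (nn k) k) \<le> \<epsilon>" "fn (V' - ?V) (Idx b (nn k) k) \<le> \<epsilon>" by blast
  let ?i = "Idx b (nn k) k"
  have "op_norm (UU k - fib U' ?i) \<le> \<epsilon>" "op_norm (VV k - fib V' ?i) \<le> \<epsilon>"
    using k fn_diff_comm[of U' ?U ?i] fn_diff_comm[of V' ?V ?i] by (simp_all add: fn_def fibs U(4) V(4))
  moreover have "inv_unitary b (nn k) (fib U' ?i)" "inv_unitary b (nn k) (fib V' ?i)"
    using fam_unitary_iff[of U'] fam_unitary_iff[of V'] U' V' by blast+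
  moreover have "fib U' ?i * fib V' ?i = fib V' ?i * fib U' ?i" using fam_eqD[OF c, of ?i] by (simp only: fibs)
  ultimately have "good (nn k) (UU k) (VV k)" unfolding good_def by blast
  then show False using nn(4) by blast
qed

lemma real_orthogonal_iff: "n \<ge> 1 \<Longrightarrow> real_orthogonal_mat n U \<longleftrightarrow> inv_unitary False (n - 1) U"
proof -
  assume n: "n \<ge> 1"
  have d: "dm (Idx False (n - 1) 0) = n" "Jm (Idx False (n - 1) 0) = 1\<^sub>m n" using n by (simp_all add: dm_def Jm_def)
  have "elements_mat U \<subseteq> \<real> \<longleftrightarrow> 1\<^sub>m n * cjm U * adj (1\<^sub>m n) = U" if U: "U \<in> carrier_mat n n"
  proof -
    have "1\<^sub>m n * cjm U * adj (1\<^sub>m n) = cjm U"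
      using U by (simp add: left_mult_one_mat[of _ n n] right_mult_one_mat[of _ n n])
    moreover have "cjm U = U \<longleftrightarrow> (\<forall>i<n. \<forall>j<n. cnj (U $$ (i, j)) = U $$ (i, j))"
      using U by (auto simp: cjm_def mat_eq_iff)
    moreover have "elements_mat U \<subseteq> \<real> \<longleftrightarrow> (\<forall>i<n. \<forall>j<n. U $$ (i, j) \<in> \<real>)"
      using U by (auto simp: elements_mat_def image_subset_iff UN_subset_iff)
    ultimately show ?thesis by (simp add: Reals_cnj_iff)
  qed
  then show ?thesis unfolding real_orthogonal_mat_def unitary_mat_def inv_unitary_def d mat_adjoint_eq_adj by blast
qed

text \<open>A block computation with \<open>Jm\<close> written in blocks \<open>0, 1, -1, 0\<close>.
  It exhibits the dual operation as transposition followed by conjugation with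
  \<open>Jm\<close>.\<close>

lemma dual_mat_eq:
  assumes n: "n \<ge> 1" and U: "U \<in> carrier_mat (2 * n) (2 * n)"
  shows "dual_mat n U = Jm (Idx True (n - 1) 0) * transpose_mat U * adj (Jm (Idx True (n - 1) 0))"
proof -
  obtain A B C D where s: "split_block U n n = (A, B, C, D)" by (metis prod_cases4)
  have abcd: "A \<in> carrier_mat n n" "B \<in> carrier_mat n n" "C \<in> carrier_mat n n" "D \<in> carrier_mat n n" "U = four_block_mat A B C D"
    using split_block[OF s, of n n] U by auto
  let ?J = "four_block_mat (0\<^sub>m n n) (1\<^sub>m n) ((- 1) \<cdot>\<^sub>m 1\<^sub>m n) (0\<^sub>m n n)"
  have J: "Jm (Idx True (n - 1) 0) = ?J"
    by (rule eq_matI) (use n in \<open>auto simp: Jm_def\<close>)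
  have J': "adj ?J = four_block_mat (0\<^sub>m n n) ((- 1) \<cdot>\<^sub>m 1\<^sub>m n) (1\<^sub>m n) (0\<^sub>m n n)"
    by (rule eq_matI) (auto simp: adj_def)
  have c: "(0\<^sub>m n n :: complex mat) \<in> carrier_mat n n" "(1\<^sub>m n :: complex mat) \<in> carrier_mat n n"
    "(- 1 :: complex) \<cdot>\<^sub>m 1\<^sub>m n \<in> carrier_mat n n" by auto
  have t: "transpose_mat A \<in> carrier_mat n n" "transpose_mat B \<in> carrier_mat n n" "transpose_mat C \<in> carrier_mat n n" "transpose_mat D \<in> carrier_mat n n"
    using abcd by auto
  have t': "(- 1 :: complex) \<cdot>\<^sub>m X \<in> carrier_mat n n" if "X \<in> carrier_mat n n" for X using that by auto
  have z: "X * 0\<^sub>m n n = 0\<^sub>m n n" "0\<^sub>m n n * X = 0\<^sub>m n n" "X * 1\<^sub>m n = X" "1\<^sub>m n * X = X" "X * ((- 1) \<cdot>\<^sub>m 1\<^sub>m n) = (- 1) \<cdot>\<^sub>m X"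
    "((- 1) \<cdot>\<^sub>m 1\<^sub>m n) * X = (- 1) \<cdot>\<^sub>m X" "X + 0\<^sub>m n n = X" "0\<^sub>m n n + X = X" "(- 1) \<cdot>\<^sub>m ((- 1) \<cdot>\<^sub>m X) = X" "(- 1) \<cdot>\<^sub>m X = - X"
    if "X \<in> carrier_mat n n" for X :: "complex mat"
    using that by (simp_all add: smult_one_mult mult_smult_one smult_smult_mat one_smult_mat) (auto intro!: eq_matI)
  have m: "?J * transpose_mat U = four_block_mat (transpose_mat B) (transpose_mat D) ((- 1) \<cdot>\<^sub>m transpose_mat A) ((- 1) \<cdot>\<^sub>m transpose_mat C)"
    unfolding abcd(5) transpose_four_block_mat[OF abcd(1-4)] mult_four_block_mat[OF c(1,2,3,1) t(1,3,2,4)]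
    by (simp only: z(1-9) t t' c)
  have f: "?J * transpose_mat U * adj ?J = four_block_mat (transpose_mat D) ((- 1) \<cdot>\<^sub>m transpose_mat B) ((- 1) \<cdot>\<^sub>m transpose_mat C) (transpose_mat A)"
    unfolding m J' mult_four_block_mat[OF t(2,4) t'[OF t(1)] t'[OF t(3)] c(1,3,2,1)]
    by (simp only: z(1-9) t t' c)
  show ?thesis unfolding J f unfolding dual_mat_def s z(10)[OF t(2)] z(10)[OF t(3)] by simp
qed

text \<open>The adjoint of \<open>Jm * transpose_mat U * adj Jm\<close> is
  \<open>Jm * cjm U * adj Jm\<close>, so taking adjoints turns the symplectic condition into
  invariance under \<open>sg\<close>.\<close>

lemma symplectic_unitary_iff: "n \<ge> 1 \<Longrightarrow> symplectic_unitary_mat n U \<longleftrightarrow> inv_unitary True (n - 1) U"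
proof -
  assume n: "n \<ge> 1"
  let ?i = "Idx True (n - 1) 0"
  have d: "dm ?i = 2 * n" using n by (simp add: dm_def)
  have "dual_mat n U = adj U \<longleftrightarrow> Jm ?i * cjm U * adj (Jm ?i) = U" if U: "U \<in> carrier_mat (2 * n) (2 * n)"
  proof -
    have J: "Jm ?i \<in> carrier_mat (2 * n) (2 * n)" using Jm_carrier[of ?i] unfolding d .
    have tU: "transpose_mat U \<in> carrier_mat (2 * n) (2 * n)" using U by simp
    have at: "adj (transpose_mat U) = cjm U" using U by (auto simp: adj_def cjm_def intro!: eq_matI)
    have "adj (Jm ?i * transpose_mat U * adj (Jm ?i)) = Jm ?i * (cjm U * adj (Jm ?i))"
      unfolding adj_mult[OF mult_carrier_mat[OF J tU] adj_carrier[OF J]] adj_mult[OF J tU] adj_adj at ..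
    also have "\<dots> = Jm ?i * cjm U * adj (Jm ?i)"
      by (rule assoc_mult_mat[symmetric, of _ "2 * n" "2 * n" _ "2 * n" _ "2 * n"]) (use J U in simp_all)
    finally have "adj (dual_mat n U) = Jm ?i * cjm U * adj (Jm ?i)" unfolding dual_mat_eq[OF n U] .
    then show ?thesis by (metis adj_adj)
  qed
  then show ?thesis unfolding symplectic_unitary_mat_def unitary_mat_def inv_unitary_def d mat_adjoint_eq_adj by blast
qed

theorem theorem1p1:
  shows "(\<forall>\<epsilon>::real. \<epsilon> > 0 \<longrightarrow> (\<exists>\<delta>::real. \<delta> > 0 \<and>
      (\<forall>n::nat. n \<ge> 1 \<longrightarrow>
        (\<forall>U V. real_orthogonal_mat n U \<longrightarrow> real_orthogonal_mat n V \<longrightarrow>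
          op_norm (U * V - V * U) \<le> \<delta> \<longrightarrow>
          (\<exists>U' V'. real_orthogonal_mat n U' \<and> real_orthogonal_mat n V' \<and>
            op_norm (U - U') \<le> \<epsilon> \<and> op_norm (V - V') \<le> \<epsilon> \<and> U' * V' = V' * U')))))
    \<and> (\<forall>\<epsilon>::real. \<epsilon> > 0 \<longrightarrow> (\<exists>\<delta>::real. \<delta> > 0 \<and>
      (\<forall>n::nat. n \<ge> 1 \<longrightarrow>
        (\<forall>U V. symplectic_unitary_mat n U \<longrightarrow> symplectic_unitary_mat n V \<longrightarrow>
          op_norm (U * V - V * U) \<le> \<delta> \<longrightarrow>
          (\<exists>U' V'. symplectic_unitary_mat n U' \<and> symplectic_unitary_mat n V' \<and>
            op_norm (U - U') \<le> \<epsilon> \<and> op_norm (V - V') \<le> \<epsilon> \<and> U' * V' = V' * U')))))"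
proof (intro conjI allI impI)
  fix \<epsilon> :: real assume "\<epsilon> > 0"
  from uniform_commuting[OF this, of False] obtain \<delta> where "\<delta> > 0"
    "\<forall>m U V. inv_unitary False m U \<longrightarrow> inv_unitary False m V \<longrightarrow> op_norm (U * V - V * U) \<le> \<delta> \<longrightarrow>
    (\<exists>U' V'. inv_unitary False m U' \<and> inv_unitary False m V' \<and> op_norm (U - U') \<le> \<epsilon> \<and> op_norm (V - V') \<le> \<epsilon> \<and> U' * V' = V' * U')" by blast
  then show "\<exists>\<delta>>0. \<forall>n\<ge>1. \<forall>U V. real_orthogonal_mat n U \<longrightarrow> real_orthogonal_mat n V \<longrightarrow> op_norm (U * V - V * U) \<le> \<delta> \<longrightarrow>
    (\<exists>U' V'. real_orthogonal_mat n U' \<and> real_orthogonal_mat n V' \<and> op_norm (U - U') \<le> \<epsilon> \<and> op_norm (V - V') \<le> \<epsilon> \<and> U' * V' = V' * U')"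
    by (intro exI[of _ \<delta>]) (simp add: real_orthogonal_iff)
next
  fix \<epsilon> :: real assume "\<epsilon> > 0"
  from uniform_commuting[OF this, of True] obtain \<delta> where "\<delta> > 0"
    "\<forall>m U V. inv_unitary True m U \<longrightarrow> inv_unitary True m V \<longrightarrow> op_norm (U * V - V * U) \<le> \<delta> \<longrightarrow>
    (\<exists>U' V'. inv_unitary True m U' \<and> inv_unitary True m V' \<and> op_norm (U - U') \<le> \<epsilon> \<and> op_norm (V - V') \<le> \<epsilon> \<and> U' * V' = V' * U')" by blast
  then show "\<exists>\<delta>>0. \<forall>n\<ge>1. \<forall>U V. symplectic_unitary_mat n U \<longrightarrow> symplectic_unitary_mat n V \<longrightarrow> op_norm (U * V - V * U) \<le> \<delta> \<longrightarrow>
    (\<exists>U' V'. symplectic_unitary_mat n U' \<and> symplectic_unitary_mat n V' \<and> op_norm (U - U') \<le> \<epsilon> \<and> op_norm (V - V') \<le> \<epsilon> \<and> U' * V' = V' * U')"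
    by (intro exI[of _ \<delta>]) (simp add: symplectic_unitary_iff)
qed

end
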